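(* Let the environment $(P_1,P_2,\ldots)$ of the first generation be given by $P_r=W_1W_2\cdots W_{r-1}(1-W_r)$, $r\in\mathbb{N}$, where $W_1,W_2,\ldots$ are independent copies of a random variable $W$ taking values in $(0,1)$. Assume that the distribution of $|\log W|$ is nonlattice, that $\sigma^2:={\rm Var}(\log W)\in(0,\infty)$ and that $\mathbb{E}|\log(1-W)|<\infty$. Let $(j_n)_{n\in\mathbb{N}}$ be a sequence of positive numbers satisfying $j_n\to\infty$ and $j_n=o((\log n)^{1/3})$ as $n\to\infty$. Then, as $n\to\infty$, the processes $$\Bigg(\frac{\lfloor j_n\rfloor^{1/2}(\lfloor j_n u\rfloor-1)!\,\big(K_n(\lfloor j_n u\rfloor)-(\mu^{-1}\log n)^{\lfloor j_n u\rfloor}/\lfloor j_n u\rfloor!\big)}{\big(\sigma^2\mu^{-2\lfloor j_n u\rfloor-1}(\log n)^{2\lfloor j_n u\rfloor-1}\big)^{1/2}}\Bigg)_{u>0}$$ converge, in the sense of weak convergence of finite-dimensional distributions, to $$\Bigg(\int_{[0,\infty)}e^{-uy}\,{\rm d}B(y)\Bigg)_{u>0},$$ where $(B(v))_{v\ge0}$ is a standard Brownian motion and $\mu:=\mathbb{E}|\log W|<\infty$.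
   Context: Nested occupancy scheme. Let $\mathbb{V}=\bigcup_{k\ge 0}\mathbb{N}^k$ (with $\mathbb{N}^0=\{\varnothing\}$); for $v\in\mathbb{N}^k$ write $|v|=k$ (generation $k$), and for $v=v_1\ldots v_k$ and $r\in\mathbb{N}$ write $vr=v_1\ldots v_k r$. Let $(P_r)_{r\in\mathbb{N}}$ be a random sequence of positive numbers with $\sum_{r\ge1}P_r=1$ a.s. and let $((P_r(v))_{r\in\mathbb{N}})_{v\in\mathbb{V}}$ be independent copies of $(P_r)_{r\in\mathbb{N}}$. Define weights by $P(\varnothing)=1$ and $P(vr)=P(v)P_r(v)$; then $\sum_{|v|=j}P(v)=1$ a.s. for each $j\in\mathbb{N}$. Individuals $v\in\mathbb{V}$ are identified with boxes. There are $n$ balls, all in box $\varnothing$ at time $0$. Given all the weights, each ball located in a box $v$ of generation $k$ is placed, independently of the other balls, into the box $vr$ of generation $k+1$ with probability $P_r(v)=P(vr)/P(v)$. $K_n(j)$ denotes the number of boxes in generation $j$ that contain at least one of the $n$ balls. A distribution is nonlattice if it is not concentrated on $\delta\mathbb{Z}$ for any $\delta>0$. $\lfloor x\rfloor$ is the floor function. For each fixed $u>0$ the quantities above are well defined for all sufficiently large $n$ (when $\lfloor j_nu\rfloor\ge1$), which suffices for convergence of finite-dimensional distributions (joint convergence in distribution of the values at any finitely many points $u_1,\ldots,u_\ell>0$). The limit process is defined via integration by parts: $\int_{[0,\infty)}e^{-uy}\,{\rm d}B(y)=u\int_0^\infty e^{-uy}B(y)\,{\rm d}y$ for $u>0$.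 *)

theory Defs
  imports "HOL-Probability.Probability" "HOL-Library.Landau_Symbols"
begin

text \<open>
  Boxes are finite words over the naturals: \<^term>\<open>[]\<close> is the root, the generation of \<open>v\<close> is
  \<^term>\<open>length v\<close>, and the children of \<open>v\<close> are the words \<^term>\<open>v @ [r]\<close>. Letters and sequence
  indices start at 0 instead of 1.
\<close>

text \<open>
  The nested occupancy scheme with \<open>n\<close> balls. \<open>env\<close> is the law of the random sequence
  \<open>(P\<^sub>r)\<close>, \<open>A v r\<close> is \<open>P\<^sub>r(v) = P(vr) / P(v)\<close>, and \<open>X i k\<close> is the box of generation \<open>k\<close> that
  contains ball \<open>i\<close> (for \<open>i < n\<close>). The last assumption is the placement rule: given all weights
  and the positions of all balls up to generation \<open>k\<close>, the balls move independently of each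
  other, and ball \<open>i\<close> moves from its current box \<open>v\<close> to \<open>v @ [r]\<close> with probability \<open>A v r\<close>.
\<close>

locale nested_occupancy_scheme = prob_space M for M :: "'a measure" +
  fixes env :: "(nat \<Rightarrow> real) measure"
    and n :: nat
    and A :: "nat list \<Rightarrow> nat \<Rightarrow> 'a \<Rightarrow> real"
    and X :: "nat \<Rightarrow> nat \<Rightarrow> 'a \<Rightarrow> nat list"
  assumes weights_indep:
      "indep_vars (\<lambda>_. Pi\<^sub>M UNIV (\<lambda>_. borel)) (\<lambda>v \<omega> r. A v r \<omega>) UNIV"
    and weights_distr:
      "distr M (Pi\<^sub>M UNIV (\<lambda>_. borel)) (\<lambda>\<omega> r. A v r \<omega>) = env"
    and positions_measurable:
      "i < n \<Longrightarrow> X i k \<in> measurable M (count_space UNIV)"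
    and start:
      "i < n \<Longrightarrow> \<omega> \<in> space M \<Longrightarrow> X i 0 \<omega> = []"
    and placement:
      "AE \<omega> in M.
         real_cond_exp M
           (sigma (space M)
             ({A v r -` S \<inter> space M | v r S. S \<in> sets borel} \<union>
              {X i m -` S \<inter> space M | i m S. i < n \<and> m \<le> k}))
           (indicator {\<omega> \<in> space M. \<forall>i<n. X i (Suc k) \<omega> = X i k \<omega> @ [rs i]}) \<omega>
         = (\<Prod>i<n. A (X i k \<omega>) (rs i) \<omega>)"

definition occupied_boxes ::
    "nat \<Rightarrow> (nat \<Rightarrow> nat \<Rightarrow> 'a \<Rightarrow> nat list) \<Rightarrow> nat \<Rightarrow> 'a \<Rightarrow> nat" where
  "occupied_boxes n X k \<omega> = card {v. length v = k \<and> (\<exists>i<n. X i k \<omega> = v)}"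

definition stick_breaking :: "(nat \<Rightarrow> real) \<Rightarrow> nat \<Rightarrow> real" where
  "stick_breaking w r = (\<Prod>i<r. w i) * (1 - w r)"

definition nonlattice :: "real measure \<Rightarrow> bool" where
  "nonlattice D \<longleftrightarrow> (\<forall>\<delta>>0. \<not> (AE x in D. x \<in> range (\<lambda>k::int. \<delta> * of_int k)))"

locale standard_brownian_motion = prob_space M for M :: "'a measure" +
  fixes B :: "real \<Rightarrow> 'a \<Rightarrow> real"
  assumes rv: "0 \<le> t \<Longrightarrow> B t \<in> borel_measurable M"
    and start: "AE \<omega> in M. B 0 \<omega> = 0"
    and increments_indep:
      "0 \<le> s 0 \<Longrightarrow> (\<And>i. i < m \<Longrightarrow> s i \<le> s (Suc i)) \<Longrightarrow>
         indep_vars (\<lambda>_. borel) (\<lambda>i \<omega>. B (s (Suc i)) \<omega> - B (s i) \<omega>) {..<m}"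
    and increments_normal:
      "0 \<le> t \<Longrightarrow> t < t' \<Longrightarrow>
         distributed M lborel (\<lambda>\<omega>. B t' \<omega> - B t \<omega>) (normal_density 0 (sqrt (t' - t)))"
    and continuous_paths: "\<omega> \<in> space M \<Longrightarrow> continuous_on {0..} (\<lambda>t. B t \<omega>)"

text \<open>
  The integral of \<open>exp (- u y)\<close> over \<open>[0, \<infinity>)\<close> against \<open>dB(y)\<close>, defined through integration by
  parts.
\<close>

definition exp_brownian_integral :: "(real \<Rightarrow> 'a \<Rightarrow> real) \<Rightarrow> real \<Rightarrow> 'a \<Rightarrow> real" where
  "exp_brownian_integral B u \<omega> = u * (LINT y:{0..}|lborel. exp (- u * y) * B y \<omega>)"

text \<open>
  Weak convergence of the finite-dimensional distributions of the real processes
  \<open>(Y n t)\<close>, \<open>t \<in> T\<close>, each on its own probability space \<open>M n\<close>, to the process \<open>(Z t)\<close>, \<open>t \<in> T\<close>,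
  on \<open>N\<close>. Measurability is part of the definition because the Bochner integral of a
  non-measurable function is 0.
\<close>

definition fdd_converges ::
    "(nat \<Rightarrow> 'a measure) \<Rightarrow> (nat \<Rightarrow> 'i \<Rightarrow> 'a \<Rightarrow> real) \<Rightarrow>
     'b measure \<Rightarrow> ('i \<Rightarrow> 'b \<Rightarrow> real) \<Rightarrow> 'i set \<Rightarrow> bool" where
  "fdd_converges M Y N Z T \<longleftrightarrow>
     (\<forall>n. \<forall>t\<in>T. Y n t \<in> borel_measurable (M n)) \<and>
     (\<forall>t\<in>T. Z t \<in> borel_measurable N) \<and>
     (\<forall>I f. finite I \<and> I \<subseteq> T \<and>
        continuous_map (powertop_real I) euclideanreal f \<and>
        bounded (f ` topspace (powertop_real I)) \<longrightarrow>
        (\<lambda>n. LINT \<omega>|M n. f (\<lambda>t\<in>I. Y n t \<omega>)) \<longlonglongrightarrow> (LINT \<omega>|N. f (\<lambda>t\<in>I. Z t \<omega>)))"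

end

theory Submission
 imports Defs "HOL-Real_Asymp.Real_Asymp"
begin

text \<open>
  Write \<open>T(v) = - ln P(v)\<close>. A box of generation \<open>m\<close> receives about \<open>n P(v)\<close> balls, so it is
  typically occupied exactly if \<open>T(v) \<le> t\<close>, where \<open>t = ln n\<close>; the expected number of boxes
  for which this fails is of the order of the number of boxes with \<open>T(v)\<close> within \<open>O(1)\<close> of \<open>t\<close>
 (\<open>occupied_vs_below\<close>). It therefore suffices to count the boxes with \<open>T(v) \<le> t\<close>.

 Let \<open>V k t\<close> be the expected number of boxes \<open>v\<close> of generation \<open>k\<close> with \<open>T(v) \<le> t\<close>. It is the
 distribution function of the \<open>k\<close>-th convolution power of a measure whose own distribution
 function differs from \<open>t / mu\<close> by a bounded amount. Hence \<open>V k t\<close> lies between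
 \<open>tau k (t - c k)\<close> and \<open>tau k (t + c k)\<close> with \<open>tau k t = (t / mu)^k / k!\<close>, and as
 \<open>j = o(t^(1/3))\<close> the error is negligible compared with the fluctuations. A decomposition
 of the count into orthogonal contributions of the generations shows that the part that stems
 from all generations but the first is negligible too (\<open>first_generation_dominates\<close>):
 what is left is the sum over \<open>r\<close> of \<open>V (m - 1) (t + ln P_r)\<close>.

 For stick breaking, \<open>- ln P_r\<close> is \<open>S_r + eta_r\<close>, where \<open>S\<close> is the random walk with
 steps \<open>\<bar>ln W\<bar>\<close>. The counting process of this perturbed walk at \<open>s\<close> equals
 \<open>s / mu - (S_K - mu K) / mu\<close> with \<open>K = s / mu\<close>, up to an error of order \<open>s^(1/4)\<close> in mean
 (\<open>cnt_linearization\<close>). After summation against \<open>V (m - 1)\<close> the fluctuation becomes a sum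
 of the centred steps with the deterministic weights \<open>V (m - 1) (t - mu r)\<close> (\<open>main_term\<close>).
 Divided by \<open>tau (m - 1) t\<close>, these weights are close to \<open>(1 - mu r / t)^(m - 1)\<close>, that is, to
 \<open>exp (- u x)\<close> if \<open>x = mu j r / t\<close> and \<open>m\<close> is about \<open>j u\<close>. The time scale \<open>x\<close> explains the limit:
 the rescaled walk tends to Brownian motion, and the weighted sum to the integral of
 \<open>exp (- u y)\<close> against it.

 The last passage needs no functional limit theorem. Replacing the weights by step
 functions with steps of length \<open>1 / q\<close> up to time \<open>q\<close> gives finitely many independent block
 sums, to which the central limit theorem applies (\<open>block_clt\<close>); the same replacement in the
 Brownian integral gives independent Gaussian increments. The replacement is uniformly good in
 mean as \<open>q\<close> grows (\<open>block_error_limit\<close>, \<open>gap_tendsto_0\<close>,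
 \<open>exp_brownian_integral_blocks\<close>), so the limits can be interchanged (\<open>law_tendsto_approx\<close>).
 As all bounds are in mean, the argument works jointly for finitely many \<open>u\<close>.
\<close>

section \<open>Independent pairs and orthogonal sums\<close>

text \<open>
  Independence stated as the factorization of a joint law. In this form it yields Fubini-type
  formulas at once, and it survives composition with arbitrary measurable maps.
\<close>

definition (in prob_space) indep_pair ::
  "'b measure => ('a => 'b) => 'c measure => ('a => 'c) => bool" where
 "indep_pair S X T Y \<longleftrightarrow> random_variable S X \<and> random_variable T Y \<and>
  distr M (S \<Otimes>\<^sub>M T) (%om. (X om, Y om)) = distr M S X \<Otimes>\<^sub>M distr M T Y"

lemma (in prob_space) indep_pair_compose:
 assumes ind: "indep_pair S X T Y" and f[measurable]: "f \<in> measurable S S'" and g[measurable]: "g \<in> measurable T T'"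
 shows "indep_pair S' (%om. f (X om)) T' (%om. g (Y om))"
proof -
 have X[measurable]: "random_variable S X" and Y[measurable]: "random_variable T Y"
  and eq: "distr M (S \<Otimes>\<^sub>M T) (%om. (X om, Y om)) = distr M S X \<Otimes>\<^sub>M distr M T Y"
  using ind by (auto simp: indep_pair_def)
 interpret dY: prob_space "distr M T' (%om. g (Y om))" by (rule prob_space_distr) simp
 have "distr M S' (%om. f (X om)) \<Otimes>\<^sub>M distr M T' (%om. g (Y om))
   = distr (distr M S X) S' f \<Otimes>\<^sub>M distr (distr M T Y) T' g"
  by (simp add: distr_distr comp_def)
 also have "\<dots> = distr (distr M S X \<Otimes>\<^sub>M distr M T Y) (S' \<Otimes>\<^sub>M T') (%(x, y). (f x, g y))"
  by (rule pair_measure_distr)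
   (auto simp: distr_distr comp_def dY.sigma_finite_measure_axioms)
 also have "\<dots> = distr M (S' \<Otimes>\<^sub>M T') (%om. (f (X om), g (Y om)))"
  unfolding eq[symmetric] by (subst distr_distr) (auto simp: comp_def)
 finally show ?thesis by (simp add: indep_pair_def)
qed

lemma (in prob_space) indep_vars_imp_indep_pair:
 assumes ind: "indep_vars N Z I" and A: "A \<subseteq> I" "i \<in> I" "i \<notin> A"
 shows "indep_pair (PiM A N) (%om. restrict (%j. Z j om) A) (N i) (Z i)"
proof -
 let ?X = "%om. restrict (%j. Z j om) A" and ?Y = "%om. restrict (%j. Z j om) {i}"
 have "indep_var (PiM A N) ?X (PiM {i} N) ?Y"
  using A by (intro indep_var_restrict[OF ind]) auto
 then have "indep_pair (PiM A N) ?X (PiM {i} N) ?Y"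
  by (simp add: indep_pair_def indep_var_distribution_eq)
 from indep_pair_compose[OF this, of "%x. x" "PiM A N" "%x. x i" "N i"]
 show ?thesis by simp
qed

lemma (in prob_space) indep_pair_nn_integral:
 assumes ind: "indep_pair S X T Y" and f: "f \<in> borel_measurable (S \<Otimes>\<^sub>M T)"
 shows "(\<integral>\<^sup>+om. f (X om, Y om) \<partial>M) = (\<integral>\<^sup>+om. (\<integral>\<^sup>+om'. f (X om, Y om') \<partial>M) \<partial>M)"
proof -
 have X[measurable]: "random_variable S X" and Y[measurable]: "random_variable T Y"
  using ind by (auto simp: indep_pair_def)
 note f[measurable]
 interpret dY: prob_space "distr M T Y" by (rule prob_space_distr) fact
 have f': "f \<in> borel_measurable (distr M S X \<Otimes>\<^sub>M distr M T Y)"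
  using f by (simp cong: measurable_cong_sets)
 have "(\<integral>\<^sup>+om. f (X om, Y om) \<partial>M) = (\<integral>\<^sup>+p. f p \<partial>distr M (S \<Otimes>\<^sub>M T) (%x. (X x, Y x)))"
  by (subst nn_integral_distr) auto
 also have "\<dots> = (\<integral>\<^sup>+p. f p \<partial>(distr M S X \<Otimes>\<^sub>M distr M T Y))"
  using ind unfolding indep_pair_def by simp
 also have "\<dots> = (\<integral>\<^sup>+x. \<integral>\<^sup>+y. f (x, y) \<partial>distr M T Y \<partial>distr M S X)"
  using dY.nn_integral_fst[OF f'] by simp
 also have "\<dots> = (\<integral>\<^sup>+x. \<integral>\<^sup>+om'. f (x, Y om') \<partial>M \<partial>distr M S X)"
  by (intro nn_integral_cong) (subst nn_integral_distr, auto)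
 also have "\<dots> = (\<integral>\<^sup>+om. (\<integral>\<^sup>+om'. f (X om, Y om') \<partial>M) \<partial>M)"
  by (subst nn_integral_distr) auto
 finally show ?thesis .
qed

lemma (in prob_space) indep_pair_expectation_zero:
 fixes f :: "'b \<times> 'c => real"
 assumes ind: "indep_pair S X T Y" and f: "f \<in> borel_measurable (S \<Otimes>\<^sub>M T)"
  and int: "integrable M (%om. f (X om, Y om))"
  and zero: "!!x. x \<in> space S ==> (\<integral>om'. f (x, Y om') \<partial>M) = 0"
 shows "(\<integral>om. f (X om, Y om) \<partial>M) = 0"
proof -
 have X[measurable]: "random_variable S X" and Y[measurable]: "random_variable T Y"
  using ind by (auto simp: indep_pair_def)
 note f[measurable]
 interpret dY: prob_space "distr M T Y" by (rule prob_space_distr) fact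
 interpret dX: prob_space "distr M S X" by (rule prob_space_distr) fact
 interpret PP: pair_prob_space "distr M S X" "distr M T Y" ..
 have eq: "distr M (S \<Otimes>\<^sub>M T) (%x. (X x, Y x)) = distr M S X \<Otimes>\<^sub>M distr M T Y"
  using ind unfolding indep_pair_def by simp
 have "integrable (distr M (S \<Otimes>\<^sub>M T) (%x. (X x, Y x))) f"
  using int by (subst integrable_distr_eq) auto
 then have i2: "integrable (distr M S X \<Otimes>\<^sub>M distr M T Y) f" by (simp add: eq)
 have "(\<integral>om. f (X om, Y om) \<partial>M) = (\<integral>p. f p \<partial>distr M (S \<Otimes>\<^sub>M T) (%x. (X x, Y x)))"
  by (subst integral_distr) auto
 also have "\<dots> = (\<integral>x. \<integral>y. f (x, y) \<partial>distr M T Y \<partial>distr M S X)"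
  unfolding eq using PP.integral_fst'[OF i2] by simp
 also have "\<dots> = (\<integral>x. 0 \<partial>distr M S X)"
 proof (rule Bochner_Integration.integral_cong[OF refl])
  fix x assume "x \<in> space (distr M S X)"
  then have x: "x \<in> space S" by simp
  have "(\<integral>y. f (x, y) \<partial>distr M T Y) = (\<integral>om'. f (x, Y om') \<partial>M)"
   using x by (subst integral_distr) auto
  with zero[OF x] show "(\<integral>y. f (x, y) \<partial>distr M T Y) = 0" by simp
 qed
 finally show ?thesis by simp
qed

lemma abs_mult_le_sum_squares: "norm (a * b) \<le> norm (a\<^sup>2 + b\<^sup>2)" for a b :: real
proof -
 have "2 * \<bar>a\<bar> * \<bar>b\<bar> \<le> a\<^sup>2 + b\<^sup>2" using sum_squares_bound[of "\<bar>a\<bar>" "\<bar>b\<bar>"] by simp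
 moreover have "0 \<le> \<bar>a\<bar> * \<bar>b\<bar>" by (rule mult_nonneg_nonneg) auto
 ultimately have "\<bar>a * b\<bar> \<le> a\<^sup>2 + b\<^sup>2" unfolding abs_mult by linarith
 then show ?thesis by simp
qed

text \<open>
  Finite partial sums satisfy the Pythagorean identity; Fatou's lemma passes to the limit. Only an
  inequality survives, which suffices for upper bounds and avoids convergence in \<open>L2\<close>.
\<close>

lemma (in prob_space) orthogonal_sums_L2:
 fixes \<phi> :: "nat => 'a => real"
 assumes [measurable]: "!!r. random_variable borel (\<phi> r)"
  and sq: "!!r. integrable M (%om. (\<phi> r om)\<^sup>2)"
  and orth: "!!r s. r < s ==> expectation (%om. \<phi> r om * \<phi> s om) = 0"
  and L: "AE om in M. (%r. \<phi> r om) sums L om"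
 shows "(\<integral>\<^sup>+om. ennreal ((L om)\<^sup>2) \<partial>M) \<le> (\<Sum>r. \<integral>\<^sup>+om. ennreal ((\<phi> r om)\<^sup>2) \<partial>M)"
proof -
 have pint: "integrable M (%om. \<phi> r om * \<phi> s om)" for r s
 proof (rule Bochner_Integration.integrable_bound[OF Bochner_Integration.integrable_add[OF sq[of r] sq[of s]]])
  show "AE om in M. norm (\<phi> r om * \<phi> s om) \<le> norm ((\<phi> r om)\<^sup>2 + (\<phi> s om)\<^sup>2)"
   by (rule AE_I2) (rule abs_mult_le_sum_squares)
 qed simp
 have part: "(\<integral>\<^sup>+om. ennreal ((\<Sum>r<k. \<phi> r om)\<^sup>2) \<partial>M) = (\<Sum>r<k. \<integral>\<^sup>+om. ennreal ((\<phi> r om)\<^sup>2) \<partial>M)" for k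
 proof -
  have "(\<Sum>r<k. \<phi> r om)\<^sup>2 = (\<Sum>r<k. \<Sum>s<k. \<phi> r om * \<phi> s om)" for om
   by (simp add: power2_eq_square sum_product)
  then have "expectation (%om. (\<Sum>r<k. \<phi> r om)\<^sup>2) = (\<Sum>r<k. \<Sum>s<k. expectation (%om. \<phi> r om * \<phi> s om))"
   by (simp add: Bochner_Integration.integral_sum pint Bochner_Integration.integrable_sum)
  also have "\<dots> = (\<Sum>r<k. \<Sum>s<k. if s = r then expectation (%om. (\<phi> r om)\<^sup>2) else 0)"
   apply (intro sum.cong refl)
   subgoal for r s
    using orth[of r s] orth[of s r] by (cases r s rule: linorder_cases) (auto simp: power2_eq_square mult.commute)
   done
  also have "\<dots> = (\<Sum>r<k. expectation (%om. (\<phi> r om)\<^sup>2))"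
   by (intro sum.cong refl) (simp add: sum.delta)
  finally have e: "expectation (%om. (\<Sum>r<k. \<phi> r om)\<^sup>2) = (\<Sum>r<k. expectation (%om. (\<phi> r om)\<^sup>2))" .
  have i: "integrable M (%om. (\<Sum>r<k. \<phi> r om)\<^sup>2)"
   unfolding power2_eq_square sum_product by (intro Bochner_Integration.integrable_sum pint)
  have "(\<integral>\<^sup>+om. ennreal ((\<Sum>r<k. \<phi> r om)\<^sup>2) \<partial>M) = ennreal (\<Sum>r<k. expectation (%om. (\<phi> r om)\<^sup>2))"
   using i by (subst nn_integral_eq_integral) (auto simp: e)
  also have "\<dots> = (\<Sum>r<k. \<integral>\<^sup>+om. ennreal ((\<phi> r om)\<^sup>2) \<partial>M)"
   by (subst sum_ennreal[symmetric]) (auto intro!: sum.cong simp: nn_integral_eq_integral[OF sq])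
  finally show ?thesis .
 qed
 have "(\<integral>\<^sup>+om. ennreal ((L om)\<^sup>2) \<partial>M) = (\<integral>\<^sup>+om. liminf (%k. ennreal ((\<Sum>r<k. \<phi> r om)\<^sup>2)) \<partial>M)"
 proof (rule nn_integral_cong_AE, use L in eventually_elim)
  fix om assume "(%r. \<phi> r om) sums L om"
  then have "(%k. ennreal ((\<Sum>r<k. \<phi> r om)\<^sup>2)) \<longlonglongrightarrow> ennreal ((L om)\<^sup>2)"
   unfolding sums_def by (intro tendsto_ennrealI tendsto_power)
  from lim_imp_Liminf[OF _ this] show "ennreal ((L om)\<^sup>2) = liminf (%k. ennreal ((\<Sum>r<k. \<phi> r om)\<^sup>2))"
   by simp
 qed
 also have "\<dots> \<le> liminf (%k. \<integral>\<^sup>+om. ennreal ((\<Sum>r<k. \<phi> r om)\<^sup>2) \<partial>M)"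
  by (rule nn_integral_liminf) simp
 also have "\<dots> \<le> (\<Sum>r. \<integral>\<^sup>+om. ennreal ((\<phi> r om)\<^sup>2) \<partial>M)"
  unfolding part
  by (rule order_trans[OF Liminf_le_Limsup]) (auto intro!: Limsup_bounded always_eventually sum_le_suminf)
 finally show ?thesis .
qed

lemma suminf_indicator_ennreal:
 "finite A ==> (\<Sum>r. indicator A r) = (ennreal (card A))" for A :: "nat set"
 by (subst suminf_finite[of A]) (auto simp: indicator_def ennreal_of_nat_eq_real_of_nat)

text \<open>
  Used for a walk whose visits to a window are counted only after steps larger than a fixed gap:
  such visits are separated, so a window contains few of them.
\<close>

lemma separated_points_card:
 fixes S xi :: "nat => real"
 assumes S: "!!r. S (Suc r) = S r + xi r" and nn: "!!r. 0 \<le> xi r" and d: "0 < d" and x: "0 \<le> x"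
 shows "finite {r. a \<le> S r \<and> S r \<le> a + x \<and> d < xi r}"
  and "real (card {r. a \<le> S r \<and> S r \<le> a + x \<and> d < xi r}) \<le> 1 + x / d"
proof -
 let ?A = "{r. a \<le> S r \<and> S r \<le> a + x \<and> d < xi r}"
 have mono: "r \<le> s ==> S r \<le> S s" for r s
  by (rule lift_Suc_mono_le[of S]) (auto simp: S nn)
 define f where "f r = \<lfloor>(S r - a) / d\<rfloor>" for r
 have less: "f r < f s" if "r \<in> ?A" "r < s" for r s
 proof -
  have "S r + d < S s" using mono[of "Suc r" s] that by (auto simp: S)
  then have "(S r + d - a) / d \<le> (S s - a) / d" using d by (intro divide_right_mono) auto
  moreover have "(S r + d - a) / d = (S r - a) / d + 1" using d by (simp add: field_simps)
  ultimately have "(S r - a) / d + 1 \<le> (S s - a) / d" by simp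
  then have "\<lfloor>(S r - a) / d\<rfloor> + 1 \<le> \<lfloor>(S s - a) / d\<rfloor>" by linarith
  then show ?thesis by (simp add: f_def)
 qed
 have inj: "inj_on f ?A"
  by (rule inj_onI) (metis less less_irrefl linorder_neqE_nat)
 have im: "f ` ?A \<subseteq> {0..\<lfloor>x / d\<rfloor>}"
  using d by (auto simp: f_def intro!: floor_mono divide_right_mono)
 show "finite ?A" using finite_imageD[OF finite_subset[OF im] inj] by simp
 have "card ?A = card (f ` ?A)" using card_image[OF inj] by simp
 also have "\<dots> \<le> card {0..\<lfloor>x / d\<rfloor>}" by (rule card_mono[OF _ im]) simp
 finally have "card ?A \<le> nat (\<lfloor>x / d\<rfloor> + 1)" by simp
 moreover have "0 \<le> x / d" using d x by simp
 ultimately have "real (card ?A) \<le> of_int (\<lfloor>x / d\<rfloor> + 1)" by linarith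
 also have "\<dots> \<le> 1 + x / d" by simp
 finally show "real (card ?A) \<le> 1 + x / d" .
qed

section \<open>Perturbed random walks\<close>

abbreviation borel2 :: "(real \<times> real) measure" where "borel2 \<equiv> borel \<Otimes>\<^sub>M borel"

text \<open>
  The points \<open>S r + eta r\<close>, with \<open>eta r\<close> independent of \<open>S r\<close> but possibly dependent on the next
  step \<open>xi r\<close>: for stick breaking both are functions of the same factor \<open>W\<close>.
\<close>

locale perturbed_walk = prob_space M for M :: "'a measure" +
 fixes xi eta :: "nat => 'a => real"
 assumes indep: "indep_vars (%_. borel2) (%r om. (xi r om, eta r om)) UNIV"
  and ident: "distr M borel2 (%om. (xi r om, eta r om)) = distr M borel2 (%om. (xi 0 om, eta 0 om))"
  and xi_nonneg: "0 \<le> xi r om" and eta_nonneg: "0 \<le> eta r om"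
  and xi_sq_integrable: "integrable M (%om. (xi 0 om)\<^sup>2)"
  and eta_integrable: "integrable M (eta 0)"
  and xi_mean_pos: "0 < expectation (xi 0)"
begin

definition "mu = expectation (xi 0)"
definition "sq = expectation (%om. (xi 0 om)\<^sup>2)"

definition S :: "nat => 'a => real" where "S r om = (\<Sum>i<r. xi i om)"
definition T :: "nat => 'a => real" where "T r om = S r om + eta r om"

lemma mu_pos: "0 < mu" using xi_mean_pos by (simp add: mu_def)

lemma rv_pair [measurable]: "(%om. (xi r om, eta r om)) \<in> M \<rightarrow>\<^sub>M borel2"
 using indep by (auto simp: indep_vars_def)

lemma rv_xi [measurable]: "random_variable borel (xi r)"
 using measurable_compose[OF rv_pair measurable_fst, of r] by simp
lemma rv_eta [measurable]: "random_variable borel (eta r)"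
 using measurable_compose[OF rv_pair measurable_snd, of r] by simp
lemma rv_S [measurable]: "random_variable borel (S r)" unfolding S_def[abs_def] by simp
lemma rv_T [measurable]: "random_variable borel (T r)" unfolding T_def[abs_def] by simp

lemma S_0: "S 0 om = 0" by (simp add: S_def)
lemma S_Suc: "S (Suc r) om = S r om + xi r om" by (simp add: S_def)
lemma S_mono: "r \<le> s ==> S r om \<le> S s om"
 by (rule lift_Suc_mono_le[of "%r. S r om"]) (auto simp: S_Suc xi_nonneg)
lemma S_nonneg: "0 \<le> S r om" using S_mono[of 0 r om] by (simp add: S_0)
lemma T_ge_S: "S r om \<le> T r om" by (simp add: T_def eta_nonneg)

lemma xi_integrable: "integrable M (xi 0)"
 by (rule square_integrable_imp_integrable[OF _ xi_sq_integrable]) simp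

lemma nn_ident:
 assumes [measurable]: "f \<in> borel_measurable borel2"
 shows "(\<integral>\<^sup>+om. f (xi r om, eta r om) \<partial>M) = (\<integral>\<^sup>+om. f (xi 0 om, eta 0 om) \<partial>M)"
proof -
 have "(\<integral>\<^sup>+om. f (xi r om, eta r om) \<partial>M) = (\<integral>\<^sup>+z. f z \<partial>distr M borel2 (%om. (xi r om, eta r om)))"
  by (subst nn_integral_distr) auto
 also have "\<dots> = (\<integral>\<^sup>+om. f (xi 0 om, eta 0 om) \<partial>M)"
  unfolding ident[of r] by (subst nn_integral_distr) auto
 finally show ?thesis .
qed

lemma integral_ident:
 fixes f :: "real \<times> real => real"
 assumes [measurable]: "f \<in> borel_measurable borel2"
 shows "(\<integral>om. f (xi r om, eta r om) \<partial>M) = (\<integral>om. f (xi 0 om, eta 0 om) \<partial>M)"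
  and "integrable M (%om. f (xi r om, eta r om)) \<longleftrightarrow> integrable M (%om. f (xi 0 om, eta 0 om))"
proof -
 have "(\<integral>om. f (xi r om, eta r om) \<partial>M) = (\<integral>z. f z \<partial>distr M borel2 (%om. (xi r om, eta r om)))"
  by (subst integral_distr) auto
 also have "\<dots> = (\<integral>om. f (xi 0 om, eta 0 om) \<partial>M)"
  unfolding ident[of r] by (subst integral_distr) auto
 finally show "(\<integral>om. f (xi r om, eta r om) \<partial>M) = (\<integral>om. f (xi 0 om, eta 0 om) \<partial>M)" .
 have "integrable M (%om. f (xi r om, eta r om)) \<longleftrightarrow> integrable (distr M borel2 (%om. (xi r om, eta r om))) f"
  by (subst integrable_distr_eq) auto
 also have "\<dots> \<longleftrightarrow> integrable M (%om. f (xi 0 om, eta 0 om))"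
  unfolding ident[of r] by (subst integrable_distr_eq) auto
 finally show "integrable M (%om. f (xi r om, eta r om)) \<longleftrightarrow> integrable M (%om. f (xi 0 om, eta 0 om))" .
qed

lemma history_indep:
 "indep_pair (PiM {..<r} (%_. borel2)) (%om. \<lambda>i\<in>{..<r}. (xi i om, eta i om)) borel2 (%om. (xi r om, eta r om))"
 by (rule indep_vars_imp_indep_pair[OF indep]) auto

lemma S_measurable_history:
 "(%h. \<Sum>i<s. fst (h i)) \<in> borel_measurable (PiM {..<r} (%_. borel2))" if "s \<le> r" for s r :: nat
proof (rule borel_measurable_sum)
 fix i assume "i \<in> {..<s}"
 then have "i < s" by simp
 from less_le_trans[OF this that] have "i < r" .
 then have "(%h. h i) \<in> PiM {..<r} (%_. borel2) \<rightarrow>\<^sub>M borel2"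
  by (intro measurable_component_singleton) auto
 from measurable_compose[OF this measurable_fst]
 show "(%h. fst (h i)) \<in> borel_measurable (PiM {..<r} (%_. borel2))" .
qed

lemma S_indep: "indep_pair borel (S r) borel2 (%om. (xi r om, eta r om))"
 using indep_pair_compose[OF history_indep[of r] S_measurable_history[OF order_refl] measurable_id]
 by (simp add: S_def[abs_def] cong: sum.cong_simp)

lemma nn_step:
 assumes [measurable]: "f \<in> borel_measurable (borel \<Otimes>\<^sub>M borel2)"
 shows "(\<integral>\<^sup>+om. f (S r om, xi r om, eta r om) \<partial>M) = (\<integral>\<^sup>+om. \<integral>\<^sup>+om'. f (S r om, xi 0 om', eta 0 om') \<partial>M \<partial>M)"
proof -
 have "(\<integral>\<^sup>+om. f (S r om, xi r om, eta r om) \<partial>M) = (\<integral>\<^sup>+om. \<integral>\<^sup>+om'. f (S r om, xi r om', eta r om') \<partial>M \<partial>M)"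
  using indep_pair_nn_integral[OF S_indep[of r], of f] by simp
 also have "\<dots> = (\<integral>\<^sup>+om. \<integral>\<^sup>+om'. f (S r om, xi 0 om', eta 0 om') \<partial>M \<partial>M)"
  by (rule nn_integral_cong) (rule nn_ident[of "%z. f (S r om, z)" for om], measurable)
 finally show ?thesis .
qed

text \<open>
  The summands are martingale differences: given the past of the walk, the next pair of step and
  perturbation is a fresh copy, over which the summand has mean zero.
\<close>

lemma martingale_L2:
 fixes f :: "nat => real \<times> real \<times> real => real"
 assumes f[measurable]: "!!r. f r \<in> borel_measurable (borel \<Otimes>\<^sub>M borel2)"
  and zero: "!!r s. (\<integral>om. f r (s, xi 0 om, eta 0 om) \<partial>M) = 0"
  and sq: "!!r. integrable M (%om. (f r (S r om, xi r om, eta r om))\<^sup>2)"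
  and L: "AE om in M. (%r. f r (S r om, xi r om, eta r om)) sums L om"
 shows "(\<integral>\<^sup>+om. ennreal ((L om)\<^sup>2) \<partial>M) \<le> (\<Sum>r. \<integral>\<^sup>+om. ennreal ((f r (S r om, xi r om, eta r om))\<^sup>2) \<partial>M)"
proof (rule orthogonal_sums_L2[OF _ sq _ L])
 fix r s :: nat assume rs: "r < s"
 let ?g = "\<lambda>h :: nat => real \<times> real. (f r (\<Sum>i<r. fst (h i), h r), \<Sum>i<s. fst (h i))"
 let ?X = "%om. (f r (S r om, xi r om, eta r om), S s om)"
 have m: "(%h. h r) \<in> PiM {..<s} (%_. borel2) \<rightarrow>\<^sub>M borel2"
  using rs by (intro measurable_component_singleton) auto
 have g: "?g \<in> PiM {..<s} (%_. borel2) \<rightarrow>\<^sub>M borel \<Otimes>\<^sub>M borel"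
  using rs S_measurable_history[of r s] S_measurable_history[of s s] m
  by (intro measurable_Pair measurable_compose[OF _ f]) auto
 have e: "(%om. ?g (\<lambda>i\<in>{..<s}. (xi i om, eta i om))) = ?X"
 proof (rule ext)
  fix om
  have "(\<Sum>i<r. fst ((\<lambda>i\<in>{..<s}. (xi i om, eta i om)) i)) = S r om" 
   using rs unfolding S_def by (intro sum.cong) auto
  moreover have "(\<Sum>i<s. fst ((\<lambda>i\<in>{..<s}. (xi i om, eta i om)) i)) = S s om" 
   unfolding S_def by (intro sum.cong) auto
  ultimately show "?g (\<lambda>i\<in>{..<s}. (xi i om, eta i om)) = ?X om" using rs by simp
 qed
 have ip: "indep_pair (borel \<Otimes>\<^sub>M borel) ?X borel2 (%om. (xi s om, eta s om))"
  using indep_pair_compose[OF history_indep[of s] g measurable_id] unfolding e by simp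
 let ?F = "%p. fst (fst p) * f s (snd (fst p), snd p) :: real"
 have "(\<integral>om. ?F (?X om, (xi s om, eta s om)) \<partial>M) = 0"
 proof (rule indep_pair_expectation_zero[OF ip])
  show "?F \<in> borel_measurable ((borel \<Otimes>\<^sub>M borel) \<Otimes>\<^sub>M borel2)" by measurable
  show "integrable M (%om. ?F (?X om, (xi s om, eta s om)))"
   using Bochner_Integration.integrable_bound[OF Bochner_Integration.integrable_add[OF sq[of r] sq[of s]],
     of "%om. f r (S r om, xi r om, eta r om) * f s (S s om, xi s om, eta s om)"]
   by (simp add: abs_mult_le_sum_squares[simplified])
  fix x :: "real \<times> real"
  have "(\<integral>om. f s (snd x, xi s om, eta s om) \<partial>M) = 0"
   by (subst integral_ident(1)[of "%z. f s (snd x, z)"]) (simp_all add: zero)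
  then show "(\<integral>om. ?F (x, (xi s om, eta s om)) \<partial>M) = 0" by (simp add: split_beta)
 qed
 then show "(\<integral>om. f r (S r om, xi r om, eta r om) * f s (S s om, xi s om, eta s om) \<partial>M) = 0" by simp
qed simp

end

section \<open>Visits of the walk to windows and half-lines\<close>

context perturbed_walk begin

lemma xi_exceeds: "\<exists>d>0. 0 < prob {om\<in>space M. d < xi 0 om}"
proof (rule ccontr)
 assume "\<not> ?thesis"
 then have z: "prob {om\<in>space M. d < xi 0 om} = 0" if "d > 0" for d
  using that by (metis less_eq_real_def measure_nonneg)
 have "AE om in M. \<not> 1 / real (Suc n) < xi 0 om" for n
  using z[of "1 / real (Suc n)"] by (subst AE_iff_measurable[OF _ refl]) (auto simp: emeasure_eq_measure)
 then have "AE om in M. \<forall>n. \<not> 1 / real (Suc n) < xi 0 om" by (simp add: AE_all_countable)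
 then have "AE om in M. xi 0 om = 0"
 proof eventually_elim
  case (elim om)
  have "\<not> 0 < xi 0 om"
  proof
   assume "0 < xi 0 om"
   from reals_Archimedean[OF this] obtain n where "inverse (real (Suc n)) < xi 0 om" by blast
   with elim show False unfolding inverse_eq_divide by blast
  qed
  with xi_nonneg[of 0 om] show ?case by linarith
 qed
 then have "expectation (xi 0) = 0" by (rule integral_eq_zero_AE)
 then show False using xi_mean_pos by simp
qed

definition "gap = (SOME d. d > 0 \<and> 0 < prob {om\<in>space M. d < xi 0 om})"
definition "gap_prob = prob {om\<in>space M. gap < xi 0 om}"
definition "visit_const = (1 + 1 / gap) / gap_prob"

lemma gap_pos: "0 < gap" and gap_prob_pos: "0 < gap_prob"
 using someI_ex[OF xi_exceeds] unfolding gap_def gap_prob_def by auto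

lemma visit_const_nonneg: "0 \<le> visit_const"
 using gap_pos gap_prob_pos by (simp add: visit_const_def)

text \<open>
  Steps larger than \<open>gap\<close> separate the walk, so only boundedly many of them start in a window of given length.
\<close>

lemma gap_visits:
 assumes "0 \<le> x"
 shows "(\<Sum>r. indicator {a..a+x} (S r om) * indicator {gap<..} (xi r om)) \<le> ennreal (1 + x / gap)"
proof -
 note sp = separated_points_card[of "%r. S r om" "%r. xi r om", OF S_Suc xi_nonneg gap_pos assms, of a]
 have "(\<Sum>r. indicator {a..a+x} (S r om) * indicator {gap<..} (xi r om) :: ennreal)
   = (\<Sum>r. indicator {r. a \<le> S r om \<and> S r om \<le> a + x \<and> gap < xi r om} r)"
  by (intro suminf_cong) (auto simp: indicator_def)
 also have "\<dots> = ennreal (card {r. a \<le> S r om \<and> S r om \<le> a + x \<and> gap < xi r om})"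
  by (rule suminf_indicator_ennreal[OF sp(1)])
 also have "\<dots> \<le> ennreal (1 + x / gap)" by (rule ennreal_leI[OF sp(2)])
 finally show ?thesis .
qed

text \<open>
  Each visit is followed by a step larger than \<open>gap\<close> with probability \<open>gap_prob\<close>, independently
  of the past. Counting only those visits loses this factor, and they are bounded surely. This gives
  a bound uniform in the position of the window without any renewal theorem.
\<close>

lemma expected_visits:
 assumes x: "0 \<le> x"
 shows "(\<integral>\<^sup>+om. (\<Sum>r. indicator {a..a+x} (S r om)) \<partial>M) \<le> ennreal (visit_const * (1 + x))"
proof -
 let ?E = "\<integral>\<^sup>+om. (\<Sum>r. indicator {a..a+x} (S r om)) \<partial>M"
 have p: "(\<integral>\<^sup>+om'. indicator {gap<..} (xi 0 om') \<partial>M) = ennreal gap_prob"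
 proof -
  have "(\<integral>\<^sup>+om'. indicator {gap<..} (xi 0 om') \<partial>M) = (\<integral>\<^sup>+om'. indicator {om\<in>space M. gap < xi 0 om} om' \<partial>M)"
   by (intro nn_integral_cong) (auto simp: indicator_def)
  then show ?thesis by (simp add: gap_prob_def emeasure_eq_measure)
 qed
 have "ennreal gap_prob * ?E = (\<Sum>r. \<integral>\<^sup>+om. ennreal gap_prob * indicator {a..a+x} (S r om) \<partial>M)"
  by (simp add: nn_integral_suminf nn_integral_cmult)
 also have "\<dots> = (\<Sum>r. \<integral>\<^sup>+om. (indicator {a..a+x} (S r om) * indicator {gap<..} (xi r om)) \<partial>M)"
 proof (rule suminf_cong)
  fix r
  have "(\<integral>\<^sup>+om. indicator {a..a+x} (S r om) * indicator {gap<..} (xi r om) \<partial>M)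
   = (\<integral>\<^sup>+om. \<integral>\<^sup>+om'. indicator {a..a+x} (S r om) * indicator {gap<..} (xi 0 om') \<partial>M \<partial>M)"
   using nn_step[of "%(s, x', e). indicator {a..a+x} s * indicator {gap<..} x'" r] by simp
  also have "\<dots> = (\<integral>\<^sup>+om. ennreal gap_prob * indicator {a..a+x} (S r om) \<partial>M)"
  proof (rule nn_integral_cong)
   fix om
   have "(\<integral>\<^sup>+om'. indicator {a..a+x} (S r om) * indicator {gap<..} (xi 0 om') \<partial>M)
    = indicator {a..a+x} (S r om) * (\<integral>\<^sup>+om'. indicator {gap<..} (xi 0 om') \<partial>M)"
    by (rule nn_integral_cmult) measurable
   then show "(\<integral>\<^sup>+om'. indicator {a..a+x} (S r om) * indicator {gap<..} (xi 0 om') \<partial>M)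
    = ennreal gap_prob * indicator {a..a+x} (S r om)" by (simp add: p mult.commute)
  qed
  finally show "(\<integral>\<^sup>+om. ennreal gap_prob * indicator {a..a+x} (S r om) \<partial>M)
   = (\<integral>\<^sup>+om. indicator {a..a+x} (S r om) * indicator {gap<..} (xi r om) \<partial>M)" by simp
 qed
 also have "\<dots> = (\<integral>\<^sup>+om. (\<Sum>r. indicator {a..a+x} (S r om) * indicator {gap<..} (xi r om)) \<partial>M)"
  by (simp add: nn_integral_suminf)
 also have "\<dots> \<le> (\<integral>\<^sup>+om. ennreal (1 + x / gap) \<partial>M)"
  by (intro nn_integral_mono gap_visits x)
 also have "\<dots> = ennreal (1 + x / gap)" by (simp add: emeasure_space_1)
 finally have *: "ennreal gap_prob * ?E \<le> ennreal (1 + x / gap)" .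
 have "?E = ennreal (1 / gap_prob) * (ennreal gap_prob * ?E)"
  using gap_prob_pos by (simp add: mult.assoc[symmetric] ennreal_mult[symmetric])
 also have "\<dots> \<le> ennreal (1 / gap_prob) * ennreal (1 + x / gap)"
  by (intro mult_left_mono *) auto
 also have "\<dots> = ennreal (1 / gap_prob * (1 + x / gap))"
  using gap_prob_pos x gap_pos by (intro ennreal_mult[symmetric]) auto
 also have "\<dots> \<le> ennreal (visit_const * (1 + x))"
 proof (rule ennreal_leI)
  have "1 + x / gap \<le> (1 + 1 / gap) * (1 + x)" using x gap_pos by (simp add: field_simps)
  then show "1 / gap_prob * (1 + x / gap) \<le> visit_const * (1 + x)"
   using gap_prob_pos by (simp add: visit_const_def divide_right_mono)
 qed
 finally show ?thesis .
qed

text \<open>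
  The window depends on the step and the perturbation of the same index only. These are independent of the
  position, so conditioning on them reduces to a fixed window.
\<close>

lemma expected_weighted_visits:
 fixes w y b :: "real \<times> real => real"
 assumes [measurable]: "w \<in> borel_measurable borel2" "y \<in> borel_measurable borel2" "b \<in> borel_measurable borel2"
  and w: "!!z. 0 \<le> w z" and y: "!!om. 0 \<le> y (xi 0 om, eta 0 om)"
 shows "(\<integral>\<^sup>+om. (\<Sum>r. if b (xi r om, eta r om) \<le> S r om \<and> S r om \<le> b (xi r om, eta r om) + y (xi r om, eta r om) then ennreal (w (xi r om, eta r om)) else 0) \<partial>M)
  \<le> (\<integral>\<^sup>+om. ennreal (w (xi 0 om, eta 0 om) * (visit_const * (1 + y (xi 0 om, eta 0 om)))) \<partial>M)"
proof -
 interpret PP: pair_prob_space M M ..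
 let ?f = "%(s, z). if b z \<le> s \<and> s \<le> b z + y z then ennreal (w z) else 0"
 have [measurable]: "?f \<in> borel_measurable (borel \<Otimes>\<^sub>M borel2)" by measurable
 have "(\<integral>\<^sup>+om. (\<Sum>r. if b (xi r om, eta r om) \<le> S r om \<and> S r om \<le> b (xi r om, eta r om) + y (xi r om, eta r om) then ennreal (w (xi r om, eta r om)) else 0) \<partial>M)
  = (\<Sum>r. \<integral>\<^sup>+om. ?f (S r om, xi r om, eta r om) \<partial>M)"
  by (subst nn_integral_suminf) (auto simp: split_beta)
 also have "\<dots> = (\<Sum>r. \<integral>\<^sup>+om. \<integral>\<^sup>+om'. ?f (S r om, xi 0 om', eta 0 om') \<partial>M \<partial>M)"
  by (intro suminf_cong nn_step) measurable
 also have "\<dots> = (\<Sum>r. \<integral>\<^sup>+om'. \<integral>\<^sup>+om. ?f (S r om, xi 0 om', eta 0 om') \<partial>M \<partial>M)"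
  by (intro suminf_cong PP.Fubini') measurable
 also have "\<dots> = (\<integral>\<^sup>+om'. \<integral>\<^sup>+om. (\<Sum>r. ?f (S r om, xi 0 om', eta 0 om')) \<partial>M \<partial>M)"
  by (simp add: nn_integral_suminf[symmetric] split_beta)
 also have "\<dots> = (\<integral>\<^sup>+om'. ennreal (w (xi 0 om', eta 0 om')) *
   (\<integral>\<^sup>+om. (\<Sum>r. indicator {b (xi 0 om', eta 0 om')..b (xi 0 om', eta 0 om') + y (xi 0 om', eta 0 om')} (S r om)) \<partial>M) \<partial>M)"
 proof (rule nn_integral_cong)
  fix om'
  let ?y = "y (xi 0 om', eta 0 om')" and ?b = "b (xi 0 om', eta 0 om')" and ?w = "w (xi 0 om', eta 0 om')"
  have "(\<Sum>r. ?f (S r om, xi 0 om', eta 0 om')) = ennreal ?w * (\<Sum>r. indicator {?b..?b + ?y} (S r om))" for om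
   unfolding ennreal_suminf_cmult[symmetric] by (intro suminf_cong) (auto simp: indicator_def)
  then show "(\<integral>\<^sup>+om. (\<Sum>r. ?f (S r om, xi 0 om', eta 0 om')) \<partial>M)
    = ennreal ?w * (\<integral>\<^sup>+om. (\<Sum>r. indicator {?b..?b + ?y} (S r om)) \<partial>M)"
   by (simp only:) (rule nn_integral_cmult, measurable)
 qed
 also have "\<dots> \<le> (\<integral>\<^sup>+om. ennreal (w (xi 0 om, eta 0 om)) * ennreal (visit_const * (1 + y (xi 0 om, eta 0 om))) \<partial>M)"
  by (intro nn_integral_mono mult_left_mono expected_visits y) auto
 also have "\<dots> = (\<integral>\<^sup>+om. ennreal (w (xi 0 om, eta 0 om) * (visit_const * (1 + y (xi 0 om, eta 0 om)))) \<partial>M)"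
  using y w visit_const_nonneg by (intro nn_integral_cong ennreal_mult[symmetric]) auto
 finally show ?thesis .
qed

definition nu :: "real => 'a => nat" where "nu t om = card {r. S r om \<le> t}"
definition cnt :: "real => 'a => nat" where "cnt t om = card {r. T r om \<le> t}"
definition late :: "real => 'a => nat" where "late t om = card {r. S r om \<le> t \<and> t < T r om}"

lemma AE_finite_nu: "AE om in M. finite {r. S r om \<le> t}"
proof -
 let ?t = "max 0 t"
 have "(\<integral>\<^sup>+om. (\<Sum>r. indicator {0..0+?t} (S r om)) \<partial>M) \<noteq> \<infinity>"
  using expected_visits[of ?t 0] by (metis ennreal_less_top infinity_ennreal_def linorder_not_less max.cobounded1)
 then have "AE om in M. (\<Sum>r. indicator {0..0+?t} (S r om) :: ennreal) \<noteq> \<infinity>"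
  by (intro nn_integral_PInf_AE) auto
 then show ?thesis
 proof eventually_elim
  case (elim om)
  show ?case
  proof (rule ccontr)
   assume inf: "infinite {r. S r om \<le> t}"
   have all: "S r om \<le> t" for r
   proof -
    obtain s where "s \<ge> r" "S s om \<le> t" using inf by (auto simp: infinite_nat_iff_unbounded_le)
    then show ?thesis using S_mono[of r s om] by simp
   qed
   then have "(\<Sum>r. indicator {0..0+?t} (S r om) :: ennreal) = (\<Sum>r. 1)"
    by (intro suminf_cong) (auto simp: indicator_def S_nonneg intro: le_max_iff_disj[THEN iffD2])
   also have "\<dots> = \<infinity>"
   proof -
    have "of_nat n \<le> (\<Sum>r::nat. 1 :: ennreal)" for n
     using sum_le_suminf[of "\<lambda>_::nat. 1::ennreal" "{..<n}"] by simp
    then show ?thesis by (metis ennreal_Ex_less_of_nat infinity_ennreal_def linorder_not_less order_le_less top.not_eq_extremum)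
   qed
   finally show False using elim by simp
  qed
 qed
qed

lemma nu_props:
 assumes fin: "finite {r. S r om \<le> t}" and t: "0 \<le> t"
 shows "{r. S r om \<le> t} = {..<nu t om}" "0 < nu t om" "t < S (nu t om) om"
  "S (nu t om - 1) om \<le> t" "nu t om = cnt t om + late t om"
proof -
 have dc: "s \<in> {r. S r om \<le> t}" if "r \<in> {r. S r om \<le> t}" "s \<le> r" for r s
  using that S_mono[of s r om] by auto
 obtain m where m: "m \<notin> {r. S r om \<le> t}" using fin ex_new_if_finite infinite_UNIV_nat by blast
 define k where "k = (LEAST m. m \<notin> {r. S r om \<le> t})"
 have k: "k \<notin> {r. S r om \<le> t}" unfolding k_def by (rule LeastI) (rule m)
 have eq: "{r. S r om \<le> t} = {..<k}"
 proof
  show "{r. S r om \<le> t} \<subseteq> {..<k}" using dc k by (meson lessThan_iff not_less subsetI)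
  show "{..<k} \<subseteq> {r. S r om \<le> t}" unfolding k_def using not_less_Least by blast
 qed
 then have nk: "nu t om = k" by (simp add: nu_def)
 show 1: "{r. S r om \<le> t} = {..<nu t om}" using eq nk by simp
 have "0 \<in> {r. S r om \<le> t}" using t by (simp add: S_0)
 then show p: "0 < nu t om" using 1 by auto
 show "t < S (nu t om) om" using k nk by auto
 have "nu t om - 1 \<in> {..<nu t om}" using p by simp
 then show "S (nu t om - 1) om \<le> t" unfolding 1[symmetric] by simp
 have "{r. S r om \<le> t} = {r. T r om \<le> t} \<union> {r. S r om \<le> t \<and> t < T r om}"
  using T_ge_S[of _ om] by (auto simp: not_less intro: order_trans)
 then show "nu t om = cnt t om + late t om"
  unfolding nu_def cnt_def late_def using fin by (auto intro!: card_Un_disjoint)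
qed

lemma ennreal_nu: "finite {r. S r om \<le> t} ==> (\<Sum>r. indicator {..t} (S r om)) = ennreal (nu t om)"
 unfolding nu_def by (subst suminf_indicator_ennreal[symmetric]) (auto intro!: arg_cong[where f=suminf] simp: indicator_def)

lemma ennreal_cnt:
 assumes "finite {r. S r om \<le> t}" shows "(\<Sum>r. indicator {..t} (T r om)) = ennreal (cnt t om)"
proof -
 have "finite {r. T r om \<le> t}"
  by (rule finite_subset[OF _ assms]) (use T_ge_S[of _ om] in \<open>auto intro: order_trans\<close>)
 then show ?thesis
  unfolding cnt_def by (subst suminf_indicator_ennreal[symmetric]) (auto intro!: arg_cong[where f=suminf] simp: indicator_def)
qed

lemma ennreal_late:
 assumes "finite {r. S r om \<le> t}"
 shows "(\<Sum>r. if S r om \<le> t \<and> t < T r om then 1 else 0) = ennreal (late t om)"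
proof -
 have "finite {r. S r om \<le> t \<and> t < T r om}" by (rule finite_subset[OF _ assms]) auto
 then show ?thesis
  unfolding late_def by (subst suminf_indicator_ennreal[symmetric]) (auto intro!: arg_cong[where f=suminf] simp: indicator_def)
qed

lemma rv_nu [measurable]: "(%om. real (nu t om)) \<in> borel_measurable M"
 unfolding nu_def by measurable
lemma rv_cnt [measurable]: "(%om. real (cnt t om)) \<in> borel_measurable M"
 unfolding cnt_def by measurable
lemma rv_late [measurable]: "(%om. real (late t om)) \<in> borel_measurable M"
 unfolding late_def by measurable

end

section \<open>First and second moments of the counting process\<close>

lemma integrable_realI:
 assumes "f \<in> borel_measurable M" "!!x. 0 \<le> f x" "(\<integral>\<^sup>+x. ennreal (f x) \<partial>M) \<le> ennreal C" "0 \<le> C"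
 shows "integrable M f" "integral\<^sup>L M f \<le> (C::real)"
proof -
 have lt: "(\<integral>\<^sup>+x. ennreal (f x) \<partial>M) < \<infinity>"
  using assms(3) by (rule le_less_trans) simp
 show i: "integrable M f"
  using assms lt by (intro integrableI_nonneg) auto
 show "integral\<^sup>L M f \<le> C"
  using assms nn_integral_eq_integral[OF i] by (simp add: assms)
qed

context perturbed_walk begin

lemma rv_nu_count [measurable]: "nu t \<in> M \<rightarrow>\<^sub>M count_space UNIV"
 unfolding nu_def[abs_def] by measurable

lemma rv_S_nu [measurable]: "(%om. S (nu t om) om) \<in> borel_measurable M"
 by (rule measurable_compose_countable[of S, OF rv_S rv_nu_count])

lemma nu_nn_crude:
 assumes t: "0 \<le> t" shows "(\<integral>\<^sup>+om. ennreal (nu t om) \<partial>M) \<le> ennreal (visit_const * (1 + t))"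
proof -
 have "(\<integral>\<^sup>+om. ennreal (nu t om) \<partial>M) = (\<integral>\<^sup>+om. (\<Sum>r. indicator {0..0+t} (S r om)) \<partial>M)"
 proof (rule nn_integral_cong_AE, use AE_finite_nu[of t] in eventually_elim)
  case (elim om)
  have "(\<Sum>r. indicator {0..0+t} (S r om) :: ennreal) = (\<Sum>r. indicator {..t} (S r om))"
   by (intro suminf_cong) (auto simp: indicator_def S_nonneg)
  then show ?case using ennreal_nu[OF elim] by simp
 qed
 also have "\<dots> \<le> ennreal (visit_const * (1 + t))" by (rule expected_visits[OF t])
 finally show ?thesis .
qed

lemma nu_integrable: "0 \<le> t ==> integrable M (%om. real (nu t om))"
 and nu_mean_crude: "0 \<le> t ==> expectation (%om. real (nu t om)) \<le> visit_const * (1 + t)"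
 using integrable_realI[OF rv_nu _ nu_nn_crude[of t]] visit_const_nonneg by auto

lemma suminf_nu:
 fixes g :: "nat => real"
 assumes fin: "finite {r. S r om \<le> t}" and t: "0 \<le> t" and g: "!!r. 0 \<le> g r"
 shows "(\<Sum>r. if S r om \<le> t then ennreal (g r) else 0) = ennreal (\<Sum>r<nu t om. g r)"
proof -
 have iff: "S r om \<le> t \<longleftrightarrow> r \<in> {..<nu t om}" for r
  using nu_props(1)[OF fin t] by blast
 have "(\<Sum>r. if S r om \<le> t then ennreal (g r) else 0) = (\<Sum>r\<in>{..<nu t om}. if S r om \<le> t then ennreal (g r) else 0)"
  by (rule suminf_finite) (auto simp: iff)
 also have "\<dots> = (\<Sum>r<nu t om. ennreal (g r))" by (intro sum.cong) (auto simp: iff)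
 finally show ?thesis using g by (simp add: sum_ennreal)
qed

text \<open>
  Wald's identity holds because the event that the walk has not passed \<open>t\<close> before step \<open>r\<close> depends
  on the earlier steps only.
\<close>

lemma wald:
 fixes g :: "real => real"
 assumes [measurable]: "g \<in> borel_measurable borel" and g: "!!x. 0 \<le> g x" and t: "0 \<le> t"
 shows "(\<integral>\<^sup>+om. (\<Sum>r. if S r om \<le> t then ennreal (g (xi r om)) else 0) \<partial>M)
  = (\<integral>\<^sup>+om. ennreal (g (xi 0 om)) \<partial>M) * (\<integral>\<^sup>+om. ennreal (nu t om) \<partial>M)"
  and "(\<integral>\<^sup>+om. ennreal (\<Sum>r<nu t om. g (xi r om)) \<partial>M)
  = (\<integral>\<^sup>+om. ennreal (g (xi 0 om)) \<partial>M) * (\<integral>\<^sup>+om. ennreal (nu t om) \<partial>M)"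
proof -
 let ?G = "\<integral>\<^sup>+om. ennreal (g (xi 0 om)) \<partial>M"
 have step: "(\<integral>\<^sup>+om. (if S r om \<le> t then ennreal (g (xi r om)) else 0) \<partial>M) = (\<integral>\<^sup>+om. ?G * indicator {..t} (S r om) \<partial>M)" for r
 proof -
  have "(\<integral>\<^sup>+om. (if S r om \<le> t then ennreal (g (xi r om)) else 0) \<partial>M)
   = (\<integral>\<^sup>+om. \<integral>\<^sup>+om'. (if S r om \<le> t then ennreal (g (xi 0 om')) else 0) \<partial>M \<partial>M)"
   using nn_step[of "%(s, x', e). if s \<le> t then ennreal (g x') else 0" r] by simp
  also have "\<dots> = (\<integral>\<^sup>+om. ?G * indicator {..t} (S r om) \<partial>M)"
   by (intro nn_integral_cong) (auto simp: indicator_def)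
  finally show ?thesis .
 qed
 have "(\<integral>\<^sup>+om. (\<Sum>r. if S r om \<le> t then ennreal (g (xi r om)) else 0) \<partial>M)
   = (\<Sum>r. \<integral>\<^sup>+om. (if S r om \<le> t then ennreal (g (xi r om)) else 0) \<partial>M)"
  by (rule nn_integral_suminf) measurable
 also have "\<dots> = (\<Sum>r. ?G * (\<integral>\<^sup>+om. indicator {..t} (S r om) \<partial>M))"
  unfolding step by (intro suminf_cong nn_integral_cmult) measurable
 also have "\<dots> = ?G * (\<integral>\<^sup>+om. (\<Sum>r. indicator {..t} (S r om)) \<partial>M)"
  by (subst nn_integral_suminf) auto
 also have "(\<integral>\<^sup>+om. (\<Sum>r. indicator {..t} (S r om)) \<partial>M) = (\<integral>\<^sup>+om. ennreal (nu t om) \<partial>M)"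
  by (rule nn_integral_cong_AE, use AE_finite_nu[of t] in eventually_elim) (rule ennreal_nu)
 finally show 1: "(\<integral>\<^sup>+om. (\<Sum>r. if S r om \<le> t then ennreal (g (xi r om)) else 0) \<partial>M) = ?G * (\<integral>\<^sup>+om. ennreal (nu t om) \<partial>M)" .
 have "(\<integral>\<^sup>+om. ennreal (\<Sum>r<nu t om. g (xi r om)) \<partial>M) = (\<integral>\<^sup>+om. (\<Sum>r. if S r om \<le> t then ennreal (g (xi r om)) else 0) \<partial>M)"
  by (rule nn_integral_cong_AE, use AE_finite_nu[of t] in eventually_elim)
   (rule suminf_nu[symmetric, OF _ t g])
 then show "(\<integral>\<^sup>+om. ennreal (\<Sum>r<nu t om. g (xi r om)) \<partial>M) = ?G * (\<integral>\<^sup>+om. ennreal (nu t om) \<partial>M)"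
  using 1 by simp
qed

lemma wald_real:
 fixes g :: "real => real"
 assumes [measurable]: "g \<in> borel_measurable borel" and g: "!!x. 0 \<le> g x" and t: "0 \<le> t"
  and int: "integrable M (%om. g (xi 0 om))"
 shows "(\<integral>\<^sup>+om. ennreal (\<Sum>r<nu t om. g (xi r om)) \<partial>M)
  = ennreal (expectation (%om. g (xi 0 om)) * expectation (%om. real (nu t om)))"
 unfolding wald(2)[OF assms(1) g t]
 using g by (simp add: nn_integral_eq_integral[OF int] nn_integral_eq_integral[OF nu_integrable[OF t]] ennreal_mult)

definition over :: "real => 'a => real" where "over t om = S (nu t om) om - t"

lemma rv_over [measurable]: "over t \<in> borel_measurable M" unfolding over_def[abs_def] by measurable

lemma over_bounds:
 assumes fin: "finite {r. S r om \<le> t}" and t: "0 \<le> t"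
 shows "0 \<le> over t om" "over t om \<le> xi (nu t om - 1) om"
 using nu_props[OF fin t] S_Suc[of "nu t om - 1" om] by (auto simp: over_def)

definition "over_const = visit_const * (mu + sq)"

lemma over_nn:
 assumes t: "0 \<le> t" shows "(\<integral>\<^sup>+om. ennreal (over t om) \<partial>M) \<le> ennreal over_const"
proof -
 have "(\<integral>\<^sup>+om. ennreal (over t om) \<partial>M) \<le> (\<integral>\<^sup>+om. (\<Sum>r. if t - fst (xi r om, eta r om) \<le> S r om \<and>
   S r om \<le> (t - fst (xi r om, eta r om)) + fst (xi r om, eta r om) then ennreal \<bar>fst (xi r om, eta r om)\<bar> else 0) \<partial>M)"
  (is "_ \<le> (\<integral>\<^sup>+om. (\<Sum>r. ?f r om) \<partial>M)")
 proof (rule nn_integral_mono_AE, use AE_finite_nu[of t] in eventually_elim)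
  case (elim om)
  let ?k = "nu t om - 1"
  have "ennreal (over t om) \<le> ?f ?k om"
   using nu_props[OF elim t] over_bounds[OF elim t] S_Suc[of ?k om] by (auto intro: ennreal_leI)
  also have "\<dots> \<le> (\<Sum>r. ?f r om)"
   using sum_le_suminf[of "%r. ?f r om" "{?k}"] by simp
  finally show ?case .
 qed
 also have "\<dots> \<le> (\<integral>\<^sup>+om. ennreal (\<bar>fst (xi 0 om, eta 0 om)\<bar> * (visit_const * (1 + fst (xi 0 om, eta 0 om)))) \<partial>M)"
  by (rule expected_weighted_visits) (auto simp: xi_nonneg)
 also have "\<dots> = (\<integral>\<^sup>+om. ennreal (visit_const * (xi 0 om + (xi 0 om)\<^sup>2)) \<partial>M)"
  by (intro nn_integral_cong) (simp add: xi_nonneg power2_eq_square algebra_simps)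
 also have "\<dots> = ennreal over_const"
  using xi_integrable xi_sq_integrable xi_nonneg visit_const_nonneg
  by (subst nn_integral_eq_integral) (auto simp: over_const_def mu_def sq_def)
 finally show ?thesis .
qed

lemma sq_nonneg: "0 \<le> sq" by (simp add: sq_def)
lemma over_const_nonneg: "0 \<le> over_const"
 using visit_const_nonneg mu_pos sq_nonneg by (simp add: over_const_def)

text \<open>
  Wald's identity turns the mean overshoot, which the second moment of the steps bounds
  uniformly, into a bound for the mean number of renewals.
\<close>

lemma wald_mean:
 assumes t: "0 \<le> t"
 shows "integrable M (over t)" "mu * expectation (%om. real (nu t om)) = t + expectation (over t)"
  "0 \<le> expectation (over t)" "expectation (over t) \<le> over_const"
proof -
 have ae: "AE om in M. 0 \<le> over t om"
  using AE_finite_nu[of t] by eventually_elim (rule over_bounds(1)[OF _ t])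
 show i: "integrable M (over t)"
  using over_nn[OF t] ae by (intro integrableI_nonneg) (auto intro: le_less_trans)
 show "0 \<le> expectation (over t)" using ae by (rule integral_nonneg_AE)
 then show "expectation (over t) \<le> over_const"
  using over_nn[OF t] nn_integral_eq_integral[OF i ae] over_const_nonneg by simp
 have "(\<integral>\<^sup>+om. ennreal (\<Sum>r<nu t om. \<bar>xi r om\<bar>) \<partial>M) = ennreal (mu * expectation (%om. real (nu t om)))"
  using wald_real[of abs t, OF _ _ t] xi_integrable by (simp add: mu_def xi_nonneg)
 moreover have "(\<integral>\<^sup>+om. ennreal (\<Sum>r<nu t om. \<bar>xi r om\<bar>) \<partial>M) = (\<integral>\<^sup>+om. ennreal (t + over t om) \<partial>M)"
  by (intro nn_integral_cong) (simp add: over_def S_def xi_nonneg)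
 moreover have "(\<integral>\<^sup>+om. ennreal (t + over t om) \<partial>M) = ennreal (t + expectation (over t))"
  using i ae t by (subst nn_integral_eq_integral) (auto simp: prob_space)
 ultimately have "ennreal (mu * expectation (%om. real (nu t om))) = ennreal (t + expectation (over t))" by simp
 then show "mu * expectation (%om. real (nu t om)) = t + expectation (over t)"
  using t \<open>0 \<le> expectation (over t)\<close> mu_pos by (subst (asm) ennreal_inj) auto
qed

definition "late_const = visit_const * (1 + expectation (eta 0))"

lemma late_const_nonneg: "0 \<le> late_const"
 using visit_const_nonneg by (simp add: late_const_def eta_nonneg)

text \<open>
  A late point has \<open>S r\<close> in the window from \<open>t - eta r\<close> to \<open>t\<close>, and the expected number of such
  visits is of the order \<open>1 + E(eta)\<close>, uniformly in \<open>t\<close>.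
\<close>

lemma late_nn: "(\<integral>\<^sup>+om. ennreal (late t om) \<partial>M) \<le> ennreal late_const"
proof -
 have "(\<integral>\<^sup>+om. ennreal (late t om) \<partial>M) \<le> (\<integral>\<^sup>+om. (\<Sum>r. if t - snd (xi r om, eta r om) \<le> S r om \<and>
   S r om \<le> (t - snd (xi r om, eta r om)) + snd (xi r om, eta r om) then ennreal 1 else 0) \<partial>M)"
  (is "_ \<le> (\<integral>\<^sup>+om. (\<Sum>r. ?f r om) \<partial>M)")
 proof (rule nn_integral_mono_AE, use AE_finite_nu[of t] in eventually_elim)
  case (elim om)
  show ?case unfolding ennreal_late[OF elim, symmetric]
   by (intro suminf_le) (auto simp: T_def)
 qed
 also have "\<dots> \<le> (\<integral>\<^sup>+om. ennreal (1 * (visit_const * (1 + snd (xi 0 om, eta 0 om)))) \<partial>M)"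
  by (rule expected_weighted_visits) (auto simp: eta_nonneg)
 also have "\<dots> = ennreal late_const"
  using eta_integrable eta_nonneg visit_const_nonneg
  by (subst nn_integral_eq_integral) (auto simp: late_const_def prob_space)
 finally show ?thesis .
qed

lemma T_window_nn:
 "(\<integral>\<^sup>+om. (\<Sum>r. indicator {a..a+1} (T r om)) \<partial>M) \<le> ennreal (2 * visit_const)"
proof -
 have "(\<integral>\<^sup>+om. (\<Sum>r. indicator {a..a+1} (T r om)) \<partial>M) = (\<integral>\<^sup>+om. (\<Sum>r. if a - snd (xi r om, eta r om) \<le> S r om \<and>
   S r om \<le> (a - snd (xi r om, eta r om)) + 1 then ennreal 1 else 0) \<partial>M)"
  by (intro nn_integral_cong suminf_cong) (auto simp: T_def indicator_def)
 also have "\<dots> \<le> (\<integral>\<^sup>+om. ennreal (1 * (visit_const * (1 + 1))) \<partial>M)"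
  by (rule expected_weighted_visits) auto
 also have "\<dots> = ennreal (2 * visit_const)" by (simp add: emeasure_space_1 mult.commute)
 finally show ?thesis .
qed

lemma late_mean: "integrable M (%om. real (late t om))" "expectation (%om. real (late t om)) \<le> late_const"
 using integrable_realI[OF rv_late _ late_nn late_const_nonneg] by auto

lemma AE_nu_split: "0 \<le> t ==> AE om in M. real (nu t om) = real (cnt t om) + real (late t om)"
 using AE_finite_nu[of t] by eventually_elim (simp add: nu_props(5))

lemma cnt_integrable: "0 \<le> t ==> integrable M (%om. real (cnt t om))"
 and cnt_mean: "0 \<le> t ==> expectation (%om. real (cnt t om)) =
  expectation (%om. real (nu t om)) - expectation (%om. real (late t om))"
proof -
 assume t: "0 \<le> t"
 have ae: "AE om in M. real (nu t om) - real (late t om) = real (cnt t om)"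
  using AE_nu_split[OF t] by eventually_elim simp
 have i: "integrable M (%om. real (nu t om) - real (late t om))"
  by (intro Bochner_Integration.integrable_diff nu_integrable t late_mean)
 show "integrable M (%om. real (cnt t om))"
  using i by (rule integrable_cong_AE_imp) (use ae in auto)
 show "expectation (%om. real (cnt t om)) = expectation (%om. real (nu t om)) - expectation (%om. real (late t om))"
  using integral_cong_AE[OF _ _ ae] Bochner_Integration.integral_diff[OF nu_integrable[OF t] late_mean(1)[of t]]
  by simp
qed

definition "mean_const = over_const + mu * late_const"

lemma mean_const_nonneg: "0 \<le> mean_const"
 using over_const_nonneg late_const_nonneg mu_pos by (simp add: mean_const_def)

text \<open>
  Linear growth with a bounded error is all that is needed from renewal theory; it
  holds for every step distribution of finite variance.
\<close>

lemma cnt_mean_bounds: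
 assumes t: "0 \<le> t"
 shows "t - mean_const \<le> mu * expectation (%om. real (cnt t om))"
  "mu * expectation (%om. real (cnt t om)) \<le> t + mean_const"
proof -
 have "0 \<le> mu * expectation (%om. real (late t om))" "mu * expectation (%om. real (late t om)) \<le> mu * late_const"
  using mu_pos late_mean(2)[of t] by (auto intro: mult_left_mono)
 moreover have "0 \<le> mu * late_const" using mu_pos late_const_nonneg by simp
 ultimately show "t - mean_const \<le> mu * expectation (%om. real (cnt t om))"
  "mu * expectation (%om. real (cnt t om)) \<le> t + mean_const"
  using wald_mean[OF t] over_const_nonneg unfolding cnt_mean[OF t] mean_const_def by (auto simp: right_diff_distrib)
qed

definition "var = expectation (%om. (xi 0 om - mu)\<^sup>2)"

lemma xi_centered_sq_integrable: "integrable M (%om. (xi 0 om - mu)\<^sup>2)"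
 using xi_integrable xi_sq_integrable by (simp add: power2_diff)

lemma var_nonneg: "0 \<le> var" by (simp add: var_def)

lemma martingale_nn:
 assumes t: "0 \<le> t"
 shows "(\<integral>\<^sup>+om. ennreal ((S (nu t om) om - mu * nu t om)\<^sup>2) \<partial>M) \<le> ennreal (var * expectation (%om. real (nu t om)))"
proof -
 let ?f = "%(r::nat) (s, x, e :: real). (x - mu) * indicator {..t} s :: real"
 have "(\<integral>\<^sup>+om. ennreal ((S (nu t om) om - mu * nu t om)\<^sup>2) \<partial>M)
   \<le> (\<Sum>r. \<integral>\<^sup>+om. ennreal ((?f r (S r om, xi r om, eta r om))\<^sup>2) \<partial>M)"
 proof (rule martingale_L2)
  show "?f r \<in> borel_measurable (borel \<Otimes>\<^sub>M borel2)" for r by measurable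
  show "(\<integral>om. ?f r (s, xi 0 om, eta 0 om) \<partial>M) = 0" for r s
   using xi_integrable by (simp add: mu_def prob_space)
  show "integrable M (%om. (?f r (S r om, xi r om, eta r om))\<^sup>2)" for r
  proof (rule Bochner_Integration.integrable_bound)
   show "integrable M (%om. (xi r om - mu)\<^sup>2)"
    using integral_ident(2)[of "%z. (fst z - mu)\<^sup>2" r] xi_centered_sq_integrable by simp
  qed (auto simp: indicator_def)
  show "AE om in M. (%r. ?f r (S r om, xi r om, eta r om)) sums (S (nu t om) om - mu * nu t om)"
   using AE_finite_nu[of t]
  proof eventually_elim
   case (elim om)
   have iff: "S r om \<le> t \<longleftrightarrow> r \<in> {..<nu t om}" for r
    using nu_props(1)[OF elim t] by blast
   have "(%r. ?f r (S r om, xi r om, eta r om)) sums (\<Sum>r<nu t om. ?f r (S r om, xi r om, eta r om))"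
    by (rule sums_finite) (auto simp: iff)
   also have "(\<Sum>r<nu t om. ?f r (S r om, xi r om, eta r om)) = (\<Sum>r<nu t om. xi r om - mu)"
    by (intro sum.cong) (auto simp: iff)
   also have "\<dots> = S (nu t om) om - mu * nu t om"
    by (simp add: sum_subtractf S_def mult.commute)
   finally show ?case .
  qed
 qed
 also have "\<dots> = (\<integral>\<^sup>+om. (\<Sum>r. if S r om \<le> t then ennreal ((xi r om - mu)\<^sup>2) else 0) \<partial>M)"
  by (subst nn_integral_suminf) (auto intro!: suminf_cong nn_integral_cong)
 also have "\<dots> = ennreal (var * expectation (%om. real (nu t om)))"
  using wald(1)[of "%x. (x - mu)\<^sup>2" t] t
  by (simp add: nn_integral_eq_integral[OF xi_centered_sq_integrable] nn_integral_eq_integral[OF nu_integrable[OF t]] var_def ennreal_mult)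
 finally show ?thesis .
qed

lemma over_sq_nn:
 assumes t: "0 \<le> t"
 shows "(\<integral>\<^sup>+om. ennreal ((over t om)\<^sup>2) \<partial>M) \<le> ennreal (sq * expectation (%om. real (nu t om)))"
proof -
 have "(\<integral>\<^sup>+om. ennreal ((over t om)\<^sup>2) \<partial>M) \<le> (\<integral>\<^sup>+om. ennreal (\<Sum>r<nu t om. (xi r om)\<^sup>2) \<partial>M)"
 proof (rule nn_integral_mono_AE, use AE_finite_nu[of t] in eventually_elim)
  case (elim om)
  have "(over t om)\<^sup>2 \<le> (xi (nu t om - 1) om)\<^sup>2"
   using over_bounds[OF elim t] by (intro power_mono)
  also have "\<dots> \<le> (\<Sum>r<nu t om. (xi r om)\<^sup>2)"
   using nu_props(2)[OF elim t] by (intro member_le_sum) auto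
  finally show ?case by (rule ennreal_leI)
 qed
 also have "\<dots> = ennreal (sq * expectation (%om. real (nu t om)))"
  unfolding sq_def by (rule wald_real) (auto simp: t xi_sq_integrable)
 finally show ?thesis .
qed

lemma nn_sq_add:
 assumes [measurable]: "f \<in> borel_measurable M" "g \<in> borel_measurable M"
  and f: "(\<integral>\<^sup>+om. ennreal ((f om)\<^sup>2) \<partial>M) \<le> ennreal a" and g: "(\<integral>\<^sup>+om. ennreal ((g om)\<^sup>2) \<partial>M) \<le> ennreal b"
  and h: "AE om in M. \<bar>h om\<bar> \<le> \<bar>f om\<bar> + \<bar>g om\<bar>" and ab: "0 \<le> a" "0 \<le> b"
 shows "(\<integral>\<^sup>+om. ennreal ((h om)\<^sup>2) \<partial>M) \<le> ennreal (2 * a + 2 * b)"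
proof -
 have "(\<integral>\<^sup>+om. ennreal ((h om)\<^sup>2) \<partial>M) \<le> (\<integral>\<^sup>+om. 2 * ennreal ((f om)\<^sup>2) + 2 * ennreal ((g om)\<^sup>2) \<partial>M)"
 proof (rule nn_integral_mono_AE, use h in eventually_elim)
  case (elim om)
  have "(h om)\<^sup>2 \<le> (\<bar>f om\<bar> + \<bar>g om\<bar>)\<^sup>2"
   using elim by (metis abs_ge_zero power2_abs power_mono)
  also have "\<dots> \<le> 2 * (f om)\<^sup>2 + 2 * (g om)\<^sup>2"
   using sum_squares_bound[of "\<bar>f om\<bar>" "\<bar>g om\<bar>"] by (simp add: power2_sum)
  finally have "ennreal ((h om)\<^sup>2) \<le> ennreal (2 * (f om)\<^sup>2 + 2 * (g om)\<^sup>2)" by (rule ennreal_leI)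
  then show ?case by (simp add: ennreal_plus ennreal_mult)
 qed
 also have "\<dots> = 2 * (\<integral>\<^sup>+om. ennreal ((f om)\<^sup>2) \<partial>M) + 2 * (\<integral>\<^sup>+om. ennreal ((g om)\<^sup>2) \<partial>M)"
  by (simp add: nn_integral_add nn_integral_cmult)
 also have "\<dots> \<le> 2 * ennreal a + 2 * ennreal b"
  using f g by (intro add_mono mult_left_mono) auto
 finally show ?thesis using ab by (simp add: ennreal_plus ennreal_mult)
qed

definition "nu_const = 2 * (sq + var) * visit_const / mu\<^sup>2"
lemma nu_const_nonneg: "0 \<le> nu_const"
 using sq_nonneg var_nonneg visit_const_nonneg by (simp add: nu_const_def)

text \<open>
  At the time of passing \<open>t\<close> the centred walk is a stopped martingale, and \<open>S (nu t)\<close> differs from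
  \<open>t\<close> by the overshoot only.
\<close>

lemma nu_L2:
 assumes t: "0 \<le> t"
 shows "(\<integral>\<^sup>+om. ennreal ((nu t om - t / mu)\<^sup>2) \<partial>M) \<le> ennreal (nu_const * (1 + t))"
proof -
 let ?E = "expectation (%om. real (nu t om))"
 have E: "0 \<le> ?E" by simp
 have 1: "(\<integral>\<^sup>+om. ennreal ((mu * nu t om - t)\<^sup>2) \<partial>M) \<le> ennreal (2 * (sq * ?E) + 2 * (var * ?E))"
  by (rule nn_sq_add[OF _ _ over_sq_nn[OF t] martingale_nn[OF t]])
   (auto simp: over_def sq_nonneg var_nonneg E intro!: mult_nonneg_nonneg)
 have "(\<integral>\<^sup>+om. ennreal ((nu t om - t / mu)\<^sup>2) \<partial>M) = (\<integral>\<^sup>+om. ennreal (1 / mu\<^sup>2) * ennreal ((mu * nu t om - t)\<^sup>2) \<partial>M)"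
 proof (rule nn_integral_cong)
  fix om
  have "(nu t om - t / mu)\<^sup>2 = 1 / mu\<^sup>2 * (mu * nu t om - t)\<^sup>2"
   using mu_pos by (simp add: field_simps power2_eq_square)
  then show "ennreal ((nu t om - t / mu)\<^sup>2) = ennreal (1 / mu\<^sup>2) * ennreal ((mu * nu t om - t)\<^sup>2)"
   by (simp only:) (intro ennreal_mult, auto)
 qed
 also have "\<dots> = ennreal (1 / mu\<^sup>2) * (\<integral>\<^sup>+om. ennreal ((mu * nu t om - t)\<^sup>2) \<partial>M)"
  by (rule nn_integral_cmult) measurable
 also have "\<dots> \<le> ennreal (1 / mu\<^sup>2) * ennreal (2 * (sq * ?E) + 2 * (var * ?E))"
  by (intro mult_left_mono 1) auto
 also have "\<dots> = ennreal (1 / mu\<^sup>2 * (2 * (sq * ?E) + 2 * (var * ?E)))"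
  using E sq_nonneg var_nonneg by (intro ennreal_mult[symmetric]) auto
 also have "\<dots> \<le> ennreal (nu_const * (1 + t))"
 proof (rule ennreal_leI)
  have "1 / mu\<^sup>2 * (2 * (sq * ?E) + 2 * (var * ?E)) = 2 * (sq + var) / mu\<^sup>2 * ?E" by (simp add: field_simps)
  also have "\<dots> \<le> 2 * (sq + var) / mu\<^sup>2 * (visit_const * (1 + t))"
   using sq_nonneg var_nonneg by (intro mult_left_mono nu_mean_crude t) auto
  finally show "1 / mu\<^sup>2 * (2 * (sq * ?E) + 2 * (var * ?E)) \<le> nu_const * (1 + t)" by (simp add: nu_const_def)
 qed
 finally show ?thesis .
qed

end

section \<open>Linearization of the counting process\<close>

context prob_space begin

lemma nn_L1_le_L2:
 fixes f :: "'a => real"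
 assumes [measurable]: "f \<in> borel_measurable M" and a: "0 \<le> a"
  and f: "(\<integral>\<^sup>+om. ennreal ((f om)\<^sup>2) \<partial>M) \<le> ennreal a"
 shows "(\<integral>\<^sup>+om. ennreal \<bar>f om\<bar> \<partial>M) \<le> ennreal (sqrt a)"
proof -
 have i2: "integrable M (%om. (f om)\<^sup>2)" and le: "expectation (%om. (f om)\<^sup>2) \<le> a"
  using integrable_realI[OF _ _ f a] by auto
 have i: "integrable M f" by (rule square_integrable_imp_integrable[OF _ i2]) simp
 then have i1: "integrable M (%om. \<bar>f om\<bar>)" by simp
 have "variance (%om. \<bar>f om\<bar>) = expectation (%om. (f om)\<^sup>2) - (expectation (%om. \<bar>f om\<bar>))\<^sup>2"
  using variance_eq[OF i1] i2 by simp
 then have "(expectation (%om. \<bar>f om\<bar>))\<^sup>2 \<le> a"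
  using variance_positive[of "%om. \<bar>f om\<bar>"] le by simp
 then have "expectation (%om. \<bar>f om\<bar>) \<le> sqrt a" by (rule real_le_rsqrt)
 then show ?thesis using nn_integral_eq_integral[OF i1] by (simp add: ennreal_leI)
qed

lemma variance_le_nn:
 fixes f :: "'a => real"
 assumes [measurable]: "f \<in> borel_measurable M" and a: "0 \<le> a"
  and f: "(\<integral>\<^sup>+om. ennreal ((f om - c)\<^sup>2) \<partial>M) \<le> ennreal a"
 shows "(\<integral>\<^sup>+om. ennreal ((f om - expectation f)\<^sup>2) \<partial>M) \<le> ennreal a"
proof -
 let ?g = "%om. f om - c"
 have i2: "integrable M (%om. (?g om)\<^sup>2)" and le: "expectation (%om. (?g om)\<^sup>2) \<le> a"
  using integrable_realI[OF _ _ f a] by auto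
 have i: "integrable M ?g" by (rule square_integrable_imp_integrable[OF _ i2]) simp
 have fi: "integrable M f" using Bochner_Integration.integrable_add[OF i, of "%_. c"] by simp
 have e: "?g om - expectation ?g = f om - expectation f" for om
  using fi by (simp add: prob_space)
 have "expectation (%om. (f om - expectation f)\<^sup>2) \<le> a"
  using variance_eq[OF i i2] le unfolding e by (smt (verit) zero_le_power2)
 moreover have "integrable M (%om. (f om - expectation f)\<^sup>2)"
 proof -
  have "integrable M (%om. (?g om - expectation ?g)\<^sup>2)"
  proof -
   have "(%om. (?g om - k)\<^sup>2) = (%om. (?g om)\<^sup>2 + k\<^sup>2 - (2 * k) * ?g om)" for k
    by (rule ext) (simp add: power2_eq_square algebra_simps)
   then show ?thesis
    by (simp only:) (intro Bochner_Integration.integrable_add Bochner_Integration.integrable_diff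
      integrable_mult_right i i2 integrable_const)
  qed
  then show ?thesis unfolding e .
 qed
 ultimately show ?thesis by (subst nn_integral_eq_integral) (auto intro: ennreal_leI)
qed

lemma nn_sq_unscale:
 fixes f :: "'a => real"
 assumes [measurable]: "f \<in> borel_measurable M" and c: "0 < c" and a: "0 \<le> a"
  and f: "(\<integral>\<^sup>+om. ennreal ((c * f om)\<^sup>2) \<partial>M) \<le> ennreal a"
 shows "(\<integral>\<^sup>+om. ennreal ((f om)\<^sup>2) \<partial>M) \<le> ennreal (a / c\<^sup>2)"
proof -
 have "(\<integral>\<^sup>+om. ennreal ((f om)\<^sup>2) \<partial>M) = (\<integral>\<^sup>+om. ennreal (1 / c\<^sup>2) * ennreal ((c * f om)\<^sup>2) \<partial>M)"
  using c by (intro nn_integral_cong) (simp add: ennreal_mult[symmetric] power_mult_distrib)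
 also have "\<dots> = ennreal (1 / c\<^sup>2) * (\<integral>\<^sup>+om. ennreal ((c * f om)\<^sup>2) \<partial>M)"
  by (rule nn_integral_cmult) measurable
 also have "\<dots> \<le> ennreal (1 / c\<^sup>2) * ennreal a" by (intro mult_left_mono f) auto
 also have "\<dots> = ennreal (a / c\<^sup>2)" using a by (simp add: ennreal_mult[symmetric])
 finally show ?thesis .
qed

end

context perturbed_walk begin

text \<open>
  The conditional probability of being late, given the position of the walk.
\<close>

definition late_prob :: "real => real => real" where
 "late_prob t s = (\<integral>om. (if s \<le> t \<and> t < s + eta 0 om then 1 else 0) \<partial>M)"

lemma late_prob_measurable [measurable]: "late_prob t \<in> borel_measurable borel"
 unfolding late_prob_def[abs_def] by measurable

lemma late_prob_bounds: "0 \<le> late_prob t s" "late_prob t s \<le> 1" "t < s ==> late_prob t s = 0"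
proof -
 show "0 \<le> late_prob t s" unfolding late_prob_def by (rule Bochner_Integration.integral_nonneg) auto
 show "late_prob t s \<le> 1" unfolding late_prob_def
  by (rule integral_le_const) (auto intro!: integrable_const_bound[where B=1])
 show "t < s ==> late_prob t s = 0" by (simp add: late_prob_def)
qed

lemma late_prob_nn: "(\<integral>\<^sup>+om. (if s \<le> t \<and> t < s + eta 0 om then 1 else 0) \<partial>M) = ennreal (late_prob t s)"
proof -
 have "integrable M (%om. (if s \<le> t \<and> t < s + eta 0 om then 1 else 0) :: real)"
  by (auto intro!: integrable_const_bound[where B=1])
 from nn_integral_eq_integral[OF this] show ?thesis
  unfolding late_prob_def by (simp add: if_distrib[of ennreal] cong: if_cong)
qed

lemma late_prob_sum: "(\<Sum>r. \<integral>\<^sup>+om. ennreal (late_prob t (S r om)) \<partial>M) \<le> ennreal late_const"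
 and late_nn_sum: "(\<Sum>r. \<integral>\<^sup>+om. (if S r om \<le> t \<and> t < T r om then 1 else 0) \<partial>M) \<le> ennreal late_const"
proof -
 have "(\<integral>\<^sup>+om. (if S r om \<le> t \<and> t < T r om then 1 else 0) \<partial>M) = (\<integral>\<^sup>+om. ennreal (late_prob t (S r om)) \<partial>M)" for r
  using nn_step[of "%(s, x, e). if s \<le> t \<and> t < s + e then 1 else 0" r] by (simp add: T_def late_prob_nn)
 moreover have "(\<Sum>r. \<integral>\<^sup>+om. (if S r om \<le> t \<and> t < T r om then 1 else 0) \<partial>M) = (\<integral>\<^sup>+om. ennreal (late t om) \<partial>M)"
  by (subst nn_integral_suminf[symmetric], measurable)
   (rule nn_integral_cong_AE, use AE_finite_nu[of t] in eventually_elim, rule ennreal_late)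
 ultimately show "(\<Sum>r. \<integral>\<^sup>+om. ennreal (late_prob t (S r om)) \<partial>M) \<le> ennreal late_const"
  "(\<Sum>r. \<integral>\<^sup>+om. (if S r om \<le> t \<and> t < T r om then 1 else 0) \<partial>M) \<le> ennreal late_const"
  using late_nn[of t] by auto
qed

definition late_comp :: "real => 'a => real" where
 "late_comp t om = (\<Sum>r<nu t om. late_prob t (S r om))"

lemma late_comp_measurable [measurable]: "late_comp t \<in> borel_measurable M"
 unfolding late_comp_def[abs_def]
 by (rule measurable_compose_countable[of "%k om. \<Sum>r<k. late_prob t (S r om)", OF _ rv_nu_count]) measurable

lemma sums_upto_nu:
 fixes f :: "nat => real"
 assumes "finite {r. S r om \<le> t}" "0 \<le> t" "!!r. t < S r om ==> f r = 0"
 shows "f sums (\<Sum>r<nu t om. f r)"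
proof (rule sums_finite)
 fix r assume "r \<notin> {..<nu t om}"
 then have "\<not> S r om \<le> t" unfolding nu_props(1)[OF assms(1,2), symmetric] by simp
 then show "f r = 0" using assms(3) by simp
qed simp

text \<open>
  Subtracting the conditional probabilities leaves a sum of martingale differences.
\<close>

lemma late_compensated_nn:
 assumes t: "0 \<le> t"
 shows "(\<integral>\<^sup>+om. ennreal ((late t om - late_comp t om)\<^sup>2) \<partial>M) \<le> ennreal (2 * late_const)"
proof -
 let ?f = "%(r::nat) (s, x :: real, e). (if s \<le> t \<and> t < s + e then 1 else 0) - late_prob t s"
 have "(\<integral>\<^sup>+om. ennreal ((late t om - late_comp t om)\<^sup>2) \<partial>M)
   \<le> (\<Sum>r. \<integral>\<^sup>+om. ennreal ((?f r (S r om, xi r om, eta r om))\<^sup>2) \<partial>M)"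
 proof (rule martingale_L2)
  show "?f r \<in> borel_measurable (borel \<Otimes>\<^sub>M borel2)" for r by measurable
  show "(\<integral>om. ?f r (s, xi 0 om, eta 0 om) \<partial>M) = 0" for r s
  proof -
   have "integrable M (%om. (if s \<le> t \<and> t < s + eta 0 om then 1 else 0) :: real)"
    by (auto intro!: integrable_const_bound[where B=1])
   then show ?thesis by (simp add: late_prob_def prob_space)
  qed
  show "integrable M (%om. (?f r (S r om, xi r om, eta r om))\<^sup>2)" for r
  proof (rule integrable_const_bound[where B=1])
   have "\<bar>?f r (S r om, xi r om, eta r om)\<bar> \<le> 1" for om
    using late_prob_bounds(1,2)[of t "S r om"] by auto
   then show "AE om in M. norm ((?f r (S r om, xi r om, eta r om))\<^sup>2) \<le> 1"
    by (intro AE_I2) (auto simp: abs_square_le_1)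
  qed measurable
  show "AE om in M. (%r. ?f r (S r om, xi r om, eta r om)) sums (late t om - late_comp t om)"
   using AE_finite_nu[of t]
  proof eventually_elim
   case (elim om)
   have "(\<Sum>r<nu t om. if S r om \<le> t \<and> t < S r om + eta r om then 1 else 0) = real (late t om)"
   proof -
    have "{r. S r om \<le> t \<and> t < T r om} = {r\<in>{..<nu t om}. t < S r om + eta r om}"
     unfolding nu_props(1)[OF elim t, symmetric] by (auto simp: T_def)
    moreover have "(\<Sum>r<nu t om. if S r om \<le> t \<and> t < S r om + eta r om then 1 else 0)
     = (\<Sum>r<nu t om. if t < S r om + eta r om then 1 else (0::real))"
     using nu_props(1)[OF elim t] by (intro sum.cong) (auto simp: set_eq_iff)
    ultimately show ?thesis
     by (simp add: late_def sum.inter_filter[symmetric])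
   qed
   then show ?case
    using sums_upto_nu[OF elim t, of "%r. ?f r (S r om, xi r om, eta r om)"]
    by (simp add: late_comp_def sum_subtractf late_prob_bounds)
  qed
 qed
 also have "\<dots> \<le> (\<Sum>r. \<integral>\<^sup>+om. (if S r om \<le> t \<and> t < T r om then 1 else 0) + ennreal (late_prob t (S r om)) \<partial>M)"
 proof (intro suminf_le nn_integral_mono)
  fix r om
  have "(late_prob t (S r om))\<^sup>2 \<le> late_prob t (S r om)" "(1 - late_prob t (S r om))\<^sup>2 \<le> 1"
   using late_prob_bounds[of t "S r om"] by (auto simp: power2_eq_square mult_left_le mult_le_one)
  then show "ennreal ((?f r (S r om, xi r om, eta r om))\<^sup>2) \<le> (if S r om \<le> t \<and> t < T r om then 1 else 0) + ennreal (late_prob t (S r om))"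
   by (auto simp: T_def intro: ennreal_leI ennreal_le_1[THEN iffD2] add_increasing2)
 qed auto
 also have "\<dots> \<le> ennreal late_const + ennreal late_const"
  by (simp add: nn_integral_add suminf_add[symmetric] add_mono late_prob_sum late_nn_sum)
 also have "\<dots> = ennreal (2 * late_const)" using late_const_nonneg by (simp add: ennreal_plus[symmetric] del: ennreal_plus)
 finally show ?thesis .
qed

definition "gap_const = 1 + expectation (eta 0) / gap"

lemma gap_late_le:
 assumes fin: "finite {r. S r om \<le> t}" and t: "0 \<le> t"
 shows "(\<Sum>r<nu t om. late_prob t (S r om) * (if gap < xi r om then 1 else 0)) \<le> gap_const"
proof -
 have gc: "0 \<le> gap_const" using gap_pos by (simp add: gap_const_def eta_nonneg)
 have "ennreal (\<Sum>r<nu t om. late_prob t (S r om) * (if gap < xi r om then 1 else 0))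
  = (\<Sum>r<nu t om. ennreal (late_prob t (S r om)) * (if gap < xi r om then 1 else 0))"
  by (subst sum_ennreal[symmetric]) (auto simp: late_prob_bounds simp del: sum_ennreal intro!: sum.cong)
 also have "\<dots> \<le> (\<Sum>r. ennreal (late_prob t (S r om)) * (if gap < xi r om then 1 else 0))"
  by (rule sum_le_suminf) auto
 also have "\<dots> = (\<Sum>r. \<integral>\<^sup>+om'. (if S r om \<le> t \<and> t < S r om + eta 0 om' then 1 else 0) * (if gap < xi r om then 1 else 0) \<partial>M)"
  by (simp add: nn_integral_multc late_prob_nn)
 also have "\<dots> = (\<integral>\<^sup>+om'. (\<Sum>r. (if S r om \<le> t \<and> t < S r om + eta 0 om' then 1 else 0) * (if gap < xi r om then 1 else 0)) \<partial>M)"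
  by (rule nn_integral_suminf[symmetric]) measurable
 also have "\<dots> \<le> (\<integral>\<^sup>+om'. ennreal (1 + eta 0 om' / gap) \<partial>M)"
 proof (rule nn_integral_mono)
  fix om'
  have "(\<Sum>r. (if S r om \<le> t \<and> t < S r om + eta 0 om' then 1 else 0) * (if gap < xi r om then 1 else 0))
   \<le> (\<Sum>r. indicator {t - eta 0 om'..t - eta 0 om' + eta 0 om'} (S r om) * indicator {gap<..} (xi r om) :: ennreal)"
   by (intro suminf_le) (auto simp: indicator_def)
  also have "\<dots> \<le> ennreal (1 + eta 0 om' / gap)" by (rule gap_visits[OF eta_nonneg])
  finally show "(\<Sum>r. (if S r om \<le> t \<and> t < S r om + eta 0 om' then 1 else 0) * (if gap < xi r om then 1 else 0))
   \<le> ennreal (1 + eta 0 om' / gap)" .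
 qed
 also have "\<dots> = ennreal gap_const"
  using eta_integrable eta_nonneg gap_pos
  by (subst nn_integral_eq_integral) (auto simp: gap_const_def prob_space)
 finally show ?thesis using gc by simp
qed

text \<open>
  The sum of the conditional probabilities is compared with its restriction to large steps. The
  difference is again a martingale, and the restricted sum is bounded surely because large steps
  separate the positions.
\<close>

lemma late_comp_nn:
 assumes t: "0 \<le> t"
 shows "(\<integral>\<^sup>+om. ennreal ((late_comp t om)\<^sup>2) \<partial>M) \<le> ennreal ((2 * late_const + 2 * gap_const\<^sup>2) / gap_prob\<^sup>2)"
proof (rule nn_sq_unscale)
 let ?f = "%(r::nat) (s, x :: real, e :: real). late_prob t s * ((if gap < x then 1 else 0) - gap_prob)"
 define L where "L om = (\<Sum>r<nu t om. ?f r (S r om, xi r om, eta r om))" for om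
 have L_meas [measurable]: "L \<in> borel_measurable M"
  unfolding L_def[abs_def]
  by (rule measurable_compose_countable[of "%k om. \<Sum>r<k. ?f r (S r om, xi r om, eta r om)", OF _ rv_nu_count]) measurable
 have gp: "gap_prob \<le> 1" "0 < gap_prob" using gap_prob_pos by (auto simp: gap_prob_def)
 have b1: "\<bar>(if gap < x then 1 else 0) - gap_prob\<bar> \<le> 1" for x using gp by auto
 have b: "\<bar>?f r z\<bar> \<le> late_prob t (fst z)" for r z
  using mult_left_mono[OF b1 late_prob_bounds(1)[of t "fst z"], of "fst (snd z)"]
  by (cases z) (auto simp: abs_mult late_prob_bounds)
 have "(\<integral>\<^sup>+om. ennreal ((L om)\<^sup>2) \<partial>M)
   \<le> (\<Sum>r. \<integral>\<^sup>+om. ennreal ((?f r (S r om, xi r om, eta r om))\<^sup>2) \<partial>M)"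
 proof (rule martingale_L2)
  show "?f r \<in> borel_measurable (borel \<Otimes>\<^sub>M borel2)" for r by measurable
  show "(\<integral>om. ?f r (s, xi 0 om, eta 0 om) \<partial>M) = 0" for r s
  proof -
   have i: "integrable M (%om. (if gap < xi 0 om then 1 else 0) :: real)"
    by (auto intro!: integrable_const_bound[where B=1])
   have "(\<integral>om. (if gap < xi 0 om then 1 else 0) \<partial>M) = (\<integral>om. indicator {om\<in>space M. gap < xi 0 om} om \<partial>M :: real)"
    by (intro Bochner_Integration.integral_cong) (auto simp: indicator_def)
   moreover have "{om\<in>space M. gap < xi 0 om} \<inter> space M = {om\<in>space M. gap < xi 0 om}" by auto
   ultimately have "(\<integral>om. (if gap < xi 0 om then 1 else 0) \<partial>M) = gap_prob"
    using Bochner_Integration.integral_indicator[of M "{om\<in>space M. gap < xi 0 om}"]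
    by (simp only: gap_prob_def)
   with i show ?thesis by (simp add: prob_space)
  qed
  show "integrable M (%om. (?f r (S r om, xi r om, eta r om))\<^sup>2)" for r
  proof (rule integrable_const_bound[where B=1])
   have "\<bar>?f r (S r om, xi r om, eta r om)\<bar> \<le> 1" for om
    using b[of "(S r om, xi r om, eta r om)"] late_prob_bounds(2)[of t "S r om"] by simp
   then show "AE om in M. norm ((?f r (S r om, xi r om, eta r om))\<^sup>2) \<le> 1"
    by (intro AE_I2) (auto simp: abs_square_le_1)
  qed measurable
  show "AE om in M. (%r. ?f r (S r om, xi r om, eta r om)) sums L om"
   using AE_finite_nu[of t]
  proof eventually_elim
   case (elim om)
   show ?case unfolding L_def by (rule sums_upto_nu[OF elim t]) (simp add: late_prob_bounds)
  qed
 qed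
 also have "\<dots> \<le> (\<Sum>r. \<integral>\<^sup>+om. ennreal (late_prob t (S r om)) \<partial>M)"
 proof (intro suminf_le nn_integral_mono ennreal_leI)
  fix r om
  let ?z = "(S r om, xi r om, eta r om)"
  have "(?f r ?z)\<^sup>2 \<le> (late_prob t (S r om))\<^sup>2" using power_mono[OF b[of ?z] abs_ge_zero, of 2] by simp
  also have "\<dots> \<le> late_prob t (S r om)"
   using late_prob_bounds[of t "S r om"] by (auto simp: power2_eq_square mult_left_le)
  finally show "(?f r ?z)\<^sup>2 \<le> late_prob t (S r om)" .
 qed auto
 also have "\<dots> \<le> ennreal late_const" by (rule late_prob_sum)
 finally have Ln: "(\<integral>\<^sup>+om. ennreal ((L om)\<^sup>2) \<partial>M) \<le> ennreal late_const" .
 show "(\<integral>\<^sup>+om. ennreal ((gap_prob * late_comp t om)\<^sup>2) \<partial>M) \<le> ennreal (2 * late_const + 2 * gap_const\<^sup>2)"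
 proof (rule nn_sq_add[OF L_meas _ Ln])
  show "(%_. gap_const) \<in> borel_measurable M" "(\<integral>\<^sup>+om. ennreal (gap_const\<^sup>2) \<partial>M) \<le> ennreal (gap_const\<^sup>2)"
   by (auto simp: emeasure_space_1)
  show "AE om in M. \<bar>gap_prob * late_comp t om\<bar> \<le> \<bar>L om\<bar> + \<bar>gap_const\<bar>"
   using AE_finite_nu[of t]
  proof eventually_elim
   case (elim om)
   have "L om = (\<Sum>r<nu t om. late_prob t (S r om) * (if gap < xi r om then 1 else 0)) - gap_prob * late_comp t om"
    by (simp add: L_def late_comp_def sum_distrib_left sum_subtractf[symmetric] algebra_simps)
   moreover have "0 \<le> (\<Sum>r<nu t om. late_prob t (S r om) * (if gap < xi r om then 1 else 0))"
    by (intro sum_nonneg) (auto simp: late_prob_bounds)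
   moreover have "0 \<le> gap_prob * late_comp t om"
    using gp by (auto simp: late_comp_def late_prob_bounds intro!: mult_nonneg_nonneg sum_nonneg)
   ultimately show ?case using gap_late_le[OF elim t] by linarith
  qed
 qed (auto simp: late_const_nonneg)
qed (auto simp: gap_prob_pos late_const_nonneg)

definition "late_sq_const = 2 * (2 * late_const) + 2 * ((2 * late_const + 2 * gap_const\<^sup>2) / gap_prob\<^sup>2)"

lemma late_sq_const_nonneg: "0 \<le> late_sq_const"
 by (simp add: late_sq_const_def late_const_nonneg)

lemma late_L2:
 assumes t: "0 \<le> t" shows "(\<integral>\<^sup>+om. ennreal ((real (late t om))\<^sup>2) \<partial>M) \<le> ennreal late_sq_const"
 unfolding late_sq_const_def
 by (rule nn_sq_add[OF _ _ late_compensated_nn[OF t] late_comp_nn[OF t]]) (auto simp: late_const_nonneg)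

definition "cnt_const = 2 * nu_const + 2 * late_sq_const"

lemma cnt_const_nonneg: "0 \<le> cnt_const" 
 by (simp add: cnt_const_def nu_const_nonneg late_sq_const_nonneg)

text \<open>
  The variance of the count is at most linear: \<open>nu\<close> has linear variance and the number of late
  points has bounded second moment.
\<close>

lemma cnt_L2:
 assumes t: "0 \<le> t"
 shows "(\<integral>\<^sup>+om. ennreal ((real (cnt t om) - expectation (%om. real (cnt t om)))\<^sup>2) \<partial>M) \<le> ennreal (cnt_const * (1 + t))"
proof (rule variance_le_nn)
 have "(\<integral>\<^sup>+om. ennreal ((real (cnt t om) - t / mu)\<^sup>2) \<partial>M) \<le> ennreal (2 * (nu_const * (1 + t)) + 2 * late_sq_const)"
 proof (rule nn_sq_add[OF _ _ nu_L2[OF t] late_L2[OF t]])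
  show "AE om in M. \<bar>real (cnt t om) - t / mu\<bar> \<le> \<bar>real (nu t om) - t / mu\<bar> + \<bar>real (late t om)\<bar>"
   using AE_nu_split[OF t] by eventually_elim linarith
 qed (use t in \<open>auto simp: nu_const_nonneg late_sq_const_nonneg\<close>)
 also have "\<dots> \<le> ennreal (cnt_const * (1 + t))"
  using t late_sq_const_nonneg by (intro ennreal_leI) (simp add: cnt_const_def algebra_simps)
 finally show "(\<integral>\<^sup>+om. ennreal ((real (cnt t om) - t / mu)\<^sup>2) \<partial>M) \<le> ennreal (cnt_const * (1 + t))" .
qed (use t cnt_const_nonneg in auto)

definition lin :: "real => 'a => real" where
 "lin t om = (\<Sum>r<nat \<lfloor>t / mu\<rfloor> + 1. xi r om - mu)"

lemma lin_measurable [measurable]: "lin t \<in> borel_measurable M" unfolding lin_def[abs_def] by measurable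

lemma suminf_abs_diff_initial:
 "(\<Sum>r. ennreal \<bar>(if r < a then 1 else 0) - (if r < b then 1 else 0)\<bar>) = ennreal \<bar>real a - real b\<bar>" for a b :: nat
proof -
 have "(\<Sum>r. ennreal \<bar>(if r < a then 1 else 0) - (if r < b then 1 else 0)\<bar>) = (\<Sum>r. indicator {min a b..<max a b} r)"
  by (intro suminf_cong) (auto simp: indicator_def)
 also have "\<dots> = ennreal (card {min a b..<max a b})" by (rule suminf_indicator_ennreal) simp
 also have "real (card {min a b..<max a b}) = \<bar>real a - real b\<bar>" by (auto simp: min_def max_def)
 finally show ?thesis .
qed

lemma centered_sq_step:
 fixes h :: "real => ennreal"
 assumes [measurable]: "h \<in> borel_measurable borel"
 shows "(\<integral>\<^sup>+om. ennreal ((xi r om - mu)\<^sup>2) * h (S r om) \<partial>M) = ennreal var * (\<integral>\<^sup>+om. h (S r om) \<partial>M)"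
proof -
 have v: "(\<integral>\<^sup>+om'. ennreal ((xi 0 om' - mu)\<^sup>2) \<partial>M) = ennreal var"
  using nn_integral_eq_integral[OF xi_centered_sq_integrable] by (simp add: var_def)
 have "(\<integral>\<^sup>+om. ennreal ((xi r om - mu)\<^sup>2) * h (S r om) \<partial>M)
  = (\<integral>\<^sup>+om. \<integral>\<^sup>+om'. ennreal ((xi 0 om' - mu)\<^sup>2) * h (S r om) \<partial>M \<partial>M)"
  using nn_step[of "%(s, x, e). ennreal ((x - mu)\<^sup>2) * h s" r] by simp
 also have "\<dots> = (\<integral>\<^sup>+om. ennreal var * h (S r om) \<partial>M)"
 proof (rule nn_integral_cong)
  fix om
  have "(\<integral>\<^sup>+om'. ennreal ((xi 0 om' - mu)\<^sup>2) * h (S r om) \<partial>M) = (\<integral>\<^sup>+om'. ennreal ((xi 0 om' - mu)\<^sup>2) \<partial>M) * h (S r om)"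
   by (rule nn_integral_multc) measurable
  then show "(\<integral>\<^sup>+om'. ennreal ((xi 0 om' - mu)\<^sup>2) * h (S r om) \<partial>M) = ennreal var * h (S r om)"
   unfolding v .
 qed
 also have "\<dots> = ennreal var * (\<integral>\<^sup>+om. h (S r om) \<partial>M)" by (rule nn_integral_cmult) measurable
 finally show ?thesis .
qed

text \<open>
  Stopping the centred walk at the random index \<open>nu t\<close> instead of the deterministic index \<open>t / mu\<close>
 changes it by a martingale over the indices in between. Their expected number is of the order
 \<open>sqrt t\<close> by \<open>nu_L2\<close>, so the change is of the order \<open>t^(1/4)\<close>.
\<close>

lemma martingale_lin_nn:
 assumes t: "0 \<le> t"
 shows "(\<integral>\<^sup>+om. ennreal ((S (nu t om) om - mu * nu t om - lin t om)\<^sup>2) \<partial>M) \<le> ennreal (var * (sqrt (nu_const * (1 + t)) + 1))"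
proof -
 let ?K = "nat \<lfloor>t / mu\<rfloor> + 1"
 let ?f = "\<lambda>r (s, x, e :: real). (x - mu) * ((if s \<le> t then 1 else 0) - (if r < ?K then 1 else 0)) :: real"
 define g where "g r s = ennreal \<bar>(if s \<le> t then 1 else 0) - (if r < ?K then 1 else 0)\<bar>" for r :: nat and s :: real
 have [measurable]: "g r \<in> borel_measurable borel" for r unfolding g_def by measurable
 have "(\<integral>\<^sup>+om. (\<Sum>r. g r (S r om)) \<partial>M)
  \<le> (\<integral>\<^sup>+om. ennreal \<bar>real (nu t om) - t / mu\<bar> + 1 \<partial>M)"
 proof (rule nn_integral_mono_AE, use AE_finite_nu[of t] in eventually_elim)
  case (elim om)
  have iff: "S r om \<le> t \<longleftrightarrow> r < nu t om" for r
   using nu_props(1)[OF elim t] by blast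
  have "0 \<le> t / mu" using t mu_pos by simp
  then have "\<bar>real (nu t om) - real ?K\<bar> \<le> \<bar>real (nu t om) - t / mu\<bar> + 1" by linarith
  then have "ennreal \<bar>real (nu t om) - real ?K\<bar> \<le> ennreal (\<bar>real (nu t om) - t / mu\<bar> + 1)" by (rule ennreal_leI)
  also have "\<dots> = ennreal \<bar>real (nu t om) - t / mu\<bar> + 1" by (simp add: ennreal_plus)
  finally show ?case unfolding g_def iff suminf_abs_diff_initial .
 qed
 also have "\<dots> = (\<integral>\<^sup>+om. ennreal \<bar>real (nu t om) - t / mu\<bar> \<partial>M) + 1"
  by (subst nn_integral_add) (auto simp: emeasure_space_1)
 also have "\<dots> \<le> ennreal (sqrt (nu_const * (1 + t))) + 1"
  using t nu_const_nonneg by (intro add_mono nn_L1_le_L2 nu_L2) auto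
 also have "\<dots> = ennreal (sqrt (nu_const * (1 + t)) + 1)"
  using t nu_const_nonneg by (simp add: ennreal_plus)
 finally have diff: "(\<integral>\<^sup>+om. (\<Sum>r. g r (S r om)) \<partial>M)
  \<le> ennreal (sqrt (nu_const * (1 + t)) + 1)" .
 have "(\<integral>\<^sup>+om. ennreal ((S (nu t om) om - mu * nu t om - lin t om)\<^sup>2) \<partial>M)
   \<le> (\<Sum>r. \<integral>\<^sup>+om. ennreal ((?f r (S r om, xi r om, eta r om))\<^sup>2) \<partial>M)"
 proof (rule martingale_L2)
  show "?f r \<in> borel_measurable (borel \<Otimes>\<^sub>M borel2)" for r by measurable
  show "(\<integral>om. ?f r (s, xi 0 om, eta 0 om) \<partial>M) = 0" for r s
   using xi_integrable by (simp add: mu_def prob_space)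
  show "integrable M (%om. (?f r (S r om, xi r om, eta r om))\<^sup>2)" for r
  proof (rule Bochner_Integration.integrable_bound)
   show "integrable M (%om. (xi r om - mu)\<^sup>2)"
    using integral_ident(2)[of "%z. (fst z - mu)\<^sup>2" r] xi_centered_sq_integrable by simp
  qed (auto simp: abs_mult power_mult_distrib)
  show "AE om in M. (%r. ?f r (S r om, xi r om, eta r om)) sums (S (nu t om) om - mu * nu t om - lin t om)"
   using AE_finite_nu[of t]
  proof eventually_elim
   case (elim om)
   have iff: "S r om \<le> t \<longleftrightarrow> r < nu t om" for r
    using nu_props(1)[OF elim t] by blast
   have "(%r. (if r \<in> {..<nu t om} then xi r om - mu else 0) - (if r \<in> {..<?K} then xi r om - mu else 0))
    sums ((\<Sum>r<nu t om. xi r om - mu) - (\<Sum>r<?K. xi r om - mu))"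
    by (intro sums_diff sums_If_finite_set) auto
   moreover have "(\<Sum>r<nu t om. xi r om - mu) = S (nu t om) om - mu * nu t om"
    by (simp add: sum_subtractf S_def mult.commute)
   moreover have "(%r. ?f r (S r om, xi r om, eta r om)) =
    (%r. (if r \<in> {..<nu t om} then xi r om - mu else 0) - (if r \<in> {..<?K} then xi r om - mu else 0))"
    by (auto simp: fun_eq_iff iff)
   ultimately show ?case by (simp only: lin_def)
  qed
 qed
 also have "\<dots> = (\<Sum>r. ennreal var * (\<integral>\<^sup>+om. g r (S r om) \<partial>M))"
 proof (rule suminf_cong)
  fix r
  have "(\<integral>\<^sup>+om. ennreal ((?f r (S r om, xi r om, eta r om))\<^sup>2) \<partial>M) = (\<integral>\<^sup>+om. ennreal ((xi r om - mu)\<^sup>2) * g r (S r om) \<partial>M)"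
   by (intro nn_integral_cong) (auto simp: g_def power_mult_distrib)
  also have "\<dots> = ennreal var * (\<integral>\<^sup>+om. g r (S r om) \<partial>M)"
   by (rule centered_sq_step) simp
  finally show "(\<integral>\<^sup>+om. ennreal ((?f r (S r om, xi r om, eta r om))\<^sup>2) \<partial>M) = ennreal var * (\<integral>\<^sup>+om. g r (S r om) \<partial>M)" .
 qed
 also have "\<dots> = ennreal var * (\<integral>\<^sup>+om. (\<Sum>r. g r (S r om)) \<partial>M)"
  by (simp add: nn_integral_suminf)
 also have "\<dots> \<le> ennreal var * ennreal (sqrt (nu_const * (1 + t)) + 1)"
  by (rule mult_left_mono[OF diff]) simp
 finally have "(\<integral>\<^sup>+om. ennreal ((S (nu t om) om - mu * nu t om - lin t om)\<^sup>2) \<partial>M)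
  \<le> ennreal var * ennreal (sqrt (nu_const * (1 + t)) + 1)" .
 then show ?thesis using var_nonneg t nu_const_nonneg by (simp add: ennreal_mult)
qed

definition "lin_const = over_const / mu + sqrt (var * (sqrt nu_const + 1)) / mu + late_const"

lemma lin_const_nonneg: "0 \<le> lin_const"
 using over_const_nonneg late_const_nonneg mu_pos var_nonneg nu_const_nonneg by (simp add: lin_const_def)

text \<open>
  The count equals \<open>t / mu\<close> minus the centred walk at the deterministic index \<open>t / mu\<close>, up to an error
  of smaller order than the fluctuations, which are of the order \<open>sqrt t\<close>.
\<close>

lemma cnt_linearization:
 assumes t: "0 \<le> t"
 shows "(\<integral>\<^sup>+om. ennreal \<bar>real (cnt t om) - t / mu + lin t om / mu\<bar> \<partial>M) \<le> ennreal (lin_const * sqrt (sqrt (1 + t)))"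
proof -
 let ?L = "%om. S (nu t om) om - mu * nu t om - lin t om"
 have "(\<integral>\<^sup>+om. ennreal \<bar>real (cnt t om) - t / mu + lin t om / mu\<bar> \<partial>M)
  \<le> (\<integral>\<^sup>+om. ennreal (1 / mu) * ennreal (over t om) + ennreal (1 / mu) * ennreal \<bar>?L om\<bar> + ennreal (late t om) \<partial>M)"
 proof (rule nn_integral_mono_AE, use AE_finite_nu[of t] AE_nu_split[OF t] in eventually_elim)
  case (elim om)
  have "real (cnt t om) - t / mu + lin t om / mu = (over t om - ?L om) / mu - late t om"
   using elim(2) mu_pos by (simp add: over_def field_simps)
  then have "\<bar>real (cnt t om) - t / mu + lin t om / mu\<bar> \<le> \<bar>(over t om - ?L om) / mu\<bar> + late t om" by linarith
  moreover have "\<bar>(over t om - ?L om) / mu\<bar> \<le> (over t om + \<bar>?L om\<bar>) / mu"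
   using mu_pos over_bounds(1)[OF elim(1) t] by (simp add: abs_divide divide_right_mono)
  ultimately have "\<bar>real (cnt t om) - t / mu + lin t om / mu\<bar> \<le> 1 / mu * over t om + 1 / mu * \<bar>?L om\<bar> + late t om"
   by (simp add: add_divide_distrib)
  from ennreal_leI[OF this] show ?case
   using mu_pos over_bounds(1)[OF elim(1) t] by (simp add: ennreal_plus ennreal_mult[symmetric])
 qed
 also have "\<dots> = ennreal (1 / mu) * (\<integral>\<^sup>+om. ennreal (over t om) \<partial>M) + ennreal (1 / mu) * (\<integral>\<^sup>+om. ennreal \<bar>?L om\<bar> \<partial>M) + (\<integral>\<^sup>+om. ennreal (late t om) \<partial>M)"
  by (simp add: nn_integral_add nn_integral_cmult)
 also have "\<dots> \<le> ennreal (1 / mu) * ennreal over_const + ennreal (1 / mu) * ennreal (sqrt (var * (sqrt (nu_const * (1 + t)) + 1))) + ennreal late_const"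
  using t var_nonneg nu_const_nonneg
  by (intro add_mono mult_left_mono over_nn late_nn nn_L1_le_L2 martingale_lin_nn) auto
 also have "\<dots> = ennreal (1 / mu * over_const + 1 / mu * sqrt (var * (sqrt (nu_const * (1 + t)) + 1)) + late_const)"
  using mu_pos t over_const_nonneg late_const_nonneg var_nonneg nu_const_nonneg
  by (simp add: ennreal_plus ennreal_mult[symmetric])
 also have "\<dots> \<le> ennreal (lin_const * sqrt (sqrt (1 + t)))"
 proof (rule ennreal_leI)
  let ?r = "sqrt (1 + t)"
  have r1: "1 \<le> ?r" "1 \<le> sqrt ?r" using t by auto
  have "sqrt (nu_const * (1 + t)) + 1 \<le> (sqrt nu_const + 1) * ?r"
   using r1 unfolding real_sqrt_mult[of nu_const "1 + t"] distrib_right by simp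
  then have "sqrt (var * (sqrt (nu_const * (1 + t)) + 1)) \<le> sqrt (var * ((sqrt nu_const + 1) * ?r))"
   using var_nonneg by (intro real_sqrt_le_mono mult_left_mono)
  also have "\<dots> = sqrt (var * (sqrt nu_const + 1)) * sqrt ?r" by (simp add: real_sqrt_mult)
  finally have "1 / mu * sqrt (var * (sqrt (nu_const * (1 + t)) + 1)) \<le> 1 / mu * (sqrt (var * (sqrt nu_const + 1)) * sqrt ?r)"
   using mu_pos by (intro mult_left_mono) auto
  moreover have "a \<le> a * sqrt ?r" if "0 \<le> a" for a
   using mult_left_mono[OF r1(2) that] by simp
  from this[of "1 / mu * over_const"] this[of late_const]
  have "1 / mu * over_const \<le> 1 / mu * over_const * sqrt ?r" "late_const \<le> late_const * sqrt ?r"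
   using mu_pos over_const_nonneg late_const_nonneg by auto
  ultimately show "1 / mu * over_const + 1 / mu * sqrt (var * (sqrt (nu_const * (1 + t)) + 1)) + late_const \<le> lin_const * sqrt ?r"
   unfolding lin_const_def by (simp add: algebra_simps)
 qed
 finally show ?thesis .
qed

end

section \<open>Convolution powers of an intensity of linear growth\<close>

text \<open>
  The mean measure of the displacements in the first generation. Apart from linear growth, the
  hypotheses bound the mass of unit windows and give mass at most one to the Laplace transform at one,
  which expresses that the weights sum to one.
\<close>

locale linear_intensity =
 fixes L :: "real measure" and c mu w :: real
 assumes sets_L [measurable_cong]: "sets L = sets borel"
  and L_neg: "emeasure L {..<0} = 0"
  and L_upper: "0 \<le> t ==> emeasure L {..t} \<le> ennreal ((t + c) / mu)"
  and L_lower: "0 \<le> t ==> ennreal ((t - c) / mu) \<le> emeasure L {..t}"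
  and L_window: "emeasure L {a..a+1} \<le> ennreal w"
  and L_laplace: "(\<integral>\<^sup>+x. ennreal (exp (- x)) \<partial>L) \<le> 1"
  and mu_pos: "0 < mu" and c_nonneg: "0 \<le> c" and w_nonneg: "0 \<le> w"
begin

lemma space_L [simp]: "space L = UNIV"
 using sets_eq_imp_space_eq[OF sets_L] by simp

lemma AE_L_nonneg: "AE x in L. 0 \<le> x"
 by (rule AE_I[of _ _ "{..<0}"]) (auto simp: L_neg sets_L)

lemma L_finite: "emeasure L {..t} < \<infinity>"
proof -
 have "emeasure L {..t} \<le> emeasure L {..max 0 t}" by (intro emeasure_mono) (auto simp: sets_L)
 also have "\<dots> < \<infinity>" using L_upper[of "max 0 t"] by (auto intro: le_less_trans)
 finally show ?thesis .
qed

lemma L_neg_Iic: assumes "t < 0" shows "emeasure L {..t} = 0"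
proof -
 have "{..t} \<subseteq> {..<0}" using assms by (auto intro: le_less_trans)
 from emeasure_mono[OF this, of L] show ?thesis by (simp add: L_neg sets_L)
qed

lemma sigma_finite_halfline:
 fixes N :: "real measure"
 assumes "sets N = sets borel" "!!t. emeasure N {..t} < \<infinity>"
 shows "sigma_finite_measure N"
proof
 show "\<exists>A. countable A \<and> A \<subseteq> sets N \<and> \<Union>A = space N \<and> (\<forall>a\<in>A. emeasure N a \<noteq> \<infinity>)"
 proof (intro exI[of _ "range (\<lambda>n::nat. {..real n})"] conjI ballI)
  show "\<Union>(range (\<lambda>n::nat. {..real n})) = space N"
   using sets_eq_imp_space_eq[OF assms(1)] real_arch_simple by auto
  fix a assume "a \<in> range (\<lambda>n::nat. {..real n})"
  then obtain n :: nat where "a = {..real n}" by auto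
  then show "emeasure N a \<noteq> \<infinity>" using assms(2)[of "real n"] by simp
 qed (auto simp: assms(1))
qed

sublocale sigma_finite_measure L
 by (rule sigma_finite_halfline[OF sets_L L_finite])

primrec lam :: "nat => real measure" where
 "lam 0 = return borel 0"
| "lam (Suc k) = distr (L \<Otimes>\<^sub>M lam k) borel (%(x, y). x + y)"

lemma sets_lam [simp, measurable_cong]: "sets (lam k) = sets borel" by (cases k) auto
lemma space_lam [simp]: "space (lam k) = UNIV" by (cases k) auto

text \<open>
  The volume \<open>x^k / (k! mu^k)\<close> would be the count if the mean measure were Lebesgue measure on the half-line
  divided by \<open>mu\<close>.
\<close>

definition tau :: "nat => real => real" where "tau k x = (max 0 x / mu) ^ k / fact k"

lemma tau_nonneg [simp]: "0 \<le> tau k x" using mu_pos by (simp add: tau_def)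
lemma tau_0 [simp]: "tau 0 x = 1" by (simp add: tau_def)
lemma tau_Suc_neg: "x \<le> 0 ==> tau (Suc k) x = 0" by (simp add: tau_def max_def)
lemma tau_measurable [measurable]: "tau k \<in> borel_measurable borel" unfolding tau_def[abs_def] by measurable

abbreviation ptau :: "nat => real => real" where "ptau k x \<equiv> (x / mu) ^ k / fact k"

lemma tau_eq: "0 \<le> x ==> tau k x = ptau k x" by (simp add: tau_def)

lemma ptau_deriv: "((%y. ptau (Suc k) (z - y)) has_field_derivative - ptau k (z - y) / mu) (at y within A)"
proof -
 have "((%y. (z - y) / mu) has_field_derivative - 1 / mu) (at y within A)"
  using mu_pos by (auto intro!: derivative_eq_intros)
 from DERIV_cdivide[OF DERIV_power[OF this, of "Suc k"], of "fact (Suc k)"]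
 have "((%y. ptau (Suc k) (z - y)) has_field_derivative
   real (Suc k) * (- 1 / mu * ((z - y) / mu) ^ k) / fact (Suc k)) (at y within A)" by simp
 moreover have "real (Suc k) * (- 1 / mu * q) / fact (Suc k) = - (q / fact k) / mu" for q
  unfolding fact_Suc using mu_pos by (simp add: field_simps del: of_nat_Suc)
 ultimately show ?thesis by (simp only:)
qed

lemma tau_layer:
 assumes "x \<le> z"
 shows "(\<integral>\<^sup>+y. ennreal (ptau k (z - y) / mu) * indicator {x..z} y \<partial>lborel) = ennreal (tau (Suc k) (z - x))"
proof -
 have "(\<integral>\<^sup>+y. ennreal (ptau k (z - y) / mu) * indicator {x..z} y \<partial>lborel)
  = ennreal ((%y. - ptau (Suc k) (z - y)) z - (%y. - ptau (Suc k) (z - y)) x)"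
 proof (rule nn_integral_FTC_Icc)
  fix y assume "y \<in> {x..z}"
  then show "0 \<le> ptau k (z - y) / mu" using mu_pos by simp
  show "((%y. - ptau (Suc k) (z - y)) has_real_derivative ptau k (z - y) / mu) (at y)"
   using DERIV_minus[OF ptau_deriv[where k=k and z=z and y=y and A=UNIV]] by simp
 qed (use assms in auto)
 then show ?thesis using assms by (simp add: tau_eq)
qed

lemma tau_linear_integral:
 assumes "a \<le> z"
 shows "(\<integral>\<^sup>+y. ennreal (ptau k (z - y) / mu * ((y - a) / mu)) * indicator {a..z} y \<partial>lborel) = ennreal (tau (Suc (Suc k)) (z - a))"
proof -
 let ?F = "%y. - (ptau (Suc k) (z - y) * ((y - a) / mu) + ptau (Suc (Suc k)) (z - y))"
 have "(\<integral>\<^sup>+y. ennreal (ptau k (z - y) / mu * ((y - a) / mu)) * indicator {a..z} y \<partial>lborel) = ennreal (?F z - ?F a)"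
 proof (rule nn_integral_FTC_Icc)
  fix y assume "y \<in> {a..z}"
  then show "0 \<le> ptau k (z - y) / mu * ((y - a) / mu)" using mu_pos by simp
  have 1: "((%y. (y - a) / mu) has_real_derivative 1 / mu) (at y)"
   using mu_pos by (auto intro!: derivative_eq_intros)
  have "(?F has_real_derivative - ((- ptau k (z - y) / mu) * ((y - a) / mu) + 1 / mu * ptau (Suc k) (z - y) + - ptau (Suc k) (z - y) / mu)) (at y)"
   by (intro DERIV_minus DERIV_add DERIV_mult ptau_deriv 1)
  then show "(?F has_real_derivative ptau k (z - y) / mu * ((y - a) / mu)) (at y)"
   by (rule DERIV_cong) (simp del: power_Suc)
 qed (use assms in auto)
 then show ?thesis using assms by (simp add: tau_eq)
qed

text \<open>
  Integration by parts in the form of Fubini's theorem: a decreasing function is a superposition of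
  indicators of half-lines, whose masses are known.
\<close>

lemma tau_step_layer:
 "(\<integral>\<^sup>+x. ennreal (tau (Suc k) (z - x)) * indicator {..z} x \<partial>L)
  = (\<integral>\<^sup>+y. ennreal (ptau k (z - y) / mu) * indicator {..z} y * emeasure L {..y} \<partial>lborel)"
proof -
 interpret P: pair_sigma_finite L lborel ..
 have m: "(%(x, y). ennreal (ptau k (z - y) / mu) * indicator {..z} y * indicator {(x, y). x \<le> y} (x, y)) \<in> borel_measurable (L \<Otimes>\<^sub>M lborel)"
  by measurable
 have "(\<integral>\<^sup>+x. ennreal (tau (Suc k) (z - x)) * indicator {..z} x \<partial>L)
  = (\<integral>\<^sup>+x. \<integral>\<^sup>+y. ennreal (ptau k (z - y) / mu) * indicator {..z} y * indicator {(x, y). x \<le> y} (x, y) \<partial>lborel \<partial>L)"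
 proof (rule nn_integral_cong)
  fix x
  show "ennreal (tau (Suc k) (z - x)) * indicator {..z} x = (\<integral>\<^sup>+y. ennreal (ptau k (z - y) / mu) * indicator {..z} y * indicator {(x, y). x \<le> y} (x, y) \<partial>lborel)"
  proof (cases "x \<le> z")
   case True
   have "(\<integral>\<^sup>+y. ennreal (ptau k (z - y) / mu) * indicator {..z} y * indicator {(x, y). x \<le> y} (x, y) \<partial>lborel)
    = (\<integral>\<^sup>+y. ennreal (ptau k (z - y) / mu) * indicator {x..z} y \<partial>lborel)"
    by (intro nn_integral_cong) (auto simp: indicator_def)
   then show ?thesis using tau_layer[OF True] True by simp
  next
   case False
   then have "(\<integral>\<^sup>+y. ennreal (ptau k (z - y) / mu) * indicator {..z} y * indicator {(x, y). x \<le> y} (x, y) \<partial>lborel) = (\<integral>\<^sup>+(y::real). 0 \<partial>lborel)"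
    by (intro nn_integral_cong) (auto simp: indicator_def)
   with False show ?thesis by simp
  qed
 qed
 also have "\<dots> = (\<integral>\<^sup>+y. \<integral>\<^sup>+x. ennreal (ptau k (z - y) / mu) * indicator {..z} y * indicator {(x, y). x \<le> y} (x, y) \<partial>L \<partial>lborel)"
  by (rule P.Fubini'[OF m, symmetric])
 also have "\<dots> = (\<integral>\<^sup>+y. ennreal (ptau k (z - y) / mu) * indicator {..z} y * emeasure L {..y} \<partial>lborel)"
 proof (rule nn_integral_cong)
  fix y :: real
  have "(\<integral>\<^sup>+x. ennreal (ptau k (z - y) / mu) * indicator {..z} y * indicator {(x, y). x \<le> y} (x, y) \<partial>L)
   = (\<integral>\<^sup>+x. ennreal (ptau k (z - y) / mu) * indicator {..z} y * indicator {..y} x \<partial>L)"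
   by (intro nn_integral_cong) (auto simp: indicator_def)
  also have "\<dots> = ennreal (ptau k (z - y) / mu) * indicator {..z} y * emeasure L {..y}"
   by (subst nn_integral_cmult) auto
  finally show "(\<integral>\<^sup>+x. ennreal (ptau k (z - y) / mu) * indicator {..z} y * indicator {(x, y). x \<le> y} (x, y) \<partial>L)
   = ennreal (ptau k (z - y) / mu) * indicator {..z} y * emeasure L {..y}" .
 qed
 finally show ?thesis .
qed

lemma tau_step_upper:
 assumes z: "0 \<le> z"
 shows "(\<integral>\<^sup>+x. ennreal (tau k (z - x)) * indicator {..z} x \<partial>L) \<le> ennreal (tau (Suc k) (z + c))"
proof (cases k)
 case 0
 then show ?thesis using L_upper[OF z] z c_nonneg by (simp add: tau_def)
next
 case (Suc k)
 have "(\<integral>\<^sup>+x. ennreal (tau (Suc k) (z - x)) * indicator {..z} x \<partial>L)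
  \<le> (\<integral>\<^sup>+y. ennreal (ptau k (z - y) / mu * ((y - (- c)) / mu)) * indicator {- c..z} y \<partial>lborel)"
  unfolding tau_step_layer
 proof (rule nn_integral_mono)
  fix y :: real
  show "ennreal (ptau k (z - y) / mu) * indicator {..z} y * emeasure L {..y}
   \<le> ennreal (ptau k (z - y) / mu * ((y - (- c)) / mu)) * indicator {- c..z} y"
  proof (cases "0 \<le> y \<and> y \<le> z")
   case True
   have "ennreal (ptau k (z - y) / mu) * emeasure L {..y} \<le> ennreal (ptau k (z - y) / mu) * ennreal ((y + c) / mu)"
    using True by (intro mult_left_mono L_upper) auto
   also have "\<dots> = ennreal (ptau k (z - y) / mu * ((y + c) / mu))"
    using True mu_pos c_nonneg by (intro ennreal_mult[symmetric]) auto
   finally show ?thesis using True c_nonneg by simp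
  next
   case False
   then show ?thesis using L_neg_Iic[of y] by (auto simp: indicator_def)
  qed
 qed
 also have "\<dots> = ennreal (tau (Suc (Suc k)) (z + c))"
  using tau_linear_integral[of "- c" z k] z c_nonneg by simp
 finally show ?thesis using Suc by simp
qed

lemma tau_step_lower:
 assumes z: "0 \<le> z"
 shows "ennreal (tau (Suc k) (z - c)) \<le> (\<integral>\<^sup>+x. ennreal (tau k (z - x)) * indicator {..z} x \<partial>L)"
proof (cases k)
 case 0
 then show ?thesis using L_lower[OF z] mu_pos by (cases "z \<le> c") (auto simp: tau_def max_def)
next
 case (Suc k)
 show ?thesis
 proof (cases "c \<le> z")
  case False
  then show ?thesis by (simp add: tau_Suc_neg)
 next
  case True
  have "ennreal (tau (Suc (Suc k)) (z - c)) = (\<integral>\<^sup>+y. ennreal (ptau k (z - y) / mu * ((y - c) / mu)) * indicator {c..z} y \<partial>lborel)"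
   using tau_linear_integral[OF True, of k] by simp
  also have "\<dots> \<le> (\<integral>\<^sup>+x. ennreal (tau (Suc k) (z - x)) * indicator {..z} x \<partial>L)"
   unfolding tau_step_layer
  proof (rule nn_integral_mono)
   fix y :: real
   show "ennreal (ptau k (z - y) / mu * ((y - c) / mu)) * indicator {c..z} y
    \<le> ennreal (ptau k (z - y) / mu) * indicator {..z} y * emeasure L {..y}"
   proof (cases "c \<le> y \<and> y \<le> z")
    case True
    have "ennreal (ptau k (z - y) / mu * ((y - c) / mu)) = ennreal (ptau k (z - y) / mu) * ennreal ((y - c) / mu)"
     using True mu_pos by (intro ennreal_mult) auto
    also have "\<dots> \<le> ennreal (ptau k (z - y) / mu) * emeasure L {..y}"
     using True c_nonneg by (intro mult_left_mono L_lower) auto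
    finally show ?thesis using True by simp
   qed (auto simp: indicator_def)
  qed
  finally show ?thesis using Suc by simp
 qed
qed

lemma nn_integral_lam_Suc_fst:
 assumes "sigma_finite_measure (lam k)" and [measurable]: "f \<in> borel_measurable borel"
 shows "(\<integral>\<^sup>+z. f z \<partial>lam (Suc k)) = (\<integral>\<^sup>+x. \<integral>\<^sup>+y. f (x + y) \<partial>lam k \<partial>L)"
proof -
 interpret lk: sigma_finite_measure "lam k" by fact
 have "(\<integral>\<^sup>+z. f z \<partial>lam (Suc k)) = (\<integral>\<^sup>+p. f (fst p + snd p) \<partial>(L \<Otimes>\<^sub>M lam k))"
  by (simp add: nn_integral_distr split_beta)
 also have "\<dots> = (\<integral>\<^sup>+x. \<integral>\<^sup>+y. f (x + y) \<partial>lam k \<partial>L)"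
  by (subst lk.nn_integral_fst[symmetric]) auto
 finally show ?thesis .
qed

text \<open>
  One induction for all properties, since the convolution with \<open>L\<close> needs the sigma-finiteness of the
  previous power.
\<close>

lemma lam_props: "sigma_finite_measure (lam k) \<and> emeasure (lam k) {..<0} = 0 \<and>
 (\<forall>t\<ge>0. emeasure (lam k) {..t} \<le> ennreal (tau k (t + c * k)) \<and> ennreal (tau k (t - c * k)) \<le> emeasure (lam k) {..t})"
proof (induction k)
 case 0
 have "prob_space (return borel (0::real))" by (rule prob_space_return) simp
 then show ?case by (auto intro: prob_space_imp_sigma_finite)
next
 case (Suc k)
 interpret lk: sigma_finite_measure "lam k" using Suc by simp
 interpret P: pair_sigma_finite L "lam k" ..
 have neg: "emeasure (lam k) {..t} = 0" if "t < 0" for t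
 proof -
  have "{..t} \<subseteq> {..<0}" using that by (auto intro: le_less_trans)
  from emeasure_mono[OF this, of "lam k"] show ?thesis using Suc by simp
 qed
 have aek: "AE x in lam k. 0 \<le> x"
  by (rule AE_I[of _ _ "{..<0}"]) (use Suc in auto)
 have step: "emeasure (lam (Suc k)) A = (\<integral>\<^sup>+x. emeasure (lam k) ((%y. x + y) -` A) \<partial>L)" if [measurable]: "A \<in> sets borel" for A
 proof -
  have "emeasure (lam (Suc k)) A = (\<integral>\<^sup>+z. indicator A z \<partial>lam (Suc k))" by simp
  also have "\<dots> = (\<integral>\<^sup>+x. \<integral>\<^sup>+y. indicator A (x + y) \<partial>lam k \<partial>L)"
   by (rule nn_integral_lam_Suc_fst) (use Suc in auto)
  also have "\<dots> = (\<integral>\<^sup>+x. \<integral>\<^sup>+y. indicator ((%y. x + y) -` A) y \<partial>lam k \<partial>L)"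
   by (simp add: indicator_def)
  also have "\<dots> = (\<integral>\<^sup>+x. emeasure (lam k) ((%y. x + y) -` A) \<partial>L)"
  proof (intro nn_integral_cong nn_integral_indicator)
   fix x :: real
   have "(%y. x + y) -` A \<inter> space borel \<in> sets borel" by (rule measurable_sets[OF _ that]) measurable
   then show "(%y. x + y) -` A \<in> sets (lam k)" by simp
  qed
  finally show ?thesis .
 qed
 have vim: "(%y. x + y) -` {..t} = {..t - x}" "(%y. x + y) -` {..<t} = {..<t - x}" for x t :: real by auto
 have upper: "emeasure (lam (Suc k)) {..t} \<le> ennreal (tau (Suc k) (t + c * Suc k))" if t: "0 \<le> t" for t
 proof -
  have "emeasure (lam (Suc k)) {..t} \<le> (\<integral>\<^sup>+x. ennreal (tau k (t + c * k - x)) * indicator {..t + c * k} x \<partial>L)"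
   unfolding step[OF atMost_borel] vim
  proof (rule nn_integral_mono)
   fix x
   show "emeasure (lam k) {..t - x} \<le> ennreal (tau k (t + c * k - x)) * indicator {..t + c * k} x"
   proof (cases "x \<le> t")
    case True
    then have "emeasure (lam k) {..t - x} \<le> ennreal (tau k (t - x + c * k))" using Suc by simp
    moreover have "x \<le> t + c * k" using True c_nonneg by (simp add: add_increasing2)
    ultimately show ?thesis by (simp add: algebra_simps)
   qed (simp add: neg)
  qed
  also have "\<dots> \<le> ennreal (tau (Suc k) (t + c * k + c))"
   using t c_nonneg by (intro tau_step_upper) auto
  finally show ?thesis by (simp add: algebra_simps)
 qed
 have lower: "ennreal (tau (Suc k) (t - c * Suc k)) \<le> emeasure (lam (Suc k)) {..t}" if t: "0 \<le> t" for t
 proof (cases "c * k \<le> t")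
  case False
  then have "t - c * Suc k \<le> 0" using c_nonneg by (simp add: algebra_simps)
  then show ?thesis by (simp only: tau_Suc_neg) simp
 next
  case True
  have "ennreal (tau (Suc k) (t - c * k - c)) \<le> (\<integral>\<^sup>+x. ennreal (tau k (t - c * k - x)) * indicator {..t - c * k} x \<partial>L)"
   using True by (intro tau_step_lower) auto
  also have "\<dots> \<le> emeasure (lam (Suc k)) {..t}"
   unfolding step[OF atMost_borel] vim
  proof (rule nn_integral_mono)
   fix x
   show "ennreal (tau k (t - c * k - x)) * indicator {..t - c * k} x \<le> emeasure (lam k) {..t - x}"
   proof (cases "x \<le> t - c * k")
    case True
    then have "0 \<le> t - x" using c_nonneg by (smt (verit) mult_nonneg_nonneg of_nat_0_le_iff)
    then have "ennreal (tau k (t - x - c * k)) \<le> emeasure (lam k) {..t - x}" using Suc by blast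
    then show ?thesis using True by (simp add: algebra_simps)
   qed simp
  qed
  finally show ?thesis by (simp add: algebra_simps)
 qed
 have fin: "emeasure (lam (Suc k)) {..t} < \<infinity>" for t
 proof -
  have "emeasure (lam (Suc k)) {..t} \<le> emeasure (lam (Suc k)) {..max 0 t}" by (intro emeasure_mono) auto
  also have "\<dots> < \<infinity>" using upper[of "max 0 t"] by (auto intro: le_less_trans)
  finally show ?thesis .
 qed
 have "emeasure (lam (Suc k)) {..<0} = (\<integral>\<^sup>+x. 0 \<partial>L)"
  unfolding step[OF lessThan_borel] vim
 proof (rule nn_integral_cong_AE, use AE_L_nonneg in eventually_elim)
  case (elim x)
  then have "emeasure (lam k) {..<0 - x} \<le> emeasure (lam k) {..<0}" by (intro emeasure_mono) auto
  then show ?case using Suc by simp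
 qed
 then show ?case using upper lower sigma_finite_halfline[OF sets_lam fin] by simp
qed

lemma sigma_finite_lam: "sigma_finite_measure (lam k)" using lam_props by blast

lemma lam_upper: "0 \<le> t ==> emeasure (lam k) {..t} \<le> ennreal (tau k (t + c * k))"
 and lam_lower: "0 \<le> t ==> ennreal (tau k (t - c * k)) \<le> emeasure (lam k) {..t}"
 using lam_props by blast+

lemma AE_lam_nonneg: "AE x in lam k. 0 \<le> x"
 by (rule AE_I[of _ _ "{..<0}"]) (use lam_props in auto)

lemma lam_neg_Iic: assumes "t < 0" shows "emeasure (lam k) {..t} = 0"
proof -
 have "{..t} \<subseteq> {..<0}" using assms by (auto intro: le_less_trans)
 from emeasure_mono[OF this, of "lam k"] show ?thesis using lam_props[of k] by simp
qed

lemma lam_finite: "emeasure (lam k) {..t} < \<infinity>"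
proof -
 have "emeasure (lam k) {..t} \<le> emeasure (lam k) {..max 0 t}" by (intro emeasure_mono) auto
 also have "\<dots> < \<infinity>" using lam_upper[of "max 0 t" k] by (auto intro: le_less_trans)
 finally show ?thesis .
qed

lemma nn_integral_lam_Suc:
 assumes [measurable]: "f \<in> borel_measurable borel"
 shows "(\<integral>\<^sup>+z. f z \<partial>lam (Suc k)) = (\<integral>\<^sup>+x. \<integral>\<^sup>+y. f (x + y) \<partial>lam k \<partial>L)"
  and "(\<integral>\<^sup>+z. f z \<partial>lam (Suc k)) = (\<integral>\<^sup>+y. \<integral>\<^sup>+x. f (x + y) \<partial>L \<partial>lam k)"
proof -
 interpret lk: sigma_finite_measure "lam k" by (rule sigma_finite_lam)
 interpret P: pair_sigma_finite L "lam k" ..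
 show 1: "(\<integral>\<^sup>+z. f z \<partial>lam (Suc k)) = (\<integral>\<^sup>+x. \<integral>\<^sup>+y. f (x + y) \<partial>lam k \<partial>L)"
  by (rule nn_integral_lam_Suc_fst[OF sigma_finite_lam assms])
 show "(\<integral>\<^sup>+z. f z \<partial>lam (Suc k)) = (\<integral>\<^sup>+y. \<integral>\<^sup>+x. f (x + y) \<partial>L \<partial>lam k)"
  unfolding 1 by (rule P.Fubini'[symmetric]) measurable
qed

definition "V k t = measure (lam k) {..t}"

lemma V_emeasure: "emeasure (lam k) {..t} = ennreal (V k t)"
 unfolding V_def using lam_finite by (intro emeasure_eq_ennreal_measure) (simp add: less_top)
lemma V_nonneg [simp]: "0 \<le> V k t" by (simp add: V_def)
lemma V_neg: "t < 0 ==> V k t = 0" by (simp add: V_def measure_def lam_neg_Iic)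
lemma V_mono: "s \<le> t ==> V k s \<le> V k t"
 using emeasure_mono[of "{..s}" "{..t}" "lam k"] by (simp add: V_emeasure)
lemma V_upper: "0 \<le> t ==> V k t \<le> tau k (t + c * k)"
 using lam_upper[of t k] by (simp add: V_emeasure)
lemma V_lower: "0 \<le> t ==> tau k (t - c * k) \<le> V k t"
 using lam_lower[of t k] by (simp add: V_emeasure)
lemma V_0: "0 \<le> t ==> V 0 t = 1" by (simp add: V_def measure_return)
lemma V_measurable [measurable]: "V k \<in> borel_measurable borel"
 by (rule borel_measurable_mono) (auto intro: monoI V_mono)

lemma V_Suc: "ennreal (V (Suc k) t) = (\<integral>\<^sup>+x. ennreal (V k (t - x)) \<partial>L)"
 "ennreal (V (Suc k) t) = (\<integral>\<^sup>+y. emeasure L {..t - y} \<partial>lam k)"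
proof -
 have "ennreal (V (Suc k) t) = (\<integral>\<^sup>+z. indicator {..t} z \<partial>lam (Suc k))" by (simp only: V_emeasure[symmetric]) simp
 then have e: "ennreal (V (Suc k) t) = (\<integral>\<^sup>+x. \<integral>\<^sup>+y. indicator {..t} (x + y) \<partial>lam k \<partial>L)"
  "ennreal (V (Suc k) t) = (\<integral>\<^sup>+y. \<integral>\<^sup>+x. indicator {..t} (x + y) \<partial>L \<partial>lam k)"
  using nn_integral_lam_Suc[of "indicator {..t}" k] by auto
 have "(\<integral>\<^sup>+y. indicator {..t} (x + y) \<partial>lam k) = (\<integral>\<^sup>+y. indicator {..t - x} y \<partial>lam k)" for x
  by (intro nn_integral_cong) (auto simp: indicator_def)
 then show "ennreal (V (Suc k) t) = (\<integral>\<^sup>+x. ennreal (V k (t - x)) \<partial>L)" using e(1) by (simp add: V_emeasure)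
 have "(\<integral>\<^sup>+x. indicator {..t} (x + y) \<partial>L) = (\<integral>\<^sup>+x. indicator {..t - y} x \<partial>L)" for y
  by (intro nn_integral_cong) (auto simp: indicator_def)
 then show "ennreal (V (Suc k) t) = (\<integral>\<^sup>+y. emeasure L {..t - y} \<partial>lam k)" using e(2) by simp
qed

definition "bump_const = 2 * w / (1 - exp (- 1))"

lemma bump_const_nonneg: "0 \<le> bump_const" using w_nonneg by (simp add: bump_const_def)

text \<open>
  The bump decreases geometrically over unit windows, each of mass at most \<open>w\<close>.
\<close>

lemma bump_L: "(\<integral>\<^sup>+x. ennreal (exp (- \<bar>s - x\<bar>)) \<partial>L) \<le> ennreal bump_const"
proof -
 have "(\<integral>\<^sup>+x. ennreal (exp (- \<bar>s - x\<bar>)) \<partial>L)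
  \<le> (\<integral>\<^sup>+x. (\<Sum>i. ennreal (exp (- 1) ^ i) * (indicator {s + i..s + i + 1} x + indicator {s - i - 1..s - i - 1 + 1} x)) \<partial>L)"
 proof (rule nn_integral_mono)
  fix x
  define i where "i = nat \<lfloor>\<bar>s - x\<bar>\<rfloor>"
  let ?f = "%i. ennreal (exp (- 1) ^ i) * (indicator {s + real i..s + real i + 1} x + indicator {s - real i - 1..s - real i - 1 + 1} x)"
  have i: "real i \<le> \<bar>s - x\<bar>" "\<bar>s - x\<bar> \<le> real i + 1" unfolding i_def by linarith+
  have "exp (- \<bar>s - x\<bar>) \<le> exp (- real i)" using i by simp
  also have "\<dots> = exp (- 1) ^ i" by (simp add: exp_of_nat_mult[symmetric])
  finally have "ennreal (exp (- \<bar>s - x\<bar>)) \<le> ennreal (exp (- 1) ^ i) * 1" by (simp add: ennreal_leI)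
  also have "\<dots> \<le> ?f i"
  proof (intro mult_left_mono)
   show "1 \<le> (indicator {s + real i..s + real i + 1} x + indicator {s - real i - 1..s - real i - 1 + 1} x :: ennreal)"
    using i by (cases "s \<le> x") (auto simp: indicator_def)
  qed simp
  also have "\<dots> \<le> (\<Sum>i. ?f i)" using sum_le_suminf[of ?f "{i}"] by simp
  finally show "ennreal (exp (- \<bar>s - x\<bar>)) \<le> (\<Sum>i. ?f i)" .
 qed
 also have "\<dots> = (\<Sum>i. ennreal (exp (- 1) ^ i) * (emeasure L {s + i..s + i + 1} + emeasure L {s - i - 1..s - i - 1 + 1}))"
  by (subst nn_integral_suminf) (auto simp: nn_integral_cmult nn_integral_add sets_L)
 also have "\<dots> \<le> (\<Sum>i. ennreal (exp (- 1) ^ i) * (ennreal w + ennreal w))"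
  by (intro suminf_le mult_left_mono add_mono L_window) auto
 also have "\<dots> = (\<Sum>i. ennreal (exp (- 1) ^ i * (2 * w)))"
  using w_nonneg by (intro suminf_cong) (simp add: ennreal_mult ennreal_plus[symmetric] del: ennreal_plus)
 also have "\<dots> = ennreal bump_const"
 proof (rule suminf_ennreal_eq)
  have "(%i. exp (- 1) ^ i * (2 * w)) sums (1 / (1 - exp (- 1)) * (2 * w))"
   by (intro sums_mult2 geometric_sums) auto
  then show "(%i. exp (- 1) ^ i * (2 * w)) sums bump_const" by (simp add: bump_const_def mult.commute)
 qed (use w_nonneg in auto)
 finally show ?thesis .
qed

definition "Vsum m t = (\<Sum>k<m. V k t)"

text \<open>
  Induction over the generations: the part of the bump to the right of \<open>t\<close> reproduces itself because of the
  bound for the Laplace transform, the part to the left costs a constant multiple of \<open>V k t\<close>.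
\<close>

lemma bump_lam:
 assumes t: "0 \<le> t"
 shows "(\<integral>\<^sup>+y. ennreal (exp (- \<bar>t - y\<bar>)) \<partial>lam m) \<le> ennreal (bump_const * Vsum m t + 1)"
proof (induction m)
 case 0
 have "(\<integral>\<^sup>+y. ennreal (exp (- \<bar>t - y\<bar>)) \<partial>lam 0) = ennreal (exp (- \<bar>t\<bar>))"
  by (simp add: nn_integral_return)
 also have "\<dots> \<le> 1" by simp
 finally show ?case by (simp add: Vsum_def)
next
 case (Suc m)
 have "(\<integral>\<^sup>+y. ennreal (exp (- \<bar>t - y\<bar>)) \<partial>lam (Suc m)) = (\<integral>\<^sup>+y. \<integral>\<^sup>+x. ennreal (exp (- \<bar>t - (x + y)\<bar>)) \<partial>L \<partial>lam m)"
  by (rule nn_integral_lam_Suc(2)) measurable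
 also have "\<dots> \<le> (\<integral>\<^sup>+y. ennreal bump_const * indicator {..t} y + ennreal (exp (- \<bar>t - y\<bar>)) \<partial>lam m)"
 proof (rule nn_integral_mono)
  fix y
  show "(\<integral>\<^sup>+x. ennreal (exp (- \<bar>t - (x + y)\<bar>)) \<partial>L) \<le> ennreal bump_const * indicator {..t} y + ennreal (exp (- \<bar>t - y\<bar>))"
  proof (cases "y \<le> t")
   case True
   have "(\<integral>\<^sup>+x. ennreal (exp (- \<bar>t - (x + y)\<bar>)) \<partial>L) = (\<integral>\<^sup>+x. ennreal (exp (- \<bar>(t - y) - x\<bar>)) \<partial>L)"
    by (intro nn_integral_cong) (simp add: algebra_simps)
   also have "\<dots> \<le> ennreal bump_const" by (rule bump_L)
   finally show ?thesis using True by (simp add: add_increasing2)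
  next
   case False
   have "(\<integral>\<^sup>+x. ennreal (exp (- \<bar>t - (x + y)\<bar>)) \<partial>L) = (\<integral>\<^sup>+x. ennreal (exp (- \<bar>t - y\<bar>)) * ennreal (exp (- x)) \<partial>L)"
   proof (rule nn_integral_cong_AE, use AE_L_nonneg in eventually_elim)
    case (elim x)
    then have "exp (- \<bar>t - (x + y)\<bar>) = exp (- \<bar>t - y\<bar>) * exp (- x)" using False by (simp add: exp_add[symmetric])
    then show ?case by (simp add: ennreal_mult)
   qed
   also have "\<dots> = ennreal (exp (- \<bar>t - y\<bar>)) * (\<integral>\<^sup>+x. ennreal (exp (- x)) \<partial>L)"
    by (rule nn_integral_cmult) measurable
   also have "\<dots> \<le> ennreal (exp (- \<bar>t - y\<bar>)) * 1" by (intro mult_left_mono L_laplace) auto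
   finally show ?thesis using False by simp
  qed
 qed
 also have "\<dots> = ennreal bump_const * ennreal (V m t) + (\<integral>\<^sup>+y. ennreal (exp (- \<bar>t - y\<bar>)) \<partial>lam m)"
  by (simp add: nn_integral_add nn_integral_cmult V_emeasure)
 also have "\<dots> \<le> ennreal bump_const * ennreal (V m t) + ennreal (bump_const * Vsum m t + 1)"
  by (intro add_left_mono Suc)
 also have "\<dots> = ennreal (bump_const * Vsum (Suc m) t + 1)"
  using bump_const_nonneg by (simp add: Vsum_def ennreal_mult[symmetric] ennreal_plus[symmetric] sum_nonneg algebra_simps del: ennreal_plus)
 finally show ?case .
qed

end

section \<open>Sums over the generations of a tree\<close>

text \<open>
  The mean measure of the point process \<open>- ln p r\<close>.
\<close>

definition env_intensity :: "(nat => real) measure => real measure" where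
 "env_intensity env = distr (env \<Otimes>\<^sub>M count_space UNIV) borel (%(p, r). - ln (p r))"

definition env_count :: "real => (nat => real) => ennreal" where
 "env_count t p = (\<Sum>r. indicator {..t} (- ln (p r)))"

lemma env_eval_measurable:
 assumes "sets env = sets (Pi\<^sub>M UNIV (\<lambda>_::nat. borel :: real measure))"
 shows "(%(p, r). - ln (p r)) \<in> env \<Otimes>\<^sub>M count_space UNIV \<rightarrow>\<^sub>M borel"
proof -
 have "(%p. - ln (p r)) \<in> borel_measurable (Pi\<^sub>M UNIV (\<lambda>_::nat. borel :: real measure))" for r by measurable
 then have "(%p. - ln (p r)) \<in> borel_measurable env" for r
  using assms by (simp cong: measurable_cong_sets)
 then have "(%z. - ln (fst z (snd z))) \<in> env \<Otimes>\<^sub>M count_space UNIV \<rightarrow>\<^sub>M borel"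
  by (intro measurable_compose_countable[where f="%r z. - ln (fst z r)" and g=snd]
    measurable_compose[OF measurable_fst]) simp_all
 then show ?thesis by (simp add: split_beta)
qed

lemma nn_integral_env_intensity:
 assumes env: "sets env = sets (Pi\<^sub>M UNIV (\<lambda>_::nat. borel :: real measure))"
  and [measurable]: "f \<in> borel_measurable borel"
 shows "(\<integral>\<^sup>+x. f x \<partial>env_intensity env) = (\<integral>\<^sup>+p. (\<Sum>r. f (- ln (p r))) \<partial>env)"
proof -
 interpret C: sigma_finite_measure "count_space (UNIV :: nat set)"
  by (rule sigma_finite_measure_count_space)
 note m[measurable] = env_eval_measurable[OF env]
 have "(\<integral>\<^sup>+x. f x \<partial>env_intensity env) = (\<integral>\<^sup>+z. f ((%(p, r). - ln (p r)) z) \<partial>(env \<Otimes>\<^sub>M count_space UNIV))"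
  unfolding env_intensity_def by (rule nn_integral_distr) measurable
 also have "\<dots> = (\<integral>\<^sup>+p. \<integral>\<^sup>+r. f ((%(p, r). - ln (p r)) (p, r)) \<partial>count_space UNIV \<partial>env)"
  by (rule C.nn_integral_fst[symmetric]) measurable
 also have "\<dots> = (\<integral>\<^sup>+p. (\<Sum>r. f (- ln (p r))) \<partial>env)"
  by (simp add: nn_integral_count_space_nat)
 finally show ?thesis .
qed

text \<open>
  A sum over all words of length \<open>k\<close>, as an integral against counting measure: Tonelli's theorem and
  monotone convergence apply to it without further preparation.
\<close>

definition gsum :: "nat => (nat list => ennreal) => ennreal" where
 "gsum k f = (\<integral>\<^sup>+v. f v \<partial>count_space {v. length v = k})"

lemma gsum_0: "gsum 0 f = f []"
proof -
 have "{v :: nat list. length v = 0} = {[]}" by auto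
 then show ?thesis by (simp add: gsum_def nn_integral_count_space_finite)
qed

lemma gsum_Suc: "gsum (Suc k) f = gsum k (%v. \<Sum>r. f (v @ [r]))"
proof -
 let ?A = "{v :: nat list. length v = k}"
 interpret C: sigma_finite_measure "count_space (UNIV :: nat set)"
  by (rule sigma_finite_measure_count_space)
 have b: "bij_betw (%(v, r). v @ [r]) (?A \<times> UNIV) {v. length v = Suc k}"
  unfolding bij_betw_def
 proof (intro conjI set_eqI iffI)
  show "inj_on (%(v, r). v @ [r]) (?A \<times> UNIV)" by (auto simp: inj_on_def)
  fix w :: "nat list" assume "w \<in> {v. length v = Suc k}"
  then have "w = butlast w @ [last w]" "length (butlast w) = k" by (auto simp: append_butlast_last_id length_0_conv[symmetric] simp del: length_0_conv)
  then show "w \<in> (%(v, r). v @ [r]) ` (?A \<times> UNIV)" by (intro image_eqI[of _ _ "(butlast w, last w)"]) auto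
 qed auto
 have "gsum (Suc k) f = (\<integral>\<^sup>+z. f ((%(v, r). v @ [r]) z) \<partial>count_space (?A \<times> UNIV))"
  unfolding gsum_def by (rule nn_integral_bij_count_space[OF b, symmetric])
 also have "count_space (?A \<times> (UNIV :: nat set)) = count_space ?A \<Otimes>\<^sub>M count_space UNIV"
  by (rule pair_measure_countable[symmetric]) (auto intro: countableI_type)
 also have "(\<integral>\<^sup>+z. f ((%(v, r). v @ [r]) z) \<partial>(count_space ?A \<Otimes>\<^sub>M count_space UNIV)) =
  (\<integral>\<^sup>+v. \<integral>\<^sup>+r. f ((%(v, r). v @ [r]) (v, r)) \<partial>count_space UNIV \<partial>count_space ?A)"
  by (rule C.nn_integral_fst[symmetric]) (simp add: pair_measure_countable)
 finally show ?thesis unfolding gsum_def by (simp add: nn_integral_count_space_nat)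
qed

lemma gsum_cong: "(!!v. length v = k ==> f v = g v) ==> gsum k f = gsum k g"
 unfolding gsum_def by (intro nn_integral_cong) auto
lemma gsum_mono: "(!!v. length v = k ==> f v \<le> g v) ==> gsum k f \<le> gsum k g"
 unfolding gsum_def by (intro nn_integral_mono) auto
lemma gsum_add: "gsum k (%v. f v + g v) = gsum k f + gsum k g"
 unfolding gsum_def by (intro nn_integral_add) auto
lemma gsum_cmult: "gsum k (%v. c * f v) = c * gsum k f"
 unfolding gsum_def by (intro nn_integral_cmult) auto

lemma gsum_nn_integral:
 assumes [measurable]: "!!v. f v \<in> borel_measurable M"
 shows "(\<integral>\<^sup>+om. gsum k (%v. f v om) \<partial>M) = gsum k (%v. \<integral>\<^sup>+om. f v om \<partial>M)"
proof (insert assms, induction k arbitrary: f)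
 case 0 then show ?case by (simp add: gsum_0)
next
 case (Suc k)
 from Suc.prems have [measurable]: "f v \<in> borel_measurable M" for v by simp
 have "(\<integral>\<^sup>+om. gsum (Suc k) (%v. f v om) \<partial>M) = gsum k (%v. \<integral>\<^sup>+om. (\<Sum>r. f (v @ [r]) om) \<partial>M)"
  unfolding gsum_Suc by (rule Suc.IH) measurable
 then show ?case unfolding gsum_Suc by (simp add: nn_integral_suminf)
qed

lemma gsum_measurable [measurable (raw)]:
 assumes [measurable]: "!!v. f v \<in> borel_measurable M"
 shows "(%om. gsum k (%v. f v om)) \<in> borel_measurable M"
proof (insert assms, induction k arbitrary: f)
 case 0 then show ?case by (simp add: gsum_0)
next
 case (Suc k)
 from Suc.prems have [measurable]: "f v \<in> borel_measurable M" for v by simp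
 show ?case unfolding gsum_Suc by (rule Suc.IH) measurable
qed

section \<open>Convolution by the intensities and weighted trees\<close>

lemma sums_of_suminf_ennreal:
 fixes f :: "nat => real"
 assumes "!!n. 0 \<le> f n" "(\<Sum>n. ennreal (f n)) < \<infinity>"
 shows "f sums enn2real (\<Sum>n. ennreal (f n))"
proof -
 have "(%n. ennreal (f n)) sums ennreal (enn2real (\<Sum>n. ennreal (f n)))"
  using assms(2) by (simp add: summable_sums)
 then show ?thesis using assms(1) by (subst (asm) sums_ennreal) auto
qed

context linear_intensity begin

lemma V_convolution: "(\<integral>\<^sup>+y. ennreal (V a (t - y)) \<partial>lam b) = ennreal (V (a + b) t)"
proof (induction b arbitrary: a t)
 case 0
 show ?case by (simp add: nn_integral_return)
next
 case (Suc b)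
 have "(\<integral>\<^sup>+y. ennreal (V a (t - y)) \<partial>lam (Suc b)) = (\<integral>\<^sup>+y. \<integral>\<^sup>+x. ennreal (V a (t - (x + y))) \<partial>L \<partial>lam b)"
  by (rule nn_integral_lam_Suc(2)) measurable
 also have "\<dots> = (\<integral>\<^sup>+y. ennreal (V (Suc a) (t - y)) \<partial>lam b)"
  unfolding V_Suc(1) by (intro nn_integral_cong) (simp add: algebra_simps)
 also have "\<dots> = ennreal (V (Suc a + b) t)" by (rule Suc)
 finally show ?case by simp
qed

lemma smoothing_nn:
 assumes tau: "!!r. 0 \<le> tt r"
 shows "(\<Sum>r. ennreal (V k (x - tt r))) = (\<integral>\<^sup>+y. (\<Sum>r. indicator {..x - y} (tt r)) * indicator {..x} y \<partial>lam k)"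
proof -
 have "(\<Sum>r. ennreal (V k (x - tt r))) = (\<Sum>r. \<integral>\<^sup>+y. indicator {..x - tt r} y \<partial>lam k)"
  by (simp add: V_emeasure)
 also have "\<dots> = (\<integral>\<^sup>+y. (\<Sum>r. indicator {..x - tt r} y) \<partial>lam k)"
  by (rule nn_integral_suminf[symmetric]) simp
 also have "\<dots> = (\<integral>\<^sup>+y. (\<Sum>r. indicator {..x - y} (tt r)) \<partial>lam k)"
  by (intro nn_integral_cong suminf_cong) (auto simp: indicator_def)
 also have "\<dots> = (\<integral>\<^sup>+y. (\<Sum>r. indicator {..x - y} (tt r)) * indicator {..x} y \<partial>lam k)"
 proof (rule nn_integral_cong)
  fix y
  have "indicator {..x - y} (tt r) = indicator {..x - y} (tt r) * (indicator {..x} y :: ennreal)" for r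
   using tau[of r] by (auto simp: indicator_def)
  then show "(\<Sum>r. indicator {..x - y} (tt r)) = (\<Sum>r. indicator {..x - y} (tt r)) * (indicator {..x} y :: ennreal)"
   by (subst ennreal_suminf_multc[symmetric]) (rule suminf_cong)
 qed
 finally show ?thesis .
qed

text \<open>
  A sum of \<open>V k (x - tt r)\<close> is the count of the points \<open>tt r\<close> integrated against \<open>lam k\<close>. An
  approximation of the count thus transfers to the sum.
\<close>

lemma smoothing_diff:
 fixes b :: "real => real" and tt :: "nat => real"
 assumes tt: "!!r. 0 \<le> tt r" and fin: "!!s. finite {r. tt r \<le> s}"
  and b: "integrable (lam k) (%y. b (x - y) * indicator {..x} y)"
 shows "(\<Sum>r. ennreal (V k (x - tt r))) < \<infinity>"
  and "ennreal \<bar>enn2real (\<Sum>r. ennreal (V k (x - tt r))) - (\<integral>y. b (x - y) * indicator {..x} y \<partial>lam k)\<bar>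
   \<le> (\<integral>\<^sup>+y. ennreal \<bar>real (card {r. tt r \<le> x - y}) - b (x - y)\<bar> * indicator {..x} y \<partial>lam k)"
proof -
 define n where "n s = real (card {r. tt r \<le> s})" for s
 have mono: "mono n"
  unfolding n_def by (intro monoI) (auto intro!: card_mono fin)
 have [measurable]: "n \<in> borel_measurable borel" by (rule borel_measurable_mono[OF mono])
 have cnt: "(\<Sum>r. indicator {..s} (tt r)) = ennreal (n s)" for s
  unfolding n_def by (subst suminf_indicator_ennreal[OF fin, symmetric]) (auto intro!: arg_cong[where f=suminf] simp: indicator_def)
 have eq: "(\<Sum>r. ennreal (V k (x - tt r))) = (\<integral>\<^sup>+y. ennreal (n (x - y) * indicator {..x} y) \<partial>lam k)"
  unfolding smoothing_nn[OF tt] cnt by (intro nn_integral_cong) (auto simp: indicator_def)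
 have "(\<integral>\<^sup>+y. ennreal (n (x - y) * indicator {..x} y) \<partial>lam k) \<le> (\<integral>\<^sup>+y. ennreal (n x) * indicator {..x} y \<partial>lam k)"
 proof (rule nn_integral_mono_AE, use AE_lam_nonneg[of k] in eventually_elim)
  case (elim y)
  then have "n (x - y) \<le> n x" by (intro monoD[OF mono]) simp
  then show ?case by (auto simp: indicator_def intro: ennreal_leI)
 qed
 also have "\<dots> = ennreal (n x) * ennreal (V k x)" by (simp add: nn_integral_cmult V_emeasure)
 also have "\<dots> < \<infinity>" by (simp add: ennreal_mult_less_top)
 finally have lt: "(\<integral>\<^sup>+y. ennreal (n (x - y) * indicator {..x} y) \<partial>lam k) < \<infinity>" .
 then show "(\<Sum>r. ennreal (V k (x - tt r))) < \<infinity>" by (simp add: eq)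
 have ni: "integrable (lam k) (%y. n (x - y) * indicator {..x} y)"
  using lt by (intro integrableI_nonneg) (auto simp: n_def indicator_def)
 have "enn2real (\<Sum>r. ennreal (V k (x - tt r))) = (\<integral>y. n (x - y) * indicator {..x} y \<partial>lam k)"
  unfolding eq by (subst nn_integral_eq_integral[OF ni]) (auto simp: n_def indicator_def intro!: Bochner_Integration.integral_nonneg)
 then have "enn2real (\<Sum>r. ennreal (V k (x - tt r))) - (\<integral>y. b (x - y) * indicator {..x} y \<partial>lam k)
  = (\<integral>y. n (x - y) * indicator {..x} y - b (x - y) * indicator {..x} y \<partial>lam k)"
  using ni b by simp
 also have "ennreal \<bar>\<dots>\<bar> \<le> (\<integral>\<^sup>+y. ennreal \<bar>n (x - y) * indicator {..x} y - b (x - y) * indicator {..x} y\<bar> \<partial>lam k)"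
  using integral_norm_bound_ennreal[OF Bochner_Integration.integrable_diff[OF ni b]] by simp
 also have "\<dots> = (\<integral>\<^sup>+y. ennreal \<bar>n (x - y) - b (x - y)\<bar> * indicator {..x} y \<partial>lam k)"
  by (intro nn_integral_cong) (auto simp: indicator_def)
 finally show "ennreal \<bar>enn2real (\<Sum>r. ennreal (V k (x - tt r))) - (\<integral>y. b (x - y) * indicator {..x} y \<partial>lam k)\<bar>
   \<le> (\<integral>\<^sup>+y. ennreal \<bar>real (card {r. tt r \<le> x - y}) - b (x - y)\<bar> * indicator {..x} y \<partial>lam k)"
  by (simp add: n_def)
qed

lemma V1_L: "emeasure L {..t} = ennreal (V 1 t)"
proof -
 have "ennreal (V 1 t) = (\<integral>\<^sup>+x. indicator {..t} x \<partial>L)"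
  unfolding One_nat_def V_Suc(1) by (intro nn_integral_cong) (auto simp: V_def measure_return indicator_def)
 then show ?thesis by (simp add: sets_L)
qed

lemma V1_smoothing:
 "integrable (lam k) (%y. V 1 (x - y) * indicator {..x} y)"
 "(\<integral>y. V 1 (x - y) * indicator {..x} y \<partial>lam k) = V (Suc k) x"
proof -
 have e: "(\<integral>\<^sup>+y. ennreal (V 1 (x - y) * indicator {..x} y) \<partial>lam k) = ennreal (V (Suc k) x)"
  unfolding V_Suc(2)[of k x] V1_L by (intro nn_integral_cong) (auto simp: indicator_def V_neg)
 show i: "integrable (lam k) (%y. V 1 (x - y) * indicator {..x} y)"
  using e by (intro integrableI_nonneg) auto
 show "(\<integral>y. V 1 (x - y) * indicator {..x} y \<partial>lam k) = V (Suc k) x"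
  using e by (subst (asm) nn_integral_eq_integral[OF i]) (auto simp: Bochner_Integration.integral_nonneg)
qed

end

text \<open>
  Independent weights whose law has a mean measure of linear growth and counts of linear variance.
\<close>

locale weighted_tree = prob_space M for M :: "'a measure" +
 fixes env :: "(nat => real) measure" and A :: "nat list => nat => 'a => real"
  and c mu w C :: real
 assumes A_indep: "indep_vars (%_. Pi\<^sub>M UNIV (%_. borel)) (%v om r. A v r om) UNIV"
  and A_distr: "distr M (Pi\<^sub>M UNIV (%_. borel)) (%om r. A v r om) = env"
  and env_pos: "AE p in env. \<forall>r. 0 < p r"
  and env_sum: "AE p in env. p sums 1"
  and env_lin: "linear_intensity (env_intensity env) c mu w"
  and env_L2: "0 \<le> t ==> (\<integral>\<^sup>+p. ennreal ((real (card {r. - ln (p r) \<le> t}) - measure (env_intensity env) {..t})\<^sup>2) \<partial>env)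
     \<le> ennreal (C * (1 + t))"
  and C_nonneg: "0 \<le> C"
begin

sublocale I: linear_intensity "env_intensity env" c mu w by (rule env_lin)

lemma sets_env [measurable_cong]: "sets env = sets (Pi\<^sub>M UNIV (%_. borel))"
 unfolding A_distr[of "[]", symmetric] by simp

lemma A_rv [measurable]: "(%om r. A v r om) \<in> M \<rightarrow>\<^sub>M Pi\<^sub>M UNIV (%_. borel)"
 using A_indep by (auto simp: indep_vars_def)

lemma A_rv1 [measurable]: "A v r \<in> borel_measurable M"
 using measurable_compose[OF A_rv measurable_component_singleton[of r UNIV]] by simp

lemma prob_env: "prob_space env"
 unfolding A_distr[of "[]", symmetric] by (rule prob_space_distr[OF A_rv])

sublocale E: prob_space env by (rule prob_env)

lemma AE_env: "AE p in env. P p ==> AE om in M. P (%r. A v r om)"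
 unfolding A_distr[of v, symmetric] by (rule AE_distrD[OF A_rv])

lemma env_facts: "AE p in env. (\<forall>r. 0 < p r \<and> p r \<le> 1) \<and> p sums 1 \<and> (\<forall>s. finite {r. - ln (p r) \<le> s})"
 using env_pos env_sum
proof eventually_elim
 case (elim p)
 have le: "p r \<le> 1" for r
  using sum_le_suminf[of p "{r}"] elim by (auto simp: sums_iff less_imp_le)
 have "finite {r. - ln (p r) \<le> s}" for s
 proof -
  have "p \<longlonglongrightarrow> 0" using elim by (auto intro: summable_LIMSEQ_zero simp: sums_iff)
  then have "eventually (%r. p r < exp (- s)) sequentially" by (rule order_tendstoD) simp
  then obtain n where n: "!!r. n \<le> r ==> p r < exp (- s)" by (auto simp: eventually_sequentially)
  have "{r. - ln (p r) \<le> s} \<subseteq> {..<n}"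
  proof
   fix r assume "r \<in> {r. - ln (p r) \<le> s}"
   then have "exp (- s) \<le> exp (ln (p r))" by simp
   then have "exp (- s) \<le> p r" using elim by simp
   with n[of r] show "r \<in> {..<n}" by (metis leD lessThan_iff not_less)
  qed
  then show ?thesis by (rule finite_subset) simp
 qed
 with le elim show ?case by auto
qed

definition T :: "nat list => 'a => real" where
 "T v om = (\<Sum>i<length v. - ln (A (take i v) (v ! i) om))"

lemma T_Nil [simp]: "T [] om = 0" by (simp add: T_def)
lemma T_snoc: "T (v @ [r]) om = T v om + - ln (A v r om)" by (simp add: T_def nth_append)
lemma T_rv [measurable]: "T v \<in> borel_measurable M" unfolding T_def[abs_def] by measurable

lemma others_indep:
 "indep_pair (PiM (- {v}) (%_. Pi\<^sub>M UNIV (%_. borel))) (%om. \<lambda>u\<in>- {v}. (%r. A u r om))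
  (Pi\<^sub>M UNIV (%_. borel)) (%om r. A v r om)"
 by (rule indep_vars_imp_indep_pair[OF A_indep]) auto

lemma path_measurable:
 assumes "!!i. i < length u ==> take i u \<noteq> v"
 shows "(%h. \<Sum>i<length u. - ln (h (take i u) (u ! i)) :: real) \<in> borel_measurable (PiM (- {v}) (%_. Pi\<^sub>M UNIV (%_. borel)))"
proof (rule borel_measurable_sum)
 fix i assume "i \<in> {..<length u}"
 then have "take i u \<in> - {v}" using assms by auto
 then have 1: "(%h. h (take i u)) \<in> PiM (- {v}) (%_. Pi\<^sub>M UNIV (%_. borel)) \<rightarrow>\<^sub>M Pi\<^sub>M UNIV (%_. borel)"
  by (rule measurable_component_singleton)
 have "(%p. - ln (p (u ! i))) \<in> Pi\<^sub>M UNIV (%_. borel) \<rightarrow>\<^sub>M (borel :: real measure)" by measurable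
 from measurable_compose[OF 1 this]
 show "(%h. - ln (h (take i u) (u ! i)) :: real) \<in> borel_measurable (PiM (- {v}) (%_. Pi\<^sub>M UNIV (%_. borel)))" .
qed

lemma T_history: "(!!i. i < length u ==> take i u \<noteq> v) ==>
 (\<Sum>i<length u. - ln ((\<lambda>u\<in>- {v}. (%r. A u r om)) (take i u) (u ! i))) = T u om"
 unfolding T_def by (intro sum.cong) auto

lemma take_neq: "i < length u ==> length u \<le> length v ==> take i u \<noteq> v" by auto

lemma T_indep: "indep_pair borel (T v) (Pi\<^sub>M UNIV (%_. borel)) (%om r. A v r om)"
 using indep_pair_compose[OF others_indep[of v] path_measurable[of v v] measurable_id]
 by (simp add: T_history take_neq T_def[abs_def] cong: sum.cong_simp)

text \<open>
  The displacement of a box is independent of the weights of its children, which have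
  law \<open>env\<close>.
\<close>

lemma tree_step:
 assumes [measurable]: "f \<in> borel_measurable (borel \<Otimes>\<^sub>M Pi\<^sub>M UNIV (%_. borel))"
 shows "(\<integral>\<^sup>+om. f (T v om, %r. A v r om) \<partial>M) = (\<integral>\<^sup>+om. \<integral>\<^sup>+p. f (T v om, p) \<partial>env \<partial>M)"
proof -
 have "(\<integral>\<^sup>+om. f (T v om, %r. A v r om) \<partial>M) = (\<integral>\<^sup>+om. \<integral>\<^sup>+om'. f (T v om, %r. A v r om') \<partial>M \<partial>M)"
  by (rule indep_pair_nn_integral[OF T_indep]) simp
 also have "\<dots> = (\<integral>\<^sup>+om. \<integral>\<^sup>+p. f (T v om, p) \<partial>env \<partial>M)"
  unfolding A_distr[of v, symmetric] by (intro nn_integral_cong, subst nn_integral_distr) auto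
 finally show ?thesis .
qed

text \<open>
  The displacements of generation \<open>k\<close> have mean measure \<open>lam k\<close>: each generation convolves with the
  mean measure of the children.
\<close>

lemma many_to_one:
 assumes "f \<in> borel_measurable borel"
 shows "(\<integral>\<^sup>+om. gsum k (%v. f (T v om)) \<partial>M) = (\<integral>\<^sup>+y. f y \<partial>I.lam k)"
 using assms
proof (induction k arbitrary: f)
 case 0
 then show ?case by (simp add: gsum_0 nn_integral_return emeasure_space_1)
next
 case (Suc k)
 note [measurable] = Suc.prems
 define g where "g y = (\<integral>\<^sup>+x. f (x + y) \<partial>env_intensity env)" for y
 have g_eq: "g y = (\<integral>\<^sup>+p. (\<Sum>r. f (y + - ln (p r))) \<partial>env)" for y
  unfolding g_def using nn_integral_env_intensity[OF sets_env, of "%x. f (x + y)"] by (simp add: add.commute)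
 have [measurable]: "g \<in> borel_measurable borel" unfolding g_def by measurable
 have "(\<integral>\<^sup>+om. gsum (Suc k) (%v. f (T v om)) \<partial>M) = gsum k (%v. \<integral>\<^sup>+om. (\<Sum>r. f (T v om + - ln (A v r om))) \<partial>M)"
  unfolding gsum_Suc T_snoc by (rule gsum_nn_integral) measurable
 also have "\<dots> = gsum k (%v. \<integral>\<^sup>+om. g (T v om) \<partial>M)"
 proof (rule gsum_cong)
  fix v :: "nat list"
  show "(\<integral>\<^sup>+om. (\<Sum>r. f (T v om + - ln (A v r om))) \<partial>M) = (\<integral>\<^sup>+om. g (T v om) \<partial>M)"
   unfolding g_eq using tree_step[of "%(y, p). \<Sum>r. f (y + - ln (p r))" v] by simp
 qed
 also have "\<dots> = (\<integral>\<^sup>+om. gsum k (%v. g (T v om)) \<partial>M)"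
  by (rule gsum_nn_integral[symmetric]) measurable
 also have "\<dots> = (\<integral>\<^sup>+y. g y \<partial>I.lam k)" by (rule Suc.IH) measurable
 also have "\<dots> = (\<integral>\<^sup>+y. f y \<partial>I.lam (Suc k))"
  unfolding g_def by (rule I.nn_integral_lam_Suc(2)[symmetric]) measurable
 finally show ?case .
qed

end

section \<open>Children of a box\<close>

lemma card_eq_enn2real_suminf: "real (card A) = enn2real (\<Sum>r. indicator A r)" for A :: "nat set"
proof -
 have "(\<Sum>r. indicator A r) = emeasure (count_space UNIV) A"
  by (simp add: nn_integral_count_space_nat[symmetric])
 then show ?thesis by (cases "finite A") (auto simp: emeasure_count_space_finite emeasure_count_space_infinite)
qed

context weighted_tree begin

definition smooth :: "nat => real => (nat => real) => real" where
 "smooth k x p = enn2real (\<Sum>r. ennreal (I.V k (x + ln (p r))))"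

lemma smooth_measurable [measurable]:
 "(%(x, p). smooth k x p) \<in> borel_measurable (borel \<Otimes>\<^sub>M Pi\<^sub>M UNIV (%_. borel))"
 unfolding smooth_def by measurable

lemma smooth_measurable1 [measurable]: "smooth k x \<in> borel_measurable (Pi\<^sub>M UNIV (%_. borel))"
 unfolding smooth_def[abs_def] by measurable

lemma smooth_nonneg: "0 \<le> smooth k x p" by (simp add: smooth_def)

lemma smooth_nn: "(\<integral>\<^sup>+p. (\<Sum>r. ennreal (I.V k (x + ln (p r)))) \<partial>env) = ennreal (I.V (Suc k) x)"
 unfolding I.V_Suc(1) by (subst nn_integral_env_intensity[OF sets_env]) simp_all

lemma AE_smooth: "AE p in env. (\<Sum>r. ennreal (I.V k (x + ln (p r)))) = ennreal (smooth k x p)"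
 using env_facts
proof eventually_elim
 case (elim p)
 have "(\<Sum>r. ennreal (I.V k (x - - ln (p r)))) < \<infinity>"
 proof (rule I.smoothing_diff(1)[OF _ _ I.V1_smoothing(1)])
  show "0 \<le> - ln (p r)" for r using elim by (simp add: ln_le_zero_iff)
 qed (use elim in auto)
 then show ?case by (simp add: smooth_def)
qed

lemma smooth_integrable: "integrable env (smooth k x)"
 and smooth_mean: "(\<integral>p. smooth k x p \<partial>env) = I.V (Suc k) x"
proof -
 have "(\<integral>\<^sup>+p. ennreal (smooth k x p) \<partial>env) = (\<integral>\<^sup>+p. (\<Sum>r. ennreal (I.V k (x + ln (p r)))) \<partial>env)"
  by (rule nn_integral_cong_AE, use AE_smooth[of k x] in eventually_elim) simp
 then have e: "(\<integral>\<^sup>+p. ennreal (smooth k x p) \<partial>env) = ennreal (I.V (Suc k) x)" by (simp add: smooth_nn)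
 show i: "integrable env (smooth k x)"
  using e by (intro integrableI_nonneg) (auto simp: smooth_nonneg)
 show "(\<integral>p. smooth k x p \<partial>env) = I.V (Suc k) x"
  using e by (subst (asm) nn_integral_eq_integral[OF i]) (auto simp: smooth_nonneg Bochner_Integration.integral_nonneg)
qed

text \<open>
  The smoothed sum is an integral of the counts against \<open>lam k\<close>, whose mass up to \<open>x\<close> is \<open>V k x\<close>; the
  variance is at most the squared mass times the largest variance of a count.
\<close>

lemma smooth_L2:
 "(\<integral>\<^sup>+p. ennreal ((smooth k x p - I.V (Suc k) x)\<^sup>2) \<partial>env) \<le> ennreal (C * (1 + max 0 x) * (I.V k x)\<^sup>2)"
proof -
 interpret lk: sigma_finite_measure "I.lam k" by (rule I.sigma_finite_lam)
 interpret P: pair_sigma_finite env "I.lam k" ..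
 let ?n = "%s p. real (card {r. - ln (p r :: real) \<le> s})"
 let ?d = "%y p. ennreal \<bar>?n (x - y) p - I.V 1 (x - y)\<bar>"
 have "?n (x - y) p = enn2real (\<Sum>r. if - ln (p r) \<le> x - y then 1 else 0)" for y p
  unfolding card_eq_enn2real_suminf by (intro arg_cong[where f=enn2real] suminf_cong) auto
 then have [measurable]: "(%(p, y). ?n (x - y) p) \<in> borel_measurable (env \<Otimes>\<^sub>M I.lam k)"
  by (simp only:) measurable
 have L: "measure (env_intensity env) {..t} = I.V 1 t" for t
  using I.V1_L[of t] by (simp add: measure_def)
 have "(\<integral>\<^sup>+p. ennreal ((smooth k x p - I.V (Suc k) x)\<^sup>2) \<partial>env)
  \<le> (\<integral>\<^sup>+p. ennreal (I.V k x) * (\<integral>\<^sup>+y. (?d y p)\<^sup>2 * indicator {..x} y \<partial>I.lam k) \<partial>env)"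
 proof (rule nn_integral_mono_AE, use env_facts in eventually_elim)
  case (elim p)
  have [measurable]: "(%y. ?n (x - y) p) \<in> borel_measurable (I.lam k)"
  proof -
   have m: "mono (%s. ?n s p)" using elim by (intro monoI) (auto intro!: card_mono)
   have [measurable]: "(%s. ?n s p) \<in> borel_measurable borel" by (rule borel_measurable_mono[OF m])
   show ?thesis by measurable
  qed
  have tt: "0 \<le> - ln (p r)" for r using elim by (simp add: ln_le_zero_iff)
  have fin: "finite {r. - ln (p r) \<le> s}" for s using elim by blast
  have "ennreal \<bar>smooth k x p - I.V (Suc k) x\<bar> \<le> (\<integral>\<^sup>+y. ?d y p * indicator {..x} y \<partial>I.lam k)"
   using I.smoothing_diff(2)[OF tt fin I.V1_smoothing(1)[of k x]]
   unfolding smooth_def I.V1_smoothing(2) diff_minus_eq_add .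
  also have "\<dots> = (\<integral>\<^sup>+y. (?d y p * indicator {..x} y) * indicator {..x} y \<partial>I.lam k)"
   by (intro nn_integral_cong) (auto simp: indicator_def)
  finally have "(ennreal \<bar>smooth k x p - I.V (Suc k) x\<bar>)\<^sup>2 \<le> (\<integral>\<^sup>+y. (?d y p * indicator {..x} y) * indicator {..x} y \<partial>I.lam k)\<^sup>2"
   by (rule power_mono) simp
  also have "\<dots> \<le> (\<integral>\<^sup>+y. (?d y p * indicator {..x} y)\<^sup>2 \<partial>I.lam k) * (\<integral>\<^sup>+y. (indicator {..x} y)\<^sup>2 \<partial>I.lam k)"
   by (rule Cauchy_Schwarz_nn_integral) measurable
  also have "(\<integral>\<^sup>+y. (?d y p * indicator {..x} y)\<^sup>2 \<partial>I.lam k) = (\<integral>\<^sup>+y. (?d y p)\<^sup>2 * indicator {..x} y \<partial>I.lam k)"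
   by (intro nn_integral_cong) (auto simp: indicator_def)
  also have "(\<integral>\<^sup>+y. (indicator {..x} y)\<^sup>2 \<partial>I.lam k) = (\<integral>\<^sup>+y. indicator {..x} y \<partial>I.lam k)"
   by (intro nn_integral_cong) (auto simp: indicator_def)
  also have "\<dots> = ennreal (I.V k x)" by (simp add: I.V_emeasure)
  finally show ?case by (simp add: ennreal_power mult.commute)
 qed
 also have "\<dots> = ennreal (I.V k x) * (\<integral>\<^sup>+p. \<integral>\<^sup>+y. (?d y p)\<^sup>2 * indicator {..x} y \<partial>I.lam k \<partial>env)"
  by (rule nn_integral_cmult) measurable
 also have "(\<integral>\<^sup>+p. \<integral>\<^sup>+y. (?d y p)\<^sup>2 * indicator {..x} y \<partial>I.lam k \<partial>env)
  = (\<integral>\<^sup>+y. \<integral>\<^sup>+p. (?d y p)\<^sup>2 * indicator {..x} y \<partial>env \<partial>I.lam k)"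
  by (rule P.Fubini'[symmetric]) measurable
 finally have 1: "(\<integral>\<^sup>+p. ennreal ((smooth k x p - I.V (Suc k) x)\<^sup>2) \<partial>env)
  \<le> ennreal (I.V k x) * (\<integral>\<^sup>+y. \<integral>\<^sup>+p. (?d y p)\<^sup>2 * indicator {..x} y \<partial>env \<partial>I.lam k)" .
 have 2: "(\<integral>\<^sup>+y. \<integral>\<^sup>+p. (?d y p)\<^sup>2 * indicator {..x} y \<partial>env \<partial>I.lam k)
   \<le> (\<integral>\<^sup>+y. ennreal (C * (1 + max 0 x)) * indicator {..x} y \<partial>I.lam k)"
 proof (rule nn_integral_mono_AE, use I.AE_lam_nonneg[of k] in eventually_elim)
  case (elim y)
  show ?case
  proof (cases "y \<le> x")
   case True
   have "(\<integral>\<^sup>+p. (?d y p)\<^sup>2 \<partial>env) = (\<integral>\<^sup>+p. ennreal ((?n (x - y) p - measure (env_intensity env) {..x - y})\<^sup>2) \<partial>env)"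
    unfolding L by (simp add: ennreal_power)
   also have "\<dots> \<le> ennreal (C * (1 + (x - y)))" using True by (intro env_L2) simp
   also have "\<dots> \<le> ennreal (C * (1 + max 0 x))" using elim C_nonneg by (intro ennreal_leI mult_left_mono) auto
   finally show ?thesis using True by simp
  qed simp
 qed
 have "ennreal (I.V k x) * (\<integral>\<^sup>+y. \<integral>\<^sup>+p. (?d y p)\<^sup>2 * indicator {..x} y \<partial>env \<partial>I.lam k)
  \<le> ennreal (I.V k x) * (ennreal (C * (1 + max 0 x)) * ennreal (I.V k x))"
  using mult_left_mono[OF 2, of "ennreal (I.V k x)"] by (simp add: nn_integral_cmult I.V_emeasure)
 also have "\<dots> = ennreal (C * (1 + max 0 x) * (I.V k x)\<^sup>2)"
  using C_nonneg by (simp add: ennreal_mult[symmetric] power2_eq_square algebra_simps)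
 finally show ?thesis using 1 by (rule order_trans[rotated])
qed

definition fluct :: "nat => real => nat list => 'a => real" where
 "fluct k t v om = smooth k (t - T v om) (%r. A v r om) - I.V (Suc k) (t - T v om)"

lemma fluct_rv [measurable]: "fluct k t v \<in> borel_measurable M"
 unfolding fluct_def[abs_def] by measurable

lemma AE_T_nonneg: "AE om in M. \<forall>v. 0 \<le> T v om"
proof -
 have "AE om in M. \<forall>v r. 0 < A v r om \<and> A v r om \<le> 1"
  using AE_env[OF env_facts] by (simp add: AE_all_countable)
 then show ?thesis
  by eventually_elim (auto simp: T_def ln_le_zero_iff intro!: sum_nonneg)
qed

text \<open>
  Given the displacement of \<open>v\<close>, this is \<open>smooth_L2\<close>; one of the two factors \<open>V k\<close> is replaced by its
  value at \<open>t\<close>, which leaves a factor that can be summed over a generation.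
\<close>

lemma fluct_nn:
 assumes t: "0 \<le> t"
 shows "(\<integral>\<^sup>+om. ennreal ((fluct k t v om)\<^sup>2) \<partial>M) \<le> (\<integral>\<^sup>+om. ennreal (C * (1 + t) * I.V k t) * ennreal (I.V k (t - T v om)) \<partial>M)"
proof -
 have "(\<integral>\<^sup>+om. ennreal ((fluct k t v om)\<^sup>2) \<partial>M) =
  (\<integral>\<^sup>+om. \<integral>\<^sup>+p. ennreal ((smooth k (t - T v om) p - I.V (Suc k) (t - T v om))\<^sup>2) \<partial>env \<partial>M)"
  unfolding fluct_def
  using tree_step[of "%(s, p). ennreal ((smooth k (t - s) p - I.V (Suc k) (t - s))\<^sup>2)" v] by simp
 also have "\<dots> \<le> (\<integral>\<^sup>+om. ennreal (C * (1 + t) * I.V k t) * ennreal (I.V k (t - T v om)) \<partial>M)"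
 proof (rule nn_integral_mono_AE, use AE_T_nonneg in eventually_elim)
  case (elim om)
  let ?V = "I.V k (t - T v om)"
  have T: "0 \<le> T v om" using elim by blast
  have "C * (1 + max 0 (t - T v om)) * ?V\<^sup>2 = (C * (1 + max 0 (t - T v om)) * ?V) * ?V"
   by (simp add: power2_eq_square)
  also have "\<dots> \<le> (C * (1 + t) * I.V k t) * ?V"
   using T t C_nonneg by (intro mult_right_mono mult_mono I.V_mono mult_nonneg_nonneg) auto
  finally have "ennreal (C * (1 + max 0 (t - T v om)) * ?V\<^sup>2) \<le> ennreal (C * (1 + t) * I.V k t) * ennreal ?V"
   by (simp add: ennreal_mult''[symmetric] ennreal_leI)
  then show ?case using smooth_L2[of k "t - T v om"] by (rule order_trans[rotated])
 qed
 finally show ?thesis .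
qed

lemma fluct_sq_integrable:
 assumes t: "0 \<le> t" shows "integrable M (%om. (fluct k t v om)\<^sup>2)"
proof -
 have "(\<integral>\<^sup>+om. ennreal (C * (1 + t) * I.V k t) * ennreal (I.V k (t - T v om)) \<partial>M)
  \<le> (\<integral>\<^sup>+om. ennreal (C * (1 + t) * I.V k t) * ennreal (I.V k t) \<partial>M)"
  by (rule nn_integral_mono_AE, use AE_T_nonneg in eventually_elim)
   (auto intro!: mult_left_mono ennreal_leI I.V_mono)
 also have "\<dots> = ennreal (C * (1 + t) * I.V k t) * ennreal (I.V k t)" by (simp add: emeasure_space_1)
 also have "\<dots> < \<infinity>" by (simp add: ennreal_mult_less_top)
 finally have "(\<integral>\<^sup>+om. ennreal (C * (1 + t) * I.V k t) * ennreal (I.V k (t - T v om)) \<partial>M) < \<infinity>" .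
 with fluct_nn[OF t] have "(\<integral>\<^sup>+om. ennreal ((fluct k t v om)\<^sup>2) \<partial>M) < \<infinity>" by (rule le_less_trans)
 then show ?thesis by (intro integrableI_nonneg) auto
qed

text \<open>
  The weights at \<open>v\<close> are independent of the displacement of \<open>v\<close> and of the weights of other boxes of the
  same or an earlier generation, and the fluctuation at \<open>v\<close> has mean zero given its displacement.
\<close>

lemma fluct_orthogonal_aux:
 assumes t: "0 \<le> t" and uv: "u \<noteq> v" "length u \<le> length v"
 shows "expectation (%om. fluct k t u om * fluct l t v om) = 0"
proof -
 let ?N = "PiM (- {v}) (\<lambda>_ :: nat list. Pi\<^sub>M UNIV (\<lambda>_ :: nat. borel :: real measure))"
 let ?H = "%om. \<lambda>u\<in>- {v}. (%r. A u r om)"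
 let ?S = "\<lambda>u (h :: nat list => nat => real). \<Sum>i<length u. - ln (h (take i u) (u ! i))"
 let ?F = "%h. smooth k (t - ?S u h) (h u) - I.V (Suc k) (t - ?S u h)"
 have [measurable]: "?S v \<in> borel_measurable ?N" "?S u \<in> borel_measurable ?N"
  using uv by (auto intro!: path_measurable)
 have "(%h. h u) \<in> ?N \<rightarrow>\<^sub>M Pi\<^sub>M UNIV (%_. borel)"
  using uv by (intro measurable_component_singleton) auto
 note [measurable] = this
 have [measurable]: "?F \<in> borel_measurable ?N" by measurable
 have ip: "indep_pair (borel \<Otimes>\<^sub>M borel) (%om. (?F (?H om), ?S v (?H om))) (Pi\<^sub>M UNIV (%_. borel)) (%om r. A v r om)"
  by (rule indep_pair_compose[OF others_indep[of v], where f="%h. (?F h, ?S v h)" and g="%p. p"]) measurable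
 have Su: "?S u (?H om) = T u om" for om using uv by (intro T_history) auto
 have Sv: "?S v (?H om) = T v om" for om by (intro T_history) auto
 have Hu: "?H om u = (%r. A u r om)" for om using uv by simp
 have ip': "indep_pair (borel \<Otimes>\<^sub>M borel) (%om. (fluct k t u om, T v om)) (Pi\<^sub>M UNIV (%_. borel)) (%om r. A v r om)"
  using ip unfolding Su Sv Hu fluct_def .
 let ?G = "%z. fst (fst z) * (smooth l (t - snd (fst z)) (snd z) - I.V (Suc l) (t - snd (fst z)))"
 have "(\<integral>om. ?G ((fluct k t u om, T v om), (%r. A v r om)) \<partial>M) = 0"
 proof (rule indep_pair_expectation_zero[OF ip'])
  show "?G \<in> borel_measurable ((borel \<Otimes>\<^sub>M borel) \<Otimes>\<^sub>M Pi\<^sub>M UNIV (%_. borel))" by measurable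
  have "integrable M (%om. fluct k t u om * fluct l t v om)"
   by (rule Bochner_Integration.integrable_bound[OF Bochner_Integration.integrable_add[OF fluct_sq_integrable[OF t, of k u] fluct_sq_integrable[OF t, of l v]]])
    (auto simp: abs_mult_le_sum_squares[simplified])
  then show "integrable M (%om. ?G ((fluct k t u om, T v om), (%r. A v r om)))" by (simp add: fluct_def)
  fix x :: "real \<times> real"
  have "(\<integral>om. smooth l (t - snd x) (%r. A v r om) \<partial>M) = (\<integral>p. smooth l (t - snd x) p \<partial>env)"
   using integral_distr[OF A_rv[of v] smooth_measurable1[of l "t - snd x"]] by (simp add: A_distr)
  moreover have "integrable M (%om. smooth l (t - snd x) (%r. A v r om))"
   using integrable_distr_eq[OF A_rv[of v] smooth_measurable1[of l "t - snd x"]] smooth_integrable[of l "t - snd x"]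
   by (simp add: A_distr)
  ultimately show "(\<integral>om. ?G (x, (%r. A v r om)) \<partial>M) = 0" by (simp add: smooth_mean prob_space)
 qed
 then show ?thesis by (simp add: fluct_def)
qed

lemma fluct_orthogonal:
 assumes t: "0 \<le> t" and uv: "u \<noteq> v"
 shows "expectation (%om. fluct k t u om * fluct l t v om) = 0"
 using fluct_orthogonal_aux[OF t uv, of k l] fluct_orthogonal_aux[OF t uv[symmetric], of l k]
 by (cases "length u \<le> length v") (auto simp: mult.commute)

end

section \<open>The first generation dominates the fluctuations\<close>

lemma gsum_split_enumeration:
 fixes b :: "nat => nat list"
 assumes b: "bij b"
 shows "(\<Sum>n. if 1 \<le> length (b n) \<and> length (b n) < m then F (length (b n)) (b n) else 0) = (\<Sum>k\<in>{1..<m}. gsum k (F k))"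
proof -
 let ?G = "\<lambda>v :: nat list. if 1 \<le> length v \<and> length v < m then F (length v) v else (0::ennreal)"
 have "(\<Sum>n. ?G (b n)) = (\<integral>\<^sup>+n. ?G (b n) \<partial>count_space UNIV)"
  by (rule nn_integral_count_space_nat[symmetric])
 also have "\<dots> = (\<integral>\<^sup>+v. ?G v \<partial>count_space UNIV)"
  using b by (intro nn_integral_bij_count_space) (simp add: bij_betw_def)
 also have "\<dots> = (\<integral>\<^sup>+v. (\<Sum>k\<in>{1..<m}. F k v * indicator {v. length v = k} v) \<partial>count_space UNIV)"
 proof (rule nn_integral_cong)
  fix v :: "nat list"
  have "(\<Sum>k\<in>{1..<m}. F k v * indicator {v. length v = k} v) = (\<Sum>k\<in>{1..<m}. if k = length v then F k v else 0)"
   by (intro sum.cong) (auto simp: indicator_def)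
  then show "?G v = (\<Sum>k\<in>{1..<m}. F k v * indicator {v. length v = k} v)"
   by (simp add: sum.delta)
 qed
 also have "\<dots> = (\<Sum>k\<in>{1..<m}. \<integral>\<^sup>+v. F k v * indicator {v. length v = k} v \<partial>count_space UNIV)"
  by (rule nn_integral_sum) simp
 also have "\<dots> = (\<Sum>k\<in>{1..<m}. gsum k (F k))"
  unfolding gsum_def by (subst nn_integral_count_space_indicator) auto
 finally show ?thesis .
qed

lemma sums_diff_ennreal:
 fixes f g :: "nat => real"
 assumes f: "!!n. 0 \<le> f n" "(\<Sum>n. ennreal (f n)) = ennreal x" "0 \<le> x"
  and g: "!!n. 0 \<le> g n" "(\<Sum>n. ennreal (g n)) = ennreal y" "0 \<le> y"
 shows "(%n. f n - g n) sums (x - y)"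
 using sums_of_suminf_ennreal[of f] sums_of_suminf_ennreal[of g] assms by (intro sums_diff) auto

context weighted_tree begin

lemma AE_smooth_all:
 "AE p in env. \<forall>k x. (\<Sum>r. ennreal (I.V k (x + ln (p r)))) = ennreal (smooth k x p)"
 using env_facts
proof eventually_elim
 case (elim p)
 show ?case
 proof (intro allI)
  fix k x
  have "(\<Sum>r. ennreal (I.V k (x - - ln (p r)))) < \<infinity>"
  proof (rule I.smoothing_diff(1)[OF _ _ I.V1_smoothing(1)])
   show "0 \<le> - ln (p r)" for r using elim by (simp add: ln_le_zero_iff)
  qed (use elim in auto)
  then show "(\<Sum>r. ennreal (I.V k (x + ln (p r)))) = ennreal (smooth k x p)" by (simp add: smooth_def)
 qed
qed

text \<open>
  The expected number of boxes of generation \<open>m\<close> up to \<open>t\<close>, given the weights of the first \<open>k\<close>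
 generations. It is a martingale in \<open>k\<close>.
\<close>

definition level_sum :: "nat => real => nat => 'a => ennreal" where
 "level_sum m t k om = gsum k (%v. ennreal (I.V (m - k) (t - T v om)))"

lemma level_sum_rv [measurable]: "level_sum m t k \<in> borel_measurable M"
 unfolding level_sum_def[abs_def] by measurable

lemma level_sum_mean: "k \<le> m ==> (\<integral>\<^sup>+om. level_sum m t k om \<partial>M) = ennreal (I.V m t)"
 unfolding level_sum_def
 by (subst many_to_one[of "%y. ennreal (I.V (m - k) (t - y))"]) (simp_all add: I.V_convolution)

definition boxes_below :: "nat => real => 'a => ennreal" where
 "boxes_below m t om = gsum m (%v. indicator {..t} (T v om))"

lemma boxes_below_level: "boxes_below m t om = level_sum m t m om"
 unfolding boxes_below_def level_sum_def
 by (intro gsum_cong) (auto simp: indicator_def I.V_0 I.V_neg)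

lemma boxes_below_rv [measurable]: "boxes_below m t \<in> borel_measurable M"
 unfolding boxes_below_def[abs_def] by measurable

text \<open>
  The difference telescopes over the generations, and the increments are sums of the orthogonal
  fluctuations of single boxes. The mean square of the fluctuation of \<open>v\<close> in generation \<open>k\<close> is at most
  \<open>C (1 + t) V (m - k - 1) t\<close> times the mean of \<open>V (m - k - 1) (t - T v)\<close>. Summed over the generation, the last factor
  gives \<open>V (m - 1) t\<close>, and the remaining sum over \<open>k \<ge> 1\<close> contains only intensities of order below \<open>m - 1\<close>.
\<close>

lemma first_generation_dominates:
 assumes t: "0 \<le> t" and m: "1 \<le> m"
 shows "(\<integral>\<^sup>+om. ennreal ((enn2real (boxes_below m t om) - smooth (m - 1) t (%r. A [] r om))\<^sup>2) \<partial>M)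
  \<le> ennreal (C * (1 + t) * I.V (m - 1) t * I.Vsum (m - 1) t)"
proof -
 obtain b :: "nat => nat list" where b: "bij b"
  using bij_betw_from_nat_into[of "UNIV :: nat list set"] by (auto intro: countableI_type simp: infinite_UNIV_listI)
 have inj: "b i \<noteq> b j" if "i < j" for i j using b that by (auto simp: bij_def inj_eq)
 define \<phi> where "\<phi> n om = (if 1 \<le> length (b n) \<and> length (b n) < m then fluct (m - 1 - length (b n)) t (b n) om else 0)" for n om
 have [measurable]: "\<phi> n \<in> borel_measurable M" for n unfolding \<phi>_def[abs_def] by measurable
 have "(\<integral>\<^sup>+om. ennreal ((enn2real (boxes_below m t om) - smooth (m - 1) t (%r. A [] r om))\<^sup>2) \<partial>M)
  \<le> (\<Sum>n. \<integral>\<^sup>+om. ennreal ((\<phi> n om)\<^sup>2) \<partial>M)"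
 proof (rule orthogonal_sums_L2)
  show "integrable M (%om. (\<phi> n om)\<^sup>2)" for n
   unfolding \<phi>_def using fluct_sq_integrable[OF t]
   by (cases "1 \<le> length (b n) \<and> length (b n) < m") auto
  show "expectation (%om. \<phi> i om * \<phi> j om) = 0" if "i < j" for i j
   unfolding \<phi>_def using fluct_orthogonal[OF t inj[OF that]]
   by (cases "1 \<le> length (b i) \<and> length (b i) < m"; cases "1 \<le> length (b j) \<and> length (b j) < m") auto
  have fin: "AE om in M. \<forall>k\<in>{..m}. level_sum m t k om < \<infinity>"
  proof (rule AE_ball_countable')
   fix k assume "k \<in> {..m}"
   then have "(\<integral>\<^sup>+om. level_sum m t k om \<partial>M) \<noteq> \<infinity>" by (simp add: level_sum_mean)
   then have "AE om in M. level_sum m t k om \<noteq> \<infinity>" by (intro nn_integral_PInf_AE) auto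
   then show "AE om in M. level_sum m t k om < \<infinity>" by eventually_elim (simp add: less_top)
  qed auto
  have sm: "AE om in M. \<forall>v k x. (\<Sum>r. ennreal (I.V k (x + ln (A v r om)))) = ennreal (smooth k x (%r. A v r om))"
   using AE_env[OF AE_smooth_all] by (simp add: AE_all_countable)
  show "AE om in M. (%n. \<phi> n om) sums (enn2real (boxes_below m t om) - smooth (m - 1) t (%r. A [] r om))"
   using fin sm
  proof eventually_elim
   case (elim om)
   let ?a = "%k. enn2real (level_sum m t k om)"
   have a: "level_sum m t k om = ennreal (?a k)" if "k \<le> m" for k using elim that by auto
   define pos where "pos n = (if 1 \<le> length (b n) \<and> length (b n) < m then smooth (m - 1 - length (b n)) (t - T (b n) om) (%r. A (b n) r om) else 0)" for n
   define neg where "neg n = (if 1 \<le> length (b n) \<and> length (b n) < m then I.V (m - length (b n)) (t - T (b n) om) else 0)" for n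
   have child: "ennreal (smooth (m - 1 - k) (t - T v om) (%r. A v r om)) = (\<Sum>r. ennreal (I.V (m - Suc k) (t - T (v @ [r]) om)))" for k v
    using elim(2)[rule_format, of "m - 1 - k" "t - T v om" v] by (simp add: T_snoc algebra_simps)
   have "(\<Sum>n. ennreal (pos n)) = (\<Sum>n. if 1 \<le> length (b n) \<and> length (b n) < m then
     ennreal (smooth (m - 1 - length (b n)) (t - T (b n) om) (%r. A (b n) r om)) else 0)"
    unfolding pos_def by (intro suminf_cong) auto
   also have "\<dots> = (\<Sum>k\<in>{1..<m}. gsum k (%v. ennreal (smooth (m - 1 - k) (t - T v om) (%r. A v r om))))"
    by (rule gsum_split_enumeration[OF b])
   also have "\<dots> = (\<Sum>k\<in>{1..<m}. level_sum m t (Suc k) om)"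
    unfolding child level_sum_def gsum_Suc ..
   also have "\<dots> = (\<Sum>k\<in>{1..<m}. ennreal (?a (Suc k)))" by (intro sum.cong) (auto intro!: a)
   also have "\<dots> = ennreal (\<Sum>k\<in>{1..<m}. ?a (Suc k))" by (rule sum_ennreal) simp
   finally have P: "(\<Sum>n. ennreal (pos n)) = ennreal (\<Sum>k\<in>{1..<m}. ?a (Suc k))" .
   have "(\<Sum>n. ennreal (neg n)) = (\<Sum>n. if 1 \<le> length (b n) \<and> length (b n) < m then
     ennreal (I.V (m - length (b n)) (t - T (b n) om)) else 0)"
    unfolding neg_def by (intro suminf_cong) auto
   also have "\<dots> = (\<Sum>k\<in>{1..<m}. level_sum m t k om)"
    unfolding level_sum_def by (rule gsum_split_enumeration[OF b])
   also have "\<dots> = (\<Sum>k\<in>{1..<m}. ennreal (?a k))" by (intro sum.cong) (auto intro!: a)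
   also have "\<dots> = ennreal (\<Sum>k\<in>{1..<m}. ?a k)" by (rule sum_ennreal) simp
   finally have Ng: "(\<Sum>n. ennreal (neg n)) = ennreal (\<Sum>k\<in>{1..<m}. ?a k)" .
   have "(%n. pos n - neg n) sums ((\<Sum>k\<in>{1..<m}. ?a (Suc k)) - (\<Sum>k\<in>{1..<m}. ?a k))"
    by (rule sums_diff_ennreal[OF _ P _ _ Ng]) (auto simp: pos_def neg_def smooth_nonneg intro!: sum_nonneg)
   also have "(\<Sum>k\<in>{1..<m}. ?a (Suc k)) - (\<Sum>k\<in>{1..<m}. ?a k) = ?a m - ?a 1"
    using sum_Suc_diff'[OF m, of ?a] by (simp add: sum_subtractf)
   also have "?a m = enn2real (boxes_below m t om)" by (simp add: boxes_below_level)
   also have "?a 1 = smooth (m - 1) t (%r. A [] r om)"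
   proof -
    have "level_sum m t 1 om = (\<Sum>r. ennreal (I.V (m - 1) (t + ln (A [] r om))))"
     unfolding level_sum_def One_nat_def gsum_Suc gsum_0 T_snoc by simp
    then show ?thesis using elim(2) by (simp add: smooth_nonneg)
   qed
   also have "(%n. pos n - neg n) = (%n. \<phi> n om)"
    by (rule ext) (auto simp: pos_def neg_def \<phi>_def fluct_def Suc_diff_Suc)
   finally show ?case .
  qed
 qed simp
 also have "\<dots> \<le> (\<Sum>n. if 1 \<le> length (b n) \<and> length (b n) < m then
  (\<integral>\<^sup>+om. ennreal (C * (1 + t) * I.V (m - 1 - length (b n)) t) * ennreal (I.V (m - 1 - length (b n)) (t - T (b n) om)) \<partial>M) else 0)"
  by (intro suminf_le) (auto simp: \<phi>_def fluct_nn[OF t])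
 also have "\<dots> = (\<Sum>k\<in>{1..<m}. gsum k (%v. \<integral>\<^sup>+om. ennreal (C * (1 + t) * I.V (m - 1 - k) t) * ennreal (I.V (m - 1 - k) (t - T v om)) \<partial>M))"
  by (rule gsum_split_enumeration[OF b])
 also have "\<dots> = (\<Sum>k\<in>{1..<m}. ennreal (C * (1 + t) * I.V (m - 1 - k) t) * ennreal (I.V (m - 1) t))"
 proof (rule sum.cong[OF refl])
  fix k assume "k \<in> {1..<m}"
  then have k: "m - 1 - k + k = m - 1" by auto
  have "gsum k (%v. \<integral>\<^sup>+om. ennreal (C * (1 + t) * I.V (m - 1 - k) t) * ennreal (I.V (m - 1 - k) (t - T v om)) \<partial>M)
   = ennreal (C * (1 + t) * I.V (m - 1 - k) t) * gsum k (%v. \<integral>\<^sup>+om. ennreal (I.V (m - 1 - k) (t - T v om)) \<partial>M)"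
   by (simp add: nn_integral_cmult gsum_cmult)
  also have "gsum k (%v. \<integral>\<^sup>+om. ennreal (I.V (m - 1 - k) (t - T v om)) \<partial>M) = (\<integral>\<^sup>+om. gsum k (%v. ennreal (I.V (m - 1 - k) (t - T v om))) \<partial>M)"
   by (rule gsum_nn_integral[symmetric]) measurable
  also have "\<dots> = ennreal (I.V (m - 1) t)"
   by (subst many_to_one[of "%y. ennreal (I.V (m - 1 - k) (t - y))"]) (simp_all only: I.V_convolution k, measurable)
  finally show "gsum k (%v. \<integral>\<^sup>+om. ennreal (C * (1 + t) * I.V (m - 1 - k) t) * ennreal (I.V (m - 1 - k) (t - T v om)) \<partial>M)
   = ennreal (C * (1 + t) * I.V (m - 1 - k) t) * ennreal (I.V (m - 1) t)" .
 qed
 also have "\<dots> = (\<Sum>k\<in>{1..<m}. ennreal (C * (1 + t) * I.V (m - 1 - k) t * I.V (m - 1) t))"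
  using C_nonneg t by (intro sum.cong refl ennreal_mult[symmetric]) auto
 also have "\<dots> = ennreal (\<Sum>k\<in>{1..<m}. C * (1 + t) * I.V (m - 1 - k) t * I.V (m - 1) t)"
  using C_nonneg t by (intro sum_ennreal) auto
 also have "(\<Sum>k\<in>{1..<m}. C * (1 + t) * I.V (m - 1 - k) t * I.V (m - 1) t) = C * (1 + t) * I.V (m - 1) t * I.Vsum (m - 1) t"
 proof -
  have "(\<Sum>k\<in>{1..<m}. I.V (m - 1 - k) t) = I.Vsum (m - 1) t"
   unfolding I.Vsum_def
   by (rule sum.reindex_bij_witness[of _ "%i. m - 1 - i" "%k. m - 1 - k"]) auto
  then show ?thesis by (simp add: sum_distrib_left[symmetric] sum_distrib_right[symmetric] mult_ac)
 qed
 finally show ?thesis .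
qed

end

section \<open>Probabilities of placements\<close>

lemma nn_integral_count_space_prod_power:
 fixes q :: "'b => ennreal" and n :: nat
 assumes S: "countable S"
 shows "(\<integral>\<^sup>+x. (\<Prod>i<n. q (x i)) \<partial>count_space (PiE {..<n} (%_. S))) = (\<integral>\<^sup>+v. q v \<partial>count_space S) ^ n"
proof -
 interpret product_sigma_finite "\<lambda>_::nat. count_space S"
  by (intro product_sigma_finite.intro sigma_finite_measure_count_space_countable S)
 have "count_space (PiE {..<n} (%_. S)) = PiM {..<n} (%_. count_space S)"
  by (rule count_space_PiM_finite[symmetric]) (auto simp: S)
 then show ?thesis by (simp only:) (subst product_nn_integral_prod, auto)
qed

locale occupancy_tree = weighted_tree M env A c mu w C + nested_occupancy_scheme M env n A X
 for M :: "'a measure" and env A c mu w C n X +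
 assumes n_pos: "1 \<le> n"
begin

text \<open>
  The placement rule conditions on the weights and on the history of the balls; the bounds below
  condition on the weights alone.
\<close>

definition weights_algebra :: "'a measure" where
 "weights_algebra = sigma (space M) {A v r -` S \<inter> space M | v r S. S \<in> sets borel}"

definition history_algebra :: "nat => 'a measure" where
 "history_algebra k = sigma (space M)
  ({A v r -` S \<inter> space M | v r S. S \<in> sets borel} \<union> {X i m -` S \<inter> space M | i m S. i < n \<and> m \<le> k})"

lemma X_rv [measurable]: "i < n ==> X i k \<in> M \<rightarrow>\<^sub>M count_space UNIV" by (rule positions_measurable)

lemma history_gen: "{A v r -` S \<inter> space M | v r S. S \<in> sets borel} \<union> {X i m -` S \<inter> space M | i m S. i < n \<and> m \<le> k} \<subseteq> Pow (space M)"
 by auto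

lemma space_history [simp]: "space (history_algebra k) = space M"
 unfolding history_algebra_def by (rule space_measure_of) auto
lemma space_weights [simp]: "space weights_algebra = space M"
 unfolding weights_algebra_def by (rule space_measure_of) auto

lemma subalgebra_history: "subalgebra M (history_algebra k)"
 unfolding subalgebra_def
proof
 show "sets (history_algebra k) \<subseteq> sets M"
  unfolding history_algebra_def using history_gen
  by (subst sets_measure_of) (auto intro!: sets.sigma_sets_subset measurable_sets[OF A_rv1] measurable_sets[OF X_rv])
qed simp

lemma weights_sub_history: "f \<in> borel_measurable weights_algebra ==> f \<in> borel_measurable (history_algebra k)"
proof (rule measurable_from_subalg[of _ weights_algebra])
 show "subalgebra (history_algebra k) weights_algebra"
  unfolding subalgebra_def
 proof
  show "sets weights_algebra \<subseteq> sets (history_algebra k)"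
   unfolding weights_algebra_def history_algebra_def
   by (subst (1 2) sets_measure_of) (auto intro!: sigma_sets_mono')
 qed simp
qed

lemma weights_sub: "f \<in> borel_measurable weights_algebra ==> f \<in> borel_measurable M"
 using weights_sub_history[of f 0] measurable_from_subalg[OF subalgebra_history] by blast

lemma A_weights [measurable]: "A v r \<in> borel_measurable weights_algebra"
proof (rule measurableI)
 fix S :: "real set" assume "S \<in> sets borel"
 then have "A v r -` S \<inter> space M \<in> {A v r -` S \<inter> space M | v r S. S \<in> sets borel}" by blast
 then have "A v r -` S \<inter> space M \<in> sets weights_algebra"
  unfolding weights_algebra_def by (subst sets_measure_of) (auto intro: sigma_sets.Basic)
 then show "A v r -` S \<inter> space weights_algebra \<in> sets weights_algebra" by simp
qed simp

lemma X_history: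
 assumes "i < n" "m \<le> k" shows "X i m \<in> history_algebra k \<rightarrow>\<^sub>M count_space UNIV"
proof (rule measurableI)
 fix S :: "nat list set"
 show "X i m -` S \<inter> space (history_algebra k) \<in> sets (history_algebra k)"
 proof -
  have "X i m -` S \<inter> space M \<in> {A v r -` S \<inter> space M | v r S. S \<in> sets borel} \<union> {X i m -` S \<inter> space M | i m S. i < n \<and> m \<le> k}"
   using assms by blast
  then have "X i m -` S \<inter> space M \<in> sets (history_algebra k)"
   unfolding history_algebra_def by (subst sets_measure_of[OF history_gen]) (rule sigma_sets.Basic)
  then show ?thesis by simp
 qed
qed simp

definition placed :: "nat => (nat => nat list) => 'a set" where
 "placed k x = {om \<in> space M. \<forall>i<n. X i k om = x i}"

lemma placed_history [measurable]: "placed k x \<in> sets (history_algebra k)"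
proof -
 have "placed k x = space M \<inter> (\<Inter>i\<in>{..<n}. X i k -` {x i} \<inter> space (history_algebra k))"
  by (auto simp: placed_def)
 also have "\<dots> = space (history_algebra k) \<inter> (\<Inter>i\<in>{..<n}. X i k -` {x i} \<inter> space (history_algebra k))" by simp
 also have "\<dots> \<in> sets (history_algebra k)"
 proof (rule sets.Int[OF sets.top sets.finite_INT])
  fix i assume "i \<in> {..<n}"
  then show "X i k -` {x i} \<inter> space (history_algebra k) \<in> sets (history_algebra k)"
   by (intro measurable_sets[OF X_history]) auto
 qed (use n_pos in \<open>auto simp: lessThan_empty_iff\<close>)
 finally show ?thesis .
qed

lemma placed_sets [measurable]: "placed k x \<in> sets M"
 using placed_history[of k x] subalgebra_history[of k] unfolding subalgebra_def by blast

text \<open>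
  Weights clipped to the unit interval: equal to \<open>A\<close> almost surely, but with bounds at every point.
\<close>

definition A1 :: "nat list => nat => 'a => real" where "A1 v r om = min 1 (max 0 (A v r om))"
definition Q :: "nat list => 'a => real" where "Q v om = (\<Prod>i<length v. A1 (take i v) (v ! i) om)"

lemma A1_bounds: "0 \<le> A1 v r om" "A1 v r om \<le> 1" by (auto simp: A1_def)
lemma A1_weights [measurable]: "A1 v r \<in> borel_measurable weights_algebra"
 unfolding A1_def[abs_def] by measurable
lemma Q_weights [measurable]: "Q v \<in> borel_measurable weights_algebra"
 unfolding Q_def[abs_def] by measurable
lemma Q_bounds: "0 \<le> Q v om" "Q v om \<le> 1"
 by (auto simp: Q_def A1_bounds intro!: prod_nonneg prod_le_1)
lemma Q_Nil [simp]: "Q [] om = 1" by (simp add: Q_def)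
lemma Q_snoc: "Q (v @ [r]) om = Q v om * A1 v r om" by (simp add: Q_def nth_append)

lemma AE_A: "AE om in M. \<forall>v. (\<forall>r. 0 < A v r om \<and> A v r om \<le> 1) \<and> (%r. A v r om) sums 1"
proof -
 have "AE om in M. (\<forall>r. 0 < A v r om \<and> A v r om \<le> 1) \<and> (%r. A v r om) sums 1" for v
  using AE_env[OF env_facts, of v] by eventually_elim auto
 then show ?thesis by (simp add: AE_all_countable)
qed

lemma AE_A1: "AE om in M. \<forall>v r. A1 v r om = A v r om"
 using AE_A by eventually_elim (auto simp: A1_def less_imp_le)

lemma AE_Q: "AE om in M. \<forall>v. Q v om = exp (- T v om)"
 using AE_A AE_A1
proof eventually_elim
 case (elim om)
 show ?case
  using elim by (auto simp: Q_def T_def sum_negf exp_sum)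
qed

lemma AE_gsum_Q: "AE om in M. \<forall>k. gsum k (%v. ennreal (Q v om)) = 1"
 using AE_A AE_A1
proof eventually_elim
 case (elim om)
 have "gsum k (%v. ennreal (Q v om)) = 1" for k
 proof (induction k)
  case (Suc k)
  have "(\<Sum>r. ennreal (Q (v @ [r]) om)) = ennreal (Q v om)" for v
  proof -
   have "(%r. Q v om * A v r om) sums (Q v om * 1)" using elim by (intro sums_mult) auto
   then have "(%r. Q (v @ [r]) om) sums Q v om" using elim by (simp add: Q_snoc)
   then show ?thesis using Q_bounds by (intro suminf_ennreal_eq)
  qed
  then show ?case using Suc by (simp add: gsum_Suc)
 qed (simp add: gsum_0)
 then show ?case by blast
qed

text \<open>
  Induction over the generations with the placement rule. Only one inequality is proved: applied to
  a family of placements and to its complement it yields both, because the products add up to one.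
\<close>

lemma placement_lower:
 assumes "h \<in> borel_measurable weights_algebra" "!!om. 0 \<le> h om \<and> h om \<le> 1" "!!i. i < n ==> length (x i) = k"
 shows "(\<integral>om. h om * (\<Prod>i<n. Q (x i) om) \<partial>M) \<le> (\<integral>om. h om * indicator (placed k x) om \<partial>M)"
 using assms
proof (induction k arbitrary: h x)
 case 0
 have "(\<integral>om. h om * (\<Prod>i<n. Q (x i) om) \<partial>M) = (\<integral>om. h om * indicator (placed 0 x) om \<partial>M)"
  using 0(3) start by (intro Bochner_Integration.integral_cong) (auto simp: placed_def indicator_def)
 then show ?case by simp
next
 case (Suc k)
 note [measurable] = Suc.prems(1)
 have h_M [measurable]: "h \<in> borel_measurable M" by (rule weights_sub[OF Suc.prems(1)])
 let ?y = "%i. butlast (x i)" and ?r = "%i. last (x i)"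
 have xy: "x i = ?y i @ [?r i]" "length (?y i) = k" if "i < n" for i
  using Suc.prems(3)[OF that] by (auto simp: length_0_conv[symmetric] simp del: length_0_conv)
 let ?D = "{om \<in> space M. \<forall>i<n. X i (Suc k) om = X i k om @ [?r i]}"
 let ?P = "%om. \<Prod>i<n. A1 (?y i) (?r i) om"
 have P_bounds: "0 \<le> ?P om" "?P om \<le> 1" for om by (auto intro!: prod_nonneg prod_le_1 simp: A1_bounds)
 have [measurable]: "?P \<in> borel_measurable weights_algebra" by measurable
 have Dm [measurable]: "?D \<in> sets M"
 proof -
  have "{om \<in> space M. X i (Suc k) om = X i k om @ [?r i]} \<in> sets M" if "i < n" for i
  proof -
   have "{om \<in> space M. X i (Suc k) om = X i k om @ [?r i]} = (\<Union>v. (X i k -` {v} \<inter> space M) \<inter> (X i (Suc k) -` {v @ [?r i]} \<inter> space M))" by auto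
   also have "\<dots> \<in> sets M" using that by (intro sets.countable_UN'' sets.Int measurable_sets[OF X_rv]) auto
   finally show ?thesis .
  qed
  then have "(\<Inter>i\<in>{..<n}. {om \<in> space M. X i (Suc k) om = X i k om @ [?r i]}) \<in> sets M"
   using n_pos by (intro sets.finite_INT) (auto simp: lessThan_empty_iff)
  also have "(\<Inter>i\<in>{..<n}. {om \<in> space M. X i (Suc k) om = X i k om @ [?r i]}) = ?D" using n_pos by (auto simp: Suc_le_eq)
  finally show ?thesis .
 qed
 interpret S: finite_measure_subalgebra M "history_algebra k"
  by (intro finite_measure_subalgebra.intro finite_measure_axioms finite_measure_subalgebra_axioms.intro subalgebra_history)
 let ?g = "%om. h om * indicator (placed k ?y) om :: real"
 have gm: "?g \<in> borel_measurable (history_algebra k)"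
  using weights_sub_history[OF Suc.prems(1), of k] by measurable
 have place: "AE om in M. real_cond_exp M (history_algebra k) (indicator ?D) om = (\<Prod>i<n. A (X i k om) (?r i) om)"
  using placement[of k ?r] unfolding history_algebra_def .
 have "(\<integral>om. h om * (\<Prod>i<n. Q (x i) om) \<partial>M) = (\<integral>om. (h om * ?P om) * (\<Prod>i<n. Q (?y i) om) \<partial>M)"
 proof (intro Bochner_Integration.integral_cong refl)
  fix om
  have "(\<Prod>i<n. Q (x i) om) = (\<Prod>i<n. Q (?y i) om * A1 (?y i) (?r i) om)"
   using xy by (intro prod.cong) (auto simp: Q_snoc[symmetric])
  then show "h om * (\<Prod>i<n. Q (x i) om) = (h om * ?P om) * (\<Prod>i<n. Q (?y i) om)"
   by (simp add: prod.distrib)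
 qed
 also have "\<dots> \<le> (\<integral>om. (h om * ?P om) * indicator (placed k ?y) om \<partial>M)"
  using Suc.prems(2) P_bounds xy by (intro Suc.IH) (auto intro!: mult_le_one)
 also have "\<dots> = (\<integral>om. ?g om * real_cond_exp M (history_algebra k) (indicator ?D) om \<partial>M)"
 proof (rule integral_cong_AE)
  show "AE om in M. h om * ?P om * indicator (placed k ?y) om = ?g om * real_cond_exp M (history_algebra k) (indicator ?D) om"
   using place AE_A1
  proof eventually_elim
   case (elim om)
   show ?case unfolding elim(1) using elim(2) by (auto simp: placed_def indicator_def intro!: prod.cong)
  qed
  show "(%om. h om * ?P om * indicator (placed k ?y) om) \<in> borel_measurable M"
   by (intro borel_measurable_times h_M borel_measurable_prod weights_sub A1_weights borel_measurable_indicator placed_sets)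
  show "(%om. ?g om * real_cond_exp M (history_algebra k) (indicator ?D) om) \<in> borel_measurable M"
   by measurable
 qed
 also have "\<dots> = (\<integral>om. ?g om * indicator ?D om \<partial>M)"
 proof (rule S.real_cond_exp_intg(2))
  show "integrable M (%om. ?g om * indicator ?D om)"
   using Suc.prems(2) by (intro integrable_const_bound[where B=1]) (auto simp: indicator_def)
 qed (use gm in auto)
 also have "\<dots> \<le> (\<integral>om. h om * indicator (placed (Suc k) x) om \<partial>M)"
 proof (rule integral_mono)
  show "integrable M (%om. ?g om * indicator ?D om)" "integrable M (%om. h om * indicator (placed (Suc k) x) om)"
   using Suc.prems(2) by (auto intro!: integrable_const_bound[where B=1] simp: indicator_def)
  fix om
  have "x i = ?y i @ [?r i]" if "i < n" for i using xy that by blast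
  then show "?g om * indicator ?D om \<le> h om * indicator (placed (Suc k) x) om"
   using Suc.prems(2)[of om] by (auto simp: indicator_def placed_def)
 qed
 finally show ?case .
qed

end

section \<open>Occupied boxes and boxes of large weight\<close>

context occupancy_tree begin

abbreviation words :: "nat => nat list set" where "words m \<equiv> {v. length v = m}"

text \<open>
  Sum of \<open>placement_lower\<close> over a countable family of placements.
\<close>

lemma placed_family_lower:
 assumes h: "h \<in> borel_measurable weights_algebra" "!!om. 0 \<le> h om \<and> h om \<le> 1"
  and F: "F \<subseteq> PiE {..<n} (%_. words m)"
 shows "(\<integral>\<^sup>+om. ennreal (h om) * (\<integral>\<^sup>+x. (\<Prod>i<n. ennreal (Q (x i) om)) \<partial>count_space F) \<partial>M)
  \<le> (\<integral>\<^sup>+om. ennreal (h om) * indicator {om. (\<lambda>i\<in>{..<n}. X i m om) \<in> F} om \<partial>M)"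
proof -
 have cF: "countable F"
  by (rule countable_subset[OF F]) (intro countable_PiE, auto)
 have h_M [measurable]: "h \<in> borel_measurable M" by (rule weights_sub[OF h(1)])
 have Q_M [measurable]: "Q v \<in> borel_measurable M" for v by (rule weights_sub[OF Q_weights])
 have "(\<integral>\<^sup>+om. ennreal (h om) * (\<integral>\<^sup>+x. (\<Prod>i<n. ennreal (Q (x i) om)) \<partial>count_space F) \<partial>M)
  = (\<integral>\<^sup>+om. (\<integral>\<^sup>+x. ennreal (h om * (\<Prod>i<n. Q (x i) om)) \<partial>count_space F) \<partial>M)"
  using h(2) Q_bounds by (intro nn_integral_cong) (simp add: nn_integral_cmult[symmetric] ennreal_mult prod_ennreal prod_nonneg)
 also have "\<dots> = (\<integral>\<^sup>+x. (\<integral>\<^sup>+om. ennreal (h om * (\<Prod>i<n. Q (x i) om)) \<partial>M) \<partial>count_space F)"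
  by (rule nn_integral_count_space_nn_integral[OF cF]) measurable
 also have "\<dots> \<le> (\<integral>\<^sup>+x. (\<integral>\<^sup>+om. ennreal (h om * indicator (placed m x) om) \<partial>M) \<partial>count_space F)"
 proof (rule nn_integral_mono)
  fix x assume "x \<in> space (count_space F)"
  then have len: "length (x i) = m" if "i < n" for i using F that by (auto simp: PiE_def Pi_def)
  have b: "0 \<le> h om * (\<Prod>i<n. Q (x i) om)" "h om * (\<Prod>i<n. Q (x i) om) \<le> 1" for om
   using h(2)[of om] Q_bounds by (auto intro!: mult_nonneg_nonneg prod_nonneg mult_le_one prod_le_1)
  have i: "integrable M (%om. h om * (\<Prod>i<n. Q (x i) om))" "integrable M (%om. h om * indicator (placed m x) om)"
   using h(2) b by (auto intro!: integrable_const_bound[where B=1] simp: indicator_def)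
  show "(\<integral>\<^sup>+om. ennreal (h om * (\<Prod>i<n. Q (x i) om)) \<partial>M) \<le> (\<integral>\<^sup>+om. ennreal (h om * indicator (placed m x) om) \<partial>M)"
   using placement_lower[OF h len] h(2) b
   by (subst (1 2) nn_integral_eq_integral) (auto simp: i intro!: ennreal_leI)
 qed
 also have "\<dots> = (\<integral>\<^sup>+om. (\<integral>\<^sup>+x. ennreal (h om * indicator (placed m x) om) \<partial>count_space F) \<partial>M)"
  by (rule nn_integral_count_space_nn_integral[OF cF, symmetric]) measurable
 also have "\<dots> = (\<integral>\<^sup>+om. ennreal (h om) * indicator {om. (\<lambda>i\<in>{..<n}. X i m om) \<in> F} om \<partial>M)"
 proof (rule nn_integral_cong)
  fix om assume om: "om \<in> space M"
  let ?x = "\<lambda>i\<in>{..<n}. X i m om"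
  have "om \<in> placed m x \<longleftrightarrow> x = ?x" if "x \<in> F" for x
  proof -
   have "x \<in> extensional {..<n}" using F that by (auto simp: PiE_def)
   then show ?thesis using om by (auto simp: placed_def fun_eq_iff extensional_def)
  qed
  then have "(\<integral>\<^sup>+x. ennreal (h om * indicator (placed m x) om) \<partial>count_space F) = (\<integral>\<^sup>+x. ennreal (h om) * indicator {?x} x \<partial>count_space F)"
   by (intro nn_integral_cong) (auto simp: indicator_def)
  also have "\<dots> = ennreal (h om) * (\<integral>\<^sup>+x. indicator {?x} x \<partial>count_space F)"
   by (rule nn_integral_cmult) simp
  also have "(\<integral>\<^sup>+x. indicator {?x} x \<partial>count_space F) = (\<integral>\<^sup>+x. indicator ({?x} \<inter> F) x \<partial>count_space F)"
   by (rule nn_integral_cong) (simp add: indicator_def)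
  also have "(\<integral>\<^sup>+x. indicator ({?x} \<inter> F) x \<partial>count_space F) = emeasure (count_space F) ({?x} \<inter> F)"
   by (rule nn_integral_indicator) simp
  also have "\<dots> = indicator {om. (\<lambda>i\<in>{..<n}. X i m om) \<in> F} om"
   by (subst emeasure_count_space_finite) (auto simp: indicator_def)
  finally show "(\<integral>\<^sup>+x. ennreal (h om * indicator (placed m x) om) \<partial>count_space F)
   = ennreal (h om) * indicator {om. (\<lambda>i\<in>{..<n}. X i m om) \<in> F} om" .
 qed
 finally show ?thesis .
qed

definition occ :: "nat => nat list => 'a => bool" where "occ m v om \<longleftrightarrow> (\<exists>i<n. X i m om = v)"

lemma occ_pred [measurable]: "Measurable.pred M (occ m v)"
proof -
 have "{om \<in> space M. occ m v om} = (\<Union>i\<in>{..<n}. X i m -` {v} \<inter> space M)" by (auto simp: occ_def)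
 also have "\<dots> \<in> sets M" by (intro sets.finite_UN measurable_sets[OF X_rv]) auto
 finally show ?thesis by (simp add: pred_def)
qed

lemma words_sum:
 assumes "gsum m (%v. ennreal (Q v om)) = 1" "length v = m"
 shows "(\<integral>\<^sup>+u. ennreal (Q u om) \<partial>count_space (words m - {v})) = ennreal (1 - Q v om)"
proof -
 have "(\<integral>\<^sup>+u. ennreal (Q u om) \<partial>count_space (words m)) =
  (\<integral>\<^sup>+u. ennreal (Q u om) * indicator (words m - {v}) u + ennreal (Q u om) * indicator {v} u \<partial>count_space UNIV)"
  by (subst nn_integral_count_space_indicator) (use assms in \<open>auto intro!: nn_integral_cong simp: indicator_def\<close>)
 also have "\<dots> = (\<integral>\<^sup>+u. ennreal (Q u om) \<partial>count_space (words m - {v})) + ennreal (Q v om)"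
  by (subst nn_integral_add) (auto simp: nn_integral_count_space_indicator[symmetric] nn_integral_count_space_finite)
 finally have e: "(\<integral>\<^sup>+u. ennreal (Q u om) \<partial>count_space (words m - {v})) + ennreal (Q v om) = 1"
  using assms(1) by (simp add: gsum_def)
 then have "(\<integral>\<^sup>+u. ennreal (Q u om) \<partial>count_space (words m - {v})) = 1 - ennreal (Q v om)"
  by (metis ennreal_add_diff_cancel_right ennreal_neq_top)
 then show ?thesis by (simp add: ennreal_minus Q_bounds ennreal_1[symmetric] del: ennreal_1)
qed

text \<open>
  A box is empty if all balls sit in the other words of its generation, which has conditional
  probability \<open>(1 - Q v)^n\<close>.
\<close>

lemma occ_bounds:
 assumes h: "h \<in> borel_measurable weights_algebra" "!!om. 0 \<le> h om \<and> h om \<le> 1" and v: "length v = m"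
 shows "(\<integral>\<^sup>+om. ennreal (h om * (if occ m v om then 1 else 0)) \<partial>M) \<le> (\<integral>\<^sup>+om. ennreal (h om * (1 - (1 - Q v om) ^ n)) \<partial>M)"
  and "(\<integral>\<^sup>+om. ennreal (h om * (if occ m v om then 0 else 1)) \<partial>M) \<le> (\<integral>\<^sup>+om. ennreal (h om * (1 - Q v om) ^ n) \<partial>M)"
proof -
 have h_M [measurable]: "h \<in> borel_measurable M" by (rule weights_sub[OF h(1)])
 have Q_M [measurable]: "Q v \<in> borel_measurable M" for v by (rule weights_sub[OF Q_weights])
 let ?E = "PiE {..<n} (%_. words m - {v})" and ?A = "PiE {..<n} (%_. words m)"
 have pow: "0 \<le> (1 - Q v om) ^ n" "(1 - Q v om) ^ n \<le> 1" for om using Q_bounds[of v om] by (auto intro: power_le_one)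
 have sumE: "AE om in M. (\<integral>\<^sup>+x. (\<Prod>i<n. ennreal (Q (x i) om)) \<partial>count_space ?E) = ennreal ((1 - Q v om) ^ n)
  \<and> (\<integral>\<^sup>+x. (\<Prod>i<n. ennreal (Q (x i) om)) \<partial>count_space (?A - ?E)) = ennreal (1 - (1 - Q v om) ^ n)"
  using AE_gsum_Q
 proof eventually_elim
  case (elim om)
  let ?f = "%x. \<Prod>i<n. ennreal (Q (x i) om)"
  have E: "(\<integral>\<^sup>+x. ?f x \<partial>count_space ?E) = ennreal ((1 - Q v om) ^ n)"
   using words_sum[OF elim[rule_format, of m] v] Q_bounds[of v om]
   by (subst nn_integral_count_space_prod_power) (auto simp: ennreal_power)
  have A: "(\<integral>\<^sup>+x. ?f x \<partial>count_space ?A) = 1"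
   using elim by (subst nn_integral_count_space_prod_power) (auto simp: gsum_def)
  have "?E \<subseteq> ?A" by (intro PiE_mono) auto
  then have "(\<integral>\<^sup>+x. ?f x \<partial>count_space ?A) = (\<integral>\<^sup>+x. ?f x * indicator ?E x + ?f x * indicator (?A - ?E) x \<partial>count_space UNIV)"
   by (subst nn_integral_count_space_indicator) (auto intro!: nn_integral_cong simp: indicator_def)
  also have "\<dots> = (\<integral>\<^sup>+x. ?f x \<partial>count_space ?E) + (\<integral>\<^sup>+x. ?f x \<partial>count_space (?A - ?E))"
   by (subst nn_integral_add) (simp_all add: nn_integral_count_space_indicator[symmetric])
  finally have "ennreal ((1 - Q v om) ^ n) + (\<integral>\<^sup>+x. ?f x \<partial>count_space (?A - ?E)) = 1" unfolding E A by simp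
  then have "(\<integral>\<^sup>+x. ?f x \<partial>count_space (?A - ?E)) = 1 - ennreal ((1 - Q v om) ^ n)"
   by (metis ennreal_add_diff_cancel_left ennreal_neq_top)
  also have "\<dots> = ennreal (1 - (1 - Q v om) ^ n)" using pow by (simp add: ennreal_minus ennreal_1[symmetric] del: ennreal_1)
  finally show ?case using E by simp
 qed
 let ?a = "\<integral>\<^sup>+om. ennreal (h om * (if occ m v om then 1 else 0)) \<partial>M" and ?b = "\<integral>\<^sup>+om. ennreal (h om * (if occ m v om then 0 else 1)) \<partial>M"
 let ?c = "\<integral>\<^sup>+om. ennreal (h om * (1 - (1 - Q v om) ^ n)) \<partial>M" and ?d = "\<integral>\<^sup>+om. ennreal (h om * (1 - Q v om) ^ n) \<partial>M"
 have "?d = (\<integral>\<^sup>+om. ennreal (h om) * (\<integral>\<^sup>+x. (\<Prod>i<n. ennreal (Q (x i) om)) \<partial>count_space ?E) \<partial>M)"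
  by (rule nn_integral_cong_AE, use sumE in eventually_elim) (use h(2) pow in \<open>auto simp: ennreal_mult\<close>)
 also have "\<dots> \<le> (\<integral>\<^sup>+om. ennreal (h om) * indicator {om. (\<lambda>i\<in>{..<n}. X i m om) \<in> ?E} om \<partial>M)"
  by (rule placed_family_lower[OF h]) (intro PiE_mono, auto)
 also have "\<dots> \<le> ?b"
  by (intro nn_integral_mono) (auto simp: indicator_def occ_def PiE_def Pi_def)
 finally have db: "?d \<le> ?b" .
 have "?c = (\<integral>\<^sup>+om. ennreal (h om) * (\<integral>\<^sup>+x. (\<Prod>i<n. ennreal (Q (x i) om)) \<partial>count_space (?A - ?E)) \<partial>M)"
  by (rule nn_integral_cong_AE, use sumE in eventually_elim) (use h(2) pow in \<open>auto simp: ennreal_mult\<close>)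
 also have "\<dots> \<le> (\<integral>\<^sup>+om. ennreal (h om) * indicator {om. (\<lambda>i\<in>{..<n}. X i m om) \<in> ?A - ?E} om \<partial>M)"
  by (rule placed_family_lower[OF h]) auto
 also have "\<dots> \<le> ?a"
  by (intro nn_integral_mono) (auto simp: indicator_def occ_def PiE_def Pi_def)
 finally have ca: "?c \<le> ?a" .
 have "?a + ?b = (\<integral>\<^sup>+om. ennreal (h om) \<partial>M)"
  by (subst nn_integral_add[symmetric]) (auto intro!: nn_integral_cong)
 moreover have "?c + ?d = (\<integral>\<^sup>+om. ennreal (h om) \<partial>M)"
 proof (subst nn_integral_add[symmetric])
  show "(\<integral>\<^sup>+om. ennreal (h om * (1 - (1 - Q v om) ^ n)) + ennreal (h om * (1 - Q v om) ^ n) \<partial>M) = (\<integral>\<^sup>+om. ennreal (h om) \<partial>M)"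
  proof (rule nn_integral_cong)
   fix om
   have "0 \<le> h om * (1 - (1 - Q v om) ^ n)" "0 \<le> h om * (1 - Q v om) ^ n" using h(2) pow by auto
   then have "ennreal (h om * (1 - (1 - Q v om) ^ n)) + ennreal (h om * (1 - Q v om) ^ n)
    = ennreal (h om * (1 - (1 - Q v om) ^ n) + h om * (1 - Q v om) ^ n)" by (rule ennreal_plus[symmetric])
   also have "h om * (1 - (1 - Q v om) ^ n) + h om * (1 - Q v om) ^ n = h om" by (simp add: right_diff_distrib)
   finally show "ennreal (h om * (1 - (1 - Q v om) ^ n)) + ennreal (h om * (1 - Q v om) ^ n) = ennreal (h om)" .
  qed
 qed measurable
 moreover have hf: "(\<integral>\<^sup>+om. ennreal (h om) \<partial>M) \<le> 1"
 proof -
  have "(\<integral>\<^sup>+om. ennreal (h om) \<partial>M) \<le> (\<integral>\<^sup>+om. 1 \<partial>M)" using h(2) by (intro nn_integral_mono) auto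
  then show ?thesis by (simp add: emeasure_space_1)
 qed
 ultimately have eq: "?a + ?b = ?c + ?d" "?a + ?b \<le> 1" by auto
 have fin: "?a \<noteq> \<top>" "?b \<noteq> \<top>" "?c \<noteq> \<top>" "?d \<noteq> \<top>"
  using eq by (auto simp: top_unique)
 have real_le: "x \<le> z \<and> y \<le> w" if "x + y = z + w" "w \<le> y" "z \<le> x" "x \<noteq> \<top>" "y \<noteq> \<top>" "z \<noteq> \<top>" "w \<noteq> \<top>" for x y z w :: ennreal
  using that by (cases x; cases y; cases z; cases w) (auto simp: ennreal_plus[symmetric] simp del: ennreal_plus)
 show "?a \<le> ?c" "?b \<le> ?d"
  using real_le[OF eq(1) db ca fin] by auto
qed

lemma T_weights [measurable]: "T v \<in> borel_measurable weights_algebra"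
 unfolding T_def[abs_def] by measurable

text \<open>
  With \<open>p = exp (- T)\<close> and \<open>n = exp t\<close>: for \<open>T > t\<close> the box is occupied with probability at most
  \<open>n p = exp (t - T)\<close>, and for \<open>T \<le> t\<close> it is empty with probability
  \<open>(1 - p)^n \<le> exp (- n p) \<le> 1 / (n p)\<close>.
\<close>

lemma box_mismatch:
 assumes v: "length v = m"
 shows "(\<integral>\<^sup>+om. (if occ m v om \<noteq> (T v om \<le> ln n) then 1 else 0) \<partial>M) \<le> (\<integral>\<^sup>+om. ennreal (exp (- \<bar>ln n - T v om\<bar>)) \<partial>M)"
proof -
 let ?g = "%om. if ln n < T v om then 1 else (0::real)" and ?h = "%om. if ln n < T v om then 0 else (1::real)"
 have Q_M [measurable]: "Q v \<in> borel_measurable M" for v by (rule weights_sub[OF Q_weights])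
 have gm: "?g \<in> borel_measurable weights_algebra" and hm: "?h \<in> borel_measurable weights_algebra"
  using measurable_If[OF borel_measurable_const borel_measurable_const borel_measurable_less[OF borel_measurable_const T_weights]]
  by blast+
 have gb: "0 \<le> ?g om \<and> ?g om \<le> 1" and hb: "0 \<le> ?h om \<and> ?h om \<le> 1" for om by auto
 have "(\<integral>\<^sup>+om. (if occ m v om \<noteq> (T v om \<le> ln n) then 1 else 0) \<partial>M)
  = (\<integral>\<^sup>+om. ennreal (?g om * (if occ m v om then 1 else 0)) + ennreal (?h om * (if occ m v om then 0 else 1)) \<partial>M)"
  by (intro nn_integral_cong) auto
 also have "\<dots> = (\<integral>\<^sup>+om. ennreal (?g om * (if occ m v om then 1 else 0)) \<partial>M) + (\<integral>\<^sup>+om. ennreal (?h om * (if occ m v om then 0 else 1)) \<partial>M)"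
  by (rule nn_integral_add) measurable
 also have "\<dots> \<le> (\<integral>\<^sup>+om. ennreal (?g om * (1 - (1 - Q v om) ^ n)) \<partial>M) + (\<integral>\<^sup>+om. ennreal (?h om * (1 - Q v om) ^ n) \<partial>M)"
  by (rule add_mono[OF occ_bounds(1)[OF gm gb v] occ_bounds(2)[OF hm hb v]])
 also have "\<dots> = (\<integral>\<^sup>+om. ennreal (?g om * (1 - (1 - Q v om) ^ n)) + ennreal (?h om * (1 - Q v om) ^ n) \<partial>M)"
  by (rule nn_integral_add[symmetric]) measurable
 also have "\<dots> \<le> (\<integral>\<^sup>+om. ennreal (exp (- \<bar>ln n - T v om\<bar>)) \<partial>M)"
 proof (rule nn_integral_mono_AE, use AE_Q in eventually_elim)
  case (elim om)
  let ?q = "Q v om"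
  have q: "?q = exp (- T v om)" "0 \<le> ?q" "?q \<le> 1"
   by (rule elim[rule_format], rule Q_bounds(1), rule Q_bounds(2))
  have nq: "real n * ?q = exp (ln n - T v om)" using n_pos by (simp add: q(1) exp_diff exp_minus field_simps)
  show ?case
  proof (cases "ln n < T v om")
   case True
   have "1 - (1 - ?q) ^ n \<le> real n * ?q" using Bernoulli_inequality[of "- ?q" n] q by simp
   then show ?thesis using True nq by (simp add: ennreal_leI)
  next
   case False
   have "(1 - ?q) ^ n \<le> (exp (- ?q)) ^ n" using exp_ge_add_one_self[of "- ?q"] q by (intro power_mono) auto
   also have "\<dots> = exp (- (real n * ?q))" by (simp add: exp_of_nat_mult[symmetric])
   also have "\<dots> \<le> exp (- (ln n - T v om))" unfolding nq
   proof -
    have "ln n - T v om \<le> exp (ln n - T v om)" using exp_ge_add_one_self[of "ln n - T v om"] by linarith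
    then show "exp (- exp (ln n - T v om)) \<le> exp (- (ln n - T v om))" by (simp only: exp_le_cancel_iff neg_le_iff_le)
   qed
   finally show ?thesis using False by (simp add: ennreal_leI)
  qed
 qed
 finally show ?thesis .
qed

lemma occupied_boxes_gsum: "ennreal (occupied_boxes n X m om) = gsum m (%v. if occ m v om then 1 else 0)"
proof -
 have sub: "{v. length v = m \<and> (\<exists>i<n. X i m om = v)} \<subseteq> (%i. X i m om) ` {..<n}"
 proof
  fix v assume "v \<in> {v. length v = m \<and> (\<exists>i<n. X i m om = v)}"
  then obtain i where "i < n" "v = X i m om" by auto
  then show "v \<in> (%i. X i m om) ` {..<n}" by (intro image_eqI[of _ _ i]) simp_all
 qed
 then have fin: "finite {v. length v = m \<and> (\<exists>i<n. X i m om = v)}" by (rule finite_subset) simp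
 have "gsum m (%v. if occ m v om then 1 else 0) = (\<integral>\<^sup>+v. indicator {v. length v = m \<and> (\<exists>i<n. X i m om = v)} v \<partial>count_space UNIV)"
  unfolding gsum_def
  by (subst nn_integral_count_space_indicator) ((rule nn_integral_cong, auto simp: indicator_def occ_def) | simp)+
 also have "\<dots> = of_nat (card {v. length v = m \<and> (\<exists>i<n. X i m om = v)})"
  using fin by (simp add: emeasure_count_space_finite)
 finally show ?thesis by (simp add: occupied_boxes_def ennreal_of_nat_eq_real_of_nat)
qed

text \<open>
  Summing the mismatch probabilities leaves the bump integral against \<open>lam m\<close>.
\<close>

lemma occupied_vs_below:
 "(\<integral>\<^sup>+om. ennreal \<bar>real (occupied_boxes n X m om) - enn2real (boxes_below m (ln n) om)\<bar> \<partial>M)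
  \<le> ennreal (I.bump_const * I.Vsum m (ln n) + 1)"
proof -
 have t: "0 \<le> ln (real n)" using n_pos by simp
 let ?d = "%om. gsum m (%v. if occ m v om \<noteq> (T v om \<le> ln n) then 1 else 0)"
 have fin: "AE om in M. boxes_below m (ln n) om \<noteq> \<infinity>"
  using level_sum_mean[of m m "ln n"] by (intro nn_integral_PInf_AE) (auto simp: boxes_below_level)
 have "(\<integral>\<^sup>+om. ennreal \<bar>real (occupied_boxes n X m om) - enn2real (boxes_below m (ln n) om)\<bar> \<partial>M) \<le> (\<integral>\<^sup>+om. ?d om \<partial>M)"
 proof (rule nn_integral_mono_AE, use fin in eventually_elim)
  case (elim om)
  let ?K = "real (occupied_boxes n X m om)" and ?B = "enn2real (boxes_below m (ln n) om)"
  have B: "boxes_below m (ln n) om = ennreal ?B" using elim by (simp add: less_top)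
  have "ennreal ?K \<le> boxes_below m (ln n) om + ?d om"
   unfolding occupied_boxes_gsum boxes_below_def gsum_add[symmetric] by (intro gsum_mono) (auto simp: indicator_def)
  then have 1: "ennreal ?K \<le> ennreal ?B + ?d om" by (simp only: B[symmetric])
  have "boxes_below m (ln n) om \<le> ennreal ?K + ?d om"
   unfolding occupied_boxes_gsum boxes_below_def gsum_add[symmetric] by (intro gsum_mono) (auto simp: indicator_def)
  then have 2: "ennreal ?B \<le> ennreal ?K + ?d om" by (simp only: B[symmetric])
  show ?case
  proof (cases "?d om = \<top>")
   case False
   then obtain d where d: "?d om = ennreal d" "0 \<le> d" by (cases "?d om") auto
   have "?K \<le> ?B + d" "?B \<le> ?K + d"
    using 1 2 d by (auto simp: ennreal_plus[symmetric] simp del: ennreal_plus)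
   then show ?thesis unfolding d by (intro ennreal_leI) auto
  qed simp
 qed
 also have "\<dots> = gsum m (%v. \<integral>\<^sup>+om. (if occ m v om \<noteq> (T v om \<le> ln n) then 1 else 0) \<partial>M)"
  by (rule gsum_nn_integral) measurable
 also have "\<dots> \<le> gsum m (%v. \<integral>\<^sup>+om. ennreal (exp (- \<bar>ln n - T v om\<bar>)) \<partial>M)"
  by (intro gsum_mono box_mismatch)
 also have "\<dots> = (\<integral>\<^sup>+om. gsum m (%v. ennreal (exp (- \<bar>ln n - T v om\<bar>))) \<partial>M)"
  by (rule gsum_nn_integral[symmetric]) measurable
 also have "\<dots> = (\<integral>\<^sup>+y. ennreal (exp (- \<bar>ln n - y\<bar>)) \<partial>I.lam m)"
  by (rule many_to_one[of "%y. ennreal (exp (- \<bar>ln n - y\<bar>))"]) measurable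
 also have "\<dots> \<le> ennreal (I.bump_const * I.Vsum m (ln n) + 1)" by (rule I.bump_lam[OF t])
 finally show ?thesis .
qed

lemma occupied_boxes_rv [measurable]: "(%om. real (occupied_boxes n X m om)) \<in> borel_measurable M"
proof -
 have "(%om. real (occupied_boxes n X m om)) = (%om. enn2real (gsum m (%v. if occ m v om then 1 else 0)))"
  unfolding occupied_boxes_gsum[symmetric] by simp
 then show ?thesis by simp
qed

text \<open>
  Combines both reductions: from occupied boxes to small displacements, and from there to the
  weights of the first generation.
\<close>

theorem occupied_vs_first_generation:
 assumes m: "1 \<le> m"
 shows "(\<integral>\<^sup>+om. ennreal \<bar>real (occupied_boxes n X m om) - smooth (m - 1) (ln n) (%r. A [] r om)\<bar> \<partial>M)
  \<le> ennreal (I.bump_const * I.Vsum m (ln n) + 1 + sqrt (C * (1 + ln n) * I.V (m - 1) (ln n) * I.Vsum (m - 1) (ln n)))"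
proof -
 have t: "0 \<le> ln (real n)" using n_pos by simp
 let ?s = "C * (1 + ln n) * I.V (m - 1) (ln n) * I.Vsum (m - 1) (ln n)"
 have s: "0 \<le> ?s" "0 \<le> I.Vsum m (ln n)" using C_nonneg t by (auto simp: I.Vsum_def intro!: mult_nonneg_nonneg sum_nonneg)
 let ?N = "%om. enn2real (boxes_below m (ln n) om)" and ?G = "%om. smooth (m - 1) (ln n) (%r. A [] r om)"
 have "(\<integral>\<^sup>+om. ennreal \<bar>real (occupied_boxes n X m om) - ?G om\<bar> \<partial>M)
  \<le> (\<integral>\<^sup>+om. ennreal \<bar>real (occupied_boxes n X m om) - ?N om\<bar> + ennreal \<bar>?N om - ?G om\<bar> \<partial>M)"
  by (intro nn_integral_mono) (auto simp: ennreal_plus[symmetric] simp del: ennreal_plus intro!: ennreal_leI)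
 also have "\<dots> = (\<integral>\<^sup>+om. ennreal \<bar>real (occupied_boxes n X m om) - ?N om\<bar> \<partial>M) + (\<integral>\<^sup>+om. ennreal \<bar>?N om - ?G om\<bar> \<partial>M)"
  by (rule nn_integral_add) measurable
 also have "\<dots> \<le> ennreal (I.bump_const * I.Vsum m (ln n) + 1) + ennreal (sqrt ?s)"
  by (intro add_mono occupied_vs_below nn_L1_le_L2 first_generation_dominates[OF t m] s) measurable
 also have "\<dots> = ennreal (I.bump_const * I.Vsum m (ln n) + 1 + sqrt ?s)"
  using s I.bump_const_nonneg by (intro ennreal_plus[symmetric]) auto
 finally show ?thesis .
qed

end

section \<open>Stick breaking as a perturbed random walk\<close>

text \<open>
  The factors \<open>W\<close> of stick breaking, with the moments that make the associated walk and its
  perturbation integrable.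
\<close>

locale stick_environment = prob_space M for M :: "'a measure" +
 fixes W :: "'a => real" and Ws :: "nat => 'a => real"
 assumes W_rv [measurable]: "W \<in> borel_measurable M"
  and W_range: "AE om in M. 0 < W om \<and> W om < 1"
  and Ws_indep: "indep_vars (%_. borel) Ws UNIV"
  and Ws_distr: "distr M borel (Ws r) = distr M borel W"
  and ln_W_sq: "integrable M (%om. (ln (W om))\<^sup>2)"
  and ln_1W: "integrable M (%om. \<bar>ln (1 - W om)\<bar>)"
begin

definition "xi0 r om = \<bar>ln (Ws r om)\<bar>"
definition "eta0 r om = \<bar>ln (1 - Ws r om)\<bar>"

lemma Ws_rv [measurable]: "Ws r \<in> borel_measurable M"
 using Ws_indep by (auto simp: indep_vars_def)

lemma Ws_integrable:
 fixes f :: "real => real"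
 assumes [measurable]: "f \<in> borel_measurable borel"
 shows "integrable M (%om. f (Ws r om)) \<longleftrightarrow> integrable M (%om. f (W om))"
  and "expectation (%om. f (Ws r om)) = expectation (%om. f (W om))"
proof -
 show "integrable M (%om. f (Ws r om)) \<longleftrightarrow> integrable M (%om. f (W om))"
  using integrable_distr_eq[OF Ws_rv[of r] assms] integrable_distr_eq[OF W_rv assms] by (simp add: Ws_distr)
 show "expectation (%om. f (Ws r om)) = expectation (%om. f (W om))"
  using integral_distr[OF Ws_rv[of r] assms] integral_distr[OF W_rv assms] by (simp add: Ws_distr)
qed

lemma AE_Ws: "AE om in M. \<forall>r. 0 < Ws r om \<and> Ws r om < 1"
proof -
 have "AE om in M. 0 < Ws r om \<and> Ws r om < 1" for r
 proof -
  have "AE x in distr M borel W. 0 < x \<and> x < 1" using W_range by (subst AE_distr_iff) auto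
  then have "AE x in distr M borel (Ws r). 0 < x \<and> x < 1" unfolding Ws_distr[of r] .
  then show ?thesis by (subst (asm) AE_distr_iff) auto
 qed
 then show ?thesis by (simp add: AE_all_countable)
qed

lemma abs_ln_W_sq: "integrable M (%om. \<bar>ln (W om)\<bar>\<^sup>2)" using ln_W_sq by simp

lemma abs_ln_W_integrable: "integrable M (%om. \<bar>ln (W om)\<bar>)"
 by (rule square_integrable_imp_integrable[OF _ abs_ln_W_sq]) measurable

lemma abs_ln_W_mean_pos: "0 < expectation (%om. \<bar>ln (W om)\<bar>)"
proof -
 have "expectation (%om. \<bar>ln (W om)\<bar>) \<noteq> 0"
 proof
  assume "expectation (%om. \<bar>ln (W om)\<bar>) = 0"
  then have "AE om in M. \<bar>ln (W om)\<bar> = 0"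
   using integral_nonneg_eq_0_iff_AE[OF abs_ln_W_integrable] by simp
  with W_range have "AE om in M. False"
   by eventually_elim auto
  then show False by simp
 qed
 moreover have "0 \<le> expectation (%om. \<bar>ln (W om)\<bar>)" by simp
 ultimately show ?thesis by linarith
qed

sublocale R: perturbed_walk M xi0 eta0
proof
 have m: "(\<lambda>x::real. (\<bar>ln x\<bar>, \<bar>ln (1 - x)\<bar>)) \<in> borel \<rightarrow>\<^sub>M borel2" by measurable
 show "indep_vars (%_. borel2) (%r om. (xi0 r om, eta0 r om)) UNIV"
  unfolding xi0_def eta0_def using indep_vars_compose2[OF Ws_indep, of "%_ x. (\<bar>ln x\<bar>, \<bar>ln (1 - x)\<bar>)" "%_. borel2"] m by simp
 have d: "distr M borel2 (%om. (xi0 r om, eta0 r om)) = distr (distr M borel W) borel2 (%x. (\<bar>ln x\<bar>, \<bar>ln (1 - x)\<bar>))" for r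
  unfolding Ws_distr[of r, symmetric] by (subst distr_distr[OF m Ws_rv]) (simp add: xi0_def eta0_def comp_def)
 show "distr M borel2 (%om. (xi0 r om, eta0 r om)) = distr M borel2 (%om. (xi0 0 om, eta0 0 om))" for r
  by (simp only: d)
 show "integrable M (%om. (xi0 0 om)\<^sup>2)"
  unfolding xi0_def using Ws_integrable(1)[of "%x. \<bar>ln x\<bar>\<^sup>2" 0] abs_ln_W_sq by simp
 show "integrable M (eta0 0)"
  unfolding eta0_def[abs_def] using Ws_integrable(1)[of "%x. \<bar>ln (1 - x)\<bar>" 0] ln_1W by simp
 show "0 < expectation (xi0 0)"
  unfolding xi0_def[abs_def] using Ws_integrable(2)[of "%x. \<bar>ln x\<bar>" 0] abs_ln_W_mean_pos by simp
qed (auto simp: xi0_def eta0_def)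

definition "env = distr M (Pi\<^sub>M UNIV (%_. borel)) (%om. stick_breaking (%r. Ws r om))"

lemma stick_rv [measurable]: "(%om. stick_breaking (%r. Ws r om)) \<in> M \<rightarrow>\<^sub>M Pi\<^sub>M UNIV (%_. borel)"
 unfolding stick_breaking_def[abs_def] by (intro measurable_PiM_single') auto

lemma sets_env0 [measurable_cong]: "sets env = sets (Pi\<^sub>M UNIV (%_. borel))" by (simp add: env_def)

text \<open>
  The product \<open>W_1 ... W_r\<close> is \<open>exp (- S r)\<close>, which tends to zero, so the telescoping sum of the
  pieces is one.
\<close>

lemma AE_stick:
 "AE om in M. (\<forall>r. stick_breaking (%r. Ws r om) r = exp (- R.T r om)) \<and> stick_breaking (%r. Ws r om) sums 1"
proof -
 have fin: "AE om in M. \<forall>t::nat. finite {r. R.S r om \<le> real t}"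
  using R.AE_finite_nu by (simp add: AE_all_countable)
 from AE_Ws fin show ?thesis
 proof eventually_elim
  case (elim om)
  have prodW: "(\<Prod>i<r. Ws i om) = exp (- R.S r om)" for r
   using elim by (simp add: R.S_def xi0_def sum_negf[symmetric] exp_sum abs_if ln_less_zero)
  have st: "stick_breaking (%r. Ws r om) r = exp (- R.T r om)" for r
  proof -
   have "exp (- eta0 r om) = 1 - Ws r om" using elim(1)[rule_format, of r] by (simp add: eta0_def abs_if ln_less_zero)
   moreover have "exp (- (R.S r om + eta0 r om)) = exp (- R.S r om) * exp (- eta0 r om)" by (simp add: exp_add[symmetric])
   ultimately show ?thesis unfolding stick_breaking_def prodW R.T_def by simp
  qed
  have partial: "(\<Sum>r<k. stick_breaking (%r. Ws r om) r) = 1 - exp (- R.S k om)" for k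
  proof -
   have "(\<Sum>r<k. stick_breaking (%r. Ws r om) r) = 1 - (\<Prod>i<k. Ws i om)"
    by (induction k) (auto simp: stick_breaking_def algebra_simps)
   then show ?thesis by (simp add: prodW)
  qed
  have "filterlim (%k. R.S k om) at_top sequentially"
   unfolding filterlim_at_top
  proof
   fix Z :: real
   obtain t :: nat where t: "Z \<le> real t" using real_arch_simple by blast
   have "finite {r. R.S r om \<le> real t}" using elim(2) by blast
   then have "eventually (%r. \<not> R.S r om \<le> real t) sequentially"
    by (simp add: eventually_cofinite[symmetric] cofinite_eq_sequentially[symmetric] eventually_cofinite)
   then show "eventually (%r. Z \<le> R.S r om) sequentially" by eventually_elim (use t in auto)
  qed
  then have "(%k. exp (- R.S k om)) \<longlonglongrightarrow> 0"
   by (intro filterlim_compose[OF exp_at_bot] filterlim_compose[OF filterlim_uminus_at_bot_at_top]) 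
  then have "(%k. 1 - exp (- R.S k om)) \<longlonglongrightarrow> 1 - 0" by (intro tendsto_intros)
  then show ?case using st unfolding sums_def partial by simp
 qed
qed

lemma nn_integral_env0:
 assumes [measurable]: "f \<in> borel_measurable borel"
 shows "(\<integral>\<^sup>+x. f x \<partial>env_intensity env) = (\<integral>\<^sup>+om. (\<Sum>r. f (R.T r om)) \<partial>M)"
proof -
 have "(\<integral>\<^sup>+x. f x \<partial>env_intensity env) = (\<integral>\<^sup>+p. (\<Sum>r. f (- ln (p r))) \<partial>env)"
  by (rule nn_integral_env_intensity[OF sets_env0]) measurable
 also have "\<dots> = (\<integral>\<^sup>+om. (\<Sum>r. f (- ln (stick_breaking (%r. Ws r om) r))) \<partial>M)"
  unfolding env_def by (rule nn_integral_distr[OF stick_rv]) measurable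
 also have "\<dots> = (\<integral>\<^sup>+om. (\<Sum>r. f (R.T r om)) \<partial>M)"
  by (rule nn_integral_cong_AE, use AE_stick in eventually_elim) simp
 finally show ?thesis .
qed

lemma intensity_Iic:
 assumes t: "0 \<le> t"
 shows "emeasure (env_intensity env) {..t} = ennreal (expectation (%om. real (R.cnt t om)))"
proof -
 have "emeasure (env_intensity env) {..t} = (\<integral>\<^sup>+x. indicator {..t} x \<partial>env_intensity env)"
  by (rule nn_integral_indicator[symmetric]) (simp add: env_intensity_def)
 also have "\<dots> = (\<integral>\<^sup>+om. (\<Sum>r. indicator {..t} (R.T r om)) \<partial>M)" by (rule nn_integral_env0) measurable
 also have "\<dots> = (\<integral>\<^sup>+om. ennreal (R.cnt t om) \<partial>M)"
  by (rule nn_integral_cong_AE, use R.AE_finite_nu[of t] in eventually_elim) (rule R.ennreal_cnt)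
 also have "\<dots> = ennreal (expectation (%om. real (R.cnt t om)))"
  by (rule nn_integral_eq_integral[OF R.cnt_integrable[OF t]]) simp
 finally show ?thesis .
qed

sublocale I: linear_intensity "env_intensity env" R.mean_const R.mu "2 * R.visit_const"
proof
 show s: "sets (env_intensity env) = sets borel" by (simp add: env_intensity_def)
 have em: "emeasure (env_intensity env) B = (\<integral>\<^sup>+om. (\<Sum>r. indicator B (R.T r om)) \<partial>M)" if [measurable]: "B \<in> sets borel" for B
 proof -
  have "emeasure (env_intensity env) B = (\<integral>\<^sup>+x. indicator B x \<partial>env_intensity env)"
   by (rule nn_integral_indicator[symmetric]) (simp add: s)
  also have "\<dots> = (\<integral>\<^sup>+om. (\<Sum>r. indicator B (R.T r om)) \<partial>M)" by (rule nn_integral_env0) measurable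
  finally show ?thesis .
 qed
 have "0 \<le> R.T r om" for r om using R.T_ge_S[of r om] R.S_nonneg[of r om] by simp
 then have "(\<Sum>r. indicator {..<0} (R.T r om)) = (0::ennreal)" for om by (simp add: not_less)
 then show "emeasure (env_intensity env) {..<0} = 0" by (simp add: em)
 show "emeasure (env_intensity env) {..t} \<le> ennreal ((t + R.mean_const) / R.mu)" if "0 \<le> t" for t
  unfolding intensity_Iic[OF that] using R.cnt_mean_bounds(2)[OF that] R.mu_pos by (intro ennreal_leI) (simp add: field_simps)
 show "ennreal ((t - R.mean_const) / R.mu) \<le> emeasure (env_intensity env) {..t}" if "0 \<le> t" for t
  unfolding intensity_Iic[OF that] using R.cnt_mean_bounds(1)[OF that] R.mu_pos by (intro ennreal_leI) (simp add: field_simps)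
 show "emeasure (env_intensity env) {a..a + 1} \<le> ennreal (2 * R.visit_const)" for a
  unfolding em[OF atLeastAtMost_borel] by (rule R.T_window_nn)
 have "(\<integral>\<^sup>+x. ennreal (exp (- x)) \<partial>env_intensity env) = (\<integral>\<^sup>+om. (\<Sum>r. ennreal (exp (- R.T r om))) \<partial>M)"
  by (rule nn_integral_env0) measurable
 also have "\<dots> = (\<integral>\<^sup>+om. 1 \<partial>M)"
 proof (rule nn_integral_cong_AE, use AE_stick in eventually_elim)
  case (elim om)
  then have "stick_breaking (%r. Ws r om) = (%r. exp (- R.T r om))" by auto
  with elim have "(%r. exp (- R.T r om)) sums 1" by metis
  then have "(\<Sum>r. ennreal (exp (- R.T r om))) = ennreal 1" by (intro suminf_ennreal_eq) simp
  then show ?case by (simp only: ennreal_1)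
 qed
 finally show "(\<integral>\<^sup>+x. ennreal (exp (- x)) \<partial>env_intensity env) \<le> 1" by (simp add: emeasure_space_1)
qed (auto simp: R.mu_pos R.mean_const_nonneg R.visit_const_nonneg)

lemma env_tree_facts:
 shows "AE p in env. \<forall>r. 0 < p r" "AE p in env. p sums 1"
  and "0 \<le> t ==> (\<integral>\<^sup>+p. ennreal ((real (card {r. - ln (p r) \<le> t}) - measure (env_intensity env) {..t})\<^sup>2) \<partial>env)
     \<le> ennreal (R.cnt_const * (1 + t))"
proof -
 let ?P = "\<lambda>p :: nat => real. (\<forall>r. 0 < p r) \<and> (\<Sum>r. ennreal (p r)) = 1"
 have m: "{p \<in> space (Pi\<^sub>M UNIV (%_. borel)). ?P p} \<in> sets (Pi\<^sub>M (UNIV :: nat set) (%_. borel))" by measurable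
 have "AE om in M. ?P (stick_breaking (%r. Ws r om))"
  using AE_stick
 proof eventually_elim
  case (elim om)
  then have pos: "0 < stick_breaking (%r. Ws r om) r" for r by simp
  have "(\<Sum>r. ennreal (stick_breaking (%r. Ws r om) r)) = ennreal 1"
   by (rule suminf_ennreal_eq[OF less_imp_le[OF pos]]) (use elim in blast)
  with pos show ?case by (simp only: ennreal_1 simp_thms)
 qed
 then have ae: "AE p in env. ?P p" unfolding env_def by (subst AE_distr_iff[OF stick_rv m])
 then show "AE p in env. \<forall>r. 0 < p r" by eventually_elim blast
 from ae show "AE p in env. p sums 1"
 proof eventually_elim
  case (elim p)
  then show ?case using sums_of_suminf_ennreal[of p] by (simp add: less_imp_le)
 qed
 assume t: "0 \<le> t"
 have [measurable]: "(%p. real (card {r. - ln (p r) \<le> t})) \<in> borel_measurable (Pi\<^sub>M (UNIV :: nat set) (%_. borel))"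
  by measurable
 have me: "measure (env_intensity env) {..t} = expectation (%om. real (R.cnt t om))"
  unfolding measure_def intensity_Iic[OF t] by simp
 have "(\<integral>\<^sup>+p. ennreal ((real (card {r. - ln (p r) \<le> t}) - measure (env_intensity env) {..t})\<^sup>2) \<partial>env)
  = (\<integral>\<^sup>+om. ennreal ((real (card {r. - ln (stick_breaking (%r. Ws r om) r) \<le> t}) - measure (env_intensity env) {..t})\<^sup>2) \<partial>M)"
  unfolding env_def by (rule nn_integral_distr[OF stick_rv]) measurable
 also have "\<dots> = (\<integral>\<^sup>+om. ennreal ((real (R.cnt t om) - expectation (%om. real (R.cnt t om)))\<^sup>2) \<partial>M)"
  unfolding me by (rule nn_integral_cong_AE, use AE_stick in eventually_elim) (simp add: R.cnt_def)
 also have "\<dots> \<le> ennreal (R.cnt_const * (1 + t))" by (rule R.cnt_L2[OF t])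
 finally show "(\<integral>\<^sup>+p. ennreal ((real (card {r. - ln (p r) \<le> t}) - measure (env_intensity env) {..t})\<^sup>2) \<partial>env)
     \<le> ennreal (R.cnt_const * (1 + t))" .
qed

end

section \<open>The main term and the growth of the intensities\<close>

context stick_environment begin

definition first_gen :: "nat => real => 'a => real" where
 "first_gen k x om = enn2real (\<Sum>r. ennreal (I.V k (x - R.T r om)))"

lemma first_gen_rv [measurable]: "first_gen k x \<in> borel_measurable M"
 unfolding first_gen_def[abs_def] by measurable

text \<open>
  The linearized count is integrated against \<open>lam k\<close>. The linear part gives \<open>V (Suc k)\<close> up to the bounded
  error of the mean, and each centred step \<open>xi0 r - mu\<close>, which is present for the levels \<open>s \<ge> mu r\<close>, gets the
  weight \<open>V k (x - mu r)\<close>.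
\<close>

lemma main_term:
 assumes x: "0 \<le> x"
 shows "(\<integral>\<^sup>+om. ennreal \<bar>first_gen k x om - I.V (Suc k) x +
    (\<Sum>r<nat \<lfloor>x / R.mu\<rfloor> + 1. (xi0 r om - R.mu) * I.V k (x - R.mu * r)) / R.mu\<bar> \<partial>M)
  \<le> ennreal ((R.lin_const * sqrt (sqrt (1 + x)) + R.mean_const / R.mu) * I.V k x)"
proof -
 interpret lk: sigma_finite_measure "I.lam k" by (rule I.sigma_finite_lam)
 interpret P: pair_sigma_finite M "I.lam k" ..
 have mu: "0 < R.mu" by (rule R.mu_pos)
 define K where "K = nat \<lfloor>x / R.mu\<rfloor> + 1"
 define b where "b om s = s / R.mu - (\<Sum>r<K. (xi0 r om - R.mu) * (if R.mu * r \<le> s then 1 else 0)) / R.mu" for om s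
 have b_lin: "b om s = s / R.mu - R.lin s om / R.mu" if s: "0 \<le> s" "s \<le> x" for om s
 proof -
  have "(\<Sum>r<K. (xi0 r om - R.mu) * (if R.mu * r \<le> s then 1 else 0)) = (\<Sum>r\<in>{..<K} \<inter> {r. R.mu * r \<le> s}. xi0 r om - R.mu)"
   by (subst sum.inter_restrict) (auto intro!: sum.cong)
  also have "{..<K} \<inter> {r. R.mu * r \<le> s} = {..<nat \<lfloor>s / R.mu\<rfloor> + 1}"
  proof (rule set_eqI)
   fix r :: nat
   have "R.mu * r \<le> s \<longleftrightarrow> real r \<le> s / R.mu" using mu by (simp add: field_simps)
   also have "\<dots> \<longleftrightarrow> r \<le> nat \<lfloor>s / R.mu\<rfloor>"
    using s mu by (simp add: le_nat_iff le_floor_iff)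
   finally have 1: "R.mu * r \<le> s \<longleftrightarrow> r < nat \<lfloor>s / R.mu\<rfloor> + 1" by auto
   have "nat \<lfloor>s / R.mu\<rfloor> \<le> nat \<lfloor>x / R.mu\<rfloor>" using s mu by (intro nat_mono floor_mono divide_right_mono) auto
   then show "r \<in> {..<K} \<inter> {r. R.mu * r \<le> s} \<longleftrightarrow> r \<in> {..<nat \<lfloor>s / R.mu\<rfloor> + 1}" using 1 by (auto simp: K_def)
  qed
  finally show ?thesis by (simp add: b_def R.lin_def)
 qed
 have [measurable]: "b om \<in> borel_measurable borel" for om unfolding b_def by measurable
 have [measurable]: "(%(om, y). b om (x - y)) \<in> borel_measurable (M \<Otimes>\<^sub>M I.lam k)"
  unfolding b_def xi0_def by measurable
 have "R.cnt (x - y) om = enn2real (\<Sum>r. if R.T r om \<le> x - y then 1 else 0)" for y om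
  unfolding R.cnt_def card_eq_enn2real_suminf by (intro arg_cong[where f=enn2real] suminf_cong) auto
 then have [measurable]: "(%(om, y). real (R.cnt (x - y) om)) \<in> borel_measurable (M \<Otimes>\<^sub>M I.lam k)"
  by (simp only:) measurable
 have ind: "integrable (I.lam k) (indicator {..z} :: real => real)" for z
  using I.lam_finite[of k z] by (intro integrable_real_indicator) (auto simp: less_top)
 have int_ind: "(\<integral>y. indicator {..z} y \<partial>I.lam k) = I.V k z" for z
  by (simp add: I.V_def)
 have lin_i: "integrable (I.lam k) (%y. (x - y) * indicator {..x} y)"
 proof (rule Bochner_Integration.integrable_bound[OF integrable_mult_right[OF ind[of x], of x]])
  show "AE y in I.lam k. norm ((x - y) * indicator {..x} y) \<le> norm (x * indicator {..x} y)"
   using I.AE_lam_nonneg[of k] by eventually_elim (auto simp: indicator_def)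
 qed measurable
 have b_split: "b om (x - y) * indicator {..x} y = ((x - y) * indicator {..x} y) / R.mu
   - (\<Sum>r<K. (xi0 r om - R.mu) * indicator {..x - R.mu * r} y) / R.mu" for om y
 proof -
  have "(if R.mu * real r \<le> x - y then 1 else 0) * indicator {..x} y = (indicator {..x - R.mu * r} y :: real)" for r
   using mu by (auto simp: indicator_def algebra_simps) (smt (verit) mult_nonneg_nonneg of_nat_0_le_iff)
  then show ?thesis
   by (simp add: b_def left_diff_distrib sum_distrib_right mult.assoc)
 qed
 have b_int: "integrable (I.lam k) (%y. b om (x - y) * indicator {..x} y)" for om
  unfolding b_split using lin_i ind by (intro Bochner_Integration.integrable_diff integrable_divide Bochner_Integration.integrable_sum integrable_mult_right) auto
 have b_val: "(\<integral>y. b om (x - y) * indicator {..x} y \<partial>I.lam k) =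
   (\<integral>y. (x - y) * indicator {..x} y \<partial>I.lam k) / R.mu - (\<Sum>r<K. (xi0 r om - R.mu) * I.V k (x - R.mu * r)) / R.mu" for om
 proof -
  have each: "integrable (I.lam k) (%y. (xi0 r om - R.mu) * indicator {..x - R.mu * r} y)" for r :: nat
   by (intro integrable_mult_right ind)
  have si: "integrable (I.lam k) (%y. \<Sum>r<K. (xi0 r om - R.mu) * indicator {..x - R.mu * r} y)"
   by (intro Bochner_Integration.integrable_sum each)
  have sv: "(\<integral>y. (\<Sum>r<K. (xi0 r om - R.mu) * indicator {..x - R.mu * r} y) \<partial>I.lam k)
   = (\<Sum>r<K. (xi0 r om - R.mu) * I.V k (x - R.mu * r))"
   by (subst Bochner_Integration.integral_sum[OF each]) (simp only: integral_mult_right_zero int_ind)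
  let ?g = "%y. \<Sum>r<K. (xi0 r om - R.mu) * indicator {..x - R.mu * r} y"
  have "(\<integral>y. b om (x - y) * indicator {..x} y \<partial>I.lam k) = (\<integral>y. ((x - y) * indicator {..x} y) / R.mu - ?g y / R.mu \<partial>I.lam k)"
   by (rule Bochner_Integration.integral_cong[OF refl b_split])
  also have "\<dots> = (\<integral>y. ((x - y) * indicator {..x} y) / R.mu \<partial>I.lam k) - (\<integral>y. ?g y / R.mu \<partial>I.lam k)"
   by (rule Bochner_Integration.integral_diff[OF integrable_divide[OF lin_i] integrable_divide[OF si]])
  also have "(\<integral>y. ((x - y) * indicator {..x} y) / R.mu \<partial>I.lam k) = (\<integral>y. (x - y) * indicator {..x} y \<partial>I.lam k) / R.mu"
   by (rule integral_divide_zero)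
  also have "(\<integral>y. ?g y / R.mu \<partial>I.lam k) = (\<Sum>r<K. (xi0 r om - R.mu) * I.V k (x - R.mu * r)) / R.mu"
   unfolding sv[symmetric] by (rule integral_divide_zero)
  finally show ?thesis .
 qed
 have V1b: "\<bar>I.V 1 s - s / R.mu\<bar> \<le> R.mean_const / R.mu" if s: "0 \<le> s" for s
 proof -
  define E where "E = expectation (%om. real (R.cnt s om))"
  have "ennreal (I.V 1 s) = ennreal E" unfolding I.V1_L[symmetric] E_def by (rule intensity_Iic[OF s])
  moreover have "0 \<le> E" unfolding E_def by (rule Bochner_Integration.integral_nonneg) simp
  ultimately have V: "I.V 1 s = E" by (subst (asm) ennreal_inj) (auto simp: I.V_nonneg)
  have "\<bar>R.mu * E - s\<bar> \<le> R.mean_const"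
   using R.cnt_mean_bounds[OF s] unfolding E_def[symmetric] by linarith
  then have "\<bar>R.mu * E - s\<bar> / R.mu \<le> R.mean_const / R.mu"
   by (rule divide_right_mono) (rule less_imp_le[OF mu])
  moreover have "E - s / R.mu = (R.mu * E - s) / R.mu" using mu by (simp add: field_simps)
  then have "\<bar>E - s / R.mu\<bar> = \<bar>R.mu * E - s\<bar> / R.mu" using mu by (simp only: abs_divide abs_of_pos)
  ultimately show ?thesis unfolding V by simp
 qed
 have center: "\<bar>I.V (Suc k) x - (\<integral>y. (x - y) * indicator {..x} y \<partial>I.lam k) / R.mu\<bar> \<le> R.mean_const / R.mu * I.V k x"
 proof -
  have diff: "I.V (Suc k) x - (\<integral>y. (x - y) * indicator {..x} y \<partial>I.lam k) / R.mu
   = (\<integral>y. I.V 1 (x - y) * indicator {..x} y - (x - y) * indicator {..x} y / R.mu \<partial>I.lam k)"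
   unfolding Bochner_Integration.integral_diff[OF I.V1_smoothing(1)[of k x] integrable_divide[OF lin_i]]
    I.V1_smoothing(2) integral_divide_zero ..
  have "\<bar>I.V (Suc k) x - (\<integral>y. (x - y) * indicator {..x} y \<partial>I.lam k) / R.mu\<bar> \<le> (\<integral>y. \<bar>I.V 1 (x - y) * indicator {..x} y - (x - y) * indicator {..x} y / R.mu\<bar> \<partial>I.lam k)"
   unfolding diff by (rule integral_abs_bound)
  also have "\<dots> \<le> (\<integral>y. R.mean_const / R.mu * indicator {..x} y \<partial>I.lam k)"
  proof (rule integral_mono)
   show "integrable (I.lam k) (%y. \<bar>I.V 1 (x - y) * indicator {..x} y - (x - y) * indicator {..x} y / R.mu\<bar>)"
    by (rule integrable_abs[OF Bochner_Integration.integrable_diff[OF I.V1_smoothing(1) integrable_divide[OF lin_i]]])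
   show "integrable (I.lam k) (%y. R.mean_const / R.mu * indicator {..x} y)" by (rule integrable_mult_right[OF ind])
   show "\<bar>I.V 1 (x - y) * indicator {..x} y - (x - y) * indicator {..x} y / R.mu\<bar> \<le> R.mean_const / R.mu * indicator {..x} y" for y
   proof (cases "y \<le> x")
    case True
    have i1: "indicator {..x} y = (1 :: real)" using True by simp
    have "0 \<le> x - y" using True by simp
    from V1b[OF this] show ?thesis unfolding i1 mult_1_right .
   next
    case False
    have i0: "indicator {..x} y = (0 :: real)" using False by simp
    show ?thesis unfolding i0 mult_zero_right by simp
   qed
  qed
  also have "\<dots> = R.mean_const / R.mu * I.V k x" by (simp only: integral_mult_right_zero int_ind)
  finally show ?thesis .
 qed
 let ?e = "%om y. ennreal \<bar>real (R.cnt (x - y) om) - b om (x - y)\<bar> * indicator {..x} y"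
 have fin: "AE om in M. \<forall>t::nat. finite {r. R.S r om \<le> real t}"
  using R.AE_finite_nu by (simp add: AE_all_countable)
 have "(\<integral>\<^sup>+om. ennreal \<bar>first_gen k x om - I.V (Suc k) x +
    (\<Sum>r<K. (xi0 r om - R.mu) * I.V k (x - R.mu * r)) / R.mu\<bar> \<partial>M)
  \<le> (\<integral>\<^sup>+om. (\<integral>\<^sup>+y. ?e om y \<partial>I.lam k) + ennreal (R.mean_const / R.mu * I.V k x) \<partial>M)"
 proof (rule nn_integral_mono_AE, use fin in eventually_elim)
  case (elim om)
  have tt: "0 \<le> R.T r om" for r using R.T_ge_S[of r om] R.S_nonneg[of r om] by simp
  have f: "finite {r. R.T r om \<le> s}" for s
  proof -
   obtain t :: nat where "s \<le> real t" using real_arch_simple by blast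
   then have "{r. R.T r om \<le> s} \<subseteq> {r. R.S r om \<le> real t}" using R.T_ge_S[of _ om] by (auto intro: order_trans)
   then show ?thesis using elim finite_subset by blast
  qed
  have 1: "ennreal \<bar>first_gen k x om - (\<integral>y. b om (x - y) * indicator {..x} y \<partial>I.lam k)\<bar> \<le> (\<integral>\<^sup>+y. ?e om y \<partial>I.lam k)"
   unfolding first_gen_def R.cnt_def by (rule I.smoothing_diff(2)[OF tt f b_int])
  have "\<bar>first_gen k x om - I.V (Suc k) x + (\<Sum>r<K. (xi0 r om - R.mu) * I.V k (x - R.mu * r)) / R.mu\<bar>
   \<le> \<bar>first_gen k x om - (\<integral>y. b om (x - y) * indicator {..x} y \<partial>I.lam k)\<bar> + R.mean_const / R.mu * I.V k x"
   using center unfolding b_val[of om] by linarith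
  then have "ennreal \<bar>first_gen k x om - I.V (Suc k) x + (\<Sum>r<K. (xi0 r om - R.mu) * I.V k (x - R.mu * r)) / R.mu\<bar>
   \<le> ennreal (\<bar>first_gen k x om - (\<integral>y. b om (x - y) * indicator {..x} y \<partial>I.lam k)\<bar> + R.mean_const / R.mu * I.V k x)"
   by (rule ennreal_leI)
  also have "\<dots> = ennreal \<bar>first_gen k x om - (\<integral>y. b om (x - y) * indicator {..x} y \<partial>I.lam k)\<bar> + ennreal (R.mean_const / R.mu * I.V k x)"
   using R.mean_const_nonneg mu by (intro ennreal_plus) auto
  also have "\<dots> \<le> (\<integral>\<^sup>+y. ?e om y \<partial>I.lam k) + ennreal (R.mean_const / R.mu * I.V k x)" using 1 by (rule add_right_mono)
  finally show ?case .
 qed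
 also have "\<dots> = (\<integral>\<^sup>+om. \<integral>\<^sup>+y. ?e om y \<partial>I.lam k \<partial>M) + ennreal (R.mean_const / R.mu * I.V k x)"
  by (subst nn_integral_add) (auto simp: emeasure_space_1)
 also have "(\<integral>\<^sup>+om. \<integral>\<^sup>+y. ?e om y \<partial>I.lam k \<partial>M) = (\<integral>\<^sup>+y. \<integral>\<^sup>+om. ?e om y \<partial>M \<partial>I.lam k)"
  by (rule P.Fubini'[symmetric]) measurable
 finally have step: "(\<integral>\<^sup>+om. ennreal \<bar>first_gen k x om - I.V (Suc k) x +
    (\<Sum>r<K. (xi0 r om - R.mu) * I.V k (x - R.mu * r)) / R.mu\<bar> \<partial>M)
  \<le> (\<integral>\<^sup>+y. \<integral>\<^sup>+om. ?e om y \<partial>M \<partial>I.lam k) + ennreal (R.mean_const / R.mu * I.V k x)" .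
 have "(\<integral>\<^sup>+y. \<integral>\<^sup>+om. ?e om y \<partial>M \<partial>I.lam k) \<le> (\<integral>\<^sup>+y. ennreal (R.lin_const * sqrt (sqrt (1 + x))) * indicator {..x} y \<partial>I.lam k)"
 proof (rule nn_integral_mono_AE, use I.AE_lam_nonneg[of k] in eventually_elim)
  case (elim y)
  show ?case
  proof (cases "y \<le> x")
   case True
   then have s: "0 \<le> x - y" "x - y \<le> x" using elim by auto
   have "(\<integral>\<^sup>+om. ?e om y \<partial>M) = (\<integral>\<^sup>+om. ennreal \<bar>real (R.cnt (x - y) om) - (x - y) / R.mu + R.lin (x - y) om / R.mu\<bar> \<partial>M)"
    using True by (intro nn_integral_cong) (simp add: b_lin[OF s] algebra_simps)
   also have "\<dots> \<le> ennreal (R.lin_const * sqrt (sqrt (1 + (x - y))))" by (rule R.cnt_linearization[OF s(1)])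
   also have "\<dots> \<le> ennreal (R.lin_const * sqrt (sqrt (1 + x)))"
    using elim R.lin_const_nonneg by (intro ennreal_leI mult_left_mono) auto
   finally show ?thesis using True by simp
  qed simp
 qed
 also have "\<dots> = ennreal (R.lin_const * sqrt (sqrt (1 + x))) * ennreal (I.V k x)"
  by (simp add: nn_integral_cmult I.V_emeasure)
 finally have "(\<integral>\<^sup>+om. ennreal \<bar>first_gen k x om - I.V (Suc k) x +
    (\<Sum>r<K. (xi0 r om - R.mu) * I.V k (x - R.mu * r)) / R.mu\<bar> \<partial>M)
  \<le> ennreal (R.lin_const * sqrt (sqrt (1 + x))) * ennreal (I.V k x) + ennreal (R.mean_const / R.mu * I.V k x)"
  using step by (meson add_right_mono order_trans)
 also have "\<dots> = ennreal ((R.lin_const * sqrt (sqrt (1 + x)) + R.mean_const / R.mu) * I.V k x)"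
 proof -
  have "0 \<le> R.lin_const * sqrt (sqrt (1 + x))" "0 \<le> R.mean_const / R.mu" "0 \<le> I.V k x"
   using x R.lin_const_nonneg R.mean_const_nonneg mu by auto
  moreover have "ennreal p * ennreal v + ennreal (q * v) = ennreal ((p + q) * v)" if "0 \<le> p" "0 \<le> q" "0 \<le> v" for p q v :: real
   using that by (simp add: distrib_right ennreal_plus ennreal_mult)
  ultimately show ?thesis by blast
 qed
 finally show ?thesis unfolding K_def .
qed

end

context linear_intensity begin

lemma tau_ratio:
 assumes t: "0 < t" and s: "0 \<le> t + s"
 shows "tau k (t + s) = tau k t * (1 + s / t) ^ k"
proof -
 have "(t + s) / mu = t / mu * (1 + s / t)" using t mu_pos by (simp add: field_simps)
 then have "((t + s) / mu) ^ k = (t / mu) ^ k * (1 + s / t) ^ k" by (simp only: power_mult_distrib)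
 then show ?thesis
  unfolding tau_eq[OF s] tau_eq[OF less_imp_le[OF t]] by (simp only: times_divide_eq_left)
qed

text \<open>
  From \<open>1 + y \<le> exp y\<close>: the profile of the intensity below \<open>t\<close> is at most exponential with rate \<open>k / t\<close>.
\<close>

lemma V_upper_exp:
 assumes t: "0 < t"
 shows "V k (t - s) \<le> tau k t * exp (real k * (c * k - s) / t)"
proof (cases "0 \<le> t - s")
 case False
 then show ?thesis by (simp add: V_neg)
next
 case True
 have "0 \<le> c * k" using c_nonneg by simp
 then have nn: "0 \<le> t + (c * k - s)" using True by linarith
 have "V k (t - s) \<le> tau k (t + (c * k - s))" using V_upper[OF True, of k] by (simp add: algebra_simps)
 also have "\<dots> = tau k t * (1 + (c * k - s) / t) ^ k" by (rule tau_ratio[OF t nn])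
 also have "\<dots> \<le> tau k t * exp ((c * k - s) / t) ^ k"
 proof (intro mult_left_mono power_mono)
  have "1 + (c * k - s) / t = (t + (c * k - s)) / t" using t by (simp add: field_simps)
  then show "0 \<le> 1 + (c * k - s) / t" using nn t by simp
 qed (auto simp: exp_ge_add_one_self)
 also have "exp ((c * k - s) / t) ^ k = exp (real k * (c * k - s) / t)" by (simp add: exp_of_nat_mult[symmetric])
 finally show ?thesis .
qed

lemma V_lower_power:
 assumes t: "0 < t" and s: "0 \<le> s" "s + c * k \<le> t"
 shows "tau k t * (1 - (s + c * k) / t) ^ k \<le> V k (t - s)"
proof -
 have ck: "0 \<le> c * k" using c_nonneg by simp
 have "tau k (t + - (s + c * k)) = tau k t * (1 + - (s + c * k) / t) ^ k" by (rule tau_ratio[OF t]) (use s in simp)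
 moreover have "tau k (t - s - c * k) \<le> V k (t - s)" using s ck by (intro V_lower) simp
 ultimately show ?thesis by (simp add: algebra_simps diff_divide_distrib add_divide_distrib)
qed

lemma exp_le_two: "x \<le> 1 / 2 ==> exp x \<le> (2::real)"
 using exp_half_le2 by (meson exp_le_cancel_iff order_trans)

lemma exp_le_linear: "0 \<le> y ==> y \<le> 1 / 2 ==> exp y \<le> 1 + 2 * y" for y :: real
 using exp_bound_lemma[of y] by simp

context
 fixes t :: real and m :: nat
 assumes t: "0 < t" and good: "2 * c * (real m)\<^sup>2 \<le> t" "2 * mu * real m \<le> t"
begin

text \<open>
  As long as \<open>2 c m^2 \<le> t\<close>, the shift by \<open>c i\<close> costs at most a factor of two. Under the second
  bound, consecutive \<open>tau\<close> differ by a factor of at least two, so sums over generations are dominated by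
  their last term.
\<close>

lemma V_le_2tau: assumes "i \<le> m" shows "V i t \<le> 2 * tau i t"
proof -
 have i2: "real i * real i \<le> (real m)\<^sup>2" using assms by (simp add: power2_eq_square mult_mono)
 have "c * (real i * real i) \<le> c * (real m)\<^sup>2" using i2 c_nonneg by (rule mult_left_mono)
 then have "real i * (c * i - 0) / t \<le> 1 / 2" using good(1) t by (simp add: field_simps)
 from exp_le_two[OF this] have "tau i t * exp (real i * (c * i - 0) / t) \<le> tau i t * 2" by (intro mult_left_mono) auto
 then show ?thesis using V_upper_exp[OF t, of i 0] by simp
qed

lemma tau_Suc: "tau i t = (mu * Suc i / t) * tau (Suc i) t"
proof -
 have "q / f = mu * s / t * (t / mu * q / (s * f))" if "s \<noteq> 0" "f \<noteq> 0" for q f s :: real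
  using that t mu_pos by (simp add: field_simps)
 from this[of "real (Suc i)" "fact i" "(t / mu) ^ i"] show ?thesis
  unfolding tau_eq[OF less_imp_le[OF t]] fact_Suc power_Suc by (simp del: of_nat_Suc)
qed

lemma tau_decay: "Suc i \<le> m ==> tau i t \<le> (mu * m / t) * tau (Suc i) t"
 unfolding tau_Suc[of i] using t mu_pos
 by (intro mult_right_mono divide_right_mono mult_left_mono) auto

lemma Vsum_le: "k \<le> m ==> Vsum (Suc k) t \<le> 4 * tau k t"
proof (induction k)
 case 0
 have "V 0 t \<le> 2 * tau 0 t" by (rule V_le_2tau) simp
 then show ?case by (simp add: Vsum_def)
next
 case (Suc k)
 have "Vsum (Suc (Suc k)) t = Vsum (Suc k) t + V (Suc k) t" by (simp add: Vsum_def)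
 also have "\<dots> \<le> 4 * tau k t + 2 * tau (Suc k) t" using Suc V_le_2tau[of "Suc k"] by (intro add_mono) auto
 also have "\<dots> \<le> 4 * ((mu * m / t) * tau (Suc k) t) + 2 * tau (Suc k) t" using tau_decay[OF Suc.prems] by simp
 also have "\<dots> \<le> 4 * ((1 / 2) * tau (Suc k) t) + 2 * tau (Suc k) t"
 proof -
  have "mu * m / t \<le> 1 / 2" using good(2) t by (simp add: field_simps)
  then have "(mu * m / t) * tau (Suc k) t \<le> (1 / 2) * tau (Suc k) t" by (intro mult_right_mono) auto
  then show ?thesis by simp
 qed
 finally show ?case by simp
qed

lemma Vsum_le': "k \<le> m ==> Vsum k t \<le> 4 * (mu * m / t) * tau k t"
proof (cases k)
 case 0 then show ?thesis using t mu_pos by (simp add: Vsum_def)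
next
 case (Suc i)
 assume "k \<le> m"
 then have "Vsum (Suc i) t \<le> 4 * tau i t" "tau i t \<le> (mu * m / t) * tau (Suc i) t"
  using Suc Vsum_le[of i] tau_decay[of i] by auto
 then show ?thesis using Suc by simp
qed

lemma V_minus_tau: "Suc k \<le> m ==> \<bar>V (Suc k) t - tau (Suc k) t\<bar> \<le> 2 * c * m / mu * tau k t"
proof -
 assume k: "Suc k \<le> m"
 let ?m = "Suc k"
 let ?x = "c * ?m / t"
 have x0: "0 \<le> ?x" using c_nonneg t by simp
 have mm: "real ?m * real ?m \<le> (real m)\<^sup>2" using k by (simp add: power2_eq_square mult_mono del: of_nat_Suc)
 have "c * (real ?m * real ?m) \<le> c * (real m)\<^sup>2" using mm c_nonneg by (rule mult_left_mono)
 then have mx: "real ?m * ?x \<le> 1 / 2" using good(1) t by (simp add: field_simps del: of_nat_Suc)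
 have x1: "?x \<le> 1 / 2"
 proof -
  have "1 * ?x \<le> real ?m * ?x" using x0 by (intro mult_right_mono) auto
  then show ?thesis using mx by linarith
 qed
 have up: "V ?m t \<le> tau ?m t * exp (real ?m * ?x)"
  using V_upper_exp[OF t, of ?m 0] by (simp add: mult.assoc)
 have "exp (real ?m * ?x) \<le> 1 + 2 * (real ?m * ?x)"
  by (rule exp_le_linear[OF mult_nonneg_nonneg[OF of_nat_0_le_iff x0] mx])
 then have "tau ?m t * exp (real ?m * ?x) \<le> tau ?m t * (1 + 2 * (real ?m * ?x))" by (intro mult_left_mono) auto
 with up have up2: "V ?m t - tau ?m t \<le> tau ?m t * (2 * (real ?m * ?x))" by (simp add: distrib_left del: of_nat_Suc)
 have "c * ?m \<le> t" using x1 t by (simp add: field_simps del: of_nat_Suc)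
 then have lo: "tau ?m t * (1 - ?x) ^ ?m \<le> V ?m t" using V_lower_power[OF t, of 0 ?m] by (simp del: of_nat_Suc)
 have "1 - real ?m * ?x \<le> (1 - ?x) ^ ?m" using Bernoulli_inequality[of "- ?x" ?m] x1 by (simp del: of_nat_Suc power_Suc)
 then have "tau ?m t * (1 - real ?m * ?x) \<le> tau ?m t * (1 - ?x) ^ ?m" by (intro mult_left_mono) auto
 with lo have lo2: "tau ?m t - V ?m t \<le> tau ?m t * (real ?m * ?x)" by (simp add: right_diff_distrib del: of_nat_Suc power_Suc)
 have pos: "0 \<le> tau ?m t * (real ?m * ?x)" using x0 by (intro mult_nonneg_nonneg) auto
 have "\<bar>V ?m t - tau ?m t\<bar> \<le> 2 * (tau ?m t * (real ?m * ?x))"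
 proof -
  have "\<bar>a - b\<bar> \<le> 2 * x" if "a - b \<le> y" "b - a \<le> x" "0 \<le> x" "y = 2 * x" for a b x y :: real
   using that by linarith
  from this[OF up2 lo2 pos mult.left_commute] show ?thesis .
 qed
 also have "tau ?m t * (real ?m * ?x) = c * ?m / mu * tau k t"
  unfolding tau_Suc[of k] using t mu_pos by (simp add: field_simps del: of_nat_Suc)
 also have "2 * (c * ?m / mu * tau k t) \<le> 2 * (c * m / mu * tau k t)"
  using k c_nonneg mu_pos by (intro mult_left_mono mult_right_mono divide_right_mono) auto
 finally show ?thesis by simp
qed

end
end

section \<open>Convergence in law through approximation\<close>

text \<open>
  Tychonoff's theorem makes the box compact, so a continuous function is uniformly continuous on
  it.
\<close>

lemma continuous_uniform_on_box:
 fixes F :: "(nat => real) => real"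
 assumes F: "continuous_on UNIV F" and e: "0 < e"
 shows "\<exists>\<delta>>0. \<delta> \<le> 1 \<and> (\<forall>x y. (\<forall>i. \<bar>x i\<bar> \<le> R \<and> \<bar>y i\<bar> \<le> R \<and> \<bar>x i - y i\<bar> \<le> \<delta>) --> \<bar>F x - F y\<bar> \<le> e)"
proof -
 let ?B = "PiE UNIV (\<lambda>_::nat. {- R..R}) :: (nat => real) set"
 have "compactin (product_topology (%_. euclidean) UNIV) ?B"
  by (subst compactin_PiE) (auto simp: compactin_euclidean_iff)
 then have c: "compact ?B" by (simp add: euclidean_product_topology compactin_euclidean_iff)
 have "uniformly_continuous_on ?B F"
  by (rule compact_uniformly_continuous[OF continuous_on_subset[OF F] c]) simp
 then obtain d where d: "d > 0" "!!x y. x \<in> ?B ==> y \<in> ?B ==> dist y x < d ==> dist (F y) (F x) < e"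
  unfolding uniformly_continuous_on_def using e by metis
 define \<delta> where "\<delta> = min 1 (d / 4)"
 show ?thesis
 proof (intro exI[of _ \<delta>] conjI allI impI)
  fix x y :: "nat => real" assume *: "\<forall>i. \<bar>x i\<bar> \<le> R \<and> \<bar>y i\<bar> \<le> R \<and> \<bar>x i - y i\<bar> \<le> \<delta>"
  have B: "x \<in> ?B" "y \<in> ?B" using * by (auto simp: abs_le_iff) (metis minus_le_iff, metis minus_le_iff)
  have s: "summable (%n. (1/2)^n * min (dist (x (from_nat n)) (y (from_nat n))) 1)"
   by (rule summable_comparison_test'[of "%n. (1/2)^n" 0]) (auto simp: summable_geometric mult_left_le)
  have "dist x y \<le> (\<Sum>n. (1/2)^n * \<delta>)"
   unfolding dist_fun_def
  proof (rule suminf_le[OF _ s])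
   show "summable (%n. (1/2::real)^n * \<delta>)" by (intro summable_mult2 summable_geometric) simp
   show "(1/2)^n * min (dist (x (from_nat n)) (y (from_nat n))) 1 \<le> (1/2)^n * \<delta>" for n
    using * by (intro mult_left_mono) (auto simp: dist_real_def min_le_iff_disj)
  qed
  also have "\<dots> = 2 * \<delta>" by (subst suminf_mult2[symmetric]) (auto simp: summable_geometric suminf_geometric)
  also have "\<dots> < d" using d(1) by (simp add: \<delta>_def min_def)
  finally show "\<bar>F x - F y\<bar> \<le> e" using d(2)[OF B(2) B(1)] by (simp add: dist_real_def)
 qed (use d(1) in \<open>auto simp: \<delta>_def\<close>)
qed

lemma borel_fun_eq: "sets (borel :: (nat => real) measure) = sets (Pi\<^sub>M UNIV (%_. borel))"
 by (rule sets_PiM_equal_borel[symmetric])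

text \<open>
  Vectors of length \<open>d\<close> are encoded as sequences that vanish from \<open>d\<close> on; the dimension can then vary without
  changing the type.
\<close>

definition trunc :: "nat => (nat => real) => nat => real" where "trunc d x = (%i. if i < d then x i else 0)"

lemma trunc_measurable:
 assumes "!!i. i < d ==> Y i \<in> borel_measurable M"
 shows "(%om. trunc d (%i. Y i om)) \<in> M \<rightarrow>\<^sub>M (borel :: (nat => real) measure)"
proof -
 have "(%om. trunc d (%i. Y i om)) \<in> M \<rightarrow>\<^sub>M Pi\<^sub>M UNIV (%_. borel)"
  unfolding trunc_def
 proof (rule measurable_PiM_single')
  show "(%om. if i < d then Y i om else 0) \<in> borel_measurable M" for i
   by (cases "i < d") (use assms in auto)
 qed auto
 then show ?thesis using measurable_cong_sets[OF refl borel_fun_eq] by blast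
qed

definition law_tendsto ::
 "(nat => 'a measure) => (nat => nat => 'a => real) => 'b measure => (nat => 'b => real) => nat => bool" where
 "law_tendsto M Y N Z d \<longleftrightarrow> (\<forall>F :: (nat => real) => real. continuous_on UNIV F --> (\<exists>C. \<forall>x. \<bar>F x\<bar> \<le> C) -->
  (%n. LINT om|M n. F (trunc d (%i. Y n i om))) \<longlonglongrightarrow> (LINT om|N. F (trunc d (%i. Z i om))))"

text \<open>
  Outside the two bad events both vectors lie in a box and are close to each other.
\<close>

lemma (in prob_space) functional_distance:
 fixes F :: "(nat => real) => real"
 assumes F: "continuous_on UNIV F" and C: "!!x. \<bar>F x\<bar> \<le> C"
  and Y[measurable]: "!!i. i < d ==> Y i \<in> borel_measurable M" "!!i. i < d ==> Y' i \<in> borel_measurable M"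
  and uc: "!!x y. (\<forall>i. \<bar>x i\<bar> \<le> R + 1 \<and> \<bar>y i\<bar> \<le> R + 1 \<and> \<bar>x i - y i\<bar> \<le> \<delta>) ==> \<bar>F x - F y\<bar> \<le> e"
  and \<delta>: "0 < \<delta>" "\<delta> \<le> 1" and R: "0 \<le> R"
 shows "\<bar>expectation (%om. F (trunc d (%i. Y i om))) - expectation (%om. F (trunc d (%i. Y' i om)))\<bar>
  \<le> e + 2 * C * (\<Sum>i<d. prob {om\<in>space M. \<delta> < \<bar>Y i om - Y' i om\<bar>}) + 2 * C * (\<Sum>i<d. prob {om\<in>space M. R < \<bar>Y' i om\<bar>})"
proof -
 let ?A = "%i. {om\<in>space M. \<delta> < \<bar>Y i om - Y' i om\<bar>}" and ?B = "%i. {om\<in>space M. R < \<bar>Y' i om\<bar>}"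
 have C0: "0 \<le> C" using C[of undefined] by (meson abs_ge_zero order_trans)
 have [measurable]: "?A i \<in> sets M" "?B i \<in> sets M" if "i < d" for i using Y[OF that] by measurable
 have Fm: "F \<in> borel_measurable borel" by (rule borel_measurable_continuous_onI[OF F])
 have [measurable]: "(%om. F (trunc d (%i. Y i om))) \<in> borel_measurable M" "(%om. F (trunc d (%i. Y' i om))) \<in> borel_measurable M"
  using measurable_compose[OF trunc_measurable[OF Y(1)] Fm] measurable_compose[OF trunc_measurable[OF Y(2)] Fm] by auto
 have i: "integrable M (%om. F (trunc d (%i. Y i om)))" "integrable M (%om. F (trunc d (%i. Y' i om)))"
  using C by (auto intro!: integrable_const_bound[where B=C])
 let ?g = "%om. e + 2 * C * (\<Sum>i<d. indicator (?A i) om) + 2 * C * (\<Sum>i<d. indicator (?B i) om)"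
 have e0: "0 \<le> e" using uc[of "%_. 0" "%_. 0"] R \<delta> by simp
 have gi: "integrable M ?g"
  by (intro Bochner_Integration.integrable_add integrable_mult_right Bochner_Integration.integrable_sum) (auto simp: emeasure_eq_measure)
 have "\<bar>expectation (%om. F (trunc d (%i. Y i om))) - expectation (%om. F (trunc d (%i. Y' i om)))\<bar>
  = \<bar>expectation (%om. F (trunc d (%i. Y i om)) - F (trunc d (%i. Y' i om)))\<bar>" using i by simp
 also have "\<dots> \<le> expectation (%om. \<bar>F (trunc d (%i. Y i om)) - F (trunc d (%i. Y' i om))\<bar>)" by (rule integral_abs_bound)
 also have "\<dots> \<le> expectation ?g"
 proof (rule integral_mono)
  fix om assume om: "om \<in> space M"
  let ?x = "trunc d (%i. Y i om)" and ?y = "trunc d (%i. Y' i om)"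
  have nn: "0 \<le> 2 * C * (\<Sum>i<d. indicator (?A i) om :: real)" "0 \<le> 2 * C * (\<Sum>i<d. indicator (?B i) om :: real)"
   using C0 by (auto intro!: mult_nonneg_nonneg sum_nonneg)
  have big: "\<bar>F ?x - F ?y\<bar> \<le> 2 * C" using C[of ?x] C[of ?y] by linarith
  show "\<bar>F ?x - F ?y\<bar> \<le> ?g om"
  proof (cases "\<exists>i<d. om \<in> ?A i \<or> om \<in> ?B i")
   case True
   then obtain j where j: "j < d" "om \<in> ?A j \<or> om \<in> ?B j" by blast
   have mem: "indicator (G j) om \<le> (\<Sum>i<d. indicator (G i) om :: real)" for G :: "nat => 'a set"
    using j by (intro member_le_sum) auto
   have "1 \<le> (\<Sum>i<d. indicator (?A i) om :: real) + (\<Sum>i<d. indicator (?B i) om :: real)"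
   proof (cases "om \<in> ?A j")
    case True
    then show ?thesis using mem[of ?A] sum_nonneg[of "{..<d}" "%i. indicator (?B i) om :: real"] by simp
   next
    case False
    then have "om \<in> ?B j" using j by blast
    then have "indicator (?B j) om = (1::real)" by simp
    then show ?thesis using mem[of ?B] sum_nonneg[of "{..<d}" "%i. indicator (?A i) om :: real"] by simp
   qed
   then have "2 * C * 1 \<le> 2 * C * ((\<Sum>i<d. indicator (?A i) om :: real) + (\<Sum>i<d. indicator (?B i) om :: real))"
    using C0 by (intro mult_left_mono) auto
   then show ?thesis using big e0 by (simp add: distrib_left)
  next
   case False
   have "\<bar>?x i\<bar> \<le> R + 1 \<and> \<bar>?y i\<bar> \<le> R + 1 \<and> \<bar>?x i - ?y i\<bar> \<le> \<delta>" for i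
   proof (cases "i < d")
    case True
    then have "om \<notin> ?A i" "om \<notin> ?B i" using False by blast+
    then have "\<bar>Y i om - Y' i om\<bar> \<le> \<delta>" "\<bar>Y' i om\<bar> \<le> R" using om by (auto simp: not_less)
    then show ?thesis using True \<delta> by (auto simp: trunc_def)
   qed (use R \<delta> in \<open>auto simp: trunc_def\<close>)
   then have "\<bar>F ?x - F ?y\<bar> \<le> e" by (intro uc) blast
   then show ?thesis using nn by linarith
  qed
 qed (use gi i in auto)
 also have "\<dots> = e + 2 * C * (\<Sum>i<d. prob (?A i)) + 2 * C * (\<Sum>i<d. prob (?B i))"
 proof -
  have ii: "integrable M (%om. \<Sum>i<d. indicator (?A i) om :: real)" "integrable M (%om. \<Sum>i<d. indicator (?B i) om :: real)"
   by (intro Bochner_Integration.integrable_sum, auto simp: emeasure_eq_measure)+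
  have "expectation (%om. \<Sum>i<d. indicator (?A i) om :: real) = (\<Sum>i<d. prob (?A i))"
   by (subst Bochner_Integration.integral_sum) (auto simp: emeasure_eq_measure Int_absorb2 intro!: sum.cong arg_cong[where f=prob])
  moreover have "expectation (%om. \<Sum>i<d. indicator (?B i) om :: real) = (\<Sum>i<d. prob (?B i))"
   by (subst Bochner_Integration.integral_sum) (auto simp: emeasure_eq_measure Int_absorb2 intro!: sum.cong arg_cong[where f=prob])
  ultimately show ?thesis using ii by (simp add: prob_space)
 qed
 finally show ?thesis .
qed

lemma (in prob_space) markov_nn:
 fixes f :: "'a => real"
 assumes [measurable]: "f \<in> borel_measurable M" and f: "(\<integral>\<^sup>+om. ennreal \<bar>f om\<bar> \<partial>M) \<le> ennreal a" and "0 \<le> a" "0 < \<delta>"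
 shows "prob {om\<in>space M. \<delta> < \<bar>f om\<bar>} \<le> a / \<delta>"
proof -
 have i: "integrable M (%om. \<bar>f om\<bar>)" "expectation (%om. \<bar>f om\<bar>) \<le> a"
  using integrable_realI[OF _ _ f] assms by auto
 have "prob {om\<in>space M. \<delta> < \<bar>f om\<bar>} \<le> prob {om\<in>space M. \<delta> \<le> \<bar>f om\<bar>}" by (intro finite_measure_mono) auto
 also have "\<dots> \<le> expectation (%om. \<bar>f om\<bar>) / \<delta>"
  using integral_Markov_inequality_measure[OF i(1), of "{}" \<delta>] assms by simp
 also have "\<dots> \<le> a / \<delta>" using i assms by (intro divide_right_mono) auto
 finally show ?thesis .
qed

lemma (in prob_space) tail_small:
 fixes Z :: "nat => 'a => real"
 assumes [measurable]: "!!i. i < d ==> Z i \<in> borel_measurable M" and e: "0 < e"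
 shows "\<exists>R\<ge>0. \<forall>i<d. prob {om\<in>space M. R < \<bar>Z i om\<bar>} \<le> e"
proof -
 have "\<exists>R\<ge>0. prob {om\<in>space M. R < \<bar>Z i om\<bar>} \<le> e" if "i < d" for i
 proof -
  have [measurable]: "Z i \<in> borel_measurable M" using that by simp
  let ?A = "\<lambda>n::nat. {om\<in>space M. real n < \<bar>Z i om\<bar>}"
  have "(%n. prob (?A n)) \<longlonglongrightarrow> prob (\<Inter>n. ?A n)"
   by (rule finite_Lim_measure_decseq) (auto simp: decseq_def)
  moreover have "(\<Inter>n. ?A n) = {}"
  proof -
   have "\<exists>n::nat. \<not> real n < \<bar>Z i om\<bar>" for om using real_arch_simple[of "\<bar>Z i om\<bar>"] by (auto simp: not_less)
   then show ?thesis by auto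
  qed
  ultimately have "(%n. prob (?A n)) \<longlonglongrightarrow> 0" by simp
  then have "eventually (%n. prob (?A n) < e) sequentially" using e by (rule order_tendstoD)
  then obtain n where "prob (?A n) < e" by (auto simp: eventually_sequentially)
  then show ?thesis by (intro exI[of _ "real n"]) auto
 qed
 then obtain R where R: "!!i. i < d ==> 0 \<le> R i \<and> prob {om\<in>space M. R i < \<bar>Z i om\<bar>} \<le> e" by metis
 let ?R = "\<Sum>i<d. R i"
 have "prob {om\<in>space M. ?R < \<bar>Z i om\<bar>} \<le> e" if "i < d" for i
 proof -
  have [measurable]: "Z i \<in> borel_measurable M" using that by simp
  have "R i \<le> ?R" using that R by (intro member_le_sum) auto
  then have "prob {om\<in>space M. ?R < \<bar>Z i om\<bar>} \<le> prob {om\<in>space M. R i < \<bar>Z i om\<bar>}" by (intro finite_measure_mono) auto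
  then show ?thesis using R[OF that] by linarith
 qed
 moreover have "0 \<le> ?R" using R by (intro sum_nonneg) auto
 ultimately show ?thesis by blast
qed

text \<open>
  Interchange of limits. Tightness of the approximants for fixed \<open>q\<close> is read off from their convergence, tested with a
  continuous cut-off function of one coordinate.
\<close>

lemma law_tendsto_approx:
 fixes M :: "nat => 'a measure" and N :: "'b measure"
  and Y' :: "nat => nat => nat => 'a => real" and Z' :: "nat => nat => 'b => real"
 assumes M: "!!n. prob_space (M n)" and N: "prob_space N"
  and Y: "!!n i. i < d ==> Y n i \<in> borel_measurable (M n)"
  and Y': "!!q n i. i < d ==> Y' q n i \<in> borel_measurable (M n)"
  and Z: "!!i. i < d ==> Z i \<in> borel_measurable N"
  and Z': "!!q i. i < d ==> Z' q i \<in> borel_measurable N"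
  and conv: "!!q. 1 \<le> q ==> law_tendsto M (Y' q) N (Z' q) d"
  and close: "!!i e. i < d ==> 0 < e ==> \<exists>q0. \<forall>q\<ge>q0. eventually (%n. (\<integral>\<^sup>+om. ennreal \<bar>Y n i om - Y' q n i om\<bar> \<partial>M n) \<le> ennreal e) sequentially"
  and close': "!!i e. i < d ==> 0 < e ==> \<exists>q0. \<forall>q\<ge>q0. (\<integral>\<^sup>+om. ennreal \<bar>Z i om - Z' q i om\<bar> \<partial>N) \<le> ennreal e"
 shows "law_tendsto M Y N Z d"
 unfolding law_tendsto_def
proof (intro allI impI)
 fix F :: "(nat => real) => real"
 assume F: "continuous_on UNIV F" and "\<exists>C. \<forall>x. \<bar>F x\<bar> \<le> C"
 then obtain C where C: "!!x. \<bar>F x\<bar> \<le> C" by blast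
 have C0: "0 \<le> C" using C[of undefined] by (meson abs_ge_zero order_trans)
 interpret N: prob_space N by (rule N)
 let ?EZ = "LINT om|N. F (trunc d (%i. Z i om))"
 show "(%n. LINT om|M n. F (trunc d (%i. Y n i om))) \<longlonglongrightarrow> ?EZ"
 proof (rule LIMSEQ_I)
  fix \<epsilon> :: real assume eps: "0 < \<epsilon>"
  define D where "D = 2 * C * real d + 1"
  have D: "0 < D" using C0 by (simp add: D_def add_nonneg_pos)
  define \<eta> where "\<eta> = \<epsilon> / (20 * D)"
  have eta: "0 < \<eta>" using eps D by (simp add: \<eta>_def)
  have ex: "\<exists>R\<ge>0. \<forall>i<d. N.prob {om\<in>space N. R < \<bar>Z i om\<bar>} \<le> \<eta>"
   by (rule N.tail_small[OF Z eta])
  then obtain R0 where R0': "0 \<le> R0" "\<forall>i<d. N.prob {om\<in>space N. R0 < \<bar>Z i om\<bar>} \<le> \<eta>" by blast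
  note R0 = R0'(1) R0'(2)[rule_format]
  define R where "R = R0 + 2"
  obtain \<delta> where \<delta>: "0 < \<delta>" "\<delta> \<le> 1"
   "!!x y. (\<forall>i. \<bar>x i\<bar> \<le> R + 1 \<and> \<bar>y i\<bar> \<le> R + 1 \<and> \<bar>x i - y i\<bar> \<le> \<delta>) ==> \<bar>F x - F y\<bar> \<le> \<epsilon> / 10"
   using continuous_uniform_on_box[OF F, of "\<epsilon> / 10" "R + 1"] eps by auto
  have ed: "0 < \<eta> * \<delta>" using eta \<delta> by simp
  have "\<exists>q0. \<forall>i<d. \<forall>q\<ge>q0. eventually (%n. (\<integral>\<^sup>+om. ennreal \<bar>Y n i om - Y' q n i om\<bar> \<partial>M n) \<le> ennreal (\<eta> * \<delta>)) sequentially
   \<and> (\<integral>\<^sup>+om. ennreal \<bar>Z i om - Z' q i om\<bar> \<partial>N) \<le> ennreal (\<eta> * \<delta>)"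
  proof -
   have "\<forall>i. \<exists>a. i < d --> (\<forall>q\<ge>a. eventually (%n. (\<integral>\<^sup>+om. ennreal \<bar>Y n i om - Y' q n i om\<bar> \<partial>M n) \<le> ennreal (\<eta> * \<delta>)) sequentially)"
    using close[OF _ ed] by blast
   from choice[OF this] obtain f where f: "\<forall>i. i < d --> (\<forall>q\<ge>f i. eventually (%n. (\<integral>\<^sup>+om. ennreal \<bar>Y n i om - Y' q n i om\<bar> \<partial>M n) \<le> ennreal (\<eta> * \<delta>)) sequentially)" by blast
   have "\<forall>i. \<exists>a. i < d --> (\<forall>q\<ge>a. (\<integral>\<^sup>+om. ennreal \<bar>Z i om - Z' q i om\<bar> \<partial>N) \<le> ennreal (\<eta> * \<delta>))"
    using close'[OF _ ed] by blast
   from choice[OF this] obtain g where g: "\<forall>i. i < d --> (\<forall>q\<ge>g i. (\<integral>\<^sup>+om. ennreal \<bar>Z i om - Z' q i om\<bar> \<partial>N) \<le> ennreal (\<eta> * \<delta>))" by blast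
   have "f i \<le> (\<Sum>i<d. f i + g i)" "g i \<le> (\<Sum>i<d. f i + g i)" if "i < d" for i
    using member_le_sum[of i "{..<d}" "%i. f i + g i"] that by auto
   then have le: "f i \<le> q" "g i \<le> q" if "i < d" "(\<Sum>i<d. f i + g i) \<le> q" for i q
    using that order_trans by blast+
   show ?thesis
   proof (intro exI[of _ "\<Sum>i<d. f i + g i"] allI impI conjI)
    fix i q assume "i < d" "(\<Sum>i<d. f i + g i) \<le> q"
    then show "eventually (%n. (\<integral>\<^sup>+om. ennreal \<bar>Y n i om - Y' q n i om\<bar> \<partial>M n) \<le> ennreal (\<eta> * \<delta>)) sequentially"
     "(\<integral>\<^sup>+om. ennreal \<bar>Z i om - Z' q i om\<bar> \<partial>N) \<le> ennreal (\<eta> * \<delta>)"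
     using f g le by blast+
   qed
  qed
  then obtain q0 where q0: "\<forall>i<d. \<forall>q\<ge>q0. eventually (%n. (\<integral>\<^sup>+om. ennreal \<bar>Y n i om - Y' q n i om\<bar> \<partial>M n) \<le> ennreal (\<eta> * \<delta>)) sequentially
   \<and> (\<integral>\<^sup>+om. ennreal \<bar>Z i om - Z' q i om\<bar> \<partial>N) \<le> ennreal (\<eta> * \<delta>)" by blast
  define q where "q = max 1 q0"
  have q1: "1 \<le> q" "q0 \<le> q" by (auto simp: q_def)
  have q: "1 \<le> q" "!!i. i < d ==> eventually (%n. (\<integral>\<^sup>+om. ennreal \<bar>Y n i om - Y' q n i om\<bar> \<partial>M n) \<le> ennreal (\<eta> * \<delta>)) sequentially"
   "!!i. i < d ==> (\<integral>\<^sup>+om. ennreal \<bar>Z i om - Z' q i om\<bar> \<partial>N) \<le> ennreal (\<eta> * \<delta>)"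
   using q0 q1 by blast+
  have pz: "N.prob {om\<in>space N. \<delta> < \<bar>Z i om - Z' q i om\<bar>} \<le> \<eta>" if "i < d" for i
   using N.markov_nn[OF _ q(3)[OF that], of \<delta>] Z[OF that] Z'[OF that] ed \<delta> by simp
  have tz: "N.prob {om\<in>space N. R0 + 1 < \<bar>Z' q i om\<bar>} \<le> 2 * \<eta>" if i: "i < d" for i
  proof -
   have [measurable]: "Z i \<in> borel_measurable N" "Z' q i \<in> borel_measurable N" using Z[OF i] Z'[OF i] by auto
   have "N.prob {om\<in>space N. R0 + 1 < \<bar>Z' q i om\<bar>} \<le> N.prob ({om\<in>space N. R0 < \<bar>Z i om\<bar>} \<union> {om\<in>space N. \<delta> < \<bar>Z i om - Z' q i om\<bar>})"
    using \<delta> by (intro N.finite_measure_mono) auto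
   also have "\<dots> \<le> N.prob {om\<in>space N. R0 < \<bar>Z i om\<bar>} + N.prob {om\<in>space N. \<delta> < \<bar>Z i om - Z' q i om\<bar>}"
    by (rule measure_Un_le) measurable
   finally show ?thesis using R0(2)[OF i] pz[OF i] by linarith
  qed
  have sums: "(\<Sum>i<d. f i) \<le> real d * a" if "!!i. i < d ==> f i \<le> a" for f and a :: real
   using sum_bounded_above[of "{..<d}" f a] that by simp
  have tz': "N.prob {om\<in>space N. R < \<bar>Z' q i om\<bar>} \<le> 2 * \<eta>" if i: "i < d" for i
  proof -
   have [measurable]: "Z' q i \<in> borel_measurable N" using Z'[OF i] by auto
   have "N.prob {om\<in>space N. R < \<bar>Z' q i om\<bar>} \<le> N.prob {om\<in>space N. R0 + 1 < \<bar>Z' q i om\<bar>}"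
    by (intro N.finite_measure_mono) (auto simp: R_def)
   then show ?thesis using tz[OF i] by linarith
  qed
  have "\<bar>?EZ - (LINT om|N. F (trunc d (%i. Z' q i om)))\<bar>
   \<le> \<epsilon> / 10 + 2 * C * (\<Sum>i<d. N.prob {om\<in>space N. \<delta> < \<bar>Z i om - Z' q i om\<bar>}) + 2 * C * (\<Sum>i<d. N.prob {om\<in>space N. R < \<bar>Z' q i om\<bar>})"
   by (rule N.functional_distance[OF F C Z Z' \<delta>(3) \<delta>(1,2)]) (use R0 in \<open>auto simp: R_def\<close>)
  also have "\<dots> \<le> \<epsilon> / 10 + 2 * C * (real d * \<eta>) + 2 * C * (real d * (2 * \<eta>))"
   using C0 pz tz' by (intro add_mono mult_left_mono sums) auto
  finally have Zd: "\<bar>?EZ - (LINT om|N. F (trunc d (%i. Z' q i om)))\<bar> \<le> \<epsilon> / 10 + 2 * C * (real d * \<eta>) + 2 * C * (real d * (2 * \<eta>))" .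
  have CD: "2 * C * (real d * \<eta>) \<le> \<epsilon> / 20"
  proof -
   have "2 * C * (real d * \<eta>) \<le> D * \<eta>" using eta by (simp add: D_def algebra_simps)
   also have "\<dots> = \<epsilon> / 20" using D by (simp add: \<eta>_def)
   finally show ?thesis .
  qed
  define \<psi> where "\<psi> s = max 0 (min 1 (\<bar>s\<bar> - (R0 + 1)))" for s :: real
  have tail_conv: "eventually (%n. measure (M n) {om\<in>space (M n). R < \<bar>Y' q n i om\<bar>} \<le> 3 * \<eta>) sequentially" if i: "i < d" for i
  proof -
   have cont: "continuous_on UNIV (\<lambda>x :: nat => real. \<psi> (x i))"
    unfolding \<psi>_def by (intro continuous_intros continuous_on_product_coordinates)
   have bd: "\<exists>C. \<forall>x :: nat => real. \<bar>\<psi> (x i)\<bar> \<le> C" by (intro exI[of _ 1]) (auto simp: \<psi>_def)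
   have \<psi>m: "\<psi> \<in> borel_measurable borel" unfolding \<psi>_def by measurable
   have lim: "(%n. LINT om|M n. \<psi> (Y' q n i om)) \<longlonglongrightarrow> (LINT om|N. \<psi> (Z' q i om))"
    using conv[OF q(1), unfolded law_tendsto_def, rule_format, OF cont bd] i by (simp add: trunc_def)
   have [measurable]: "Z' q i \<in> borel_measurable N" using Z'[OF i] by auto
   have "(LINT om|N. \<psi> (Z' q i om)) \<le> (LINT om|N. indicator {om\<in>space N. R0 + 1 < \<bar>Z' q i om\<bar>} om)"
   proof (rule integral_mono)
    show "integrable N (%om. \<psi> (Z' q i om))"
     using \<psi>m by (intro N.integrable_const_bound[where B=1]) (auto simp: \<psi>_def)
    show "integrable N (%om. indicator {om\<in>space N. R0 + 1 < \<bar>Z' q i om\<bar>} om :: real)"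
     by (intro integrable_real_indicator) (auto simp: N.emeasure_eq_measure)
   qed (auto simp: \<psi>_def indicator_def)
   also have "\<dots> = N.prob ({om\<in>space N. R0 + 1 < \<bar>Z' q i om\<bar>} \<inter> space N)" by (rule Bochner_Integration.integral_indicator)
   also have "\<dots> \<le> 2 * \<eta>" using tz[OF i] by (simp add: Int_absorb2)
   finally have "(LINT om|N. \<psi> (Z' q i om)) < 3 * \<eta>" using eta by linarith
   with lim have "eventually (%n. (LINT om|M n. \<psi> (Y' q n i om)) < 3 * \<eta>) sequentially" by (rule order_tendstoD)
   then show ?thesis
   proof eventually_elim
    case (elim n)
    interpret Mn: prob_space "M n" by (rule M)
    have [measurable]: "Y' q n i \<in> borel_measurable (M n)" using Y'[OF i] by auto
    have "measure (M n) {om\<in>space (M n). R < \<bar>Y' q n i om\<bar>} = (LINT om|M n. indicator {om\<in>space (M n). R < \<bar>Y' q n i om\<bar>} om)"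
     by (subst Bochner_Integration.integral_indicator) (auto intro!: arg_cong[where f="measure (M n)"])
    also have "\<dots> \<le> (LINT om|M n. \<psi> (Y' q n i om))"
    proof (rule integral_mono)
     show "integrable (M n) (%om. \<psi> (Y' q n i om))"
      using \<psi>m by (intro Mn.integrable_const_bound[where B=1]) (auto simp: \<psi>_def)
     show "integrable (M n) (%om. indicator {om\<in>space (M n). R < \<bar>Y' q n i om\<bar>} om :: real)"
      by (intro integrable_real_indicator) (auto simp: Mn.emeasure_eq_measure)
    qed (auto simp: \<psi>_def indicator_def R_def)
    finally show ?case using elim by linarith
   qed
  qed
  have fin: "eventually (%n. \<forall>i<d. P n i) sequentially" if "!!i. i < d ==> eventually (%n. P n i) sequentially"
   for P :: "nat => nat => bool"
  proof -
   have "eventually (%n. \<forall>i\<in>{..<d}. P n i) sequentially"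
    by (rule eventually_ball_finite) (use that in auto)
   then show ?thesis by (simp add: Ball_def)
  qed
  have "eventually (%n. \<forall>i<d. (\<integral>\<^sup>+om. ennreal \<bar>Y n i om - Y' q n i om\<bar> \<partial>M n) \<le> ennreal (\<eta> * \<delta>)) sequentially"
   by (rule fin) (rule q(2))
  moreover have "eventually (%n. \<forall>i<d. measure (M n) {om\<in>space (M n). R < \<bar>Y' q n i om\<bar>} \<le> 3 * \<eta>) sequentially"
   by (rule fin) (rule tail_conv)
  moreover have "eventually (%n. \<bar>(LINT om|M n. F (trunc d (%i. Y' q n i om))) - (LINT om|N. F (trunc d (%i. Z' q i om)))\<bar> < \<epsilon> / 10) sequentially"
  proof -
   have "(%n. LINT om|M n. F (trunc d (%i. Y' q n i om))) \<longlonglongrightarrow> (LINT om|N. F (trunc d (%i. Z' q i om)))"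
    using conv[OF q(1), unfolded law_tendsto_def, rule_format, OF F] C by blast
   from tendstoD[OF this, of "\<epsilon> / 10"] eps show ?thesis by (simp add: dist_real_def)
  qed
  ultimately have "eventually (%n. norm ((LINT om|M n. F (trunc d (%i. Y n i om))) - ?EZ) < \<epsilon>) sequentially"
  proof eventually_elim
   case (elim n)
   interpret Mn: prob_space "M n" by (rule M)
   have py: "Mn.prob {om\<in>space (M n). \<delta> < \<bar>Y n i om - Y' q n i om\<bar>} \<le> \<eta>" if i: "i < d" for i
    using Mn.markov_nn[of "%om. Y n i om - Y' q n i om" "\<eta> * \<delta>" \<delta>] elim(1) i Y[OF i, of n] Y'[OF i, of q n] ed \<delta> by auto
   have "\<bar>(LINT om|M n. F (trunc d (%i. Y n i om))) - (LINT om|M n. F (trunc d (%i. Y' q n i om)))\<bar>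
    \<le> \<epsilon> / 10 + 2 * C * (\<Sum>i<d. Mn.prob {om\<in>space (M n). \<delta> < \<bar>Y n i om - Y' q n i om\<bar>}) + 2 * C * (\<Sum>i<d. Mn.prob {om\<in>space (M n). R < \<bar>Y' q n i om\<bar>})"
    by (rule Mn.functional_distance[OF F C Y Y' \<delta>(3) \<delta>(1,2)]) (use R0 in \<open>auto simp: R_def\<close>)
   also have "\<dots> \<le> \<epsilon> / 10 + 2 * C * (real d * \<eta>) + 2 * C * (real d * (3 * \<eta>))"
    using C0 py elim(2) by (intro add_mono mult_left_mono sums) auto
   finally have Yd: "\<bar>(LINT om|M n. F (trunc d (%i. Y n i om))) - (LINT om|M n. F (trunc d (%i. Y' q n i om)))\<bar>
    \<le> \<epsilon> / 10 + 2 * C * (real d * \<eta>) + 2 * C * (real d * (3 * \<eta>))" .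
   have comb: "\<bar>y - z\<bar> < e" if "\<bar>y - y'\<bar> \<le> e / 10 + x + 3 * x" "\<bar>y' - z'\<bar> < e / 10" "\<bar>z - z'\<bar> \<le> e / 10 + x + 2 * x" "x \<le> e / 20" "0 < e"
    for y y' z z' e x :: real using that by linarith
   show ?case unfolding real_norm_def
    by (rule comb[OF _ elim(3) _ CD eps]) (use Yd Zd in \<open>simp_all add: mult_ac\<close>)
  qed
  then show "\<exists>n0. \<forall>n\<ge>n0. norm ((LINT om|M n. F (trunc d (%i. Y n i om))) - ?EZ) < \<epsilon>"
   by (simp add: eventually_sequentially)
 qed
qed

section \<open>The central limit theorem for blocks\<close>

lemma independent_families_same_law:
 fixes X1 :: "'i => 'a => real" and X2 :: "'i => 'b => real"
 assumes "prob_space M1" "prob_space M2"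
  and i1: "prob_space.indep_vars M1 (%_. borel) X1 I" and i2: "prob_space.indep_vars M2 (%_. borel) X2 I"
  and I: "I \<noteq> {}" and same: "!!i. i \<in> I ==> distr M1 borel (X1 i) = distr M2 borel (X2 i)"
 shows "distr M1 (PiM I (%_. borel)) (%om. \<lambda>i\<in>I. X1 i om) = distr M2 (PiM I (%_. borel)) (%om. \<lambda>i\<in>I. X2 i om)"
proof -
 interpret A: prob_space M1 by fact
 interpret B: prob_space M2 by fact
 have r1: "X1 i \<in> borel_measurable M1" if "i \<in> I" for i using i1 that by (auto simp: A.indep_vars_def)
 have r2: "X2 i \<in> borel_measurable M2" if "i \<in> I" for i using i2 that by (auto simp: B.indep_vars_def)
 have "distr M1 (PiM I (%_. borel)) (%om. \<lambda>i\<in>I. X1 i om) = PiM I (%i. distr M1 borel (X1 i))"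
  using A.indep_vars_iff_distr_eq_PiM'[OF I r1] i1 by simp
 also have "\<dots> = PiM I (%i. distr M2 borel (X2 i))" by (rule PiM_cong) (simp_all add: same)
 also have "\<dots> = distr M2 (PiM I (%_. borel)) (%om. \<lambda>i\<in>I. X2 i om)"
  using B.indep_vars_iff_distr_eq_PiM'[OF I r2] i2 by simp
 finally show ?thesis .
qed

lemma independent_families_same_functional:
 fixes X1 :: "'i => 'a => real" and X2 :: "'i => 'b => real"
 assumes ass: "prob_space M1" "prob_space M2"
  "prob_space.indep_vars M1 (%_. borel) X1 I" "prob_space.indep_vars M2 (%_. borel) X2 I"
  "I \<noteq> {}" "!!i. i \<in> I ==> distr M1 borel (X1 i) = distr M2 borel (X2 i)"
  and g: "g \<in> PiM I (%_. borel) \<rightarrow>\<^sub>M N"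
 shows "distr M1 N (%om. g (\<lambda>i\<in>I. X1 i om)) = distr M2 N (%om. g (\<lambda>i\<in>I. X2 i om))"
proof -
 interpret A: prob_space M1 by fact
 interpret B: prob_space M2 by fact
 have r1: "(%om. \<lambda>i\<in>I. X1 i om) \<in> M1 \<rightarrow>\<^sub>M PiM I (%_. borel)"
  using ass(3) by (intro measurable_restrict) (auto simp: A.indep_vars_def)
 have r2: "(%om. \<lambda>i\<in>I. X2 i om) \<in> M2 \<rightarrow>\<^sub>M PiM I (%_. borel)"
  using ass(4) by (intro measurable_restrict) (auto simp: B.indep_vars_def)
 show ?thesis
  using distr_distr[OF g r1] distr_distr[OF g r2] independent_families_same_law[OF ass] by (simp add: comp_def)
qed

lemma (in prob_space) iid_shift_sum:
 fixes \<zeta> :: "nat => 'a => real"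
 assumes ind: "indep_vars (%_. borel) \<zeta> UNIV" and same: "!!r. distr M borel (\<zeta> r) = distr M borel (\<zeta> 0)"
 shows "distr M borel (%om. \<Sum>r\<in>{s..<s + n}. \<zeta> r om) = distr M borel (%om. \<Sum>r<n. \<zeta> r om)"
proof (cases "n = 0")
 case False
 have m: "\<zeta> r \<in> borel_measurable M" for r using ind by (auto simp: indep_vars_def)
 have 1: "indep_vars (%_. borel) (%r. \<zeta> (s + r)) {..<n}"
 proof -
  have "indep_vars (%j. PiM {s + j} (%_. borel)) (%j om. restrict (%i. \<zeta> i om) {s + j}) {..<n}"
   by (rule indep_vars_restrict[OF ind]) (auto simp: disjoint_family_on_def)
  from indep_vars_compose2[OF this, of "%j h. h (s + j)" "%_. borel"] show ?thesis by simp
 qed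
 have 2: "indep_vars (%_. borel) \<zeta> {..<n}" by (rule indep_vars_subset[OF ind]) simp
 have "distr M borel (%om. \<Sum>r<n. (\<lambda>r\<in>{..<n}. \<zeta> (s + r) om) r) = distr M borel (%om. \<Sum>r<n. (\<lambda>r\<in>{..<n}. \<zeta> r om) r)"
 proof (rule independent_families_same_functional[OF prob_space_axioms prob_space_axioms 1 2])
  show "(%h. \<Sum>r<n. h r) \<in> PiM {..<n} (%_. borel) \<rightarrow>\<^sub>M (borel :: real measure)"
   by (intro borel_measurable_sum measurable_component_singleton) auto
  show "distr M borel (\<zeta> (s + i)) = distr M borel (\<zeta> i)" for i using same[of "s + i"] same[of i] by simp
 qed (use False in \<open>auto simp: lessThan_empty_iff\<close>)
 moreover have "(\<Sum>r<n. (\<lambda>r\<in>{..<n}. \<zeta> (s + r) om) r) = (\<Sum>r\<in>{s..<s + n}. \<zeta> r om)" for om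
  by (rule sum.reindex_bij_witness[of _ "%r. r - s" "%r. s + r"]) auto
 moreover have "(\<Sum>r<n. (\<lambda>r\<in>{..<n}. \<zeta> r om) r) = (\<Sum>r<n. \<zeta> r om)" for om by (intro sum.cong) auto
 ultimately show ?thesis by simp
qed simp

lemma fun_tendsto_coordinatewise:
 fixes f :: "'a => nat => real"
 assumes "!!i. ((%x. f x i) \<longlongrightarrow> l i) F"
 shows "(f \<longlongrightarrow> l) F"
proof -
 have "limitin (product_topology (%_. euclidean) UNIV) f l F"
  using assms by (simp add: limitin_componentwise)
 then show ?thesis by (simp add: euclidean_product_topology limitin_canonical_iff)
qed

text \<open>
  The blocks are independent and each converges in law by the central limit theorem. Skorohod's
  representation, used in each coordinate of a product space, makes the block sums converge pointwise, and
  dominated convergence then gives joint convergence.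
\<close>

lemma (in prob_space) block_clt:
 fixes \<zeta> :: "nat => 'a => real" and \<theta> :: "nat => real" and a :: "nat => nat => real" and N :: "'b measure"
  and G :: "nat => 'b => real" and L :: "nat => nat"
 assumes ind: "indep_vars (%_. borel) \<zeta> UNIV" and same: "!!r. distr M borel (\<zeta> r) = distr M borel (\<zeta> 0)"
  and mean: "!!r. expectation (\<zeta> r) = 0" and sq: "!!r. integrable M (%om. (\<zeta> r om)\<^sup>2)" and var: "!!r. expectation (%om. (\<zeta> r om)\<^sup>2) = 1"
  and L: "filterlim L at_top sequentially" and \<theta>L: "(%n. \<theta> n * real (L n)) \<longlonglongrightarrow> \<epsilon>" and \<epsilon>: "0 < \<epsilon>"
  and \<theta>: "!!n. 0 \<le> \<theta> n"
  and K: "0 < K" and N: "prob_space N" and G: "prob_space.indep_vars N (%_. borel) G {..<K}"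
  and Gd: "!!l. l < K ==> distr N borel (G l) = density lborel (normal_density 0 (sqrt \<epsilon>))"
 shows "law_tendsto (%_. M) (%n i om. \<Sum>l<K. a i l * (sqrt (\<theta> n) * (\<Sum>r\<in>{l * L n..<l * L n + L n}. \<zeta> r om)))
  N (%i om. \<Sum>l<K. a i l * G l om) d"
proof -
 have m [measurable]: "\<zeta> r \<in> borel_measurable M" for r using ind by (auto simp: indep_vars_def)
 have v1: "variance (\<zeta> r) = 1\<^sup>2" for r using var by (simp add: mean)
 define \<mu> where "\<mu> n = distr M borel (%om. (\<Sum>r<n. \<zeta> r om) / sqrt (real n))" for n
 have clt: "weak_conv_m \<mu> std_normal_distribution"
  using central_limit_theorem_zero_mean[OF ind mean _ sq v1 same] unfolding \<mu>_def by simp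
 have \<mu>d: "real_distribution (\<mu> n)" for n
  unfolding \<mu>_def by (rule real_distribution_distr) measurable
 obtain \<Omega> :: "real measure" and Ys :: "nat => real => real" and Y :: "real => real" where
  sk: "prob_space \<Omega>" "\<forall>n. Ys n \<in> borel_measurable \<Omega>" "\<forall>n. distr \<Omega> borel (Ys n) = \<mu> n"
   "Y \<in> borel_measurable \<Omega>" "distr \<Omega> borel Y = std_normal_distribution"
   "\<forall>x\<in>space \<Omega>. (%n. Ys n x) \<longlonglongrightarrow> Y x"
  using Skorohod[OF \<mu>d real_dist_normal_dist clt] by (simp only: measurable_lborel1) (elim exE conjE, rule that)
 note \<Omega> = sk(1) sk(2)[rule_format] sk(3)[rule_format] sk(4,5) sk(6)[rule_format]
 interpret O: prob_space \<Omega> by (rule \<Omega>(1))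
 define P where "P = PiM {..<K} (\<lambda>_::nat. \<Omega>)"
 interpret P: prob_space P unfolding P_def by (rule prob_space_PiM) (rule \<Omega>(1))
 have comp: "(%x. x l) \<in> P \<rightarrow>\<^sub>M \<Omega>" if "l < K" for l
  unfolding P_def by (rule measurable_component_singleton) (use that in simp)
 have coord: "P.indep_vars (%_. \<Omega>) (%l x. x l) {..<K}"
 proof (subst P.indep_vars_iff_distr_eq_PiM')
  show "{..<K} \<noteq> {}" using K by (auto simp: lessThan_empty_iff)
  show "(%x. x l) \<in> P \<rightarrow>\<^sub>M \<Omega>" if "l \<in> {..<K}" for l using comp that by simp
  have "distr P (PiM {..<K} (%_. \<Omega>)) (%x. \<lambda>l\<in>{..<K}. x l) = distr P P (%x. x)"
  proof (rule distr_cong)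
   fix x assume "x \<in> space P"
   then show "(\<lambda>l\<in>{..<K}. x l) = x" by (auto simp: P_def space_PiM PiE_restrict)
  qed (simp_all add: P_def)
  also have "\<dots> = PiM {..<K} (%_. \<Omega>)" by (simp add: P_def)
  also have "\<dots> = (\<Pi>\<^sub>M l\<in>{..<K}. distr P \<Omega> (%x. x l))"
   unfolding P_def by (intro PiM_cong refl distr_PiM_component[symmetric] \<Omega>(1)) auto
  finally show "distr P (\<Pi>\<^sub>M l\<in>{..<K}. \<Omega>) (%x. \<lambda>l\<in>{..<K}. x l) = (\<Pi>\<^sub>M l\<in>{..<K}. distr P \<Omega> (%x. x l))" .
 qed
 have marg: "distr P borel (%x. f (x l)) = distr \<Omega> borel f" if "f \<in> borel_measurable \<Omega>" "l < K" for f :: "real => real" and l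
 proof -
  have "distr P borel (%x. f (x l)) = distr (distr P \<Omega> (%x. x l)) borel f"
   using distr_distr[OF that(1) comp[OF that(2)]] by (simp add: comp_def)
  also have "distr P \<Omega> (%x. x l) = \<Omega>" unfolding P_def using that by (intro distr_PiM_component) (auto simp: \<Omega>(1))
  finally show ?thesis .
 qed
 define D where "D n l x = sqrt (\<theta> n * real (L n)) * Ys (L n) (x l)" for n l and x :: "nat => real"
 define Dlim where "Dlim l x = sqrt \<epsilon> * Y (x l)" for l and x :: "nat => real"
 have D_ind: "P.indep_vars (%_. borel) (D n) {..<K}" for n
  unfolding D_def[abs_def] using P.indep_vars_compose2[OF coord, of "%_ y. sqrt (\<theta> n * real (L n)) * Ys (L n) y" "%_. borel"] \<Omega>(2) by simp
 have Dlim_ind: "P.indep_vars (%_. borel) Dlim {..<K}"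
  unfolding Dlim_def[abs_def] using P.indep_vars_compose2[OF coord, of "%_ y. sqrt \<epsilon> * Y y" "%_. borel"] \<Omega>(4) by simp
 define Bl where "Bl n l om = sqrt (\<theta> n) * (\<Sum>r\<in>{l * L n..<l * L n + L n}. \<zeta> r om)" for n l om
 have Bl_ind: "indep_vars (%_. borel) (Bl n) {..<K}" for n
 proof -
  let ?I = "%l. {l * L n..<l * L n + L n}"
  have disj: "disjoint_family_on ?I {..<K}"
   unfolding disjoint_family_on_def
  proof (intro ballI impI)
   fix l l' :: nat assume "l \<noteq> l'"
   have "?I p \<inter> ?I q = {}" if "p < q" for p q
   proof -
    have "p * L n + L n \<le> q * L n" using that mult_le_mono1[of "Suc p" q "L n"] by simp
    then show ?thesis by auto
   qed
   from this[of l l'] this[of l' l] \<open>l \<noteq> l'\<close> show "?I l \<inter> ?I l' = {}" by (cases "l < l'") auto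
  qed
  have "indep_vars (%l. PiM (?I l) (%_. borel)) (%l om. restrict (%i. \<zeta> i om) (?I l)) {..<K}"
   by (rule indep_vars_restrict[OF ind _ disj]) simp
  moreover have "(%h. sqrt (\<theta> n) * (\<Sum>r\<in>?I l. h r)) \<in> PiM (?I l) (%_. borel) \<rightarrow>\<^sub>M (borel :: real measure)" for l
   by (intro borel_measurable_times borel_measurable_const borel_measurable_sum measurable_component_singleton)
  ultimately have "indep_vars (%_. borel) (%l om. sqrt (\<theta> n) * (\<Sum>r\<in>?I l. restrict (%i. \<zeta> i om) (?I l) r)) {..<K}"
   by (rule indep_vars_compose2)
  then show ?thesis unfolding Bl_def[abs_def] by (simp cong: sum.cong_simp)
 qed
 have Bl_D: "distr M borel (Bl n l) = distr P borel (D n l)" if l: "l < K" for n l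
 proof -
  let ?c = "sqrt (\<theta> n * real (L n))"
  have "distr M borel (Bl n l) = distr (distr M borel (%om. \<Sum>r\<in>{l * L n..<l * L n + L n}. \<zeta> r om)) borel (%s. sqrt (\<theta> n) * s)"
   unfolding Bl_def[abs_def] by (subst distr_distr) (auto simp: comp_def)
  also have "\<dots> = distr (distr M borel (%om. \<Sum>r<L n. \<zeta> r om)) borel (%s. sqrt (\<theta> n) * s)"
   by (simp only: iid_shift_sum[OF ind same])
  also have "\<dots> = distr M borel (%om. sqrt (\<theta> n) * (\<Sum>r<L n. \<zeta> r om))"
   by (subst distr_distr) (auto simp: comp_def)
  also have "\<dots> = distr M borel (%om. ?c * ((\<Sum>r<L n. \<zeta> r om) / sqrt (real (L n))))"
   by (cases "L n = 0") (simp_all add: real_sqrt_mult)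
  also have "\<dots> = distr (\<mu> (L n)) borel (%s. ?c * s)"
   unfolding \<mu>_def by (subst distr_distr) (auto simp: comp_def)
  also have "\<dots> = distr \<Omega> borel (%y. ?c * Ys (L n) y)"
   unfolding \<Omega>(3)[symmetric] using \<Omega>(2) by (subst distr_distr) (auto simp: comp_def)
  also have "\<dots> = distr P borel (D n l)"
   unfolding D_def[abs_def] using \<Omega>(2) by (intro marg[symmetric] l) auto
  finally show ?thesis .
 qed
 have Dlim_G: "distr P borel (Dlim l) = distr N borel (G l)" if l: "l < K" for l
 proof -
  have dY: "distributed \<Omega> lborel Y std_normal_density"
   using \<Omega>(4,5) by (simp add: distributed_def measurable_lborel1 distr_cong[OF refl sets_lborel refl])
  have "distributed \<Omega> lborel (%y. 0 + sqrt \<epsilon> * Y y) (normal_density (0 + sqrt \<epsilon> * 0) (\<bar>sqrt \<epsilon>\<bar> * 1))"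
   by (rule O.normal_density_affine[OF dY]) (use \<epsilon> in auto)
  then have "distr \<Omega> lborel (%y. sqrt \<epsilon> * Y y) = density lborel (normal_density 0 (sqrt \<epsilon>))"
   using \<epsilon> by (simp add: distributed_def)
  then have "distr \<Omega> borel (%y. sqrt \<epsilon> * Y y) = density lborel (normal_density 0 (sqrt \<epsilon>))"
   by (simp add: distr_cong[OF refl sets_lborel refl])
  then show ?thesis
   unfolding Dlim_def[abs_def] Gd[OF l] using \<Omega>(4) by (subst marg[OF _ l]) auto
 qed
 show ?thesis
  unfolding law_tendsto_def
 proof (intro allI impI)
  fix F :: "(nat => real) => real"
  assume F: "continuous_on UNIV F" and "\<exists>C. \<forall>x. \<bar>F x\<bar> \<le> C"
  then obtain C where C: "!!x. \<bar>F x\<bar> \<le> C" by blast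
  let ?H = "%h. F (trunc d (%i. \<Sum>l<K. a i l * h l))"
  have Fm: "F \<in> borel_measurable borel" by (rule borel_measurable_continuous_onI[OF F])
  have H: "?H \<in> PiM {..<K} (%_. borel) \<rightarrow>\<^sub>M (borel :: real measure)"
  proof (rule measurable_compose[OF trunc_measurable Fm])
   show "(%h. \<Sum>l<K. a i l * h l) \<in> borel_measurable (PiM {..<K} (%_. borel))" for i
    by (intro borel_measurable_sum borel_measurable_times borel_measurable_const measurable_component_singleton)
  qed
  have restr: "?H (\<lambda>l\<in>{..<K}. z l) = ?H z" for z :: "nat => real" by (simp cong: sum.cong_simp)
  have Kne: "{..<K} \<noteq> {}" using K by (auto simp: lessThan_empty_iff)
  have same_int: "(LINT om|M1. ?H (%l. X1 l om)) = (LINT om|M2. ?H (%l. X2 l om))"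
   if "prob_space M1" "prob_space M2" "prob_space.indep_vars M1 (%_. borel) X1 {..<K}" "prob_space.indep_vars M2 (%_. borel) X2 {..<K}"
    "!!l. l < K ==> distr M1 borel (X1 l) = distr M2 borel (X2 l)" for M1 :: "'x measure" and M2 :: "'y measure" and X1 X2
  proof -
   interpret A: prob_space M1 by fact
   interpret B: prob_space M2 by fact
   have e: "distr M1 borel (%om. ?H (\<lambda>l\<in>{..<K}. X1 l om)) = distr M2 borel (%om. ?H (\<lambda>l\<in>{..<K}. X2 l om))"
    using that by (intro independent_families_same_functional[OF _ _ _ _ Kne _ H]) auto
   have m1: "(%om. ?H (\<lambda>l\<in>{..<K}. X1 l om)) \<in> borel_measurable M1"
    using that(3) by (intro measurable_compose[OF measurable_restrict H]) (auto simp: A.indep_vars_def)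
   have m2: "(%om. ?H (\<lambda>l\<in>{..<K}. X2 l om)) \<in> borel_measurable M2"
    using that(4) by (intro measurable_compose[OF measurable_restrict H]) (auto simp: B.indep_vars_def)
   have "(LINT om|M1. ?H (%l. X1 l om)) = (LINT om|M1. ?H (\<lambda>l\<in>{..<K}. X1 l om))"
    by (rule Bochner_Integration.integral_cong[OF refl restr[symmetric]])
   also have "\<dots> = (LINT y|distr M1 borel (%om. ?H (\<lambda>l\<in>{..<K}. X1 l om)). y)"
    by (rule integral_distr[OF m1, symmetric]) simp
   also have "\<dots> = (LINT om|M2. ?H (\<lambda>l\<in>{..<K}. X2 l om))"
    unfolding e by (rule integral_distr[OF m2]) simp
   also have "\<dots> = (LINT om|M2. ?H (%l. X2 l om))"
    by (rule Bochner_Integration.integral_cong[OF refl restr])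
   finally show ?thesis .
  qed
  have e1: "(LINT om|M. ?H (%l. Bl n l om)) = (LINT x|P. ?H (%l. D n l x))" for n
   by (rule same_int[OF prob_space_axioms P.prob_space_axioms Bl_ind D_ind Bl_D])
  have e2: "(LINT x|P. ?H (%l. Dlim l x)) = (LINT om|N. ?H (%l. G l om))"
   by (rule same_int[OF P.prob_space_axioms N Dlim_ind G Dlim_G])
  have "(%n. LINT x|P. ?H (%l. D n l x)) \<longlonglongrightarrow> (LINT x|P. ?H (%l. Dlim l x))"
  proof (rule integral_dominated_convergence[where w="%_. C"])
   have Dm: "D n l \<in> borel_measurable P" if "l < K" for n l using D_ind[of n] that by (auto simp: P.indep_vars_def)
   have Dlm: "Dlim l \<in> borel_measurable P" if "l < K" for l using Dlim_ind that by (auto simp: P.indep_vars_def)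
   show "(%x. ?H (%l. Dlim l x)) \<in> borel_measurable P"
    by (rule measurable_compose[OF trunc_measurable Fm]) (intro borel_measurable_sum borel_measurable_times borel_measurable_const Dlm, simp)
   show "(%x. ?H (%l. D n l x)) \<in> borel_measurable P" for n
    by (rule measurable_compose[OF trunc_measurable Fm]) (intro borel_measurable_sum borel_measurable_times borel_measurable_const Dm, simp)
   show "AE x in P. (%n. ?H (%l. D n l x)) \<longlonglongrightarrow> ?H (%l. Dlim l x)"
   proof (rule AE_I2)
    fix x assume x: "x \<in> space P"
    have Dc: "(%n. D n l x) \<longlonglongrightarrow> Dlim l x" if "l < K" for l
    proof -
     have "x l \<in> space \<Omega>" using x that by (auto simp: P_def space_PiM)
     then have "(%n. Ys (L n) (x l)) \<longlonglongrightarrow> Y (x l)" using filterlim_compose[OF \<Omega>(6) L] by simp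
     then show ?thesis unfolding D_def Dlim_def by (intro tendsto_mult tendsto_real_sqrt \<theta>L)
    qed
    have "(%n. trunc d (%i. \<Sum>l<K. a i l * D n l x)) \<longlonglongrightarrow> trunc d (%i. \<Sum>l<K. a i l * Dlim l x)"
    proof (rule fun_tendsto_coordinatewise)
     fix i
     show "(%n. trunc d (%i. \<Sum>l<K. a i l * D n l x) i) \<longlonglongrightarrow> trunc d (%i. \<Sum>l<K. a i l * Dlim l x) i"
      unfolding trunc_def by (cases "i < d") (auto intro!: tendsto_sum tendsto_mult Dc)
    qed
    then show "(%n. ?H (%l. D n l x)) \<longlonglongrightarrow> ?H (%l. Dlim l x)"
     by (rule continuous_on_tendsto_compose[OF F]) auto
   qed
  qed (auto simp: C)
  then show "(%n. LINT om|M. F (trunc d (%i. \<Sum>l<K. a i l * (sqrt (\<theta> n) * (\<Sum>r\<in>{l * L n..<l * L n + L n}. \<zeta> r om)))))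
   \<longlonglongrightarrow> (LINT om|N. F (trunc d (%i. \<Sum>l<K. a i l * G l om)))"
   unfolding e1[symmetric] e2 Bl_def .
 qed
qed

section \<open>The exponential integral of Brownian motion\<close>

text \<open>
  The integral of the step function with values \<open>exp (- u l / q)\<close> on \<open>[l / q, (l + 1) / q)\<close>, for \<open>l < q^2\<close>.
\<close>

definition blocks :: "(real => 'a => real) => nat => real => 'a => real" where
 "blocks B q u om = (\<Sum>l<q\<^sup>2. exp (- u * (real l / real q)) * (B (real (Suc l) / real q) om - B (real l / real q) om))"

text \<open>
  The integral defined through integration by parts is the mean of the path at an independent exponential
  time of rate \<open>u\<close>.
\<close>

lemma exponential_as_density:
 assumes u: "0 < u" and f [measurable]: "(%y. f (max 0 y)) \<in> borel_measurable borel"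
 shows "u * (LINT y:{0..}|lborel. exp (- u * y) * f y) = (LINT y|density lborel (exponential_density u). f (max 0 y))"
proof -
 have "u * (LINT y:{0..}|lborel. exp (- u * y) * f y) = (LINT y|lborel. exponential_density u y * f (max 0 y))"
  unfolding set_lebesgue_integral_def Bochner_Integration.integral_mult_right_zero[symmetric]
  by (intro Bochner_Integration.integral_cong refl) (auto simp: exponential_density_def indicator_def max_def mult_ac)
 also have "\<dots> = (LINT y|density lborel (exponential_density u). f (max 0 y))"
  using u by (subst integral_real_density) (auto simp: exponential_density_nonneg)
 finally show ?thesis .
qed

lemma exponential_space:
 assumes u: "0 < u"
 shows "prob_space (density lborel (exponential_density u))"
  and "AE y in density lborel (exponential_density u). 0 \<le> y"
  and "0 \<le> a ==> (LINT y|density lborel (exponential_density u). indicator {a<..} y) = exp (- a * u)"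
  and "(\<integral>\<^sup>+y. ennreal (1 + y\<^sup>2) \<partial>density lborel (exponential_density u)) = ennreal (1 + 2 / u\<^sup>2)"
proof -
 let ?D = "density lborel (exponential_density u)"
 show D: "prob_space ?D" by (rule prob_space_exponential_density[OF u])
 interpret D: prob_space ?D by (rule D)
 show "AE y in ?D. 0 \<le> y"
  by (subst AE_density) (auto simp: exponential_density_def)
 have dist: "distributed ?D lborel (%y. y) (exponential_density u)"
  by (auto simp: distributed_def distr_id2)
 show "(LINT y|?D. indicator {a<..} y) = exp (- a * u)" if "0 \<le> a"
 proof -
  have e: "{y \<in> space ?D. a < y} = {a<..}" by auto
  show ?thesis using D.exponential_distributedD_gt[OF dist that u] unfolding e by simp
 qed
 have i: "integrable ?D (%y. y\<^sup>2)" by (rule D.erlang_ith_moment_integrable[OF u dist])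
 have "D.expectation (%y. y\<^sup>2) = 2 / u\<^sup>2"
  using D.erlang_ith_moment[OF u dist, of 2] by (simp add: fact_2)
 then have "D.expectation (%y. 1 + y\<^sup>2) = 1 + 2 / u\<^sup>2"
  using i by (simp add: D.prob_space[simplified])
 moreover have "integrable ?D (%y. 1 + y\<^sup>2)" using i by (intro Bochner_Integration.integrable_add) auto
 ultimately show "(\<integral>\<^sup>+y. ennreal (1 + y\<^sup>2) \<partial>?D) = ennreal (1 + 2 / u\<^sup>2)"
  by (subst nn_integral_eq_integral) auto
qed

lemma sqrt_le_weighted: "0 < a ==> 0 \<le> x ==> sqrt x \<le> (a + x / a) / 2" for a x :: real
 using arith_geo_mean_sqrt[of a "x / a"] by (simp add: field_simps)

context standard_brownian_motion
begin

text \<open>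
  By continuity of the paths, the values along finer and finer grids converge.
\<close>

lemma joint_measurable: "(%p. B (max 0 (snd p)) (fst p)) \<in> borel_measurable (M \<Otimes>\<^sub>M borel)"
proof -
 define g where "g k x = nat \<lceil>real (Suc k) * max 0 x\<rceil>" for k and x :: real
 show ?thesis
 proof (rule borel_measurable_LIMSEQ_real)
  show "(%p. B (real (g k (snd p)) / real (Suc k)) (fst p)) \<in> borel_measurable (M \<Otimes>\<^sub>M borel)" for k
  proof (rule measurable_compose_countable[where g="%p. g k (snd p)" and f="%i p. B (real i / real (Suc k)) (fst p)"])
   show "(%p. B (real i / real (Suc k)) (fst p)) \<in> borel_measurable (M \<Otimes>\<^sub>M borel)" for i :: nat
    by (intro measurable_compose[OF measurable_fst] rv) simp
   show "(%p. g k (snd p)) \<in> M \<Otimes>\<^sub>M borel \<rightarrow>\<^sub>M count_space UNIV"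
    unfolding g_def by measurable
  qed
  fix p assume "p \<in> space (M \<Otimes>\<^sub>M (borel :: real measure))"
  then have p: "fst p \<in> space M" by (auto simp: space_pair_measure)
  let ?x = "max 0 (snd p)"
  have "(%k. real (g k (snd p)) / real (Suc k)) \<longlonglongrightarrow> ?x"
  proof (rule tendsto_sandwich)
   show "eventually (%k. ?x \<le> real (g k (snd p)) / real (Suc k)) sequentially"
   proof (rule always_eventually, rule allI)
    fix k
    have "real (Suc k) * ?x \<le> real (g k (snd p))" unfolding g_def by linarith
    then show "?x \<le> real (g k (snd p)) / real (Suc k)" by (simp only: pos_le_divide_eq of_nat_0_less_iff zero_less_Suc mult.commute)
   qed
   show "eventually (%k. real (g k (snd p)) / real (Suc k) \<le> ?x + inverse (real (Suc k))) sequentially"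
   proof (rule always_eventually, rule allI)
    fix k
    have nn: "0 \<le> real (Suc k) * ?x" by simp
    have inv: "c * x + 1 = (x + inverse c) * c" if "0 < c" for c x :: real
     using that by (simp add: field_simps)
    have "real (g k (snd p)) \<le> real (Suc k) * ?x + 1" unfolding g_def using nn by linarith
    also have "\<dots> = (?x + inverse (real (Suc k))) * real (Suc k)"
     by (rule inv) simp
    finally show "real (g k (snd p)) / real (Suc k) \<le> ?x + inverse (real (Suc k))"
     by (simp add: pos_divide_le_eq del: of_nat_Suc)
   qed
   show "(%k. ?x + inverse (real (Suc k))) \<longlonglongrightarrow> ?x"
    using tendsto_add[OF tendsto_const LIMSEQ_inverse_real_of_nat, of ?x] by simp
  qed simp
  then show "(%k. B (real (g k (snd p)) / real (Suc k)) (fst p)) \<longlonglongrightarrow> B ?x (fst p)"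
   by (rule continuous_on_tendsto_compose[OF continuous_paths[OF p]]) auto
 qed
qed

lemma section_measurable: "om \<in> space M ==> (%y. B (max 0 y) om) \<in> borel_measurable borel"
 using measurable_compose_Pair1[OF _ joint_measurable] by simp

lemma increment_L1:
 assumes "0 \<le> s" "s \<le> t"
 shows "(\<integral>\<^sup>+om. ennreal \<bar>B t om - B s om\<bar> \<partial>M) \<le> ennreal (sqrt (t - s))"
proof (cases "s = t")
 case False
 then have st: "s < t" using assms by simp
 have [measurable]: "B s \<in> borel_measurable M" "B t \<in> borel_measurable M" using assms by (auto intro!: rv)
 let ?X = "%om. B t om - B s om"
 have D: "distributed M lborel ?X (normal_density 0 (sqrt (t - s)))" using increments_normal[OF assms(1) st] .
 have s0: "0 < sqrt (t - s)" using st by simp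
 have m: "has_bochner_integral lborel (%x. normal_density 0 (sqrt (t - s)) x * x\<^sup>2) (t - s)"
  using normal_moment_even[OF s0, of 0 1] st by (simp add: fact_2 diff_divide_distrib)
 have i: "integrable M (%om. (?X om)\<^sup>2)"
  using distributed_integrable[OF D, of "%x. x\<^sup>2"] m by (auto simp: has_bochner_integral_iff)
 have "expectation (%om. (?X om)\<^sup>2) = t - s"
  using distributed_integral[OF D, of "%x. x\<^sup>2"] m by (auto simp: has_bochner_integral_iff)
 then have "(\<integral>\<^sup>+om. ennreal ((?X om)\<^sup>2) \<partial>M) \<le> ennreal (t - s)"
  using i by (subst nn_integral_eq_integral) auto
 then show ?thesis using st by (intro nn_L1_le_L2) auto
qed simp

lemma AE_path_integrable:
 assumes u: "0 < u"
 shows "AE om in M. integrable (density lborel (exponential_density u)) (%y. B (max 0 y) om)"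
proof -
 let ?D = "density lborel (exponential_density u)"
 interpret D: prob_space ?D by (rule exponential_space[OF u])
 interpret P: pair_sigma_finite M ?D ..
 have jm: "(%p. B (max 0 (snd p)) (fst p)) \<in> borel_measurable (M \<Otimes>\<^sub>M ?D)"
  using joint_measurable measurable_cong_sets[OF sets_pair_measure_cong[OF refl, of ?D borel M] refl] by auto
 have jm': "(%(om, y). ennreal \<bar>B (max 0 y) om\<bar>) \<in> borel_measurable (M \<Otimes>\<^sub>M ?D)"
  using jm by (auto simp: split_beta)
 have nm: "(%om. \<integral>\<^sup>+y. ennreal \<bar>B (max 0 y) om\<bar> \<partial>?D) \<in> borel_measurable M"
  using D.borel_measurable_nn_integral[OF jm'] by simp
 have "(\<integral>\<^sup>+om. (\<integral>\<^sup>+y. ennreal \<bar>B (max 0 y) om\<bar> \<partial>?D) \<partial>M) = (\<integral>\<^sup>+y. (\<integral>\<^sup>+om. ennreal \<bar>B (max 0 y) om\<bar> \<partial>M) \<partial>?D)"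
  by (rule P.Fubini'[OF jm', symmetric])
 also have "\<dots> \<le> (\<integral>\<^sup>+y. ennreal (1 + y\<^sup>2) \<partial>?D)"
 proof (rule nn_integral_mono)
  fix y :: real
  have "(\<integral>\<^sup>+om. ennreal \<bar>B (max 0 y) om\<bar> \<partial>M) = (\<integral>\<^sup>+om. ennreal \<bar>B (max 0 y) om - B 0 om\<bar> \<partial>M)"
   using start by (intro nn_integral_cong_AE) auto
  also have "\<dots> \<le> ennreal (sqrt (max 0 y - 0))" by (rule increment_L1) auto
  also have "\<dots> \<le> ennreal (1 + y\<^sup>2)"
  proof (rule ennreal_leI)
   have gen: "s \<le> 1 + z" if "s \<le> (1 + m / 1) / 2" "m \<le> 1 + z" "0 \<le> z" for s m z :: real
    using that by simp
   have "sqrt (max 0 y) \<le> (1 + max 0 y / 1) / 2" by (rule sqrt_le_weighted) auto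
   moreover have "max 0 y \<le> 1 + y\<^sup>2" using zero_le_power2[of "y - 1"] zero_le_power2[of y] by (simp add: power2_diff max_def)
   ultimately show "sqrt (max 0 y - 0) \<le> 1 + y\<^sup>2" unfolding diff_zero
    by (rule gen) (rule zero_le_power2)
  qed
  finally show "(\<integral>\<^sup>+om. ennreal \<bar>B (max 0 y) om\<bar> \<partial>M) \<le> ennreal (1 + y\<^sup>2)" .
 qed
 also have "\<dots> < \<infinity>" unfolding exponential_space(4)[OF u] by simp
 finally have "AE om in M. (\<integral>\<^sup>+y. ennreal \<bar>B (max 0 y) om\<bar> \<partial>?D) \<noteq> \<infinity>"
  by (intro nn_integral_PInf_AE nm) auto
 with AE_space show ?thesis
 proof eventually_elim
  case (elim om)
  then show ?case using section_measurable[OF elim(1)]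
   by (intro integrableI_bounded) (auto simp: top.not_eq_extremum)
 qed
qed

lemma exp_brownian_integral_measurable:
 assumes u: "0 < u" shows "exp_brownian_integral B u \<in> borel_measurable M"
proof -
 let ?D = "density lborel (exponential_density u)"
 interpret D: prob_space ?D by (rule exponential_space[OF u])
 have "(%p. B (max 0 (snd p)) (fst p)) \<in> borel_measurable (M \<Otimes>\<^sub>M ?D)"
  using joint_measurable measurable_cong_sets[OF sets_pair_measure_cong[OF refl, of ?D borel M] refl] by auto
 then have "(%om. LINT y|?D. B (max 0 y) om) \<in> borel_measurable M"
  by (intro D.borel_measurable_lebesgue_integral) (simp add: split_beta)
 then show ?thesis
 proof (rule measurable_cong[THEN iffD2, rotated])
  fix om assume that: "om \<in> space M"
  show "exp_brownian_integral B u om = (LINT y|?D. B (max 0 y) om)"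
  unfolding exp_brownian_integral_def by (rule exponential_as_density[OF u section_measurable[OF that]])
 qed
qed

text \<open>
  The increments over the grid intervals that start before \<open>y\<close> add up to the path at the next grid
  point. Beyond the horizon \<open>q\<close> the distance to \<open>y\<close> is bounded by \<open>y^2 / q\<close>.
\<close>

lemma blocks_telescope:
 assumes q: "1 \<le> q" and y: "0 \<le> y"
 defines "\<tau> \<equiv> real (min (q\<^sup>2) (nat \<lceil>real q * y\<rceil>)) / real q"
 shows "(\<Sum>l<q\<^sup>2. indicator {real l / real q<..} y * (B (real (Suc l) / real q) om - B (real l / real q) om)) = B \<tau> om - B 0 om"
  and "0 \<le> \<tau>" and "\<bar>y - \<tau>\<bar> \<le> (1 + y\<^sup>2) / real q"
proof -
 have q0: "0 < real q" using q by simp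
 let ?N = "min (q\<^sup>2) (nat \<lceil>real q * y\<rceil>)"
 let ?d = "%l. B (real (Suc l) / real q) om - B (real l / real q) om"
 have lt: "real l / real q < y \<longleftrightarrow> l < nat \<lceil>real q * y\<rceil>" for l
 proof -
  have "real l / real q < y \<longleftrightarrow> real l < real q * y" using q0 by (simp add: divide_less_eq mult.commute)
  also have "\<dots> \<longleftrightarrow> l < nat \<lceil>real q * y\<rceil>" by linarith
  finally show ?thesis .
 qed
 have "(\<Sum>l<q\<^sup>2. indicator {real l / real q<..} y * ?d l) = (\<Sum>l<?N. ?d l)"
 proof -
  have "(\<Sum>l<q\<^sup>2. indicator {real l / real q<..} y * ?d l) = (\<Sum>l<q\<^sup>2. if l < nat \<lceil>real q * y\<rceil> then ?d l else 0)"
   by (intro sum.cong refl) (simp only: indicator_def greaterThan_iff lt, simp)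
  also have "\<dots> = (\<Sum>l\<in>{l\<in>{..<q\<^sup>2}. l < nat \<lceil>real q * y\<rceil>}. ?d l)"
   by (rule sum.inter_filter[symmetric]) simp
  also have "{l\<in>{..<q\<^sup>2}. l < nat \<lceil>real q * y\<rceil>} = {..<?N}" by auto
  finally show ?thesis .
 qed
 also have "\<dots> = B (real ?N / real q) om - B (real 0 / real q) om"
  by (rule sum_lessThan_telescope)
 finally show "(\<Sum>l<q\<^sup>2. indicator {real l / real q<..} y * ?d l) = B \<tau> om - B 0 om" by (simp add: \<tau>_def)
 show "0 \<le> \<tau>" by (simp add: \<tau>_def)
 have qy: "0 \<le> real q * y" using y by simp
 show "\<bar>y - \<tau>\<bar> \<le> (1 + y\<^sup>2) / real q"
 proof (cases "nat \<lceil>real q * y\<rceil> \<le> q\<^sup>2")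
  case True
  then have "\<bar>real q * y - real ?N\<bar> \<le> 1" using qy by (simp add: min_absorb2) linarith
  moreover have "\<bar>y - n / c\<bar> * c \<le> 1" if "\<bar>c * y - n\<bar> \<le> 1" "0 < c" for n c :: real
  proof -
   have "\<bar>y - n / c\<bar> * c = \<bar>(y - n / c) * c\<bar>" using that(2) by (simp add: abs_mult)
   also have "(y - n / c) * c = c * y - n" using that(2) by (simp add: left_diff_distrib)
   finally show ?thesis using that(1) by simp
  qed
  ultimately have "\<bar>y - \<tau>\<bar> * real q \<le> 1" unfolding \<tau>_def using q0 by blast
  also have "\<dots> \<le> 1 + y\<^sup>2" by simp
  finally show ?thesis using q0 by (simp add: pos_le_divide_eq)
 next
  case False
  have "q\<^sup>2 \<le> nat \<lceil>real q * y\<rceil>" using False by linarith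
  then have "\<tau> = real q" unfolding \<tau>_def using q0 by (simp only: min_absorb1) (simp add: power2_eq_square)
  moreover have "(real q)\<^sup>2 \<le> real q * y"
  proof -
   have "real (q\<^sup>2) \<le> real q * y" using False qy by linarith
   then show ?thesis by simp
  qed
  then have "real q \<le> y" using q0 by (simp add: power2_eq_square)
  moreover from this have "y * real q \<le> y\<^sup>2" using y by (simp add: power2_eq_square mult_left_mono)
  then have "y \<le> (1 + y\<^sup>2) / real q" using q0 by (simp add: pos_le_divide_eq)
  ultimately show ?thesis by simp
 qed
qed

lemma blocks_measurable: "1 \<le> q ==> blocks B q u \<in> borel_measurable M"
 unfolding blocks_def[abs_def]
 by (intro borel_measurable_sum borel_measurable_times borel_measurable_const borel_measurable_diff rv) auto

text \<open>
  Both sides are means over an exponential time: of the path itself and of the path at a grid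
  point near that time. The increment in between has mean at most the square root of the distance.
\<close>

lemma exp_brownian_integral_blocks:
 assumes u: "0 < u" and q: "1 \<le> q"
 shows "(\<integral>\<^sup>+om. ennreal \<bar>exp_brownian_integral B u om - blocks B q u om\<bar> \<partial>M) \<le> ennreal ((1 + 2 / u\<^sup>2) / sqrt (real q))"
proof -
 let ?D = "density lborel (exponential_density u)"
 interpret D: prob_space ?D by (rule exponential_space[OF u])
 interpret P: pair_sigma_finite M ?D ..
 have q0: "0 < real q" using q by simp
 define \<tau> where "\<tau> y = real (min (q\<^sup>2) (nat \<lceil>real q * max 0 y\<rceil>)) / real q" for y :: real
 note tel = blocks_telescope[OF q max.cobounded1, folded \<tau>_def]
 define g where "g om y = (\<Sum>l<q\<^sup>2. indicator {real l / real q<..} (max 0 y) * (B (real (Suc l) / real q) om - B (real l / real q) om))" for om y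
 have [measurable]: "B (real l / real q) \<in> borel_measurable M" for l by (intro rv) simp
 have jm: "(%p. B (max 0 (snd p)) (fst p)) \<in> borel_measurable (M \<Otimes>\<^sub>M ?D)"
  using joint_measurable measurable_cong_sets[OF sets_pair_measure_cong[OF refl, of ?D borel M] refl] by auto
 have gm: "(%p. g (fst p) (snd p)) \<in> borel_measurable (M \<Otimes>\<^sub>M ?D)"
  unfolding g_def
 proof (intro borel_measurable_sum borel_measurable_times borel_measurable_diff)
  show "(%p. indicator {real l / real q<..} (max 0 (snd p)) :: real) \<in> borel_measurable (M \<Otimes>\<^sub>M ?D)" for l
   by measurable
 qed measurable
 have jm': "(%(om, y). ennreal \<bar>B (max 0 y) om - B 0 om - g om y\<bar>) \<in> borel_measurable (M \<Otimes>\<^sub>M ?D)"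
 proof -
  have "B 0 \<in> borel_measurable M" by (rule rv) simp
  then have "(%p. B 0 (fst p)) \<in> borel_measurable (M \<Otimes>\<^sub>M ?D)" by (rule measurable_compose[OF measurable_fst])
  then show ?thesis using jm gm by (simp add: split_beta)
 qed
 have pt: "AE om in M. ennreal \<bar>exp_brownian_integral B u om - blocks B q u om\<bar> \<le> (\<integral>\<^sup>+y. ennreal \<bar>B (max 0 y) om - B 0 om - g om y\<bar> \<partial>?D)"
  using AE_path_integrable[OF u] start AE_space
 proof eventually_elim
  case (elim om)
  have gi: "integrable ?D (g om)"
   unfolding g_def
   by (intro Bochner_Integration.integrable_sum integrable_mult_left D.integrable_const_bound[where B=1]) (auto simp: indicator_def)
  have ind: "(LINT y|?D. indicator {real l / real q<..} (max 0 y)) = exp (- u * (real l / real q))" for l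
  proof -
   have "(LINT y|?D. indicator {real l / real q<..} (max 0 y)) = (LINT y|?D. indicator {real l / real q<..} y :: real)"
    by (intro Bochner_Integration.integral_cong refl) (auto simp: indicator_def max_def, smt (verit) divide_nonneg_nonneg of_nat_0_le_iff)
   also have "\<dots> = exp (- (real l / real q) * u)" by (rule exponential_space(3)[OF u]) simp
   finally show ?thesis by (simp add: mult.commute)
  qed
  have "(LINT y|?D. g om y) = blocks B q u om"
   unfolding g_def blocks_def
  proof (subst Bochner_Integration.integral_sum)
   show "integrable ?D (%y. indicator {real l / real q<..} (max 0 y) * (B (real (Suc l) / real q) om - B (real l / real q) om))" for l
    by (intro integrable_mult_left D.integrable_const_bound[where B=1]) (auto simp: indicator_def)
  qed (simp only: Bochner_Integration.integral_mult_left_zero ind)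
  moreover have "exp_brownian_integral B u om = (LINT y|?D. B (max 0 y) om)"
   unfolding exp_brownian_integral_def by (rule exponential_as_density[OF u section_measurable[OF elim(3)]])
  ultimately have "exp_brownian_integral B u om - blocks B q u om = (LINT y|?D. B (max 0 y) om - B 0 om - g om y)"
   using gi elim by simp
  moreover have "ennreal (norm (LINT y|?D. B (max 0 y) om - B 0 om - g om y)) \<le> (\<integral>\<^sup>+y. norm (B (max 0 y) om - B 0 om - g om y) \<partial>?D)"
   using gi elim by (intro integral_norm_bound_ennreal) auto
  ultimately show ?case by simp
 qed
 have "(\<integral>\<^sup>+om. ennreal \<bar>exp_brownian_integral B u om - blocks B q u om\<bar> \<partial>M) \<le> (\<integral>\<^sup>+om. (\<integral>\<^sup>+y. ennreal \<bar>B (max 0 y) om - B 0 om - g om y\<bar> \<partial>?D) \<partial>M)"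
  by (rule nn_integral_mono_AE[OF pt])
 also have "\<dots> = (\<integral>\<^sup>+y. (\<integral>\<^sup>+om. ennreal \<bar>B (max 0 y) om - B 0 om - g om y\<bar> \<partial>M) \<partial>?D)"
  by (rule P.Fubini'[OF jm', symmetric])
 also have "\<dots> \<le> (\<integral>\<^sup>+y. ennreal (1 / sqrt (real q)) * ennreal (1 + y\<^sup>2) \<partial>?D)"
 proof (rule nn_integral_mono)
  fix y :: real
  let ?y = "max 0 y"
  have "(\<integral>\<^sup>+om. ennreal \<bar>B ?y om - B 0 om - g om y\<bar> \<partial>M) = (\<integral>\<^sup>+om. ennreal \<bar>B ?y om - B (\<tau> y) om\<bar> \<partial>M)"
   unfolding g_def tel(1) by (intro nn_integral_cong arg_cong[where f=ennreal]) simp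
  also have "\<dots> \<le> ennreal (sqrt \<bar>?y - \<tau> y\<bar>)"
  proof (cases "\<tau> y \<le> ?y")
   case True
   then show ?thesis using increment_L1[OF tel(2) True] by simp
  next
   case False
   then have "?y \<le> \<tau> y" by linarith
   then show ?thesis using increment_L1[of ?y "\<tau> y"] by (simp add: abs_minus_commute)
  qed
  also have "\<dots> \<le> ennreal (1 / sqrt (real q) * (1 + y\<^sup>2))"
  proof (rule ennreal_leI)
   have sq: "?y\<^sup>2 \<le> y\<^sup>2" by (simp add: max_def)
   let ?a = "1 / sqrt (real q)"
   have gen: "s \<le> z" if "d \<le> z" "s \<le> (a + d) / 2" "a \<le> z" for s z d a :: real using that by simp
   have a: "0 < ?a" "?a * ?a = 1 / real q" using q0 by auto
   have "\<bar>?y - \<tau> y\<bar> \<le> (1 + ?y\<^sup>2) / real q" by (rule tel(3))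
   also have "\<dots> \<le> (1 + y\<^sup>2) / real q" using sq q0 by (intro divide_right_mono) auto
   also have "\<dots> = (1 + y\<^sup>2) * ?a * ?a" using a(2) by (simp add: mult.assoc)
   finally have "\<bar>?y - \<tau> y\<bar> / ?a \<le> (1 + y\<^sup>2) * ?a" using a(1) by (simp only: pos_divide_le_eq)
   moreover have "sqrt \<bar>?y - \<tau> y\<bar> \<le> (?a + \<bar>?y - \<tau> y\<bar> / ?a) / 2" by (rule sqrt_le_weighted[OF a(1)]) simp
   moreover have "1 * ?a \<le> (1 + y\<^sup>2) * ?a" by (rule mult_right_mono) (use a(1) in auto)
   ultimately have "sqrt \<bar>?y - \<tau> y\<bar> \<le> (1 + y\<^sup>2) * ?a" unfolding mult_1 using gen by blast
   then show "sqrt \<bar>?y - \<tau> y\<bar> \<le> ?a * (1 + y\<^sup>2)" by (simp only: mult.commute)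
  qed
  also have "\<dots> = ennreal (1 / sqrt (real q)) * ennreal (1 + y\<^sup>2)" by (rule ennreal_mult) auto
  finally show "(\<integral>\<^sup>+om. ennreal \<bar>B ?y om - B 0 om - g om y\<bar> \<partial>M) \<le> ennreal (1 / sqrt (real q)) * ennreal (1 + y\<^sup>2)" .
 qed
 also have "\<dots> = ennreal (1 / sqrt (real q)) * ennreal (1 + 2 / u\<^sup>2)"
  by (subst nn_integral_cmult) (simp, simp only: exponential_space(4)[OF u])
 also have "\<dots> = ennreal ((1 + 2 / u\<^sup>2) / sqrt (real q))"
  by (subst ennreal_mult[symmetric]) (auto simp: add_nonneg_nonneg)
 finally show ?thesis .
qed

lemma block_increments:
 assumes q: "1 \<le> q"
 shows "indep_vars (%_. borel) (%l om. B (real (Suc l) / real q) om - B (real l / real q) om) {..<q\<^sup>2}"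
  and "distr M borel (%om. B (real (Suc l) / real q) om - B (real l / real q) om) = density lborel (normal_density 0 (sqrt (1 / real q)))"
proof -
 show "indep_vars (%_. borel) (%l om. B (real (Suc l) / real q) om - B (real l / real q) om) {..<q\<^sup>2}"
  by (rule increments_indep) (auto intro!: divide_right_mono)
 have "real (Suc l) / real q - real l / real q = 1 / real q" by (simp add: diff_divide_distrib[symmetric])
 moreover have "real l / real q < real (Suc l) / real q" using q by (intro divide_strict_right_mono) auto
 ultimately have "distributed M lborel (%om. B (real (Suc l) / real q) om - B (real l / real q) om) (normal_density 0 (sqrt (1 / real q)))"
  using increments_normal[of "real l / real q" "real (Suc l) / real q"] by simp
 then have "distr M lborel (%om. B (real (Suc l) / real q) om - B (real l / real q) om) = density lborel (normal_density 0 (sqrt (1 / real q)))"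
  by (simp add: distributed_def)
 then show "distr M borel (%om. B (real (Suc l) / real q) om - B (real l / real q) om) = density lborel (normal_density 0 (sqrt (1 / real q)))"
  by (simp add: distr_cong[OF refl sets_lborel refl])
qed

end

section \<open>Block approximation of the weights\<close>

lemma (in prob_space) orthonormal_combination:
 fixes \<zeta> :: "nat => 'a => real"
 assumes ind: "indep_vars (%_. borel) \<zeta> UNIV" and mean: "!!r. expectation (\<zeta> r) = 0"
  and sq: "!!r. integrable M (%om. (\<zeta> r om)\<^sup>2)" and var: "!!r. expectation (%om. (\<zeta> r om)\<^sup>2) = 1"
 shows "(\<integral>\<^sup>+om. ennreal ((\<Sum>r<K. c r * \<zeta> r om)\<^sup>2) \<partial>M) = ennreal (\<Sum>r<K. (c r)\<^sup>2)"
proof -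
 have m [measurable]: "\<zeta> r \<in> borel_measurable M" for r using ind by (auto simp: indep_vars_def)
 have i1: "integrable M (\<zeta> r)" for r by (rule square_integrable_imp_integrable[OF m sq])
 have pair: "integrable M (%om. \<zeta> r om * \<zeta> s om) \<and> expectation (%om. \<zeta> r om * \<zeta> s om) = (if r = s then 1 else 0)" for r s
 proof (cases "r = s")
  case True
  then show ?thesis using sq[of s] var[of s] by (simp add: power2_eq_square)
 next
  case False
  have "indep_var (PiM {r} (%_. borel)) (%om. restrict (%i. \<zeta> i om) {r}) (PiM {s} (%_. borel)) (%om. restrict (%i. \<zeta> i om) {s})"
   using False by (intro indep_var_restrict[OF ind]) auto
  from indep_var_compose[OF this measurable_component_singleton[of r] measurable_component_singleton[of s]]
  have iv: "indep_var borel (\<zeta> r) borel (\<zeta> s)" by (simp add: comp_def)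
  show ?thesis using indep_var_integrable[OF iv i1 i1] indep_var_lebesgue_integral[OF iv i1 i1] False by (simp add: mean)
 qed
 have eq: "(\<Sum>r<K. c r * \<zeta> r om)\<^sup>2 = (\<Sum>r<K. \<Sum>s<K. c r * c s * (\<zeta> r om * \<zeta> s om))" for om
  unfolding power2_eq_square sum_product by (intro sum.cong refl) (simp add: mult_ac)
 have "integrable M (%om. (\<Sum>r<K. c r * \<zeta> r om)\<^sup>2)"
  unfolding eq using pair by (intro Bochner_Integration.integrable_sum integrable_mult_right) blast
 moreover have "expectation (%om. (\<Sum>r<K. c r * \<zeta> r om)\<^sup>2) = (\<Sum>r<K. (c r)\<^sup>2)"
 proof -
  have i2: "integrable M (%om. c r * c s * (\<zeta> r om * \<zeta> s om))" for r s using pair by (intro integrable_mult_right) blast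
  have e2: "expectation (%om. c r * c s * (\<zeta> r om * \<zeta> s om)) = c r * c s * (if r = s then 1 else 0)" for r s
   using pair[of r s] by (simp only: Bochner_Integration.integral_mult_right_zero)
  have "expectation (%om. (\<Sum>r<K. c r * \<zeta> r om)\<^sup>2) = (\<Sum>r<K. \<Sum>s<K. c r * c s * (if r = s then 1 else 0))"
   unfolding eq by (simp only: Bochner_Integration.integral_sum Bochner_Integration.integrable_sum i2 e2)
  also have "\<dots> = (\<Sum>r<K. (c r)\<^sup>2)"
   by (intro sum.cong refl) (simp add: power2_eq_square if_distrib sum.delta cong: if_cong)
  finally show ?thesis .
 qed
 ultimately show ?thesis by (subst nn_integral_eq_integral) auto
qed

lemma geometric_exp_sum_le: "0 < h ==> (\<Sum>r<K. exp (- h) ^ r) \<le> (1 + h) / h" for h :: real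
proof -
 assume h: "0 < h"
 have e: "exp (- h) < 1" using h by simp
 have "(\<Sum>r<K. exp (- h) ^ r) = (1 - exp (- h) ^ K) / (1 - exp (- h))"
  using e by (subst sum_gp_strict) auto
 also have "\<dots> \<le> 1 / (1 - exp (- h))" using e by (intro divide_right_mono) auto
 also have "\<dots> \<le> (1 + h) / h"
 proof -
  have "(1 + h) * exp (- h) \<le> exp h * exp (- h)" by (intro mult_right_mono) (simp_all add: exp_ge_add_one_self)
  also have "\<dots> = 1" by (simp add: exp_minus)
  finally have "h \<le> (1 + h) * (1 - exp (- h))" by (simp add: algebra_simps)
  then show ?thesis using h e by (simp add: divide_le_eq pos_le_divide_eq mult.commute)
 qed
 finally show ?thesis .
qed

context linear_intensity begin

text \<open>
  The weight of the \<open>r\<close>-th step, normalized to be about one at \<open>r = 0\<close>.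
\<close>

definition wt :: "nat => real => nat => real" where "wt k t r = V k (t - mu * r) / tau k t"

lemma tau_pos: "0 < t ==> 0 < tau k t" using mu_pos by (simp add: tau_def)

lemma wt_nonneg [simp]: "0 < t ==> 0 \<le> wt k t r" by (simp add: wt_def)

lemma wt_mono: "0 < t ==> r \<le> s ==> wt k t s \<le> wt k t r"
 unfolding wt_def using mu_pos tau_pos[of t k] by (intro divide_right_mono V_mono diff_left_mono mult_left_mono) auto

lemma wt_zero: "0 < t ==> t < mu * r ==> wt k t r = 0"
 by (simp add: wt_def V_neg)

text \<open>
  A geometric series, with a prefactor close to one as long as \<open>k^2 = o(t)\<close>.
\<close>

lemma wt_square_sum:
 assumes t: "0 < t" and k: "0 < k"
 defines "h \<equiv> 2 * real k * mu / t"
 shows "(\<Sum>r<K. (wt k t r)\<^sup>2) \<le> exp (2 * c * (real k)\<^sup>2 / t) * ((1 + h) / h)"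
proof -
 have h: "0 < h" using t k mu_pos by (simp add: h_def)
 have "(wt k t r)\<^sup>2 \<le> exp (2 * c * (real k)\<^sup>2 / t) * exp (- h) ^ r" for r
 proof -
  have "V k (t - mu * r) \<le> exp (real k * (c * k - mu * r) / t) * tau k t"
   using V_upper_exp[OF t, of k "mu * r"] by (simp add: mult.commute)
  then have "wt k t r \<le> exp (real k * (c * k - mu * r) / t)"
   unfolding wt_def using tau_pos[OF t, of k] by (simp add: pos_divide_le_eq)
  then have "(wt k t r)\<^sup>2 \<le> (exp (real k * (c * k - mu * r) / t))\<^sup>2" using t by (intro power_mono) auto
  also have "\<dots> = exp (2 * (real k * (c * k - mu * r) / t))" by (rule exp_double[symmetric])
  also have "2 * (real k * (c * k - mu * r) / t) = 2 * c * (real k)\<^sup>2 / t + real r * (- h)"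
   using t by (simp add: h_def field_simps power2_eq_square)
  also have "exp \<dots> = exp (2 * c * (real k)\<^sup>2 / t) * exp (- h) ^ r" by (simp only: exp_add exp_of_nat_mult)
  finally show ?thesis .
 qed
 then have "(\<Sum>r<K. (wt k t r)\<^sup>2) \<le> (\<Sum>r<K. exp (2 * c * (real k)\<^sup>2 / t) * exp (- h) ^ r)" by (rule sum_mono)
 also have "\<dots> \<le> exp (2 * c * (real k)\<^sup>2 / t) * ((1 + h) / h)"
  unfolding sum_distrib_left[symmetric] by (intro mult_left_mono geometric_exp_sum_le h) simp
 finally show ?thesis .
qed

text \<open>
  From \<open>ln (1 - y) \<ge> - y - 2 y^2\<close>.
\<close>

lemma wt_lower:
 fixes r k :: nat
 assumes t: "0 < t"
 defines "y \<equiv> (mu * r + c * k) / t"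
 assumes y: "y \<le> 1 / 2"
 shows "exp (- (real k * y) - 2 * (real k * y * y)) \<le> wt k t r"
proof -
 have y0: "0 \<le> y" using t mu_pos c_nonneg by (simp add: y_def)
 have "mu * r + c * k \<le> t" using y t by (simp add: y_def field_simps)
 then have "tau k t * (1 - y) ^ k \<le> V k (t - mu * r)"
  unfolding y_def using mu_pos by (intro V_lower_power[OF t]) auto
 then have "(1 - y) ^ k \<le> wt k t r"
  unfolding wt_def using tau_pos[OF t, of k] by (simp add: pos_le_divide_eq mult.commute)
 moreover have "exp (- y - 2 * y\<^sup>2) \<le> 1 - y"
  using ln_one_minus_pos_lower_bound[OF y0 y] y by (subst ln_ge_iff[symmetric]) auto
 then have "exp (- y - 2 * y\<^sup>2) ^ k \<le> (1 - y) ^ k" by (intro power_mono) auto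
 moreover have "exp (- y - 2 * y\<^sup>2) ^ k = exp (- (real k * y) - 2 * (real k * y * y))"
  unfolding exp_of_nat_mult[symmetric] by (simp add: algebra_simps power2_eq_square)
 ultimately show ?thesis by simp
qed

text \<open>
  Expanding the square avoids a pointwise comparison: the squares of the weights are bounded by a
  geometric series, the squares of the steps are explicit, and by monotonicity of the weights the
  cross term is at least its value at the right ends of the blocks.
\<close>

lemma block_square_error:
 fixes len m K k :: nat and \<theta> t :: real and e :: "nat => real"
 assumes e: "!!l. 0 \<le> e l" and t: "0 < t" and k: "0 < k" and \<theta>: "0 \<le> \<theta>" and len: "0 < len" and K: "m * len \<le> K"
 defines "h \<equiv> 2 * real k * mu / t"
 shows "\<theta> * (\<Sum>r<K. (wt k t r - (if r < m * len then e (r div len) else 0))\<^sup>2)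
  \<le> exp (2 * c * (real k)\<^sup>2 / t) * ((1 + h) * (\<theta> / h)) - 2 * (\<Sum>l<m. e l * ((\<theta> * len) * wt k t (Suc l * len)))
   + \<theta> * len * (\<Sum>l<m. (e l)\<^sup>2)"
proof -
 let ?w = "wt k t" and ?b = "%r. if r < m * len then e (r div len) else 0"
 have group: "(\<Sum>r<m * len. f r) = (\<Sum>l<m. \<Sum>r\<in>{l * len..<l * len + len}. f r)" for f :: "nat => real"
  by (rule sum.nat_group[symmetric])
 have dv: "r div len = l" if "r \<in> {l * len..<l * len + len}" for r l
  using that len by (intro div_nat_eqI) (auto simp: mult.commute)
 have restr: "(\<Sum>r<K. if r < m * len then f r else 0) = (\<Sum>r<m * len. f r)" for f :: "nat => real"
  using K by (simp add: sum.If_cases Int_absorb1 Collect_conj_eq[symmetric] lessThan_def[symmetric] Int_absorb2)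
 have "(\<Sum>r<K. (?w r - ?b r)\<^sup>2) = (\<Sum>r<K. (?w r)\<^sup>2 + (if r < m * len then (e (r div len))\<^sup>2 - 2 * (e (r div len) * ?w r) else 0))"
  by (intro sum.cong refl) (simp add: power2_diff)
 also have "\<dots> = (\<Sum>r<K. (?w r)\<^sup>2) + (\<Sum>r<m * len. (e (r div len))\<^sup>2 - 2 * (e (r div len) * ?w r))"
  by (simp only: sum.distrib restr)
 also have "\<dots> = (\<Sum>r<K. (?w r)\<^sup>2) + (\<Sum>r<m * len. (e (r div len))\<^sup>2) - 2 * (\<Sum>r<m * len. e (r div len) * ?w r)"
  by (simp add: sum_subtractf sum_distrib_left)
 finally have E: "(\<Sum>r<K. (?w r - ?b r)\<^sup>2) = (\<Sum>r<K. (?w r)\<^sup>2) + (\<Sum>r<m * len. (e (r div len))\<^sup>2) - 2 * (\<Sum>r<m * len. e (r div len) * ?w r)" .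
 have sq: "(\<Sum>r<m * len. (e (r div len))\<^sup>2) = len * (\<Sum>l<m. (e l)\<^sup>2)"
 proof -
  have "(\<Sum>r\<in>{l * len..<l * len + len}. (e (r div len))\<^sup>2) = len * (e l)\<^sup>2" for l
  proof -
   have "(\<Sum>r\<in>{l * len..<l * len + len}. (e (r div len))\<^sup>2) = (\<Sum>r\<in>{l * len..<l * len + len}. (e l)\<^sup>2)"
    by (intro sum.cong refl) (simp only: dv)
   then show ?thesis by simp
  qed
  then show ?thesis unfolding group sum_distrib_left by simp
 qed
 have cross: "(\<Sum>l<m. e l * (len * ?w (Suc l * len))) \<le> (\<Sum>r<m * len. e (r div len) * ?w r)"
  unfolding group
 proof (rule sum_mono)
  fix l
  have "e l * (len * ?w (Suc l * len)) = (\<Sum>r\<in>{l * len..<l * len + len}. e l * ?w (Suc l * len))" by simp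
  also have "\<dots> \<le> (\<Sum>r\<in>{l * len..<l * len + len}. e (r div len) * ?w r)"
  proof (rule sum_mono)
   fix r assume r: "r \<in> {l * len..<l * len + len}"
   have "?w (Suc l * len) \<le> ?w r" using r by (intro wt_mono[OF t]) auto
   then show "e l * ?w (Suc l * len) \<le> e (r div len) * ?w r" unfolding dv[OF r] using e by (rule mult_left_mono)
  qed
  finally show "e l * (len * ?w (Suc l * len)) \<le> (\<Sum>r\<in>{l * len..<l * len + len}. e (r div len) * ?w r)" .
 qed
 have main: "(\<Sum>r<K. (?w r - ?b r)\<^sup>2) \<le> exp (2 * c * (real k)\<^sup>2 / t) * ((1 + h) / h)
   + len * (\<Sum>l<m. (e l)\<^sup>2) - 2 * (\<Sum>l<m. e l * (len * ?w (Suc l * len)))"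
  unfolding E sq using wt_square_sum[OF t k, of K] cross unfolding h_def by linarith
 have "\<theta> * (\<Sum>r<K. (?w r - ?b r)\<^sup>2) \<le> \<theta> * (exp (2 * c * (real k)\<^sup>2 / t) * ((1 + h) / h)
   + len * (\<Sum>l<m. (e l)\<^sup>2) - 2 * (\<Sum>l<m. e l * (len * ?w (Suc l * len))))"
  by (rule mult_left_mono[OF main \<theta>])
 also have "\<dots> = exp (2 * c * (real k)\<^sup>2 / t) * ((1 + h) * (\<theta> / h)) - 2 * (\<Sum>l<m. e l * ((\<theta> * len) * wt k t (Suc l * len)))
   + \<theta> * len * (\<Sum>l<m. (e l)\<^sup>2)"
  by (simp add: algebra_simps sum_distrib_left)
 finally show ?thesis .
qed

end

definition gap :: "real => nat => real" where
 "gap u q = 1 / (2 * u) - 2 * (\<Sum>l<q\<^sup>2. exp (- u * (real l / real q)) * (1 / real q * exp (- (u * (real (Suc l) / real q)))))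
  + 1 / real q * (\<Sum>l<q\<^sup>2. (exp (- u * (real l / real q)))\<^sup>2)"

text \<open>
  The three terms tend to \<open>1 / (2 u)\<close>, the integral of \<open>exp (- 2 u x)\<close>, with coefficients one, minus two and one.
\<close>

lemma gap_tendsto_0:
 assumes u: "0 < u" shows "gap u \<longlonglongrightarrow> 0"
proof -
 let ?S = "\<lambda>q::nat. (1 - exp (- 2 * u * real q)) / (1 - exp (- 2 * u / real q))"
 have eq: "gap u q = 1 / (2 * u) - (2 * exp (- u / real q) - 1) * (?S q / real q)" if q: "1 \<le> q" for q
 proof -
  have q0: "0 < real q" using q by simp
  have lt: "exp (- 2 * u / real q) < 1" using u q0 by simp
  have sq: "(exp (- u * (real l / real q)))\<^sup>2 = exp (- 2 * u / real q) ^ l" for l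
   unfolding exp_of_nat_mult[symmetric] by (simp add: algebra_simps)
  have cr: "exp (- u * (real l / real q)) * (1 / real q * exp (- (u * (real (Suc l) / real q)))) = exp (- u / real q) / real q * exp (- 2 * u / real q) ^ l" for l
  proof -
   have "exp (- u * (real l / real q)) * exp (- (u * (real (Suc l) / real q))) = exp (- u / real q) * exp (- 2 * u / real q) ^ l"
    unfolding exp_of_nat_mult[symmetric] exp_add[symmetric] using q0 by (simp add: field_simps)
   then show ?thesis by simp
  qed
  have "exp (- 2 * u / real q) ^ q\<^sup>2 = exp (- 2 * u * real q)"
   unfolding exp_of_nat_mult[symmetric] using q0 by (simp add: power2_eq_square)
  then have S: "(\<Sum>l<q\<^sup>2. exp (- 2 * u / real q) ^ l) = ?S q"
   using lt by (subst sum_gp_strict) auto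
  have "gap u q = 1 / (2 * u) - 2 * (exp (- u / real q) / real q * ?S q) + 1 / real q * ?S q"
   unfolding gap_def sq cr sum_distrib_left[symmetric] S ..
  moreover have "A - 2 * (E / Q * S) + 1 / Q * S = A - (2 * E - 1) * (S / Q)" for A E Q S :: real
   by (simp add: algebra_simps)
  ultimately show ?thesis by (simp only:)
 qed
 have "(\<lambda>q::nat. 1 / (2 * u) - (2 * exp (- u / real q) - 1) * (?S q / real q)) \<longlonglongrightarrow> 1 / (2 * u) - inverse u / 2"
  using u by real_asymp
 also have "1 / (2 * u) - inverse u / 2 = 0" using u by (simp add: field_simps)
 finally have "(\<lambda>q::nat. 1 / (2 * u) - (2 * exp (- u / real q) - 1) * (?S q / real q)) \<longlonglongrightarrow> 0" .
 moreover have "eventually (%q. 1 / (2 * u) - (2 * exp (- u / real q) - 1) * (?S q / real q) = gap u q) sequentially"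
  using eq by (intro eventually_sequentiallyI[of 1]) simp
 ultimately show ?thesis using Lim_transform_eventually by blast
qed

section \<open>The asymptotic regime\<close>

text \<open>
  The assumption \<open>j = o(t^(1/3))\<close>, freed from the concrete sequences.
\<close>

locale regime =
 fixes t J :: "nat => real" and mu :: real
 assumes J_top: "filterlim J at_top sequentially"
  and t_top: "filterlim t at_top sequentially"
  and J3: "(%n. J n ^ 3 / t n) \<longlonglongrightarrow> 0"
  and mu_pos: "0 < mu"
begin

text \<open>
  The mesh of the time scale \<open>x = mu J r / t\<close>. The absolute value makes it nonnegative for every \<open>n\<close>, not only
  for the large ones.
\<close>

definition theta :: "nat => real" where "theta n = \<bar>mu * J n / t n\<bar>"

text \<open>
  The number of steps in a block of length \<open>1 / q\<close> on the time scale.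
\<close>

definition len :: "nat => nat => nat" where "len q n = nat \<lfloor>1 / (real q * theta n)\<rfloor>"

lemma theta_nonneg [simp]: "0 \<le> theta n" by (simp add: theta_def)

lemma ev_ge1: "eventually (%n. 1 \<le> J n \<and> 1 \<le> t n) sequentially"
 using J_top t_top by (intro eventually_conj) (auto simp: filterlim_at_top)

lemma ev_theta: "eventually (%n. theta n = mu * J n / t n \<and> 0 < theta n) sequentially"
 using ev_ge1 by eventually_elim (use mu_pos in \<open>auto simp: theta_def abs_mult\<close>)

lemma inv_J: "(%n. inverse (J n)) \<longlonglongrightarrow> 0"
 by (rule tendsto_inverse_0_at_top[OF J_top])

lemma J2: "(%n. J n ^ 2 / t n) \<longlonglongrightarrow> 0"
proof -
 have "(%n. J n ^ 3 / t n * inverse (J n)) \<longlonglongrightarrow> 0 * 0" by (intro tendsto_mult J3 inv_J)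
 moreover have "eventually (%n. J n ^ 3 / t n * inverse (J n) = J n ^ 2 / t n) sequentially"
  using ev_ge1 by eventually_elim (simp add: power2_eq_square power3_eq_cube)
 ultimately show ?thesis using Lim_transform_eventually by fastforce
qed

lemma J1: "(%n. J n / t n) \<longlonglongrightarrow> 0"
proof -
 have "(%n. J n ^ 2 / t n * inverse (J n)) \<longlonglongrightarrow> 0 * 0" by (intro tendsto_mult J2 inv_J)
 moreover have "eventually (%n. J n ^ 2 / t n * inverse (J n) = J n / t n) sequentially"
  using ev_ge1 by eventually_elim (simp add: power2_eq_square)
 ultimately show ?thesis using Lim_transform_eventually by fastforce
qed

lemma theta_0: "theta \<longlonglongrightarrow> 0"
proof -
 have "(%n. \<bar>mu * (J n / t n)\<bar>) \<longlonglongrightarrow> \<bar>mu * 0\<bar>" by (intro tendsto_intros J1)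
 then show ?thesis by (simp add: theta_def[abs_def])
qed

lemma len_top: assumes q: "1 \<le> q" shows "filterlim (len q) at_top sequentially"
proof -
 have "(%n. real q * theta n) \<longlonglongrightarrow> real q * 0" by (intro tendsto_intros theta_0)
 then have "filterlim (%n. inverse (real q * theta n)) at_top sequentially"
 proof (intro filterlim_inverse_at_top)
  show "eventually (%n. 0 < real q * theta n) sequentially"
   using ev_theta
  proof eventually_elim
   case (elim n)
   have "0 < real q" using q by simp
   then show ?case using elim by (intro mult_pos_pos) (auto simp only:)
  qed
 qed simp
 then have "filterlim (%n. nat \<lfloor>inverse (real q * theta n)\<rfloor>) at_top sequentially"
  using filterlim_compose[OF filterlim_nat_sequentially] filterlim_compose[OF filterlim_floor_sequentially] by blast
 then show ?thesis by (simp add: len_def[abs_def] inverse_eq_divide)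
qed

lemma theta_len: assumes q: "1 \<le> q" shows "(%n. theta n * real (len q n)) \<longlonglongrightarrow> 1 / real q"
proof (rule tendsto_sandwich)
 show "(%n. 1 / real q - theta n) \<longlonglongrightarrow> 1 / real q" using tendsto_diff[OF tendsto_const theta_0, of "1 / real q"] by simp
 have key: "1 / real q - theta n \<le> theta n * real (len q n) \<and> theta n * real (len q n) \<le> 1 / real q" if p: "0 < theta n" for n
 proof -
  let ?x = "1 / (real q * theta n)"
  have x: "0 \<le> ?x" "theta n * ?x = 1 / real q" using p by auto
  have "?x - 1 \<le> real (len q n)" "real (len q n) \<le> ?x" unfolding len_def using x(1) by linarith+
  then have "theta n * (?x - 1) \<le> theta n * real (len q n) \<and> theta n * real (len q n) \<le> theta n * ?x"
   by (intro conjI mult_left_mono theta_nonneg)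
  then show ?thesis by (simp only: right_diff_distrib x(2) mult_1_right)
 qed
 show "eventually (%n. 1 / real q - theta n \<le> theta n * real (len q n)) sequentially"
  "eventually (%n. theta n * real (len q n) \<le> 1 / real q) sequentially"
  using ev_theta by (eventually_elim, use key in blast)+
qed simp

context
 fixes k :: "nat => nat" and u :: real
 assumes k: "(%n. real (k n) / J n) \<longlonglongrightarrow> u" and u: "0 < u"
begin

lemma k_top: "filterlim (%n. real (k n)) at_top sequentially"
proof -
 have "filterlim (%n. real (k n) / J n * J n) at_top sequentially"
  by (rule filterlim_tendsto_pos_mult_at_top[OF k u J_top])
 then show ?thesis
  by (rule filterlim_mono_eventually) (auto intro: eventually_mono[OF ev_ge1])
qed

lemma ev_k: "eventually (%n. 0 < k n) sequentially"
proof -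
 have "eventually (%n. 1 \<le> real (k n)) sequentially" using k_top unfolding filterlim_at_top by blast
 then show ?thesis by eventually_elim simp
qed

lemma kJ_t: "(%n. real (k n) * J n / t n) \<longlonglongrightarrow> 0"
proof -
 have "(%n. real (k n) / J n * (J n ^ 2 / t n)) \<longlonglongrightarrow> u * 0" by (intro tendsto_mult k J2)
 moreover have "eventually (%n. real (k n) / J n * (J n ^ 2 / t n) = real (k n) * J n / t n) sequentially"
  using ev_ge1 by eventually_elim (simp add: power2_eq_square)
 ultimately show ?thesis using Lim_transform_eventually by fastforce
qed

lemma k2_t: "(%n. real (k n) ^ 2 / t n) \<longlonglongrightarrow> 0"
proof -
 have "(%n. real (k n) / J n * (real (k n) * J n / t n)) \<longlonglongrightarrow> u * 0" by (intro tendsto_mult k kJ_t)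
 moreover have "eventually (%n. real (k n) / J n * (real (k n) * J n / t n) = real (k n) ^ 2 / t n) sequentially"
  using ev_ge1 by eventually_elim (simp add: power2_eq_square)
 ultimately show ?thesis using Lim_transform_eventually by fastforce
qed

lemma k_t: "(%n. real (k n) / t n) \<longlonglongrightarrow> 0"
proof -
 have "(%n. real (k n) / J n * (J n / t n)) \<longlonglongrightarrow> u * 0" by (intro tendsto_mult k J1)
 moreover have "eventually (%n. real (k n) / J n * (J n / t n) = real (k n) / t n) sequentially"
  using ev_ge1 by eventually_elim simp
 ultimately show ?thesis using Lim_transform_eventually by fastforce
qed

text \<open>
  This product is the size of the errors relative to the fluctuations; here the exponent \<open>1/3\<close> enters.
\<close>

lemma sqrt_theta_k: "(%n. sqrt (theta n) * real (k n)) \<longlonglongrightarrow> 0"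
proof -
 have "(%n. mu * ((real (k n) / J n) ^ 2 * (J n ^ 3 / t n))) \<longlonglongrightarrow> mu * (u ^ 2 * 0)" by (intro tendsto_intros k J3)
 moreover have "eventually (%n. mu * ((real (k n) / J n) ^ 2 * (J n ^ 3 / t n)) = theta n * real (k n) ^ 2) sequentially"
  using ev_ge1 ev_theta by eventually_elim (simp add: power2_eq_square power3_eq_cube field_simps)
 ultimately have "(%n. theta n * real (k n) ^ 2) \<longlonglongrightarrow> 0" using Lim_transform_eventually by fastforce
 then have "(%n. sqrt (theta n * real (k n) ^ 2)) \<longlonglongrightarrow> sqrt 0" by (rule tendsto_real_sqrt)
 then show ?thesis by (simp add: real_sqrt_mult)
qed

end

lemma sqrt_theta_0: "(%n. sqrt (theta n)) \<longlonglongrightarrow> 0"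
 using tendsto_real_sqrt[OF theta_0] by simp

lemma sqrt_theta_t: "(%n. sqrt (theta n) * sqrt (sqrt (1 + t n))) \<longlonglongrightarrow> 0"
proof -
 have "(%n. sqrt ((mu ^ 2 * (J n ^ 2 / t n)) * (1 + 1 / t n))) \<longlonglongrightarrow> sqrt ((mu ^ 2 * 0) * (1 + 0))"
  by (intro tendsto_intros J2 tendsto_divide_0[OF tendsto_const] filterlim_at_top_imp_at_infinity t_top)
 moreover have "eventually (%n. sqrt ((mu ^ 2 * (J n ^ 2 / t n)) * (1 + 1 / t n)) = theta n * sqrt (1 + t n)) sequentially"
  using ev_ge1 ev_theta
 proof eventually_elim
  case (elim n)
  have eq: "(mu ^ 2 * (J n ^ 2 / t n)) * (1 + 1 / t n) = (theta n)\<^sup>2 * (1 + t n)"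
  proof -
   have th: "theta n = mu * J n / t n" and t0: "t n \<noteq> 0" using elim by auto
   show ?thesis unfolding th using t0 by (simp add: field_simps power2_eq_square)
  qed
  show ?case unfolding eq by (simp only: real_sqrt_mult real_sqrt_abs abs_of_nonneg theta_nonneg)
 qed
 ultimately have "(%n. theta n * sqrt (1 + t n)) \<longlonglongrightarrow> 0" using Lim_transform_eventually by fastforce
 from tendsto_real_sqrt[OF this] show ?thesis by (simp add: real_sqrt_mult)
qed

end

text \<open>
  Only finitely many weights, those at the ends of the blocks, enter the lower bound of the cross
  term, so pointwise limits suffice.
\<close>

lemma (in linear_intensity) block_error_limit:
 assumes "regime t J mu"
  and k: "(%n. real (k n) / J n) \<longlonglongrightarrow> u" and u: "0 < u" and q: "1 \<le> q" and e: "0 < e"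
 shows "eventually (%n. \<forall>K \<ge> q\<^sup>2 * regime.len t J mu q n.
  regime.theta t J mu n * (\<Sum>r<K. (wt (k n) (t n) r - (if r < q\<^sup>2 * regime.len t J mu q n then exp (- u * (real (r div regime.len t J mu q n) / real q)) else 0))\<^sup>2)
   \<le> gap u q + e) sequentially"
proof -
 interpret G: regime t J mu by fact
 define E where "E l = exp (- u * (real l / real q))" for l
 define ky where "ky l n = real (k n) / J n * (real (Suc l) * (G.theta n * real (G.len q n)) + c * (real (k n) * J n / t n))" for l n
 define y where "y l n = (real (Suc l) * (G.theta n * real (G.len q n)) + c * (real (k n) * J n / t n)) * inverse (J n)" for l n
 define h where "h n = 2 * real (k n) * mu / t n" for n
 define U where "U n = exp (2 * c * (real (k n))\<^sup>2 / t n) * ((1 + h n) * (1 / (2 * (real (k n) / J n))))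
  - 2 * (\<Sum>l<q\<^sup>2. E l * ((G.theta n * real (G.len q n)) * exp (- ky l n - 2 * (ky l n * y l n))))
  + (G.theta n * real (G.len q n)) * (\<Sum>l<q\<^sup>2. (E l)\<^sup>2)" for n
 have inner: "(%n. real (Suc l) * (G.theta n * real (G.len q n)) + c * (real (k n) * J n / t n)) \<longlonglongrightarrow> real (Suc l) * (1 / real q) + c * 0" for l
  by (intro tendsto_add tendsto_mult tendsto_const G.theta_len[OF q] G.kJ_t[OF k u])
 have ky: "ky l \<longlonglongrightarrow> u * (real (Suc l) * (1 / real q) + c * 0)" for l
  unfolding ky_def[abs_def] by (intro tendsto_mult k inner)
 have y: "y l \<longlonglongrightarrow> (real (Suc l) * (1 / real q) + c * 0) * 0" for l
  unfolding y_def[abs_def] by (intro tendsto_mult G.inv_J inner)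
 have c2: "(%n. 2 * c * (real (k n))\<^sup>2 / t n) \<longlonglongrightarrow> 0"
  using tendsto_mult[OF tendsto_const[of "2 * c"] G.k2_t[OF k u]] by simp
 have h0: "h \<longlonglongrightarrow> 0"
  using tendsto_mult[OF tendsto_const[of "2 * mu"] G.k_t[OF k u]] by (simp add: h_def[abs_def] mult_ac)
 have "U \<longlonglongrightarrow> exp 0 * ((1 + 0) * (1 / (2 * u)))
  - 2 * (\<Sum>l<q\<^sup>2. E l * ((1 / real q) * exp (- (u * (real (Suc l) * (1 / real q) + c * 0)) - 2 * ((u * (real (Suc l) * (1 / real q) + c * 0)) * ((real (Suc l) * (1 / real q) + c * 0) * 0)))))
  + (1 / real q) * (\<Sum>l<q\<^sup>2. (E l)\<^sup>2)"
 proof -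
  have a: "(%n. exp (2 * c * (real (k n))\<^sup>2 / t n) * ((1 + h n) * (1 / (2 * (real (k n) / J n))))) \<longlonglongrightarrow> exp 0 * ((1 + 0) * (1 / (2 * u)))"
   by (rule tendsto_mult[OF tendsto_exp[OF c2] tendsto_mult[OF tendsto_add[OF tendsto_const h0] tendsto_divide[OF tendsto_const tendsto_mult[OF tendsto_const k]]]])
    (use u in simp)
  have b: "(%n. E l * ((G.theta n * real (G.len q n)) * exp (- ky l n - 2 * (ky l n * y l n))))
   \<longlonglongrightarrow> E l * ((1 / real q) * exp (- (u * (real (Suc l) * (1 / real q) + c * 0)) - 2 * ((u * (real (Suc l) * (1 / real q) + c * 0)) * ((real (Suc l) * (1 / real q) + c * 0) * 0))))" for l
   by (rule tendsto_mult[OF tendsto_const tendsto_mult[OF G.theta_len[OF q] tendsto_exp[OF tendsto_diff[OF tendsto_minus[OF ky] tendsto_mult[OF tendsto_const tendsto_mult[OF ky y]]]]]])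
  show ?thesis
   unfolding U_def[abs_def]
   by (rule tendsto_add[OF tendsto_diff[OF a tendsto_mult[OF tendsto_const tendsto_sum[OF b]]] tendsto_mult[OF G.theta_len[OF q] tendsto_const]])
 qed
 also have "exp 0 * ((1 + 0) * (1 / (2 * u)))
  - 2 * (\<Sum>l<q\<^sup>2. E l * ((1 / real q) * exp (- (u * (real (Suc l) * (1 / real q) + c * 0)) - 2 * ((u * (real (Suc l) * (1 / real q) + c * 0)) * ((real (Suc l) * (1 / real q) + c * 0) * 0)))))
  + (1 / real q) * (\<Sum>l<q\<^sup>2. (E l)\<^sup>2) = gap u q"
  unfolding gap_def E_def by simp
 finally have Ulim: "U \<longlonglongrightarrow> gap u q" .
 have "eventually (%n. U n < gap u q + e) sequentially" using Ulim e by (intro order_tendstoD) auto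
 moreover have "eventually (%n. \<forall>l\<in>{..<q\<^sup>2}. y l n < 1 / 2) sequentially"
 proof (rule eventually_ball_finite)
  have "eventually (%n. y l n < 1 / 2) sequentially" for l by (rule order_tendstoD(2)[OF y]) simp
  then show "\<forall>l\<in>{..<q\<^sup>2}. eventually (%n. y l n < 1 / 2) sequentially" by blast
 qed simp
 moreover have "eventually (%n. 1 \<le> G.len q n) sequentially" using G.len_top[OF q] by (auto simp: filterlim_at_top)
 ultimately show ?thesis using G.ev_ge1 G.ev_theta G.ev_k[OF k u]
 proof eventually_elim
  case (elim n)
  let ?t = "t n" and ?k = "k n" and ?L = "G.len q n" and ?th = "G.theta n"
  have t0: "0 < ?t" "0 < J n" "0 < ?k" "0 < ?L" using elim by auto
  have E0: "0 \<le> E l" for l by (simp add: E_def)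
  have yeq: "(mu * real (Suc l * ?L) + c * ?k) / ?t = y l n" for l
  proof -
   have a: "a * (s * (x * b)) = (s * (x * b * a))" for a s x b :: real by simp
   have "y l n = (real (Suc l) * (mu * J n / ?t * real ?L) + c * (real ?k * J n / ?t)) * inverse (J n)"
    using elim by (simp add: y_def)
   also have "\<dots> = (mu * (real (Suc l) * real ?L) + c * ?k) / ?t"
    using t0 by (simp add: field_simps del: of_nat_Suc)
   finally show ?thesis by (simp only: of_nat_mult)
  qed
  have kyeq: "real ?k * y l n = ky l n" for l using t0 by (simp add: y_def ky_def field_simps del: of_nat_Suc)
  have low: "exp (- ky l n - 2 * (ky l n * y l n)) \<le> wt ?k ?t (Suc l * ?L)" if "l < q\<^sup>2" for l
  proof -
   have "y l n \<le> 1 / 2" using bspec[OF elim(2), of l] that by simp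
   then show ?thesis by (rule wt_lower[OF t0(1), of "Suc l * ?L" ?k, unfolded yeq kyeq])
  qed
  have heq: "?th / h n = 1 / (2 * (real ?k / J n))" unfolding h_def using elim t0 mu_pos by (simp add: field_simps)
  show ?case
  proof (intro allI impI)
   fix K assume K: "q\<^sup>2 * ?L \<le> K"
   have "?th * (\<Sum>r<K. (wt ?k ?t r - (if r < q\<^sup>2 * ?L then E (r div ?L) else 0))\<^sup>2)
    \<le> exp (2 * c * (real ?k)\<^sup>2 / ?t) * ((1 + h n) * (?th / h n)) - 2 * (\<Sum>l<q\<^sup>2. E l * ((?th * ?L) * wt ?k ?t (Suc l * ?L)))
   + ?th * ?L * (\<Sum>l<q\<^sup>2. (E l)\<^sup>2)"
    unfolding h_def by (rule block_square_error[OF E0 t0(1,3) _ t0(4) K]) simp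
   moreover have "(\<Sum>l<q\<^sup>2. E l * ((?th * ?L) * exp (- ky l n - 2 * (ky l n * y l n)))) \<le> (\<Sum>l<q\<^sup>2. E l * ((?th * ?L) * wt ?k ?t (Suc l * ?L)))"
    by (intro sum_mono mult_left_mono low E0) auto
   ultimately have "?th * (\<Sum>r<K. (wt ?k ?t r - (if r < q\<^sup>2 * ?L then E (r div ?L) else 0))\<^sup>2) \<le> U n"
    unfolding U_def heq by linarith
   then show "?th * (\<Sum>r<K. (wt ?k ?t r - (if r < q\<^sup>2 * ?L then exp (- u * (real (r div ?L) / real q)) else 0))\<^sup>2) \<le> gap u q + e"
    using elim unfolding E_def by linarith
  qed
 qed
qed

section \<open>Fluctuations caused by the first generation\<close>

context stick_environment begin

definition "sd = sqrt R.var"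

definition "zeta r om = (R.mu - xi0 r om) / sd"

definition fluct :: "nat => real => real => real => real" where
 "fluct k t th x = (x - I.tau (Suc k) t) / (I.tau k t * (sd / (R.mu * sqrt th)))"

lemma mu_eq: "R.mu = expectation (%om. \<bar>ln (W om)\<bar>)"
 unfolding R.mu_def xi0_def by (rule Ws_integrable(2)) measurable

lemma var_eq: "R.var = expectation (%om. (\<bar>ln (W om)\<bar> - R.mu)\<^sup>2)"
 unfolding R.var_def xi0_def by (rule Ws_integrable(2)) measurable

lemma zeta_facts:
 assumes v: "0 < R.var"
 shows "indep_vars (%_. borel) zeta UNIV" and "distr M borel (zeta r) = distr M borel (zeta 0)"
  and "expectation (zeta r) = 0" and "integrable M (%om. (zeta r om)\<^sup>2)" and "expectation (%om. (zeta r om)\<^sup>2) = 1"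
proof -
 define f where "f x = (R.mu - \<bar>ln x\<bar>) / sd" for x :: real
 have [measurable]: "f \<in> borel_measurable borel" unfolding f_def by measurable
 have z: "zeta r = (%om. f (Ws r om))" for r by (simp add: zeta_def f_def xi0_def fun_eq_iff)
 have "indep_vars (%_. borel) (%r om. f (Ws r om)) UNIV"
  by (rule indep_vars_compose2[OF Ws_indep]) measurable
 then show "indep_vars (%_. borel) zeta UNIV" by (simp add: z[abs_def])
 have "distr M borel (zeta r) = distr (distr M borel (Ws r)) borel f" for r
  unfolding z by (subst distr_distr) (auto simp: comp_def)
 then show "distr M borel (zeta r) = distr M borel (zeta 0)" by (simp add: Ws_distr)
 have "expectation (zeta r) = expectation (%om. f (W om))" unfolding z by (rule Ws_integrable(2)) measurable
 also have "\<dots> = 0" unfolding f_def using abs_ln_W_integrable by (simp add: prob_space mu_eq)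
 finally show "expectation (zeta r) = 0" .
 have sq: "(f x)\<^sup>2 = (\<bar>ln x\<bar> - R.mu)\<^sup>2 / R.var" for x
  using v by (simp add: f_def sd_def power_divide power2_commute)
 have i: "integrable M (%om. (\<bar>ln (W om)\<bar> - R.mu)\<^sup>2)"
 proof -
  have "integrable M (%om. \<bar>ln (W om)\<bar>\<^sup>2 - 2 * \<bar>ln (W om)\<bar> * R.mu + R.mu\<^sup>2)"
   using abs_ln_W_sq abs_ln_W_integrable
   by (intro Bochner_Integration.integrable_add Bochner_Integration.integrable_diff integrable_mult_left integrable_mult_right) auto
  then show ?thesis by (simp add: power2_diff algebra_simps)
 qed
 then have "integrable M (%om. (f (W om))\<^sup>2)" unfolding sq by (rule integrable_divide)
 then show "integrable M (%om. (zeta r om)\<^sup>2)" unfolding z using Ws_integrable(1)[of "%x. (f x)\<^sup>2" r] by simp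
 have "expectation (%om. (zeta r om)\<^sup>2) = expectation (%om. (f (W om))\<^sup>2)"
  unfolding z by (rule Ws_integrable(2)) measurable
 also have "\<dots> = 1" unfolding sq using v by (simp add: var_eq[symmetric])
 finally show "expectation (%om. (zeta r om)\<^sup>2) = 1" .
qed

lemma zeta_rv [measurable]: "zeta r \<in> borel_measurable M"
 unfolding zeta_def[abs_def] xi0_def by measurable

text \<open>
  Normalized form of \<open>main_term\<close>; the difference between \<open>V (Suc k)\<close> and \<open>tau (Suc k)\<close> is absorbed here.
\<close>

lemma fluct_vs_walk:
 assumes v: "0 < R.var" and t: "0 < t" and th: "0 < th"
  and good: "2 * R.mean_const * (real (Suc k))\<^sup>2 \<le> t" "2 * R.mu * real (Suc k) \<le> t"
 shows "(\<integral>\<^sup>+om. ennreal \<bar>fluct k t th (first_gen k t om) - (\<Sum>r<nat \<lfloor>t / R.mu\<rfloor> + 1. (sqrt th * I.wt k t r) * zeta r om)\<bar> \<partial>M)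
  \<le> ennreal (R.mu * sqrt th / sd * (2 * (R.lin_const * sqrt (sqrt (1 + t)) + R.mean_const / R.mu) + 2 * R.mean_const * real (Suc k) / R.mu))"
proof -
 let ?N = "nat \<lfloor>t / R.mu\<rfloor> + 1" and ?x = "R.lin_const * sqrt (sqrt (1 + t)) + R.mean_const / R.mu"
 have sd: "0 < sd" using v by (simp add: sd_def)
 have mu: "0 < R.mu" by (rule R.mu_pos)
 have tau: "0 < I.tau k t" by (rule I.tau_pos[OF t])
 define a where "a = I.tau k t * (sd / (R.mu * sqrt th))"
 have a: "0 < a" using sd mu tau th by (simp add: a_def)
 let ?D = "%om. first_gen k t om - I.V (Suc k) t + (\<Sum>r<?N. (xi0 r om - R.mu) * I.V k (t - R.mu * r)) / R.mu"
 let ?d = "I.V (Suc k) t - I.tau (Suc k) t"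
 have lin_nn: "0 \<le> ?x"
  using R.lin_const_nonneg R.mean_const_nonneg mu t by (intro add_nonneg_nonneg mult_nonneg_nonneg divide_nonneg_nonneg) auto
 have split: "fluct k t th (first_gen k t om) - (\<Sum>r<?N. (sqrt th * I.wt k t r) * zeta r om) = ?D om / a + ?d / a" for om
 proof -
  have "(\<Sum>r<?N. (sqrt th * I.wt k t r) * zeta r om) = - ((\<Sum>r<?N. (xi0 r om - R.mu) * I.V k (t - R.mu * r)) / R.mu / a)"
   unfolding sum_divide_distrib sum_negf[symmetric]
  proof (rule sum.cong[OF refl])
   fix r
   have gen: "(s * (V / T)) * ((m - x) / d) = - ((x - m) * V / m / (T * (d / (m * s))))" if "0 < m" "0 < s" "0 < T" "0 < d" for s V T m x d :: real
    using that by (simp add: field_simps)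
   show "(sqrt th * I.wt k t r) * zeta r om = - ((xi0 r om - R.mu) * I.V k (t - R.mu * r) / R.mu / a)"
    unfolding I.wt_def zeta_def a_def by (rule gen) (use mu th tau sd in auto)
  qed
  then show ?thesis unfolding fluct_def a_def[symmetric] by (simp add: add_divide_distrib diff_divide_distrib)
 qed
 have [measurable]: "xi0 r \<in> borel_measurable M" for r unfolding xi0_def[abs_def] by measurable
 have "(\<integral>\<^sup>+om. ennreal \<bar>fluct k t th (first_gen k t om) - (\<Sum>r<?N. (sqrt th * I.wt k t r) * zeta r om)\<bar> \<partial>M)
   \<le> (\<integral>\<^sup>+om. ennreal (1 / a) * ennreal \<bar>?D om\<bar> + ennreal (\<bar>?d\<bar> / a) \<partial>M)"
 proof (rule nn_integral_mono)
  fix om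
  have bd: "\<bar>?D om / a + ?d / a\<bar> \<le> 1 / a * \<bar>?D om\<bar> + \<bar>?d\<bar> / a"
  proof -
   have "\<bar>p / a + s / a\<bar> \<le> 1 / a * \<bar>p\<bar> + \<bar>s\<bar> / a" for p s
   proof -
    have "\<bar>p / a + s / a\<bar> \<le> \<bar>p / a\<bar> + \<bar>s / a\<bar>" by (rule abs_triangle_ineq)
    then show ?thesis using a by (simp add: abs_divide)
   qed
   then show ?thesis .
  qed
  have gen: "ennreal x \<le> ennreal b * ennreal p + ennreal s" if "x \<le> b * p + s" "0 \<le> b" "0 \<le> p" "0 \<le> s" for x b p s :: real
   using ennreal_leI[OF that(1)] that(2-4) by (simp add: ennreal_mult)
  show "ennreal \<bar>fluct k t th (first_gen k t om) - (\<Sum>r<?N. (sqrt th * I.wt k t r) * zeta r om)\<bar> \<le> ennreal (1 / a) * ennreal \<bar>?D om\<bar> + ennreal (\<bar>?d\<bar> / a)"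
   unfolding split by (rule gen[OF bd]) (use a in auto)
 qed
 also have "\<dots> = ennreal (1 / a) * (\<integral>\<^sup>+om. ennreal \<bar>?D om\<bar> \<partial>M) + ennreal (\<bar>?d\<bar> / a)"
  by (subst nn_integral_add) (simp_all add: nn_integral_cmult emeasure_space_1)
 also have "\<dots> \<le> ennreal (1 / a) * ennreal (?x * I.V k t) + ennreal (\<bar>?d\<bar> / a)"
  using main_term[of t k] t by (intro add_mono mult_left_mono) auto
 also have "\<dots> \<le> ennreal (1 / a) * ennreal (?x * (2 * I.tau k t)) + ennreal (2 * R.mean_const * real (Suc k) / R.mu * I.tau k t / a)"
 proof (intro add_mono mult_left_mono ennreal_leI divide_right_mono)
  show "I.V k t \<le> 2 * I.tau k t"
   by (rule I.V_le_2tau[OF t good]) simp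
  show "\<bar>?d\<bar> \<le> 2 * R.mean_const * real (Suc k) / R.mu * I.tau k t"
   by (rule I.V_minus_tau[OF t good]) simp
 qed (use a lin_nn in auto)
 also have "\<dots> = ennreal (1 / a * (?x * (2 * I.tau k t)) + 2 * R.mean_const * real (Suc k) / R.mu * I.tau k t / a)"
  using a lin_nn tau mu I.c_nonneg by (subst ennreal_mult[symmetric], simp, simp, subst ennreal_plus[symmetric]) auto
 also have "1 / a * (?x * (2 * I.tau k t)) + 2 * R.mean_const * real (Suc k) / R.mu * I.tau k t / a
  = R.mu * sqrt th / sd * (2 * ?x + 2 * R.mean_const * real (Suc k) / R.mu)"
 proof -
  have gen: "1 / (T * (d / (m * s))) * (x * (2 * T)) + z * T / (T * (d / (m * s))) = m * s / d * (2 * x + z)"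
   if "0 < m" "0 < s" "0 < T" "0 < d" for s T m x d z :: real
   using that by (simp add: field_simps)
  show ?thesis unfolding a_def by (rule gen) (use mu th tau sd in auto)
 qed
 finally show ?thesis .
qed

definition walk_blocks :: "(nat => real) => (nat => real) => nat => nat => real => 'a => real" where
 "walk_blocks t J q n u om = (\<Sum>l<q\<^sup>2. exp (- u * (real l / real q)) *
  (sqrt (regime.theta t J R.mu n) * (\<Sum>r\<in>{l * regime.len t J R.mu q n..<l * regime.len t J R.mu q n + regime.len t J R.mu q n}. zeta r om)))"

text \<open>
  Both are linear combinations of orthonormal variables.
\<close>

lemma walk_vs_blocks:
 assumes v: "0 < R.var" and t: "0 < t n" and len: "0 < regime.len t J R.mu q n" and th: "0 \<le> regime.theta t J R.mu n"
  and bound: "!!K. q\<^sup>2 * regime.len t J R.mu q n \<le> K ==> regime.theta t J R.mu n * (\<Sum>r<K. (I.wt k (t n) r - (if r < q\<^sup>2 * regime.len t J R.mu q n then exp (- u * (real (r div regime.len t J R.mu q n) / real q)) else 0))\<^sup>2) \<le> e"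
 shows "(\<integral>\<^sup>+om. ennreal \<bar>(\<Sum>r<nat \<lfloor>t n / R.mu\<rfloor> + 1. (sqrt (regime.theta t J R.mu n) * I.wt k (t n) r) * zeta r om) - walk_blocks t J q n u om\<bar> \<partial>M) \<le> ennreal (sqrt e)"
proof -
 let ?L = "regime.len t J R.mu q n" and ?th = "regime.theta t J R.mu n" and ?N = "nat \<lfloor>t n / R.mu\<rfloor> + 1"
 define E where "E l = exp (- u * (real l / real q))" for l
 define K where "K = max ?N (q\<^sup>2 * ?L)"
 let ?b = "%r. if r < q\<^sup>2 * ?L then E (r div ?L) else 0"
 let ?w = "I.wt k (t n)"
 have mu: "0 < R.mu" by (rule R.mu_pos)
 have w0: "?w r = 0" if "?N \<le> r" for r
 proof (rule I.wt_zero[OF t])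
  have "t n / R.mu < real r" using that by linarith
  then show "t n < R.mu * real r" using mu by (simp add: divide_less_eq mult.commute)
 qed
 have eq: "(\<Sum>r<?N. (sqrt ?th * ?w r) * zeta r om) - walk_blocks t J q n u om = (\<Sum>r<K. (sqrt ?th * (?w r - ?b r)) * zeta r om)" for om
 proof -
  have 1: "(\<Sum>r<?N. (sqrt ?th * ?w r) * zeta r om) = (\<Sum>r<K. (sqrt ?th * ?w r) * zeta r om)"
   by (rule sum.mono_neutral_left) (auto simp: K_def w0 not_less simp del: I.wt_nonneg)
  have "walk_blocks t J q n u om = (\<Sum>l<q\<^sup>2. \<Sum>r\<in>{l * ?L..<l * ?L + ?L}. (sqrt ?th * E (r div ?L)) * zeta r om)"
   unfolding walk_blocks_def
  proof (rule sum.cong[OF refl])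
   fix l
   have "(\<Sum>r\<in>{l * ?L..<l * ?L + ?L}. (sqrt ?th * E (r div ?L)) * zeta r om) = (\<Sum>r\<in>{l * ?L..<l * ?L + ?L}. (sqrt ?th * E l) * zeta r om)"
   proof (rule sum.cong[OF refl])
    fix r assume "r \<in> {l * ?L..<l * ?L + ?L}"
    then have "r div ?L = l" using len by (intro div_nat_eqI) (auto simp: mult.commute)
    then show "(sqrt ?th * E (r div ?L)) * zeta r om = (sqrt ?th * E l) * zeta r om" by simp
   qed
   moreover have "exp (- u * (real l / real q)) * (sqrt ?th * (\<Sum>r\<in>{l * ?L..<l * ?L + ?L}. zeta r om)) = (sqrt ?th * E l) * (\<Sum>r\<in>{l * ?L..<l * ?L + ?L}. zeta r om)"
    by (simp add: E_def)
   moreover have "\<dots> = (\<Sum>r\<in>{l * ?L..<l * ?L + ?L}. (sqrt ?th * E l) * zeta r om)" by (rule sum_distrib_left)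
   ultimately show "exp (- u * (real l / real q)) * (sqrt ?th * (\<Sum>r\<in>{l * ?L..<l * ?L + ?L}. zeta r om)) = (\<Sum>r\<in>{l * ?L..<l * ?L + ?L}. (sqrt ?th * E (r div ?L)) * zeta r om)"
    by (simp only:)
  qed
  also have "\<dots> = (\<Sum>r<q\<^sup>2 * ?L. (sqrt ?th * E (r div ?L)) * zeta r om)" by (rule sum.nat_group)
  also have "\<dots> = (\<Sum>r<q\<^sup>2 * ?L. (sqrt ?th * ?b r) * zeta r om)" by (intro sum.cong refl) simp
  also have "\<dots> = (\<Sum>r<K. (sqrt ?th * ?b r) * zeta r om)"
   by (rule sum.mono_neutral_left) (auto simp: K_def)
  finally show ?thesis unfolding 1 by (simp only: sum_subtractf[symmetric] left_diff_distrib right_diff_distrib)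
 qed
 have sq: "(\<integral>\<^sup>+om. ennreal ((\<Sum>r<K. (sqrt ?th * (?w r - ?b r)) * zeta r om)\<^sup>2) \<partial>M) = ennreal (?th * (\<Sum>r<K. (?w r - ?b r)\<^sup>2))"
  unfolding orthonormal_combination[OF zeta_facts(1)[OF v] zeta_facts(3,4,5)[OF v]] using th
  by (simp add: power_mult_distrib sum_distrib_left)
 have le: "?th * (\<Sum>r<K. (?w r - ?b r)\<^sup>2) \<le> e" unfolding E_def by (rule bound) (simp add: K_def)
 have e0: "0 \<le> e" by (rule order_trans[OF _ le]) (use th in \<open>auto intro!: mult_nonneg_nonneg sum_nonneg\<close>)
 show ?thesis
  unfolding eq by (rule nn_L1_le_L2[OF _ e0]) (measurable, unfold sq, rule ennreal_leI[OF le])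
qed

lemma good_eventually:
 assumes G: "regime t J R.mu" and k: "(%n. real (k n) / J n) \<longlonglongrightarrow> u" and u: "0 < u"
 shows "eventually (%n. 2 * R.mean_const * (real (k n))\<^sup>2 \<le> t n \<and> 2 * R.mu * real (k n) \<le> t n) sequentially"
proof -
 interpret G: regime t J R.mu by (rule G)
 have "(%n. 2 * R.mean_const * (real (k n) ^ 2 / t n)) \<longlonglongrightarrow> 2 * R.mean_const * 0"
  "(%n. 2 * R.mu * (real (k n) / t n)) \<longlonglongrightarrow> 2 * R.mu * 0"
  by (intro tendsto_mult tendsto_const G.k2_t[OF k u] G.k_t[OF k u])+
 then have "eventually (%n. 2 * R.mean_const * (real (k n) ^ 2 / t n) < 1) sequentially"
  "eventually (%n. 2 * R.mu * (real (k n) / t n) < 1) sequentially"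
  by (auto intro: order_tendstoD)
 then show ?thesis using G.ev_ge1
 proof eventually_elim
  case (elim n)
  have le: "a * x \<le> s" if "a * (x / s) < 1" "1 \<le> s" for a x s :: real
   using that by (simp add: field_simps)
  show ?case using le[OF elim(1)] le[OF elim(2)] elim(3) by simp
 qed
qed

text \<open>
  The law of the first generation alone already produces the limit.
\<close>

lemma fluct_limit:
 assumes v: "0 < R.var" and G: "regime t J R.mu" and B: "standard_brownian_motion N B"
  and k: "!!i. i < d ==> (%n. real (k i n) / J n) \<longlonglongrightarrow> u i" and u: "!!i. i < d ==> 0 < u i"
 shows "law_tendsto (%_. M) (%n i om. fluct (k i n) (t n) (regime.theta t J R.mu n) (first_gen (k i n) (t n) om)) N
  (%i. exp_brownian_integral B (u i)) d"
proof (rule law_tendsto_approx[where Y'="%q n i. walk_blocks t J q n (u i)" and Z'="%q i. blocks B q (u i)"])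
 interpret G: regime t J R.mu by (rule G)
 interpret B: standard_brownian_motion N B by (rule B)
 have mu: "0 < R.mu" by (rule R.mu_pos)
 show "prob_space M" by (rule prob_space_axioms)
 show N: "prob_space N" by (rule B.prob_space_axioms)
 show "(%om. fluct (k i n) (t n) (G.theta n) (first_gen (k i n) (t n) om)) \<in> borel_measurable M" for i n
  unfolding fluct_def by measurable
 show wm: "walk_blocks t J q n (u i) \<in> borel_measurable M" for q n i
  unfolding walk_blocks_def[abs_def] by measurable
 show "exp_brownian_integral B (u i) \<in> borel_measurable N" if "i < d" for i
  by (rule B.exp_brownian_integral_measurable[OF u[OF that]])
 show "blocks B q (u i) \<in> borel_measurable N" for q i
  by (cases "q = 0") (use B.blocks_measurable[of q "u i"] in \<open>auto simp: blocks_def[abs_def]\<close>)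
 show "law_tendsto (%_. M) (%n i. walk_blocks t J q n (u i)) N (%i. blocks B q (u i)) d" if q: "1 \<le> q" for q
  unfolding walk_blocks_def[abs_def] blocks_def[abs_def]
  by (rule block_clt[OF zeta_facts(1)[OF v] zeta_facts(2)[OF v] zeta_facts(3,4,5)[OF v] G.len_top[OF q] G.theta_len[OF q] _ G.theta_nonneg _ N
     B.block_increments(1)[OF q] B.block_increments(2)[OF q]]) (use q in auto)
 show "\<exists>q0. \<forall>q\<ge>q0. (\<integral>\<^sup>+om. ennreal \<bar>exp_brownian_integral B (u i) om - blocks B q (u i) om\<bar> \<partial>N) \<le> ennreal e"
  if i: "i < d" and e: "0 < e" for i e
 proof -
  let ?c = "1 + 2 / (u i)\<^sup>2"
  have "(\<lambda>q::nat. ?c * inverse (sqrt (real q))) \<longlonglongrightarrow> ?c * 0"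
   by (intro tendsto_mult tendsto_const tendsto_inverse_0_at_top filterlim_compose[OF sqrt_at_top] filterlim_real_sequentially)
  then have "eventually (\<lambda>q::nat. ?c * inverse (sqrt (real q)) < e) sequentially" using e by (intro order_tendstoD) auto
  then obtain q0 where q0: "!!q. q0 \<le> q ==> ?c * inverse (sqrt (real q)) < e" by (auto simp: eventually_sequentially)
  have "(\<integral>\<^sup>+om. ennreal \<bar>exp_brownian_integral B (u i) om - blocks B q (u i) om\<bar> \<partial>N) \<le> ennreal e" if "max 1 q0 \<le> q" for q
  proof -
   have "1 \<le> q" "q0 \<le> q" using that by auto
   have "?c / sqrt (real q) \<le> e" using q0[OF \<open>q0 \<le> q\<close>] by (simp add: divide_inverse)
   then show ?thesis using B.exp_brownian_integral_blocks[OF u[OF i] \<open>1 \<le> q\<close>] ennreal_leI order_trans by blast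
  qed
  then show ?thesis by blast
 qed
 show "\<exists>q0. \<forall>q\<ge>q0. eventually (%n. (\<integral>\<^sup>+om. ennreal \<bar>fluct (k i n) (t n) (G.theta n) (first_gen (k i n) (t n) om) - walk_blocks t J q n (u i) om\<bar> \<partial>M) \<le> ennreal e) sequentially"
  if i: "i < d" and e: "0 < e" for i e
 proof -
  define \<eta> where "\<eta> = (e / 2)\<^sup>2"
  have \<eta>: "0 < \<eta> / 2" using e by (simp add: \<eta>_def)
  have "eventually (%q. gap (u i) q < \<eta> / 2) sequentially" using gap_tendsto_0[OF u[OF i]] \<eta> by (rule order_tendstoD)
  then obtain q0 where q0: "!!q. q0 \<le> q ==> gap (u i) q < \<eta> / 2" by (auto simp: eventually_sequentially)
  let ?D = "%n. R.mu * sqrt (G.theta n) / sd * (2 * (R.lin_const * sqrt (sqrt (1 + t n)) + R.mean_const / R.mu) + 2 * R.mean_const * real (Suc (k i n)) / R.mu)"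
  have lim: "(%n. R.mu / sd * (2 * (R.lin_const * (sqrt (G.theta n) * sqrt (sqrt (1 + t n))) + R.mean_const / R.mu * sqrt (G.theta n))
    + 2 * R.mean_const / R.mu * (sqrt (G.theta n) * real (k i n) + sqrt (G.theta n)))) \<longlonglongrightarrow>
    R.mu / sd * (2 * (R.lin_const * 0 + R.mean_const / R.mu * 0) + 2 * R.mean_const / R.mu * (0 + 0))"
   by (rule tendsto_mult[OF tendsto_const tendsto_add[OF tendsto_mult[OF tendsto_const tendsto_add[OF tendsto_mult[OF tendsto_const G.sqrt_theta_t] tendsto_mult[OF tendsto_const G.sqrt_theta_0]]]
     tendsto_mult[OF tendsto_const tendsto_add[OF G.sqrt_theta_k[OF k[OF i] u[OF i]] G.sqrt_theta_0]]]])
  have eqD: "R.mu / sd * (2 * (R.lin_const * (sqrt (G.theta n) * sqrt (sqrt (1 + t n))) + R.mean_const / R.mu * sqrt (G.theta n))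
    + 2 * R.mean_const / R.mu * (sqrt (G.theta n) * real (k i n) + sqrt (G.theta n))) = ?D n" for n
  proof -
   have eq: "a / s * (2 * (l * (x * y) + m * x) + b / a * (x * z + x)) = a * x / s * (2 * (l * y + m) + b * (1 + z) / a)" for a s l x y m b z :: real
    by (simp add: algebra_simps add_divide_distrib)
   show ?thesis unfolding of_nat_Suc by (rule eq)
  qed
  have "?D \<longlonglongrightarrow> 0" using lim unfolding eqD by (simp only: mult_zero_right add_0_right mult_zero_right)
  then have D: "eventually (%n. ?D n < e / 2) sequentially" using e by (intro order_tendstoD) auto
  have kS: "(%n. real (Suc (k i n)) / J n) \<longlonglongrightarrow> u i"
  proof -
   have "(%n. real (k i n) / J n + inverse (J n)) \<longlonglongrightarrow> u i + 0" by (intro tendsto_add k[OF i] G.inv_J)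
   then show ?thesis by (simp add: add_divide_distrib inverse_eq_divide add.commute)
  qed
  have good: "eventually (%n. 2 * R.mean_const * (real (Suc (k i n)))\<^sup>2 \<le> t n \<and> 2 * R.mu * real (Suc (k i n)) \<le> t n) sequentially"
   by (rule good_eventually[OF G kS u[OF i]])
  have "eventually (%n. (\<integral>\<^sup>+om. ennreal \<bar>fluct (k i n) (t n) (G.theta n) (first_gen (k i n) (t n) om) - walk_blocks t J q n (u i) om\<bar> \<partial>M) \<le> ennreal e) sequentially"
   if "max 1 q0 \<le> q" for q
  proof -
   have q: "1 \<le> q" "q0 \<le> q" using that by auto
   have l1: "eventually (%n. 1 \<le> G.len q n) sequentially" using G.len_top[OF q(1)] unfolding filterlim_at_top by blast
   show ?thesis
    using good D G.ev_ge1 G.ev_theta l1 I.block_error_limit[OF G k[OF i] u[OF i] q(1) \<eta>]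
   proof eventually_elim
    case (elim n)
    let ?G = "%om. \<Sum>r<nat \<lfloor>t n / R.mu\<rfloor> + 1. (sqrt (G.theta n) * I.wt (k i n) (t n) r) * zeta r om"
    let ?Q = "%om. fluct (k i n) (t n) (G.theta n) (first_gen (k i n) (t n) om)"
    have [measurable]: "?Q \<in> borel_measurable M" unfolding fluct_def by measurable
    have t0: "0 < t n" using elim(3) by simp
    have "(\<integral>\<^sup>+om. ennreal \<bar>?Q om - ?G om\<bar> \<partial>M) \<le> ennreal (?D n)"
     using elim by (intro fluct_vs_walk[OF v t0]) auto
    also have "\<dots> \<le> ennreal (e / 2)" using elim(2) by (intro ennreal_leI) simp
    finally have 1: "(\<integral>\<^sup>+om. ennreal \<bar>?Q om - ?G om\<bar> \<partial>M) \<le> ennreal (e / 2)" .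
    have 2: "(\<integral>\<^sup>+om. ennreal \<bar>?G om - walk_blocks t J q n (u i) om\<bar> \<partial>M) \<le> ennreal (sqrt \<eta>)"
    proof (rule walk_vs_blocks[where u="u i" and q=q and t=t and J=J and n=n and k="k i n", OF v t0])
     fix K assume "q\<^sup>2 * G.len q n \<le> K"
     from elim(6)[rule_format, OF this] q0[OF q(2)]
     show "G.theta n * (\<Sum>r<K. (I.wt (k i n) (t n) r - (if r < q\<^sup>2 * G.len q n then exp (- u i * (real (r div G.len q n) / real q)) else 0))\<^sup>2) \<le> \<eta>"
      by linarith
    qed (use elim in auto)
    have tri: "ennreal \<bar>x - z\<bar> \<le> ennreal \<bar>x - y\<bar> + ennreal \<bar>y - z\<bar>" for x y z :: real
     by (simp add: ennreal_plus[symmetric] ennreal_leI del: ennreal_plus)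
    have sq: "sqrt \<eta> = e / 2" using e by (simp add: \<eta>_def)
    have "(\<integral>\<^sup>+om. ennreal \<bar>?Q om - walk_blocks t J q n (u i) om\<bar> \<partial>M)
     \<le> (\<integral>\<^sup>+om. ennreal \<bar>?Q om - ?G om\<bar> + ennreal \<bar>?G om - walk_blocks t J q n (u i) om\<bar> \<partial>M)"
     by (rule nn_integral_mono) (rule tri)
    also have "\<dots> = (\<integral>\<^sup>+om. ennreal \<bar>?Q om - ?G om\<bar> \<partial>M) + (\<integral>\<^sup>+om. ennreal \<bar>?G om - walk_blocks t J q n (u i) om\<bar> \<partial>M)"
     using wm[of q n i] by (intro nn_integral_add) measurable
    also have "\<dots> \<le> ennreal (e / 2) + ennreal (e / 2)" using 1 2 unfolding sq by (rule add_mono)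
    also have "\<dots> = ennreal e" using e by (subst ennreal_plus[symmetric]) auto
    finally show ?case .
   qed
  qed
  then show ?thesis by blast
 qed
qed

end

section \<open>Fluctuations of the number of occupied boxes\<close>

context stick_environment begin

definition smooth0 :: "nat => real => (nat => real) => real" where
 "smooth0 k x p = enn2real (\<Sum>r. ennreal (I.V k (x + ln (p r))))"

lemma smooth0_measurable [measurable]: "smooth0 k x \<in> borel_measurable (Pi\<^sub>M UNIV (%_. borel))"
 unfolding smooth0_def[abs_def] by measurable

lemma fluct_measurable [measurable]: "fluct k t th \<in> borel_measurable borel"
 unfolding fluct_def[abs_def] by measurable

lemma smooth0_stick: "AE om in M. \<forall>k x. smooth0 k x (stick_breaking (%r. Ws r om)) = first_gen k x om"
 using AE_stick by eventually_elim (simp add: smooth0_def first_gen_def)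

lemma one_le_tau:
 assumes t: "0 < t" and k: "R.mu * real k \<le> t"
 shows "1 \<le> I.tau k t"
proof -
 have mu: "0 < R.mu" by (rule R.mu_pos)
 have "fact k \<le> real (k ^ k)" by (rule fact_le_power)
 also have "\<dots> = real k ^ k" by simp
 also have "\<dots> \<le> (t / R.mu) ^ k"
  using k mu by (intro power_mono) (auto simp: pos_le_divide_eq mult.commute)
 finally show ?thesis using t by (simp add: I.tau_eq)
qed

text \<open>
  The bound of \<open>occupied_vs_first_generation\<close>, divided by the size of the fluctuations.
\<close>

lemma occupied_fluct_close:
 assumes O: "occupancy_tree M' env A R.mean_const R.mu (2 * R.visit_const) R.cnt_const n X"
  and v: "0 < R.var" and t: "1 \<le> ln (real n)" and th: "0 < th"
  and good: "2 * R.mean_const * (real (Suc k))\<^sup>2 \<le> ln n" "2 * R.mu * real (Suc k) \<le> ln n"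
 shows "(\<integral>\<^sup>+om. ennreal \<bar>fluct k (ln n) th (real (occupied_boxes n X (Suc k) om)) - fluct k (ln n) th (smooth0 k (ln n) (%r. A [] r om))\<bar> \<partial>M')
  \<le> ennreal (R.mu * sqrt th / sd * (4 * I.bump_const + 1 + 4 * sqrt (R.cnt_const * R.mu) * real (Suc k)))"
proof -
 interpret O: occupancy_tree M' env A R.mean_const R.mu "2 * R.visit_const" R.cnt_const n X by (rule O)
 define t where "t = ln (real n)"
 have t1: "1 \<le> t" "0 < t" using t by (auto simp: t_def)
 have good': "2 * R.mean_const * (real (Suc k))\<^sup>2 \<le> t" "2 * R.mu * real (Suc k) \<le> t" using good by (auto simp: t_def)
 have mu: "0 < R.mu" by (rule R.mu_pos)
 have sd: "0 < sd" using v by (simp add: sd_def)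
 have tau: "0 < I.tau k t" by (rule I.tau_pos[OF t1(2)])
 have C: "0 \<le> R.cnt_const" by (rule R.cnt_const_nonneg)
 have tau1: "1 \<le> I.tau k t"
 proof (rule one_le_tau[OF t1(2)])
  have "R.mu * real k \<le> 2 * R.mu * real (Suc k)" using mu by (simp add: algebra_simps)
  then show "R.mu * real k \<le> t" using good'(2) by linarith
 qed
 define a where "a = I.tau k t * (sd / (R.mu * sqrt th))"
 have a: "0 < a" using sd mu tau th by (simp add: a_def)
 have sm: "O.smooth k t p = smooth0 k t p" for p by (simp add: O.smooth_def smooth0_def)
 have [measurable]: "(%om. smooth0 k t (%r. A [] r om)) \<in> borel_measurable M'"
  by (rule measurable_compose[OF O.A_rv smooth0_measurable])
 let ?x = "%om. real (occupied_boxes n X (Suc k) om)" and ?y = "%om. smooth0 k t (%r. A [] r om)"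
 let ?B = "I.bump_const * I.Vsum (Suc k) t + 1 + sqrt (R.cnt_const * (1 + t) * I.V k t * I.Vsum k t)"
 have main: "(\<integral>\<^sup>+om. ennreal \<bar>?x om - ?y om\<bar> \<partial>M') \<le> ennreal ?B"
  using O.occupied_vs_first_generation[of "Suc k"] unfolding t_def[symmetric] by (simp add: sm)
 have Vs: "0 \<le> I.Vsum i t" for i by (simp add: I.Vsum_def sum_nonneg)
 have "I.bump_const * I.Vsum (Suc k) t \<le> I.bump_const * (4 * I.tau k t)"
  by (intro mult_left_mono I.Vsum_le[OF t1(2) good'] I.bump_const_nonneg) simp
 moreover have "sqrt (R.cnt_const * (1 + t) * I.V k t * I.Vsum k t) \<le> 4 * sqrt (R.cnt_const * R.mu) * real (Suc k) * I.tau k t"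
 proof (rule real_le_lsqrt)
  have "R.cnt_const * (1 + t) * I.V k t * I.Vsum k t \<le> R.cnt_const * (2 * t) * (2 * I.tau k t) * (4 * (R.mu * real (Suc k) / t) * I.tau k t)"
   using t1 C Vs tau by (intro mult_mono I.V_le_2tau[OF t1(2) good'] I.Vsum_le'[OF t1(2) good'] mult_nonneg_nonneg) auto
  also have "\<dots> = 16 * (R.cnt_const * R.mu) * real (Suc k) * (I.tau k t)\<^sup>2"
   using t1 by (simp add: power2_eq_square)
  also have "\<dots> \<le> 16 * (R.cnt_const * R.mu) * (real (Suc k))\<^sup>2 * (I.tau k t)\<^sup>2"
  proof (intro mult_right_mono mult_left_mono)
   have "real (Suc k) * 1 \<le> real (Suc k) * real (Suc k)" by (intro mult_left_mono) auto
   then show "real (Suc k) \<le> (real (Suc k))\<^sup>2" by (simp add: power2_eq_square)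
  qed (use C mu in auto)
  also have "\<dots> = (4 * sqrt (R.cnt_const * R.mu) * real (Suc k) * I.tau k t)\<^sup>2"
   using C mu by (simp only: power_mult_distrib real_sqrt_pow2 mult_nonneg_nonneg less_imp_le) simp
  finally show "R.cnt_const * (1 + t) * I.V k t * I.Vsum k t \<le> (4 * sqrt (R.cnt_const * R.mu) * real (Suc k) * I.tau k t)\<^sup>2" .
 qed (use C mu tau in \<open>auto intro!: mult_nonneg_nonneg\<close>)
 ultimately have "?B \<le> I.bump_const * (4 * I.tau k t) + I.tau k t + 4 * sqrt (R.cnt_const * R.mu) * real (Suc k) * I.tau k t"
  using tau1 by linarith
 then have "1 / a * ?B \<le> 1 / a * (I.bump_const * (4 * I.tau k t) + I.tau k t + 4 * sqrt (R.cnt_const * R.mu) * real (Suc k) * I.tau k t)"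
  using a by (intro mult_left_mono) auto
 also have "\<dots> = R.mu * sqrt th / sd * (4 * I.bump_const + 1 + 4 * sqrt (R.cnt_const * R.mu) * real (Suc k))"
 proof -
  have gen: "1 / (T * (d / (m * s))) * (b * (4 * T) + T + z * T) = m * s / d * (4 * b + 1 + z)"
   if "0 < m" "0 < s" "0 < T" "0 < d" for s T m d b z :: real
   using that by (simp add: field_simps)
  show ?thesis unfolding a_def by (rule gen) (use mu th tau sd in auto)
 qed
 finally have bd: "1 / a * ?B \<le> R.mu * sqrt th / sd * (4 * I.bump_const + 1 + 4 * sqrt (R.cnt_const * R.mu) * real (Suc k))" .
 have "(\<integral>\<^sup>+om. ennreal \<bar>fluct k t th (?x om) - fluct k t th (?y om)\<bar> \<partial>M') = (\<integral>\<^sup>+om. ennreal (1 / a) * ennreal \<bar>?x om - ?y om\<bar> \<partial>M')"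
 proof (rule nn_integral_cong)
  fix om
  have "fluct k t th (?x om) - fluct k t th (?y om) = 1 / a * (?x om - ?y om)"
   unfolding fluct_def a_def[symmetric] by (simp add: diff_divide_distrib)
  then show "ennreal \<bar>fluct k t th (?x om) - fluct k t th (?y om)\<bar> = ennreal (1 / a) * ennreal \<bar>?x om - ?y om\<bar>"
   using a by (simp only: abs_mult ennreal_mult[symmetric] abs_ge_zero) (simp add: ennreal_mult[symmetric])
 qed
 also have "\<dots> = ennreal (1 / a) * (\<integral>\<^sup>+om. ennreal \<bar>?x om - ?y om\<bar> \<partial>M')" by (rule nn_integral_cmult) measurable
 also have "\<dots> \<le> ennreal (1 / a) * ennreal ?B" by (rule mult_left_mono[OF main]) simp
 also have "\<dots> = ennreal (1 / a * ?B)" by (rule ennreal_mult'[symmetric]) (use a in simp)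
 also have "\<dots> \<le> ennreal (R.mu * sqrt th / sd * (4 * I.bump_const + 1 + 4 * sqrt (R.cnt_const * R.mu) * real (Suc k)))" by (rule ennreal_leI[OF bd])
 finally show ?thesis unfolding t_def .
qed

text \<open>
  The weights of the first generation have the law of stick breaking on every probability space, so the
  limit on the space of the factors carries over.
\<close>

lemma occupancy_limit:
 fixes M' :: "nat => 'b measure" and k :: "nat => nat => nat" and N :: "'c measure"
 assumes v: "0 < R.var" and G: "regime (%n. ln (real n)) J R.mu" and B: "standard_brownian_motion N B"
  and scheme: "!!n. nested_occupancy_scheme (M' n) env n (A n) (X n)"
  and k: "!!i. i < d ==> (%n. real (k i n) / J n) \<longlonglongrightarrow> u i" and u: "!!i. i < d ==> 0 < u i"
 shows "law_tendsto M' (%n i om. fluct (k i n) (ln (real n)) (regime.theta (%n. ln (real n)) J R.mu n) (real (occupied_boxes n (X n) (Suc (k i n)) om))) N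
  (%i. exp_brownian_integral B (u i)) d"
  and "(%om. real (occupied_boxes n (X n) m om)) \<in> borel_measurable (M' n)"
proof -
 interpret G: regime "%n. ln (real n)" J R.mu by (rule G)
 interpret B: standard_brownian_motion N B by (rule B)
 have tree: "occupancy_tree (M' n) env (A n) R.mean_const R.mu (2 * R.visit_const) R.cnt_const n (X n)" if "1 \<le> n" for n
 proof -
  interpret S: nested_occupancy_scheme "M' n" env n "A n" "X n" by (rule scheme)
  show ?thesis
   by unfold_locales (use that S.weights_indep S.weights_distr env_tree_facts I.linear_intensity_axioms R.cnt_const_nonneg in auto)
 qed
 show occ: "(%om. real (occupied_boxes n (X n) m om)) \<in> borel_measurable (M' n)" for n m
 proof (cases "1 \<le> n")
  case True
  then interpret O: occupancy_tree "M' n" env "A n" R.mean_const R.mu "2 * R.visit_const" R.cnt_const n "X n" by (rule tree)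
  show ?thesis by (rule O.occupied_boxes_rv)
 next
  case False
  then show ?thesis by (simp add: occupied_boxes_def[abs_def])
 qed
 have Av: "(%om r. A n [] r om) \<in> M' n \<rightarrow>\<^sub>M Pi\<^sub>M UNIV (%_. borel)" for n
 proof -
  interpret S: nested_occupancy_scheme "M' n" env n "A n" "X n" by (rule scheme)
  show ?thesis using S.weights_indep by (auto simp: S.indep_vars_def)
 qed
 let ?t = "%n. ln (real n)"
 let ?S = "%n i om. fluct (k i n) (?t n) (G.theta n) (smooth0 (k i n) (?t n) (%r. A n [] r om))"
 have Sm: "?S n i \<in> borel_measurable (M' n)" for n i
  by (rule measurable_compose[OF measurable_compose[OF Av smooth0_measurable] fluct_measurable])
 show "law_tendsto M' (%n i om. fluct (k i n) (?t n) (G.theta n) (real (occupied_boxes n (X n) (Suc (k i n)) om))) N (%i. exp_brownian_integral B (u i)) d"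
 proof (rule law_tendsto_approx[where Y'="%q. ?S" and Z'="%q i. exp_brownian_integral B (u i)"])
  show "prob_space (M' n)" for n
   using scheme[of n] by (simp add: nested_occupancy_scheme_def)
  show "prob_space N" by (rule B.prob_space_axioms)
  show "(%om. fluct (k i n) (?t n) (G.theta n) (real (occupied_boxes n (X n) (Suc (k i n)) om))) \<in> borel_measurable (M' n)" for n i
   by (rule measurable_compose[OF occ fluct_measurable])
  show "?S n i \<in> borel_measurable (M' n)" for n i by (rule Sm)
  show Zm: "exp_brownian_integral B (u i) \<in> borel_measurable N" if "i < d" for i
   by (rule B.exp_brownian_integral_measurable[OF u[OF that]])
  then show "exp_brownian_integral B (u i) \<in> borel_measurable N" if "i < d" for i using that .
  show "\<exists>q0. \<forall>q\<ge>q0. (\<integral>\<^sup>+om. ennreal \<bar>exp_brownian_integral B (u i) om - exp_brownian_integral B (u i) om\<bar> \<partial>N) \<le> ennreal e" for i e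
   by simp
  show "law_tendsto M' ?S N (%i. exp_brownian_integral B (u i)) d"
   unfolding law_tendsto_def
  proof (intro allI impI)
   fix F :: "(nat => real) => real" assume F: "continuous_on UNIV F" and bd: "\<exists>C. \<forall>x. \<bar>F x\<bar> \<le> C"
   have Fm: "F \<in> borel_measurable borel" by (rule borel_measurable_continuous_onI[OF F])
   have eq: "(LINT om|M' n. F (trunc d (%i. ?S n i om))) = (LINT om|M. F (trunc d (%i. fluct (k i n) (?t n) (G.theta n) (first_gen (k i n) (?t n) om))))" for n
   proof -
    interpret S: nested_occupancy_scheme "M' n" env n "A n" "X n" by (rule scheme)
    let ?H = "%p. F (trunc d (%i. fluct (k i n) (?t n) (G.theta n) (smooth0 (k i n) (?t n) p)))"
    have H: "?H \<in> borel_measurable (Pi\<^sub>M UNIV (%_. borel))"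
     by (rule measurable_compose[OF trunc_measurable Fm]) (rule measurable_compose[OF smooth0_measurable fluct_measurable])
    have "(LINT om|M' n. F (trunc d (%i. ?S n i om))) = (LINT p|distr (M' n) (Pi\<^sub>M UNIV (%_. borel)) (%om r. A n [] r om). ?H p)"
     by (rule integral_distr[OF Av H, symmetric])
    also have "\<dots> = (LINT p|distr M (Pi\<^sub>M UNIV (%_. borel)) (%om. stick_breaking (%r. Ws r om)). ?H p)"
     by (simp only: S.weights_distr env_def)
    also have "\<dots> = (LINT om|M. ?H (stick_breaking (%r. Ws r om)))" by (rule integral_distr[OF stick_rv H])
    also have "\<dots> = (LINT om|M. F (trunc d (%i. fluct (k i n) (?t n) (G.theta n) (first_gen (k i n) (?t n) om))))"
    proof (rule integral_cong_AE)
     show "(%om. ?H (stick_breaking (%r. Ws r om))) \<in> borel_measurable M" by (rule measurable_compose[OF stick_rv H])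
     show "(%om. F (trunc d (%i. fluct (k i n) (?t n) (G.theta n) (first_gen (k i n) (?t n) om)))) \<in> borel_measurable M"
      by (rule measurable_compose[OF trunc_measurable Fm]) (rule measurable_compose[OF first_gen_rv fluct_measurable])
     show "AE om in M. ?H (stick_breaking (%r. Ws r om)) = F (trunc d (%i. fluct (k i n) (?t n) (G.theta n) (first_gen (k i n) (?t n) om)))"
      using smooth0_stick by eventually_elim (simp only:)
    qed
    finally show ?thesis .
   qed
   show "(%n. LINT om|M' n. F (trunc d (%i. ?S n i om))) \<longlonglongrightarrow> (LINT om|N. F (trunc d (%i. exp_brownian_integral B (u i) om)))"
    unfolding eq using fluct_limit[where d=d and k=k and u=u, OF v G B k u] F bd unfolding law_tendsto_def by blast
  qed
  show "\<exists>q0. \<forall>q\<ge>q0. eventually (%n. (\<integral>\<^sup>+om. ennreal \<bar>fluct (k i n) (?t n) (G.theta n) (real (occupied_boxes n (X n) (Suc (k i n)) om)) - ?S n i om\<bar> \<partial>M' n) \<le> ennreal e) sequentially"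
   if i: "i < d" and e: "0 < e" for i e
  proof -
   let ?a = "4 * I.bump_const + 1" and ?b = "4 * sqrt (R.cnt_const * R.mu)"
   let ?D = "%n. R.mu * sqrt (G.theta n) / sd * (?a + ?b * real (Suc (k i n)))"
   have lim: "(%n. R.mu / sd * (?a * sqrt (G.theta n) + ?b * (sqrt (G.theta n) * real (k i n) + sqrt (G.theta n)))) \<longlonglongrightarrow>
     R.mu / sd * (?a * 0 + ?b * (0 + 0))"
    by (rule tendsto_mult[OF tendsto_const tendsto_add[OF tendsto_mult[OF tendsto_const G.sqrt_theta_0] tendsto_mult[OF tendsto_const tendsto_add[OF G.sqrt_theta_k[OF k[OF i] u[OF i]] G.sqrt_theta_0]]]])
   have eqD: "R.mu / sd * (?a * sqrt (G.theta n) + ?b * (sqrt (G.theta n) * real (k i n) + sqrt (G.theta n))) = ?D n" for n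
   proof -
    have eq: "m / s * (a * x + b * (x * z + x)) = m * x / s * (a + b * (1 + z))" for a s x m b z :: real
     by (simp add: algebra_simps add_divide_distrib)
    show ?thesis unfolding of_nat_Suc by (rule eq)
   qed
   have "?D \<longlonglongrightarrow> 0" using lim unfolding eqD by (simp only: mult_zero_right add_0_right)
   then have D: "eventually (%n. ?D n < e) sequentially" using e by (intro order_tendstoD) auto
   have kS: "(%n. real (Suc (k i n)) / J n) \<longlonglongrightarrow> u i"
   proof -
    have "(%n. real (k i n) / J n + inverse (J n)) \<longlonglongrightarrow> u i + 0" by (intro tendsto_add k[OF i] G.inv_J)
    then show ?thesis by (simp add: add_divide_distrib inverse_eq_divide add.commute)
   qed
   have "eventually (%n. (\<integral>\<^sup>+om. ennreal \<bar>fluct (k i n) (?t n) (G.theta n) (real (occupied_boxes n (X n) (Suc (k i n)) om)) - ?S n i om\<bar> \<partial>M' n) \<le> ennreal e) sequentially"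
    using D good_eventually[OF G kS u[OF i]] G.ev_ge1 G.ev_theta eventually_ge_at_top[of 1]
   proof eventually_elim
    case (elim n)
    have "(\<integral>\<^sup>+om. ennreal \<bar>fluct (k i n) (?t n) (G.theta n) (real (occupied_boxes n (X n) (Suc (k i n)) om)) - ?S n i om\<bar> \<partial>M' n) \<le> ennreal (?D n)"
     by (rule occupied_fluct_close[OF tree v]) (use elim in blast)+
    also have "\<dots> \<le> ennreal e" using elim(1) by (intro ennreal_leI) simp
    finally show ?case .
   qed
   then show ?thesis by blast
  qed
 qed
qed

end

section \<open>Normalization and finite-dimensional distributions\<close>

text \<open>
  The normalization in terms of factorials is \<open>tau (m - 1) t\<close> times the standard deviation of the weighted
  sum of the steps.
\<close>

lemma (in stick_environment) fluct_eq_normalised: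
 assumes v: "0 < R.var" and t: "0 < t" and J: "0 < J" and m: "1 \<le> m" and th: "th = R.mu * J / t"
 shows "sqrt J * fact (m - 1) * (x - (t / R.mu) ^ m / fact m) / sqrt (R.var * R.mu powi (- 2 * int m - 1) * t ^ (2 * m - 1))
  = fluct (m - 1) t th x"
proof -
 obtain k where mk: "m = Suc k" using m by (cases m) auto
 have mu: "0 < R.mu" by (rule R.mu_pos)
 have th0: "0 < th" using mu J t by (simp add: th)
 have sd: "0 < sd" "sd\<^sup>2 = R.var" using v by (auto simp: sd_def)
 define a where "a = I.tau k t * (sd / (R.mu * sqrt th))"
 have tau: "I.tau k t = (t / R.mu) ^ k / fact k" "I.tau (Suc k) t = (t / R.mu) ^ Suc k / fact (Suc k)"
  using t by (auto simp: I.tau_eq)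
 have a: "0 < a" using sd mu th0 I.tau_pos[OF t, of k] by (simp add: a_def)
 have c: "0 < sqrt J * fact k" using J by simp
 have "R.mu powi (- 2 * int (Suc k) - 1) = R.mu powi (- int (2 * k + 3))"
  by (rule arg_cong[where f="%i. R.mu powi i"]) simp
 also have "\<dots> = inverse (R.mu ^ (2 * k + 3))" by (simp only: power_int_minus power_int_of_nat)
 finally have pw: "R.mu powi (- 2 * int (Suc k) - 1) = inverse (R.mu ^ (2 * k + 3))" .
 have e: "2 * Suc k - 1 = Suc (2 * k)" by simp
 have "(sqrt J * fact k * a)\<^sup>2 = R.var * inverse (R.mu ^ (2 * k + 3)) * t ^ Suc (2 * k)"
 proof -
  have "(sqrt J * fact k * a)\<^sup>2 = (sqrt J)\<^sup>2 * (fact k)\<^sup>2 * (((t / R.mu) ^ k)\<^sup>2 / (fact k)\<^sup>2 * (sd\<^sup>2 / (R.mu\<^sup>2 * (sqrt th)\<^sup>2)))"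
   unfolding a_def tau by (simp only: power_mult_distrib power_divide)
  also have "\<dots> = J * (fact k)\<^sup>2 * (((t / R.mu) ^ k)\<^sup>2 / (fact k)\<^sup>2 * (R.var / (R.mu\<^sup>2 * th)))"
   using J th0 by (simp add: sd(2))
  also have "\<dots> = J * ((t / R.mu) ^ k)\<^sup>2 * (R.var / (R.mu\<^sup>2 * (R.mu * J / t)))" by (simp add: th)
  also have "\<dots> = R.var * inverse (R.mu ^ (2 * k + 3)) * t ^ Suc (2 * k)"
  proof -
   have gen: "J * (P / Q)\<^sup>2 * (V / (m\<^sup>2 * (m * J / t))) = V * inverse (Q\<^sup>2 * m ^ 3) * (t * P\<^sup>2)" if "0 < Q" "0 < m" for P Q V m :: real
    using that J t by (simp add: power_divide field_simps power2_eq_square power3_eq_cube)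
   have p1: "R.mu ^ (2 * k + 3) = (R.mu ^ k)\<^sup>2 * R.mu ^ 3" by (simp only: power_add power_even_eq)
   have p2: "t ^ Suc (2 * k) = t * (t ^ k)\<^sup>2" by (simp only: power_Suc power_even_eq)
   show ?thesis unfolding p1 p2 power_divide[of t R.mu k] by (rule gen) (use mu in auto)
  qed
  finally show ?thesis .
 qed
 then have X: "sqrt (R.var * R.mu powi (- 2 * int m - 1) * t ^ (2 * m - 1)) = sqrt J * fact k * a"
  unfolding mk pw e using a c by (intro real_sqrt_unique) auto
 have gen: "c * y / (c * a) = y / a" if "0 < c" for c y :: real using that by simp
 have "m - 1 = k" by (simp add: mk)
 show ?thesis
  unfolding X \<open>m - 1 = k\<close> fluct_def a_def[symmetric] unfolding mk tau(2) by (rule gen[OF c])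
qed

lemma floor_ratio_tendsto:
 fixes j :: "nat => real"
 assumes j: "filterlim j at_top sequentially" and u: "0 < u"
 shows "(%n. real (nat \<lfloor>j n * u\<rfloor> - 1) / of_int \<lfloor>j n\<rfloor>) \<longlonglongrightarrow> u"
  and "eventually (%n. 1 \<le> nat \<lfloor>j n * u\<rfloor>) sequentially"
proof -
 have inv: "(%n. inverse (j n)) \<longlonglongrightarrow> 0" by (rule tendsto_inverse_0_at_top[OF j])
 have ev: "eventually (%n. 2 \<le> j n \<and> 2 / u \<le> j n) sequentially"
  using j unfolding filterlim_at_top by (intro eventually_conj) blast+
 have ju: "2 \<le> j n * u" if "2 / u \<le> j n" for n using that u by (simp add: divide_le_eq)
 show "eventually (%n. 1 \<le> nat \<lfloor>j n * u\<rfloor>) sequentially"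
  using ev
 proof eventually_elim
  case (elim n)
  then have "2 \<le> j n * u" using ju by blast
  then show ?case by linarith
 qed
 have a: "(%n. real (nat \<lfloor>j n * u\<rfloor> - 1) / j n) \<longlonglongrightarrow> u"
 proof (rule tendsto_sandwich)
  show "(%n. u - 2 * inverse (j n)) \<longlonglongrightarrow> u" using tendsto_diff[OF tendsto_const tendsto_mult[OF tendsto_const inv], of u 2] by simp
  have b: "j n * u - 2 \<le> real (nat \<lfloor>j n * u\<rfloor> - 1) \<and> real (nat \<lfloor>j n * u\<rfloor> - 1) \<le> j n * u" if "2 / u \<le> j n" for n
   using ju[OF that] by linarith
  show "eventually (%n. u - 2 * inverse (j n) \<le> real (nat \<lfloor>j n * u\<rfloor> - 1) / j n) sequentially"
   using ev
  proof eventually_elim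
   case (elim n)
   have gen: "(u - 2 * inverse x) * x = x * u - 2" if "x \<noteq> 0" for x :: real
    using that by (simp add: field_simps)
   have "(u - 2 * inverse (j n)) * j n = j n * u - 2" using elim by (intro gen) auto
   then show ?case using b[of n] elim by (simp add: pos_le_divide_eq)
  qed
  show "eventually (%n. real (nat \<lfloor>j n * u\<rfloor> - 1) / j n \<le> u) sequentially"
   using ev
  proof eventually_elim
   case (elim n)
   then show ?case using b[of n] by (simp add: pos_divide_le_eq mult.commute)
  qed
 qed simp
 have b: "(%n. of_int \<lfloor>j n\<rfloor> / j n) \<longlonglongrightarrow> 1"
 proof (rule tendsto_sandwich)
  show "(%n. 1 - inverse (j n)) \<longlonglongrightarrow> 1" using tendsto_diff[OF tendsto_const inv, of 1] by simp
  show "eventually (%n. 1 - inverse (j n) \<le> of_int \<lfloor>j n\<rfloor> / j n) sequentially"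
   using ev
  proof eventually_elim
   case (elim n)
   have "(1 - inverse (j n)) * j n = j n - 1" using elim by (simp add: left_diff_distrib)
   moreover have "j n - 1 \<le> of_int \<lfloor>j n\<rfloor>" by linarith
   ultimately show ?case using elim by (simp add: pos_le_divide_eq)
  qed
  show "eventually (%n. of_int \<lfloor>j n\<rfloor> / j n \<le> 1) sequentially"
   using ev by eventually_elim (simp add: pos_divide_le_eq)
 qed simp
 have "(%n. (real (nat \<lfloor>j n * u\<rfloor> - 1) / j n) / (of_int \<lfloor>j n\<rfloor> / j n)) \<longlonglongrightarrow> u / 1"
  by (rule tendsto_divide[OF a b]) simp
 moreover have "eventually (%n. (real (nat \<lfloor>j n * u\<rfloor> - 1) / j n) / (of_int \<lfloor>j n\<rfloor> / j n) = real (nat \<lfloor>j n * u\<rfloor> - 1) / of_int \<lfloor>j n\<rfloor>) sequentially"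
  using ev by eventually_elim simp
 ultimately show "(%n. real (nat \<lfloor>j n * u\<rfloor> - 1) / of_int \<lfloor>j n\<rfloor>) \<longlonglongrightarrow> u"
  using Lim_transform_eventually by fastforce
qed

lemma regime_of_little_o:
 fixes j :: "nat => real"
 assumes j: "filterlim j at_top sequentially" and o: "j \<in> o(%n. ln (real n) powr (1 / 3))" and mu: "0 < mu"
 shows "regime (%n. ln (real n)) (%n. of_int \<lfloor>j n\<rfloor>) mu"
proof
 show "filterlim (%n. of_int \<lfloor>j n\<rfloor> :: real) at_top sequentially"
 proof (rule filterlim_at_top_mono[OF filterlim_tendsto_add_at_top[OF tendsto_const[of "- 1 :: real"] j]])
  show "eventually (%n. - 1 + j n \<le> of_int \<lfloor>j n\<rfloor>) sequentially" by (rule always_eventually, rule allI) linarith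
 qed
 show tt: "filterlim (%n. ln (real n)) at_top sequentially"
  by (rule filterlim_compose[OF ln_at_top filterlim_real_sequentially])
 have ev: "eventually (%n. 1 \<le> j n \<and> 1 \<le> ln (real n)) sequentially"
  using j tt unfolding filterlim_at_top by (intro eventually_conj) blast+
 have "(%n. (j n / ln (real n) powr (1 / 3)) ^ 3) \<longlonglongrightarrow> 0 ^ 3"
  by (rule tendsto_power[OF smalloD_tendsto[OF o]])
 moreover have "eventually (%n. (j n / ln (real n) powr (1 / 3)) ^ 3 = j n ^ 3 / ln (real n)) sequentially"
  using ev
 proof eventually_elim
  case (elim n)
  have "(ln (real n) powr (1 / 3)) ^ 3 = ln (real n) powr (1 / 3 * 3)"
   using elim by (simp add: powr_power)
  then show ?case using elim by (simp add: power_divide)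
 qed
 ultimately have lim: "(%n. j n ^ 3 / ln (real n)) \<longlonglongrightarrow> 0" using Lim_transform_eventually by fastforce
 show "(%n. of_int \<lfloor>j n\<rfloor> ^ 3 / ln (real n)) \<longlonglongrightarrow> 0"
 proof (rule tendsto_sandwich[OF _ _ tendsto_const lim])
  show "eventually (%n. 0 \<le> (of_int \<lfloor>j n\<rfloor> :: real) ^ 3 / ln (real n)) sequentially"
   using ev by eventually_elim auto
  show "eventually (%n. (of_int \<lfloor>j n\<rfloor> :: real) ^ 3 / ln (real n) \<le> j n ^ 3 / ln (real n)) sequentially"
   using ev by eventually_elim (auto intro!: divide_right_mono power_mono)
 qed
qed (rule mu)

text \<open>
  A test function on a finite product indexed by \<open>I\<close> becomes one on sequences after
  an enumeration of \<open>I\<close>.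
\<close>

lemma fdd_convergesI:
 assumes Y: "!!n t. t \<in> T ==> Y n t \<in> borel_measurable (M n)" and Z: "!!t. t \<in> T ==> Z t \<in> borel_measurable N"
  and law: "!!d h. (!!i. i < d ==> h i \<in> T) ==> law_tendsto M (%n i. Y' n (h i)) N (%i. Z (h i)) d"
  and eq: "!!t. t \<in> T ==> eventually (%n. Y n t = Y' n t) sequentially"
 shows "fdd_converges M Y N Z T"
 unfolding fdd_converges_def
proof (intro conjI allI ballI impI)
 fix I f
 assume *: "finite I \<and> I \<subseteq> T \<and> continuous_map (powertop_real I) euclideanreal f \<and> bounded (f ` topspace (powertop_real I))"
 then have I: "finite I" "I \<subseteq> T" and f: "continuous_map (powertop_real I) euclideanreal f" and b: "bounded (f ` topspace (powertop_real I))" by auto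
 define d where "d = card I"
 obtain h where h: "bij_betw h {0..<d} I" using ex_bij_betw_nat_finite[OF I(1)] unfolding d_def by blast
 define g where "g = inv_into {0..<d} h"
 have g: "g s < d" "h (g s) = s" if "s \<in> I" for s
  using bij_betw_inv_into[OF h] bij_betw_inv_into_right[OF h that] that unfolding g_def bij_betw_def by auto
 have hT: "h i \<in> T" if "i < d" for i using h I that by (auto simp: bij_betw_def)
 define F where "F x = f (\<lambda>s\<in>I. x (g s))" for x :: "nat => real"
 have "continuous_map euclidean (powertop_real I) (\<lambda>x :: nat => real. \<lambda>s\<in>I. x (g s))"
  unfolding continuous_map_componentwise
 proof (intro conjI ballI)
  fix s assume s: "s \<in> I"
  have "continuous_map euclidean euclideanreal (\<lambda>x :: nat => real. x (g s))"
   by (simp add: continuous_on_product_coordinates)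
  then show "continuous_map euclidean euclideanreal (\<lambda>x :: nat => real. (\<lambda>s\<in>I. x (g s)) s)" using s by simp
 qed auto
 from continuous_map_compose[OF this f] have Fc: "continuous_on UNIV F"
  by (simp add: F_def[abs_def] comp_def)
 have Fb: "\<exists>C. \<forall>x. \<bar>F x\<bar> \<le> C"
 proof -
  obtain C where C: "!!y. y \<in> f ` topspace (powertop_real I) ==> norm y \<le> C" using b by (auto simp: bounded_iff)
  have "\<bar>F x\<bar> \<le> C" for x unfolding F_def real_norm_def[symmetric] by (rule C, rule imageI) (auto simp: PiE_def extensional_def)
  then show ?thesis by blast
 qed
 have lim: "(%n. LINT om|M n. F (trunc d (%i. Y' n (h i) om))) \<longlonglongrightarrow> (LINT om|N. F (trunc d (%i. Z (h i) om)))"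
  using law[where d=d and h=h, OF hT] Fc Fb unfolding law_tendsto_def by blast
 have FY: "F (trunc d (%i. y (h i))) = f (\<lambda>s\<in>I. y s)" for y
  unfolding F_def trunc_def by (intro arg_cong[where f=f] restrict_ext) (simp add: g)
 have "eventually (%n. \<forall>t\<in>I. Y n t = Y' n t) sequentially"
  by (rule eventually_ball_finite[OF I(1)]) (use eq I in blast)
 then have "eventually (%n. (LINT om|M n. F (trunc d (%i. Y' n (h i) om))) = (LINT om|M n. f (\<lambda>t\<in>I. Y n t om))) sequentially"
 proof eventually_elim
  case (elim n)
  have "(\<lambda>t\<in>I. Y' n t om) = (\<lambda>t\<in>I. Y n t om)" for om by (rule restrict_ext) (use elim in simp)
  then show ?case using FY[of "%t. Y' n t om" for om] by simp
 qed
 from Lim_transform_eventually[OF lim this]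
 show "(%n. LINT om|M n. f (\<lambda>t\<in>I. Y n t om)) \<longlonglongrightarrow> (LINT om|N. f (\<lambda>t\<in>I. Z t om))"
  using FY[of "%t. Z t om" for om] by simp
qed (use Y Z in auto)

theorem theorem2p5:
  fixes Om :: "'a measure" and W :: "'a \<Rightarrow> real" and Ws :: "nat \<Rightarrow> 'a \<Rightarrow> real"
    and mu sigma2 :: real
    and j :: "nat \<Rightarrow> real"
    and M :: "nat \<Rightarrow> 'b measure"
    and A :: "nat \<Rightarrow> nat list \<Rightarrow> nat \<Rightarrow> 'b \<Rightarrow> real"
    and X :: "nat \<Rightarrow> nat \<Rightarrow> nat \<Rightarrow> 'b \<Rightarrow> nat list"
    and N :: "'c measure" and B :: "real \<Rightarrow> 'c \<Rightarrow> real"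
  assumes "prob_space Om"
    and "W \<in> borel_measurable Om"
    and "AE \<omega> in Om. 0 < W \<omega> \<and> W \<omega> < 1"
    and "prob_space.indep_vars Om (\<lambda>_. borel) Ws UNIV"
    and "\<And>r. distr Om borel (Ws r) = distr Om borel W"
    and "nonlattice (distr Om borel (\<lambda>\<omega>. \<bar>ln (W \<omega>)\<bar>))"
    and "mu = prob_space.expectation Om (\<lambda>\<omega>. \<bar>ln (W \<omega>)\<bar>)"
    and "sigma2 = prob_space.variance Om (\<lambda>\<omega>. ln (W \<omega>))"
    and "integrable Om (\<lambda>\<omega>. (ln (W \<omega>))\<^sup>2)" and "0 < sigma2"
    and "integrable Om (\<lambda>\<omega>. \<bar>ln (1 - W \<omega>)\<bar>)"
    and "\<And>n. 1 \<le> n \<Longrightarrow> 0 < j n"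
    and "filterlim j at_top sequentially"
    and "j \<in> o(\<lambda>n. ln (real n) powr (1 / 3))"
    and "\<And>n. nested_occupancy_scheme (M n)
           (distr Om (Pi\<^sub>M UNIV (\<lambda>_. borel)) (\<lambda>\<omega>. stick_breaking (\<lambda>r. Ws r \<omega>)))
           n (A n) (X n)"
    and "standard_brownian_motion N B"
  shows "integrable Om (\<lambda>\<omega>. \<bar>ln (W \<omega>)\<bar>) \<and>
    fdd_converges M
      (\<lambda>n u \<omega>. let m = nat \<lfloor>j n * u\<rfloor> in
         sqrt (of_int \<lfloor>j n\<rfloor>) * fact (m - 1) *
         (real (occupied_boxes n (X n) m \<omega>) - (ln (real n) / mu) ^ m / fact m) /
         sqrt (sigma2 * mu powi (- 2 * int m - 1) * ln (real n) ^ (2 * m - 1)))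
      N (exp_brownian_integral B) {0<..}"
proof -
 interpret S: stick_environment Om W Ws
 proof -
  interpret prob_space Om by fact
  show "stick_environment Om W Ws"
   by unfold_locales (use assms in auto)
 qed
 interpret B: standard_brownian_motion N B by fact
 let ?J = "%n. of_int \<lfloor>j n\<rfloor> :: real" and ?t = "%n. ln (real n)" and ?m = "%u n. nat \<lfloor>j n * u\<rfloor>"
 have mu: "mu = S.R.mu" using assms(7) S.mu_eq by simp
 have lnW: "AE om in Om. ln (W om) = - \<bar>ln (W om)\<bar>"
  using assms(3) by eventually_elim simp
 have "S.expectation (%om. ln (W om)) = S.expectation (%om. - \<bar>ln (W om)\<bar>)"
  by (rule integral_cong_AE[OF _ _ lnW]) measurable
 then have mean: "S.expectation (%om. ln (W om)) = - S.R.mu" by (simp add: S.mu_eq)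
 have "S.expectation (%om. (ln (W om) - - S.R.mu)\<^sup>2) = S.expectation (%om. (\<bar>ln (W om)\<bar> - S.R.mu)\<^sup>2)"
 proof (rule integral_cong_AE)
  show "AE om in Om. (ln (W om) - - S.R.mu)\<^sup>2 = (\<bar>ln (W om)\<bar> - S.R.mu)\<^sup>2"
   using lnW
  proof eventually_elim
   case (elim om)
   have "(- a - - b)\<^sup>2 = (a - b)\<^sup>2" for a b :: real by (simp add: power2_eq_square algebra_simps)
   then show ?case by (subst elim) simp
  qed
 qed measurable
 then have var: "sigma2 = S.R.var" unfolding assms(8) mean S.var_eq .
 have v: "0 < S.R.var" using assms(10) var by simp
 have G: "regime ?t ?J S.R.mu"
  by (rule regime_of_little_o[OF assms(13,14) S.R.mu_pos])
 interpret G: regime ?t ?J S.R.mu by (rule G)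
 have scheme: "nested_occupancy_scheme (M n) S.env n (A n) (X n)" for n
  unfolding S.env_def by (rule assms(15))
 have rv: "(%om. real (occupied_boxes n (X n) m om)) \<in> borel_measurable (M n)" for n m
  by (rule S.occupancy_limit(2)[where d=0 and k="%_ _. 0" and u="%_. 1", OF v G B.standard_brownian_motion_axioms scheme]) auto
 let ?Y' = "%n u om. S.fluct (?m u n - 1) (?t n) (G.theta n) (real (occupied_boxes n (X n) (Suc (?m u n - 1)) om))"
 have "fdd_converges M
   (%n u om. let m = nat \<lfloor>j n * u\<rfloor> in
    sqrt (of_int \<lfloor>j n\<rfloor>) * fact (m - 1) *
    (real (occupied_boxes n (X n) m om) - (ln (real n) / mu) ^ m / fact m) /
    sqrt (sigma2 * mu powi (- 2 * int m - 1) * ln (real n) ^ (2 * m - 1)))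
   N (exp_brownian_integral B) {0<..}"
 proof (rule fdd_convergesI[where Y'="?Y'"])
  fix n and u :: real
  show "(%om. let m = nat \<lfloor>j n * u\<rfloor> in
    sqrt (of_int \<lfloor>j n\<rfloor>) * fact (m - 1) *
    (real (occupied_boxes n (X n) m om) - (ln (real n) / mu) ^ m / fact m) /
    sqrt (sigma2 * mu powi (- 2 * int m - 1) * ln (real n) ^ (2 * m - 1))) \<in> borel_measurable (M n)"
   unfolding Let_def by (intro borel_measurable_divide borel_measurable_times borel_measurable_diff borel_measurable_const rv)
 next
  fix u :: real assume "u \<in> {0<..}"
  then show "exp_brownian_integral B u \<in> borel_measurable N" by (intro B.exp_brownian_integral_measurable) simp
 next
  fix d and h :: "nat => real" assume h: "!!i. i < d ==> h i \<in> {0<..}"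
  show "law_tendsto M (%n i. ?Y' n (h i)) N (%i. exp_brownian_integral B (h i)) d"
  proof (rule S.occupancy_limit(1)[where d=d and k="%i n. ?m (h i) n - 1" and u=h, OF v G B.standard_brownian_motion_axioms scheme])
   show "(%n. real (?m (h i) n - 1) / ?J n) \<longlonglongrightarrow> h i" if "i < d" for i
    by (rule floor_ratio_tendsto(1)[OF assms(13)]) (use h[OF that] in simp)
   show "0 < h i" if "i < d" for i using h[OF that] by simp
  qed
 next
  fix u :: real assume "u \<in> {0<..}"
  then have u: "0 < u" by simp
  show "eventually (%n. (%om. let m = nat \<lfloor>j n * u\<rfloor> in
    sqrt (of_int \<lfloor>j n\<rfloor>) * fact (m - 1) *
    (real (occupied_boxes n (X n) m om) - (ln (real n) / mu) ^ m / fact m) /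
    sqrt (sigma2 * mu powi (- 2 * int m - 1) * ln (real n) ^ (2 * m - 1))) = ?Y' n u) sequentially"
   using floor_ratio_tendsto(2)[OF assms(13) u] G.ev_ge1 G.ev_theta
  proof eventually_elim
   case (elim n)
   have s: "Suc (?m u n - 1) = ?m u n" using elim(1) by simp
   have "0 < ?t n" "0 < ?J n" using elim(2) by linarith+
   from S.fluct_eq_normalised[OF v this elim(1) conjunct1[OF elim(3)]]
   show ?case unfolding Let_def s mu var by (intro ext) simp
  qed
 qed
 then show ?thesis using S.abs_ln_W_integrable by blast
qed

end
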